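(* Let $G$ and $H$ be simple graphs with $|V(G)|=|V(H)|$ and let $k\in\mathbb{N}$, $k\ge 1$. The following are equivalent: (i) there exists a certificate for the $k^{\text{th}}$ level of the NPA hierarchy for the $(G,H)$-isomorphism game; (ii) there exists a level-$k$ quantum isomorphism map from $G$ to $H$; (iii) $G$ and $H$ are algebraically $k$-equivalent; (iv) $G$ and $H$ are homomorphism indistinguishable over $\mathcal{P}_k$, i.e. $\hom(F,G)=\hom(F,H)$ for every graph $F$ that is the underlying graph of some member of $\mathcal{P}_k$.
   Context: All graphs are finite, undirected, without multiple edges; $G,H$ are simple (loopless). A homomorphism $F\to G$ is a map $h:V(F)\to V(G)$ with $h(u)h(v)\in E(G)$ for all $uv\in E(F)$; $\hom(F,G)$ is their number. For $g,g'\in V(G)$, $\mathrm{rel}_G(g,g')$ records whether $g=g'$, $g\sim g'$ (adjacent), or $g\ne g'$ non-adjacent; $\mathrm{rel}_G(g,g')=\mathrm{rel}_H(h,h')$ means both pairs are in the same one of these three cases. Bilabelled graphs: for $k,l\ge1$ a $(k,l)$-bilabelled graph is $\boldsymbol F=(F,\boldsymbol u,\boldsymbol v)$ with $F$ a graph, $\boldsymbol u\in V(F)^k$ (in-labels), $\boldsymbol v\in V(F)^l$ (out-labels); $F$ is its underlying graph. Its homomorphism tensor $\boldsymbol F_G\in\mathbb{C}^{V(G)^k\times V(G)^l}$ has $(\boldsymbol x,\boldsymbol y)$-entry the number of homomorphisms $h:F\to G$ with $h(u_i)=x_i$, $h(v_j)=y_j$ for all $i,j$. Series composition: for $(k,l)$-bilabelled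 $\boldsymbol F$ and $(l,n)$-bilabelled $\boldsymbol F'=(F',\boldsymbol u',\boldsymbol v')$, $\boldsymbol F\cdot\boldsymbol F'$ is the disjoint union of $F,F'$ with $v_i$ identified with $u'_i$ for all $i$, multiple edges removed, in-labels $\boldsymbol u$, out-labels $\boldsymbol v'$. Parallel composition: for two $(k,l)$-bilabelled graphs, $\boldsymbol F\odot\boldsymbol F'$ is the disjoint union with $u_i$ identified with $u'_i$ and $v_j$ with $v'_j$, multiple edges removed, labels $\boldsymbol u,\boldsymbol v$. For a $(k,k)$-bilabelled $\boldsymbol F$ and $\sigma\in\mathfrak S_{2k}$, let $\boldsymbol w=(u_1,\dots,u_k,v_1,\dots,v_k)$ and $\boldsymbol F^\sigma=(F,\boldsymbol x,\boldsymbol y)$ with $x_i=w_{\sigma(i)}$, $y_j=w_{\sigma(k+j)}$. For a matrix $X$ indexed by $V^k\times V^k$ (viewing an index pair as $\boldsymbol z\in V^{2k}$), $X^\sigma$ is defined by $(X^\sigma)_{\boldsymbol z}=X_{\boldsymbol w}$ where $w_{\sigma(i)}=z_i$; thus $(\boldsymbol F^\sigma)_G=(\boldsymbol F_G)^\sigma$. Let $\mathscr C_k\le\mathfrak S_{2k}$ be the cyclic group of rotations of the cyclic sequence $(1,2,\dots,k,2k,2k-1,\dots,k+1)$ (generated by the permutation sending each entry of this sequence to the next one, and the last to the first). A bilabelled minor of $\boldsymbol F$ is a bilabelled graph obtained by a sequence of edge contractions, edge deletions and deletions of unlabelled vertices (labels stay on their vertices). Atomic graphs: $\boldsymbol C_k=(C_k,(1,\dots,k),(k+1,\dots,2k))$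 with $V(C_k)=[2k]$ and $E(C_k)=\{\{i,i+1\}: i\in[2k]\setminus\{k,2k\}\}\cup\{\{1,k+1\},\{k,2k\}\}$; $\boldsymbol M_k=(M_k,(1,\dots,k),(k+1,\dots,2k))$ with $V(M_k)=[2k]$, $E(M_k)=\{\{i,i+k\}:i\in[k]\}$. $\mathcal Q_k^P$ is the set of bilabelled minors of $\boldsymbol C_k$, $\mathcal Q_k^S$ the set of bilabelled minors of $\boldsymbol M_k$, $\mathcal Q_k=\mathcal Q_k^P\cup\mathcal Q_k^S$. $\mathcal P_k$ is the smallest class of $(k,k)$-bilabelled graphs containing $\mathcal Q_k$ and closed under series composition, under $\boldsymbol F\mapsto \boldsymbol F\odot\boldsymbol Q$ for $\boldsymbol Q\in\mathcal Q_k^P$, and under $\boldsymbol F\mapsto\boldsymbol F^\sigma$ for $\sigma\in\mathscr C_k$. NPA certificate: let $\Sigma=V(G)\times V(H)$, $\Sigma^{\le k}$ the words of length at most $k$ over $\Sigma$, $\epsilon$ the empty word, $s^R$ the reversal of $s$, $st$ concatenation. Let $\sim$ be the coarsest equivalence relation on words with $s\,a\,a\,t\sim s\,a\,t$ for every letter $a\in\Sigma$ and words $s,t$, and $st\sim ts$ for all words $s,t$. A certificate for the $k^{\text{th}}$ level of the NPA hierarchy for the $(G,H)$-isomorphism game is a positive semidefinite matrix $\mathcal R\in\mathbb{C}^{\Sigma^{\le k}\times\Sigma^{\le k}}$ with: (1) $\mathcal R_{\epsilon,\epsilon}=1$; (2) $\mathcal R_{s,t}=\mathcal R_{s',t'}$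 whenever $s^Rt\sim s'^Rt'$; (3) for all words $s,s'$, $g\in V(G)$, $h\in V(H)$ with $s(g,h)s'\in\Sigma^{\le k}$ and all $t\in\Sigma^{\le k}$: $\sum_{h'\in V(H)}\mathcal R_{s(g,h')s',t}=\mathcal R_{ss',t}$, $\sum_{g'\in V(G)}\mathcal R_{s(g',h)s',t}=\mathcal R_{ss',t}$, $\sum_{h'}\mathcal R_{t,s(g,h')s'}=\mathcal R_{t,ss'}$, $\sum_{g'}\mathcal R_{t,s(g',h)s'}=\mathcal R_{t,ss'}$; (4) if $s^Rt$ contains consecutive letters $(g,h),(g',h')$ with $\mathrm{rel}_G(g,g')\ne\mathrm{rel}_H(h,h')$ then $\mathcal R_{s,t}=0$. Level-$k$ quantum isomorphism map: a linear map $\Phi:\mathbb{C}^{V(G)^k\times V(G)^k}\to\mathbb{C}^{V(H)^k\times V(H)^k}$ that is completely positive, satisfies $\Phi(\boldsymbol F_G\odot X)=\boldsymbol F_H\odot\Phi(X)$ for all $\boldsymbol F\in\mathcal Q_k^P$ and all $X$ ($\odot$ = entrywise product), $\Phi(I)=I=\Phi^*(I)$, $\Phi(J)=J=\Phi^*(J)$ ($I$ identity, $J$ all-ones, $\Phi^*$ the adjoint w.r.t. $\langle A,B\rangle=\mathrm{tr}(A^*B)$), $\Phi(\boldsymbol F_G)=\boldsymbol F_H$ for all $\boldsymbol F\in\mathcal Q_k$, and $\Phi(X^\sigma)=\Phi(X)^\sigma$ for all $X$ and $\sigma\in\mathscr C_k$. Algebraic $k$-equivalence: $\widehat{\mathcal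 Q}^k_G$ is the smallest subalgebra of $\mathbb{C}^{V(G)^k\times V(G)^k}$ that contains $I$ and $J$, is closed under conjugate transpose, under $X\mapsto\boldsymbol F_G\odot X$ for $\boldsymbol F\in\mathcal Q_k^P$ and under $X\mapsto X^\sigma$ for $\sigma\in\mathscr C_k$, and contains $\boldsymbol F_G$ for all $\boldsymbol F\in\mathcal Q_k$; similarly $\widehat{\mathcal Q}^k_H$. $G,H$ are algebraically $k$-equivalent if there is a vector space isomorphism $\varphi:\widehat{\mathcal Q}^k_G\to\widehat{\mathcal Q}^k_H$ with $\varphi(M^* )=\varphi(M)^*$, $\varphi(MN)=\varphi(M)\varphi(N)$, $\varphi(\boldsymbol F_G\odot M)=\boldsymbol F_H\odot\varphi(M)$ for $\boldsymbol F\in\mathcal Q_k^P$, $\varphi(I)=I$, $\varphi(J)=J$, $\varphi(\boldsymbol F_G)=\boldsymbol F_H$ for $\boldsymbol F\in\mathcal Q_k$, $\varphi(M^\sigma)=\varphi(M)^\sigma$ for $\sigma\in\mathscr C_k$, and $\mathrm{tr}(\varphi(M))=\mathrm{tr}(M)$, for all $M,N\in\widehat{\mathcal Q}^k_G$.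
   Formalization: The relation ∼ on words is taken to be the finest (i.e. the generated) equivalence relation with saat ∼ sat and st ∼ ts, instead of the "coarsest" one, which would literally relate all words and make the equivalence with (i) false. *)

theory Defs
  imports Complex_Main "HOL-Library.FuncSet"
begin

type_synonym 'a sgraph = "'a set \<times> ('a \<Rightarrow> 'a \<Rightarrow> bool)"

definition simple_graph :: "'a sgraph \<Rightarrow> bool" where
  "simple_graph G \<longleftrightarrow> finite (fst G) \<and>
     (\<forall>x y. snd G x y \<longrightarrow> x \<in> fst G \<and> y \<in> fst G) \<and>
     (\<forall>x y. snd G x y \<longrightarrow> snd G y x) \<and> (\<forall>x. \<not> snd G x x)"

datatype relkind = RelEq | RelAdj | RelNonAdj

definition rel :: "'a sgraph \<Rightarrow> 'a \<Rightarrow> 'a \<Rightarrow> relkind" where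
  "rel G g g' = (if g = g' then RelEq else if snd G g g' then RelAdj else RelNonAdj)"

section \<open>Graphs F with vertices in nat (loops allowed: an edge is a set of 1 or 2 vertices)\<close>

type_synonym lgraph = "nat set \<times> nat set set"
type_synonym blgraph = "lgraph \<times> nat list \<times> nat list"

definition is_hom :: "nat set set \<Rightarrow> ('a \<Rightarrow> 'a \<Rightarrow> bool) \<Rightarrow> (nat \<Rightarrow> 'a) \<Rightarrow> bool" where
  "is_hom E adj h \<longleftrightarrow> (\<forall>a b. {a, b} \<in> E \<longrightarrow> adj (h a) (h b))"

definition hom_count :: "lgraph \<Rightarrow> 'a sgraph \<Rightarrow> nat" where
  "hom_count F G = card {h \<in> PiE (fst F) (\<lambda>_. fst G). is_hom (snd F) (snd G) h}"

definition labels_ok :: "(nat \<Rightarrow> 'a) \<Rightarrow> nat list \<Rightarrow> 'a list \<Rightarrow> bool" where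
  "labels_ok h u x \<longleftrightarrow> length x = length u \<and> (\<forall>i<length u. h (u ! i) = x ! i)"

definition hom_tensor :: "blgraph \<Rightarrow> 'a sgraph \<Rightarrow> 'a list \<Rightarrow> 'a list \<Rightarrow> complex" where
  "hom_tensor F G x y = of_nat (card {h \<in> PiE (fst (fst F)) (\<lambda>_. fst G).
      is_hom (snd (fst F)) (snd G) h \<and> labels_ok h (fst (snd F)) x \<and> labels_ok h (snd (snd F)) y})"

definition quot_graph :: "(nat \<Rightarrow> nat) \<Rightarrow> lgraph \<Rightarrow> lgraph" where
  "quot_graph r F = (r ` fst F, (\<lambda>e. r ` e) ` snd F)"

definition gen_rep :: "(nat \<times> nat) set \<Rightarrow> nat \<Rightarrow> nat" where
  "gen_rep R a = Min {b. (a, b) \<in> (R \<union> R\<inverse>)\<^sup>*}"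

definition ev :: "nat \<Rightarrow> nat" where "ev n = 2 * n"
definition od :: "nat \<Rightarrow> nat" where "od n = 2 * n + 1"

definition disj_union :: "lgraph \<Rightarrow> lgraph \<Rightarrow> lgraph" where
  "disj_union F F' = (ev ` fst F \<union> od ` fst F', (\<lambda>e. ev ` e) ` snd F \<union> (\<lambda>e. od ` e) ` snd F')"

text \<open>Series composition: identify v_i with u'_i; multiple edges disappear automatically
  since the edge set is a set.\<close>
definition series :: "blgraph \<Rightarrow> blgraph \<Rightarrow> blgraph" where
  "series F F' = (let r = gen_rep (set (zip (map ev (snd (snd F))) (map od (fst (snd F')))))
     in (quot_graph r (disj_union (fst F) (fst F')), map (r \<circ> ev) (fst (snd F)), map (r \<circ> od) (snd (snd F'))))"

definition parallel :: "blgraph \<Rightarrow> blgraph \<Rightarrow> blgraph" where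
  "parallel F F' = (let r = gen_rep (set (zip (map ev (fst (snd F))) (map od (fst (snd F'))))
                                   \<union> set (zip (map ev (snd (snd F))) (map od (snd (snd F')))))
     in (quot_graph r (disj_union (fst F) (fst F')), map (r \<circ> ev) (fst (snd F)), map (r \<circ> ev) (snd (snd F))))"

definition bl_perm :: "nat \<Rightarrow> (nat \<Rightarrow> nat) \<Rightarrow> blgraph \<Rightarrow> blgraph" where
  "bl_perm k \<sigma> F = (let w = fst (snd F) @ snd (snd F)
     in (fst F, map (\<lambda>i. w ! \<sigma> i) [0..<k], map (\<lambda>j. w ! \<sigma> (k + j)) [0..<k]))"

text \<open>0-indexed cyclic sequence (0,1,...,k-1,2k-1,2k-2,...,k): position of a value and value at a position.\<close>
definition cyc_pos :: "nat \<Rightarrow> nat \<Rightarrow> nat" where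
  "cyc_pos k j = (if j < k then j else 3 * k - 1 - j)"
definition cyc_val :: "nat \<Rightarrow> nat \<Rightarrow> nat" where
  "cyc_val k p = (if p < k then p else 3 * k - 1 - p)"

definition cyc_gen :: "nat \<Rightarrow> nat \<Rightarrow> nat" where
  "cyc_gen k j = (if j < 2 * k then cyc_val k ((cyc_pos k j + 1) mod (2 * k)) else j)"

definition cyc_group :: "nat \<Rightarrow> (nat \<Rightarrow> nat) set" where
  "cyc_group k = range (\<lambda>n. cyc_gen k ^^ n)"

inductive_set bl_minors :: "blgraph \<Rightarrow> blgraph set" for F0 :: blgraph where
  self: "F0 \<in> bl_minors F0"
| del_edge: "((V, E), u, v) \<in> bl_minors F0 \<Longrightarrow> e \<in> E \<Longrightarrow> ((V, E - {e}), u, v) \<in> bl_minors F0"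
| contract: "((V, E), u, v) \<in> bl_minors F0 \<Longrightarrow> {a, b} \<in> E \<Longrightarrow> a \<noteq> b \<Longrightarrow>
     (let r = (\<lambda>x. if x = b then a else x)
      in (quot_graph r (V, E - {{a, b}}), map r u, map r v)) \<in> bl_minors F0"
| del_vertex: "((V, E), u, v) \<in> bl_minors F0 \<Longrightarrow> x \<in> V \<Longrightarrow> x \<notin> set u \<Longrightarrow> x \<notin> set v \<Longrightarrow>
     ((V - {x}, {e \<in> E. x \<notin> e}), u, v) \<in> bl_minors F0"

definition C_atom :: "nat \<Rightarrow> blgraph" where
  "C_atom k = (({0..<2 * k},
      {{i, i + 1} | i. i + 1 < 2 * k \<and> i \<noteq> k - 1} \<union> {{0, k}, {k - 1, 2 * k - 1}}),
     [0..<k], [k..<2 * k])"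

definition M_atom :: "nat \<Rightarrow> blgraph" where
  "M_atom k = (({0..<2 * k}, {{i, i + k} | i. i < k}), [0..<k], [k..<2 * k])"

definition QP :: "nat \<Rightarrow> blgraph set" where "QP k = bl_minors (C_atom k)"
definition QS :: "nat \<Rightarrow> blgraph set" where "QS k = bl_minors (M_atom k)"
definition Q :: "nat \<Rightarrow> blgraph set" where "Q k = QP k \<union> QS k"

inductive_set PP :: "nat \<Rightarrow> blgraph set" for k :: nat where
  atom: "F \<in> Q k \<Longrightarrow> F \<in> PP k"
| ser: "F \<in> PP k \<Longrightarrow> F' \<in> PP k \<Longrightarrow> series F F' \<in> PP k"
| par: "F \<in> PP k \<Longrightarrow> F' \<in> QP k \<Longrightarrow> parallel F F' \<in> PP k"
| perm: "F \<in> PP k \<Longrightarrow> \<sigma> \<in> cyc_group k \<Longrightarrow> bl_perm k \<sigma> F \<in> PP k"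

definition hom_indist_PP :: "nat \<Rightarrow> 'a sgraph \<Rightarrow> 'b sgraph \<Rightarrow> bool" where
  "hom_indist_PP k G H \<longleftrightarrow> (\<forall>F \<in> PP k. hom_count (fst F) G = hom_count (fst F) H)"

type_synonym 'a mat = "'a list \<Rightarrow> 'a list \<Rightarrow> complex"

definition tuples :: "'a set \<Rightarrow> nat \<Rightarrow> 'a list set" where
  "tuples V k = {xs. length xs = k \<and> set xs \<subseteq> V}"

definition matspace :: "'a set \<Rightarrow> nat \<Rightarrow> 'a mat set" where
  "matspace V k = {M. \<forall>x y. M x y \<noteq> 0 \<longrightarrow> x \<in> tuples V k \<and> y \<in> tuples V k}"

definition madd :: "'a mat \<Rightarrow> 'a mat \<Rightarrow> 'a mat" where
  "madd M N = (\<lambda>x y. M x y + N x y)"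
definition msmult :: "complex \<Rightarrow> 'a mat \<Rightarrow> 'a mat" where
  "msmult c M = (\<lambda>x y. c * M x y)"
definition mmul :: "'a set \<Rightarrow> nat \<Rightarrow> 'a mat \<Rightarrow> 'a mat \<Rightarrow> 'a mat" where
  "mmul V k M N = (\<lambda>x y. \<Sum>z\<in>tuples V k. M x z * N z y)"
definition mstar :: "'a mat \<Rightarrow> 'a mat" where
  "mstar M = (\<lambda>x y. cnj (M y x))"
definition hadamard :: "'a mat \<Rightarrow> 'a mat \<Rightarrow> 'a mat" where
  "hadamard M N = (\<lambda>x y. M x y * N x y)"
definition idm :: "'a set \<Rightarrow> nat \<Rightarrow> 'a mat" where
  "idm V k = (\<lambda>x y. if x \<in> tuples V k \<and> y = x then 1 else 0)"
definition onesm :: "'a set \<Rightarrow> nat \<Rightarrow> 'a mat" where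
  "onesm V k = (\<lambda>x y. if x \<in> tuples V k \<and> y \<in> tuples V k then 1 else 0)"
definition mtrace :: "'a set \<Rightarrow> nat \<Rightarrow> 'a mat \<Rightarrow> complex" where
  "mtrace V k M = (\<Sum>x\<in>tuples V k. M x x)"
definition minner :: "'a set \<Rightarrow> nat \<Rightarrow> 'a mat \<Rightarrow> 'a mat \<Rightarrow> complex" where
  "minner V k A B = mtrace V k (mmul V k (mstar A) B)"

text \<open>X^sigma: (X^sigma)_z = X_w where w_(sigma i) = z_i (0-indexed, z = x @ y).\<close>
definition permute_mat :: "nat \<Rightarrow> (nat \<Rightarrow> nat) \<Rightarrow> 'a mat \<Rightarrow> 'a mat" where
  "permute_mat k \<sigma> X = (\<lambda>x y. if length x = k \<and> length y = k then
      (let w = map (\<lambda>j. (x @ y) ! inv_into {..<2 * k} \<sigma> j) [0..<2 * k]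
       in X (take k w) (drop k w)) else 0)"

definition psd_on :: "'i set \<Rightarrow> ('i \<Rightarrow> 'i \<Rightarrow> complex) \<Rightarrow> bool" where
  "psd_on S M \<longleftrightarrow> (\<forall>v :: 'i \<Rightarrow> complex.
      Im (\<Sum>a\<in>S. \<Sum>b\<in>S. cnj (v a) * M a b * v b) = 0 \<and>
      0 \<le> Re (\<Sum>a\<in>S. \<Sum>b\<in>S. cnj (v a) * M a b * v b))"

inductive word_equiv :: "'c list \<Rightarrow> 'c list \<Rightarrow> bool" where
  refl: "word_equiv s s"
| sym: "word_equiv s t \<Longrightarrow> word_equiv t s"
| trans: "word_equiv s t \<Longrightarrow> word_equiv t r \<Longrightarrow> word_equiv s r"
| dup: "word_equiv (s @ [a, a] @ t) (s @ [a] @ t)"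
| cyc: "word_equiv (s @ t) (t @ s)"

definition words :: "'a set \<Rightarrow> 'b set \<Rightarrow> nat \<Rightarrow> ('a \<times> 'b) list set" where
  "words VG VH k = {w. length w \<le> k \<and> set w \<subseteq> VG \<times> VH}"

definition npa_certificate :: "nat \<Rightarrow> 'a sgraph \<Rightarrow> 'b sgraph
     \<Rightarrow> (('a \<times> 'b) list \<Rightarrow> ('a \<times> 'b) list \<Rightarrow> complex) \<Rightarrow> bool" where
  "npa_certificate k G H R \<longleftrightarrow>
     (let W = words (fst G) (fst H) k in
       psd_on W R \<and>
       R [] [] = 1 \<and>
       (\<forall>s\<in>W. \<forall>t\<in>W. \<forall>s'\<in>W. \<forall>t'\<in>W.
          word_equiv (rev s @ t) (rev s' @ t') \<longrightarrow> R s t = R s' t') \<and>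
       (\<forall>s s' g h t. g \<in> fst G \<longrightarrow> h \<in> fst H \<longrightarrow> s @ [(g, h)] @ s' \<in> W \<longrightarrow> t \<in> W \<longrightarrow>
          (\<Sum>h'\<in>fst H. R (s @ [(g, h')] @ s') t) = R (s @ s') t \<and>
          (\<Sum>g'\<in>fst G. R (s @ [(g', h)] @ s') t) = R (s @ s') t \<and>
          (\<Sum>h'\<in>fst H. R t (s @ [(g, h')] @ s')) = R t (s @ s') \<and>
          (\<Sum>g'\<in>fst G. R t (s @ [(g', h)] @ s')) = R t (s @ s')) \<and>
       (\<forall>s\<in>W. \<forall>t\<in>W. \<forall>i. i + 1 < length (rev s @ t) \<longrightarrow>
          rel G (fst ((rev s @ t) ! i)) (fst ((rev s @ t) ! (i + 1))) \<noteq>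
          rel H (snd ((rev s @ t) ! i)) (snd ((rev s @ t) ! (i + 1))) \<longrightarrow> R s t = 0))"

definition completely_positive :: "nat \<Rightarrow> 'a set \<Rightarrow> 'b set \<Rightarrow> ('a mat \<Rightarrow> 'b mat) \<Rightarrow> bool" where
  "completely_positive k VG VH \<Phi> \<longleftrightarrow>
     (\<forall>(n::nat) (B :: nat \<times> 'a list \<Rightarrow> nat \<times> 'a list \<Rightarrow> complex).
        (\<forall>i<n. \<forall>j<n. (\<lambda>x y. B (i, x) (j, y)) \<in> matspace VG k) \<longrightarrow>
        psd_on ({..<n} \<times> tuples VG k) B \<longrightarrow>
        psd_on ({..<n} \<times> tuples VH k) (\<lambda>(i, x) (j, y). \<Phi> (\<lambda>x' y'. B (i, x') (j, y')) x y))"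

definition is_adjoint :: "nat \<Rightarrow> 'a set \<Rightarrow> 'b set \<Rightarrow> ('a mat \<Rightarrow> 'b mat) \<Rightarrow> ('b mat \<Rightarrow> 'a mat) \<Rightarrow> bool" where
  "is_adjoint k VG VH \<Phi> \<Psi> \<longleftrightarrow>
     (\<forall>A\<in>matspace VH k. \<Psi> A \<in> matspace VG k) \<and>
     (\<forall>A\<in>matspace VH k. \<forall>B\<in>matspace VG k. minner VG k (\<Psi> A) B = minner VH k A (\<Phi> B))"

definition qiso_map :: "nat \<Rightarrow> 'a sgraph \<Rightarrow> 'b sgraph \<Rightarrow> ('a mat \<Rightarrow> 'b mat) \<Rightarrow> bool" where
  "qiso_map k G H \<Phi> \<longleftrightarrow>
     (let VG = fst G; VH = fst H in
       (\<forall>X\<in>matspace VG k. \<Phi> X \<in> matspace VH k) \<and>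
       (\<forall>X\<in>matspace VG k. \<forall>Y\<in>matspace VG k. \<Phi> (madd X Y) = madd (\<Phi> X) (\<Phi> Y)) \<and>
       (\<forall>c. \<forall>X\<in>matspace VG k. \<Phi> (msmult c X) = msmult c (\<Phi> X)) \<and>
       completely_positive k VG VH \<Phi> \<and>
       (\<forall>F\<in>QP k. \<forall>X\<in>matspace VG k. \<Phi> (hadamard (hom_tensor F G) X) = hadamard (hom_tensor F H) (\<Phi> X)) \<and>
       \<Phi> (idm VG k) = idm VH k \<and> \<Phi> (onesm VG k) = onesm VH k \<and>
       (\<exists>\<Psi>. is_adjoint k VG VH \<Phi> \<Psi> \<and> \<Psi> (idm VH k) = idm VG k \<and> \<Psi> (onesm VH k) = onesm VG k) \<and>
       (\<forall>F\<in>Q k. \<Phi> (hom_tensor F G) = hom_tensor F H) \<and>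
       (\<forall>\<sigma>\<in>cyc_group k. \<forall>X\<in>matspace VG k. \<Phi> (permute_mat k \<sigma> X) = permute_mat k \<sigma> (\<Phi> X)))"

inductive_set qalg :: "nat \<Rightarrow> 'a sgraph \<Rightarrow> 'a mat set" for k :: nat and G :: "'a sgraph" where
  I: "idm (fst G) k \<in> qalg k G"
| J: "onesm (fst G) k \<in> qalg k G"
| atom: "F \<in> Q k \<Longrightarrow> hom_tensor F G \<in> qalg k G"
| add: "M \<in> qalg k G \<Longrightarrow> N \<in> qalg k G \<Longrightarrow> madd M N \<in> qalg k G"
| smult: "M \<in> qalg k G \<Longrightarrow> msmult c M \<in> qalg k G"
| mul: "M \<in> qalg k G \<Longrightarrow> N \<in> qalg k G \<Longrightarrow> mmul (fst G) k M N \<in> qalg k G"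
| star: "M \<in> qalg k G \<Longrightarrow> mstar M \<in> qalg k G"
| had: "M \<in> qalg k G \<Longrightarrow> F \<in> QP k \<Longrightarrow> hadamard (hom_tensor F G) M \<in> qalg k G"
| perm: "M \<in> qalg k G \<Longrightarrow> \<sigma> \<in> cyc_group k \<Longrightarrow> permute_mat k \<sigma> M \<in> qalg k G"

definition alg_equiv :: "nat \<Rightarrow> 'a sgraph \<Rightarrow> 'b sgraph \<Rightarrow> bool" where
  "alg_equiv k G H \<longleftrightarrow> (\<exists>\<phi> :: 'a mat \<Rightarrow> 'b mat.
     inj_on \<phi> (qalg k G) \<and> \<phi> ` qalg k G = qalg k H \<and>
     (\<forall>M\<in>qalg k G. \<forall>N\<in>qalg k G. \<phi> (madd M N) = madd (\<phi> M) (\<phi> N) \<and>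
        \<phi> (mmul (fst G) k M N) = mmul (fst H) k (\<phi> M) (\<phi> N)) \<and>
     (\<forall>M\<in>qalg k G. (\<forall>c. \<phi> (msmult c M) = msmult c (\<phi> M)) \<and>
        \<phi> (mstar M) = mstar (\<phi> M) \<and>
        (\<forall>F\<in>QP k. \<phi> (hadamard (hom_tensor F G) M) = hadamard (hom_tensor F H) (\<phi> M)) \<and>
        (\<forall>\<sigma>\<in>cyc_group k. \<phi> (permute_mat k \<sigma> M) = permute_mat k \<sigma> (\<phi> M)) \<and>
        mtrace (fst H) k (\<phi> M) = mtrace (fst G) k M) \<and>
     \<phi> (idm (fst G) k) = idm (fst H) k \<and> \<phi> (onesm (fst G) k) = onesm (fst H) k \<and>
     (\<forall>F\<in>Q k. \<phi> (hom_tensor F G) = hom_tensor F H))"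

end

theory Submission
  imports Defs
begin

text \<open>
  The entries of a certificate at pairs of words of length exactly \<open>k\<close> form the Choi matrix of a quantum isomorphism
  map. Conversely, a unital, trace-preserving, completely positive map \<open>\<Phi>\<close> is multiplicative on every matrix whose
  Hilbert-Schmidt norm it preserves. Applied to the tensor that forgets one label, this allows letters to be summed out
  of the Choi matrix consistently, which yields the entries of a certificate at shorter words.

  The matrices whose norm is preserved by \<open>\<Phi>\<close> contain the algebra of \<open>G\<close>, so \<open>\<Phi>\<close> restricts to an isomorphism of
  algebras. An isomorphism of algebras maps \<open>F\<^sub>G\<close> to \<open>F\<^sub>H\<close> for every \<open>F\<close> in \<open>P\<^sub>k\<close> and preserves traces, hence
  homomorphism counts. Conversely, equal homomorphism counts give equal traces of \<open>F\<^sub>G\<close> and \<open>F\<^sub>H\<close>, because a graph in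
  \<open>P\<^sub>k\<close> can be closed up inside \<open>P\<^sub>k\<close>; hence equal inner products of tensors, and \<open>F\<^sub>G \<mapsto> F\<^sub>H\<close> extends to an
  isomorphism of algebras. Composed with the orthogonal projection onto the algebra of \<open>G\<close>, such an isomorphism is a
  quantum isomorphism map; its complete positivity is the main point.
\<close>

section \<open>Positive semidefinite matrices and orthonormal bases\<close>

text \<open>Every vertex of a member of \<open>Q k\<close> is labelled, so its tensor is a 0/1
  matrix. The squared norm of such a matrix is the sum of its entries, and that sum is preserved by
  a map whose adjoint fixes J; this is why the atomic tensors, in particular the one that forgets a
  label, have their norm preserved. The Choi matrix only knows words of length 2k. That the sums
  defining the values at shorter words do not depend on the chosen letters has to be carried through
  the summation together with cyclic invariance and the vanishing at mismatched neighbours. The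
  obstacle in passing from an algebra isomorphism \<phi> to a map is positivity outside the algebra.
  For an orthonormal basis B of the algebra the Choi matrix of \<phi> after projection acts as the
  selfadjoint operator that sends V to the sum over b in B of \<phi> b times V times the adjoint of
  b. Its square is the operator itself followed by right multiplication with a positive definite
  matrix, and this forces nonnegativity. No structure theory of finite-dimensional algebras
  enters.\<close>

lemma cmod_square: "(complex_of_real (cmod z))\<^sup>2 = z * cnj z"
  using complex_norm_square[of z] by simp

definition quad_form :: "'i set \<Rightarrow> ('i \<Rightarrow> 'i \<Rightarrow> complex) \<Rightarrow> ('i \<Rightarrow> complex) \<Rightarrow> complex" where
  "quad_form S M v = (\<Sum>a\<in>S. \<Sum>b\<in>S. cnj (v a) * M a b * v b)"

lemma psd_on_iff: "psd_on S M \<longleftrightarrow> (\<forall>v. \<exists>r\<ge>0. quad_form S M v = complex_of_real r)"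
proof -
  have "(Im z = 0 \<and> 0 \<le> Re z) = (\<exists>r\<ge>0. z = complex_of_real r)" for z
    by (auto simp: complex_eq_iff)
  thus ?thesis unfolding psd_on_def quad_form_def by presburger
qed

lemma cnj_mult_self: "cnj z * z = complex_of_real ((cmod z)\<^sup>2)"
  by (simp add: cmod_square)

lemma sum_swap3: "(\<Sum>a\<in>A. \<Sum>b\<in>B a. \<Sum>r\<in>R. f a b r) = (\<Sum>r\<in>R. \<Sum>a\<in>A. \<Sum>b\<in>B a. f a b r)"
proof -
  have "(\<Sum>a\<in>A. \<Sum>b\<in>B a. \<Sum>r\<in>R. f a b r) = (\<Sum>a\<in>A. \<Sum>r\<in>R. \<Sum>b\<in>B a. f a b r)"
    by (intro sum.cong HOL.refl sum.swap)
  also have "\<dots> = (\<Sum>r\<in>R. \<Sum>a\<in>A. \<Sum>b\<in>B a. f a b r)" by (rule sum.swap)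
  finally show ?thesis .
qed

lemma quad_form_cong:
  "(\<And>a b. a \<in> S \<Longrightarrow> b \<in> S \<Longrightarrow> M a b = M' a b) \<Longrightarrow> (\<And>a. a \<in> S \<Longrightarrow> v a = v' a) \<Longrightarrow>
   quad_form S M v = quad_form S M' v'"
  unfolding quad_form_def by (intro sum.cong HOL.refl) simp_all

lemma psd_on_subset:
  assumes "psd_on S M" "T \<subseteq> S" "finite S" shows "psd_on T M"
  unfolding psd_on_iff
proof
  fix v
  have "quad_form T M v = quad_form S M (\<lambda>a. if a \<in> T then v a else 0)"
    unfolding quad_form_def
    by (rule sum.mono_neutral_cong_left[OF assms(3,2)], simp,
        rule sum.mono_neutral_cong_left[OF assms(3,2)]) auto
  thus "\<exists>r\<ge>0. quad_form T M v = complex_of_real r" using assms(1) unfolding psd_on_iff by metis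
qed

lemma quad_form_insert:
  assumes "finite S" "c \<notin> S"
  shows "quad_form (insert c S) M v = cnj (v c) * M c c * v c + cnj (v c) * (\<Sum>b\<in>S. M c b * v b)
     + (\<Sum>a\<in>S. cnj (v a) * M a c) * v c + quad_form S M v"
  using assms unfolding quad_form_def
  by (simp add: sum.distrib sum_distrib_left sum_distrib_right mult.assoc add.assoc)

lemma quad_form_pair:
  assumes "a \<noteq> b"
  shows "quad_form {a, b} M v = cnj (v a) * M a a * v a + cnj (v a) * M a b * v b
     + cnj (v b) * M b a * v a + cnj (v b) * M b b * v b"
  using assms unfolding quad_form_def by (simp add: algebra_simps)

lemma psd_on_diag:
  assumes "psd_on S M" "a \<in> S" "finite S" shows "\<exists>r\<ge>0. M a a = complex_of_real r"
  using psd_on_subset[OF assms(1), of "{a}"] assms(2,3)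
  unfolding psd_on_iff quad_form_def by (auto dest: spec[where x="\<lambda>_. 1"])

text \<open>Polarization: the form is real at the vectors (1, 1) and (1, i), and the two vanishing
  imaginary parts compare the imaginary and the real parts of \<open>M a b\<close> and
  \<open>M b a\<close>.\<close>

lemma psd_on_hermitian:
  assumes "psd_on S M" "a \<in> S" "b \<in> S" "finite S" shows "M b a = cnj (M a b)"
proof (cases "a = b")
  case True thus ?thesis using psd_on_diag[OF assms(1,2,4)] by auto
next
  case False
  have p: "psd_on {a, b} M" by (rule psd_on_subset[OF assms(1)]) (use assms in auto)
  obtain ra rb where d: "M a a = complex_of_real ra" "M b b = complex_of_real rb"
    using psd_on_diag[OF assms(1,2,4)] psd_on_diag[OF assms(1,3,4)] by blast
  obtain r1 where "quad_form {a,b} M (\<lambda>_. 1) = complex_of_real r1"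
    using p unfolding psd_on_iff by meson
  hence 1: "complex_of_real ra + M a b + M b a + complex_of_real rb = complex_of_real r1"
    using False d by (simp add: quad_form_pair)
  obtain r2 where "quad_form {a,b} M (\<lambda>x. if x = a then 1 else \<i>) = complex_of_real r2"
    using p unfolding psd_on_iff by meson
  hence 2: "complex_of_real ra + M a b * \<i> - \<i> * M b a + complex_of_real rb = complex_of_real r2"
    using False d by (simp add: quad_form_pair mult.commute mult.left_commute)
  show ?thesis using arg_cong[OF 1, of Im] arg_cong[OF 2, of Im] by (intro complex_eqI) auto
qed

text \<open>At the vector (- t \<open>M a b\<close>, 1) the form equals \<open>M b b\<close> - 2t
  |\<open>M a b\<close>|^2, which is negative for large t unless \<open>M a b\<close>
  vanishes.\<close>

lemma psd_on_zero_diag: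
  assumes "psd_on S M" "a \<in> S" "b \<in> S" "finite S" "M a a = 0" shows "M a b = 0"
proof (cases "a = b")
  case False
  have p: "psd_on {a, b} M" by (rule psd_on_subset[OF assms(1)]) (use assms in auto)
  have h: "M b a = cnj (M a b)" using psd_on_hermitian[OF assms(1-4)] .
  obtain rb where d: "rb \<ge> 0" "M b b = complex_of_real rb"
    using psd_on_diag[OF assms(1,3,4)] by blast
  define w where "w t x = (if x = a then - complex_of_real t * M a b else 1)" for t x
  have w: "0 \<le> rb - 2 * t * (cmod (M a b))\<^sup>2" for t
  proof -
    obtain r where r: "r \<ge> 0" "quad_form {a,b} M (w t) = complex_of_real r"
      using p unfolding psd_on_iff by meson
    have "quad_form {a,b} M (w t) = complex_of_real (rb - 2 * t * (cmod (M a b))\<^sup>2)"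
      using False d h assms(5)
      by (simp add: quad_form_pair w_def cmod_square algebra_simps cmod_square)
    thus ?thesis using r by (metis of_real_eq_iff)
  qed
  show ?thesis
  proof (rule ccontr)
    assume "M a b \<noteq> 0"
    hence "0 < (cmod (M a b))\<^sup>2" by simp
    \<comment> \<open>For this t the form would have the value -1.\<close>
    with w[of "(rb + 1) / (2 * (cmod (M a b))\<^sup>2)"] show False by (simp add: field_simps)
  qed
qed (use assms in simp)

text \<open>Cholesky factorization: the Schur complement of the pivot \<open>c\<close> is again
  positive semidefinite. If the pivot is zero, so is its row, and division by zero yields the right
  complement.\<close>

lemma psd_on_gram:
  assumes "finite S" "psd_on S M"
  shows "\<exists>(n::nat) p. \<forall>a\<in>S. \<forall>b\<in>S. M a b = (\<Sum>r<n. cnj (p r a) * p r b)"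
  using assms
proof (induction S arbitrary: M rule: finite_induct)
  case empty show ?case by simp
next
  case (insert c S)
  have fin: "finite (insert c S)" using insert by simp
  obtain al where al: "al \<ge> 0" "M c c = complex_of_real al"
    using psd_on_diag[OF insert.prems _ fin] by blast
  define M' where "M' a b = M a b - M a c * M c b / of_real al" for a b
  have herm: "M a c = cnj (M c a)" if "a \<in> S" for a
    using psd_on_hermitian[OF insert.prems _ _ fin, of c a] that by simp
  have z: "M c b = 0" if "al = 0" "b \<in> S" for b
    using psd_on_zero_diag[OF insert.prems _ _ fin, of c b] al that by simp
  have "psd_on S M'"
    unfolding psd_on_iff
  proof
    fix v
    define L where "L = (\<Sum>b\<in>S. M c b * v b)"
    \<comment> \<open>Completing the square: this value at \<open>c\<close> minimizes the form in
      that coordinate, and what remains is the form of the Schur complement.\<close>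
    define w where "w x = (if x = c then - L / of_real al else v x)" for x
    have L': "(\<Sum>a\<in>S. cnj (v a) * M a c) = cnj L" unfolding L_def by (simp add: herm mult.commute)
    have e: "(\<Sum>b\<in>S. M c b * w b) = L" "(\<Sum>a\<in>S. cnj (w a) * M a c) = cnj L"
      using insert(2) unfolding L'[symmetric] unfolding L_def
      by (auto intro!: sum.cong simp: w_def)
    have q: "quad_form S M w = quad_form S M v"
      using insert(2) by (intro quad_form_cong) (auto simp: w_def)
    have "quad_form S M' v = quad_form S M v - (\<Sum>a\<in>S. \<Sum>b\<in>S. (cnj (v a) * M a c) * (M c b * v b) / of_real al)"
      unfolding quad_form_def M'_def by (simp add: sum_subtractf[symmetric] algebra_simps)
    also have "(\<Sum>a\<in>S. \<Sum>b\<in>S. (cnj (v a) * M a c) * (M c b * v b) / of_real al) = cnj L * L / of_real al"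
      unfolding L'[symmetric] unfolding L_def sum_product sum_divide_distrib ..
    finally have 1: "quad_form S M' v = quad_form S M v - cnj L * L / of_real al" .
    have wc: "w c = - L / of_real al" unfolding w_def by simp
    have "quad_form (insert c S) M w = quad_form S M v - cnj L * L / of_real al"
      unfolding quad_form_insert[OF insert(1,2)] e q wc al(2) by (cases "al = 0") (simp_all add: field_simps)
    thus "\<exists>r\<ge>0. quad_form S M' v = complex_of_real r" using 1 insert.prems unfolding psd_on_iff by metis
  qed
  from insert.IH[OF this] obtain n :: nat and p where p: "\<And>a b. a \<in> S \<Longrightarrow> b \<in> S \<Longrightarrow> M' a b = (\<Sum>r<n. cnj (p r a) * p r b)"
    by fast
  define p' where "p' r b = (if r = n then M c b / of_real (sqrt al) else if b = c then 0 else p r b)" for r b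
  have s: "complex_of_real (sqrt al) * complex_of_real (sqrt al) = complex_of_real al"
    using al(1) by (metis of_real_mult real_sqrt_mult_self abs_of_nonneg)
  have rest: "(\<Sum>r<n. cnj (p' r a) * p' r b) = (if a = c \<or> b = c then 0 else (\<Sum>r<n. cnj (p r a) * p r b))" for a b
    by (auto simp: p'_def intro!: sum.neutral)
  have last: "cnj (p' n a) * p' n b = cnj (M c a) * M c b / of_real al" for a b
    unfolding p'_def using s by simp
  have "M a b = (\<Sum>r<Suc n. cnj (p' r a) * p' r b)" if ab: "a \<in> insert c S" "b \<in> insert c S" for a b
  proof (cases "a = c \<or> b = c")
    case True
    have "M a b = cnj (M c a) * M c b / of_real al"
    proof (cases "a = c")
      case True
      show ?thesis
      proof (cases "b = c")
        case True thus ?thesis using \<open>a = c\<close> al(2) by simp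
      next
        case False thus ?thesis using \<open>a = c\<close> al(2) z[of b] ab by (cases "al = 0") simp_all
      qed
    next
      case False
      hence "b = c" "a \<in> S" using \<open>a = c \<or> b = c\<close> ab by auto
      thus ?thesis using al(2) herm[of a] z[of a] by (cases "al = 0") simp_all
    qed
    thus ?thesis unfolding sum.lessThan_Suc rest last using True by simp
  next
    case False
    hence "a \<in> S" "b \<in> S" using ab by auto
    have "M a b = M' a b + cnj (M c a) * M c b / of_real al"
      unfolding M'_def herm[OF \<open>a \<in> S\<close>, symmetric] by simp
    also have "M' a b = (\<Sum>r<n. cnj (p' r a) * p' r b)"
      unfolding rest using p[OF \<open>a \<in> S\<close> \<open>b \<in> S\<close>] False by simp
    finally show ?thesis unfolding sum.lessThan_Suc last .
  qed
  hence "\<forall>a\<in>insert c S. \<forall>b\<in>insert c S. M a b = (\<Sum>r<Suc n. cnj (p' r a) * p' r b)" by (intro ballI)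
  thus ?case by - (rule exI, rule exI, assumption)
qed

lemma psd_on_if_gram:
  assumes "\<And>a b. a \<in> S \<Longrightarrow> b \<in> S \<Longrightarrow> M a b = (\<Sum>r\<in>R. cnj (p r a) * p r b)"
  shows "psd_on S M"
  unfolding psd_on_iff
proof
  fix v
  have "quad_form S M v = (\<Sum>a\<in>S. \<Sum>b\<in>S. \<Sum>r\<in>R. cnj (p r a * v a) * (p r b * v b))"
    unfolding quad_form_def
  proof (intro sum.cong HOL.refl)
    fix a b assume ab: "a \<in> S" "b \<in> S"
    show "cnj (v a) * M a b * v b = (\<Sum>r\<in>R. cnj (p r a * v a) * (p r b * v b))"
      unfolding assms[OF ab] sum_distrib_left sum_distrib_right
      by (intro sum.cong HOL.refl) (simp only: complex_cnj_mult mult_ac)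
  qed
  also have "\<dots> = (\<Sum>r\<in>R. \<Sum>a\<in>S. \<Sum>b\<in>S. cnj (p r a * v a) * (p r b * v b))"
    by (rule sum_swap3)
  also have "\<dots> = (\<Sum>r\<in>R. cnj (\<Sum>a\<in>S. p r a * v a) * (\<Sum>b\<in>S. p r b * v b))"
    by (simp add: sum_product)
  also have "\<dots> = complex_of_real (\<Sum>r\<in>R. (cmod (\<Sum>a\<in>S. p r a * v a))\<^sup>2)"
    by (simp only: cnj_mult_self of_real_sum)
  finally have "quad_form S M v = complex_of_real (\<Sum>r\<in>R. (cmod (\<Sum>a\<in>S. p r a * v a))\<^sup>2)" .
  moreover have "0 \<le> (\<Sum>r\<in>R. (cmod (\<Sum>a\<in>S. p r a * v a))\<^sup>2)" by (simp add: sum_nonneg)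
  ultimately show "\<exists>r\<ge>0. quad_form S M v = complex_of_real r" by blast
qed

text \<open>Gram vectors may be summed over blocks. With singleton blocks this reindexes a Choi
  matrix; with the blocks of all paddings it gives the positivity of a certificate on short
  words.\<close>

lemma psd_on_pullback:
  assumes "finite T" "psd_on T M" and "\<And>s a. s \<in> S \<Longrightarrow> a \<in> P s \<Longrightarrow> f s a \<in> T"
    and "\<And>s t. s \<in> S \<Longrightarrow> t \<in> S \<Longrightarrow> N s t = (\<Sum>a\<in>P s. \<Sum>b\<in>P t. M (f s a) (f t b))"
  shows "psd_on S N"
proof -
  obtain n :: nat and p where p: "\<And>a b. a \<in> T \<Longrightarrow> b \<in> T \<Longrightarrow> M a b = (\<Sum>r<n. cnj (p r a) * p r b)"
    using psd_on_gram[OF assms(1,2)] by fast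
  have "N s t = (\<Sum>r<n. cnj (\<Sum>a\<in>P s. p r (f s a)) * (\<Sum>b\<in>P t. p r (f t b)))"
    if "s \<in> S" "t \<in> S" for s t
  proof -
    have "N s t = (\<Sum>a\<in>P s. \<Sum>b\<in>P t. \<Sum>r<n. cnj (p r (f s a)) * p r (f t b))"
      unfolding assms(4)[OF that] by (intro sum.cong HOL.refl p assms(3) that)
    also have "\<dots> = (\<Sum>r<n. \<Sum>a\<in>P s. \<Sum>b\<in>P t. cnj (p r (f s a)) * p r (f t b))"
      by (rule sum_swap3)
    finally show ?thesis by (simp add: sum_product)
  qed
  thus ?thesis by (rule psd_on_if_gram)
qed

section \<open>Orthonormal bases of finite-dimensional function spaces\<close>

definition dot :: "'i set \<Rightarrow> ('i \<Rightarrow> complex) \<Rightarrow> ('i \<Rightarrow> complex) \<Rightarrow> complex" where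
  "dot S f g = (\<Sum>s\<in>S. cnj (f s) * g s)"

definition orthonormal :: "'i set \<Rightarrow> ('i \<Rightarrow> complex) set \<Rightarrow> bool" where
  "orthonormal S B \<longleftrightarrow> (\<forall>b\<in>B. \<forall>c\<in>B. dot S b c = (if b = c then 1 else 0))"

text \<open>Members vanish outside \<open>S\<close>, so that an expansion valid on \<open>S\<close>
  is an equality of functions.\<close>

definition subspace_on :: "'i set \<Rightarrow> ('i \<Rightarrow> complex) set \<Rightarrow> bool" where
  "subspace_on S A \<longleftrightarrow> (\<forall>f\<in>A. \<forall>s. s \<notin> S \<longrightarrow> f s = 0) \<and> (\<lambda>_. 0) \<in> A \<and>
     (\<forall>f\<in>A. \<forall>g\<in>A. (\<lambda>s. f s + g s) \<in> A) \<and> (\<forall>c. \<forall>f\<in>A. (\<lambda>s. c * f s) \<in> A)"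

lemma subspace_on_add: "subspace_on S A \<Longrightarrow> f \<in> A \<Longrightarrow> g \<in> A \<Longrightarrow> (\<lambda>s. f s + g s) \<in> A"
  unfolding subspace_on_def by simp

lemma subspace_on_scale: "subspace_on S A \<Longrightarrow> f \<in> A \<Longrightarrow> (\<lambda>s. c * f s) \<in> A"
  unfolding subspace_on_def by simp

lemma dot_self: "dot S f f = complex_of_real (\<Sum>s\<in>S. (cmod (f s))\<^sup>2)"
  unfolding dot_def by (simp only: cnj_mult_self of_real_sum)

lemma dot_self_zero: "finite S \<Longrightarrow> dot S f f = 0 \<Longrightarrow> s \<in> S \<Longrightarrow> f s = 0"
  unfolding dot_self of_real_eq_0_iff by (subst (asm) sum_nonneg_eq_0_iff) auto

lemma dot_cnj: "dot S g f = cnj (dot S f g)"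
  unfolding dot_def by (simp add: mult.commute)

lemma dot_sum_right: "dot S f (\<lambda>s. \<Sum>b\<in>B. c b * b s) = (\<Sum>b\<in>B. c b * dot S f b)"
  unfolding dot_def by (simp add: sum_distrib_left, subst sum.swap) (simp add: ac_simps)

lemma dot_diff_right: "dot S f (\<lambda>s. g s - h s) = dot S f g - dot S f h"
  unfolding dot_def by (simp add: algebra_simps sum_subtractf)

lemma dot_diff_left: "dot S (\<lambda>s. g s - h s) f = dot S g f - dot S h f"
  unfolding dot_def by (simp add: algebra_simps sum_subtractf)

lemma orthonormal_residual:
  assumes "finite B" "orthonormal S B" "c \<in> B"
  shows "dot S c (\<lambda>s. f s - (\<Sum>b\<in>B. dot S b f * b s)) = 0"
proof -
  have "(\<Sum>b\<in>B. dot S b f * dot S c b) = (\<Sum>b\<in>B. if b = c then dot S c f else 0)"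
    using assms(2,3) unfolding orthonormal_def by (intro sum.cong) auto
  thus ?thesis using assms(1,3) by (simp add: dot_diff_right dot_sum_right sum.delta)
qed

text \<open>Bessel's inequality for the unit vector at \<open>s\<close> bounds the sum of |b s|^2
  over \<open>B\<close> by 1. Summed over \<open>s\<close>, the left side is the cardinality of
  \<open>B\<close>.\<close>

lemma orthonormal_card_le:
  assumes "finite S" "finite B" "orthonormal S B"
  shows "card B \<le> card S"
proof -
  have le: "(\<Sum>b\<in>B. (cmod (b s))\<^sup>2) \<le> 1" if s: "s \<in> S" for s
  proof -
    define e where "e t = (if t = s then 1 else 0 :: complex)" for t
    define g where "g t = e t - (\<Sum>b\<in>B. dot S b e * b t)" for t
    have de: "dot S b e = cnj (b s)" for b
      unfolding dot_def e_def using assms(1) s by (simp add: if_distrib[of "\<lambda>x. _ * x"] sum.delta cong: if_cong)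
    have "dot S (\<lambda>t. \<Sum>b\<in>B. dot S b e * b t) g = cnj (\<Sum>b\<in>B. dot S b e * dot S g b)"
      by (subst dot_cnj) (simp add: dot_sum_right)
    also have "\<dots> = 0"
    proof -
      have "dot S g b = 0" if "b \<in> B" for b
        using orthonormal_residual[OF assms(2,3) that, of e] dot_cnj[of S b g] unfolding g_def by simp
      thus ?thesis by simp
    qed
    finally have "dot S g g = dot S e g"
      using dot_diff_left[of S e "\<lambda>t. \<Sum>b\<in>B. dot S b e * b t" g] unfolding g_def by simp
    also have "dot S e g = g s" unfolding dot_def e_def using assms(1) s
      by (simp add: if_distrib[of cnj] if_distrib[of "\<lambda>x. x * _"] sum.delta cong: if_cong)
    also have "g s = complex_of_real (1 - (\<Sum>b\<in>B. (cmod (b s))\<^sup>2))"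
      unfolding g_def de e_def by (simp add: cmod_square mult.commute)
    finally have "(\<Sum>t\<in>S. (cmod (g t))\<^sup>2) = 1 - (\<Sum>b\<in>B. (cmod (b s))\<^sup>2)"
      unfolding dot_self of_real_eq_iff .
    moreover have "(\<Sum>t\<in>S. (cmod (g t))\<^sup>2) \<ge> 0" by (simp add: sum_nonneg)
    ultimately show ?thesis by simp
  qed
  have "dot S b b = 1" if "b \<in> B" for b using assms(3) that unfolding orthonormal_def by auto
  hence one: "(\<Sum>s\<in>S. (cmod (b s))\<^sup>2) = 1" if "b \<in> B" for b
    using that unfolding dot_self of_real_eq_1_iff by simp
  have "real (card B) = (\<Sum>b\<in>B. \<Sum>s\<in>S. (cmod (b s))\<^sup>2)" using one by simp
  also have "\<dots> = (\<Sum>s\<in>S. \<Sum>b\<in>B. (cmod (b s))\<^sup>2)" by (rule sum.swap)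
  also have "\<dots> \<le> (\<Sum>s\<in>S. 1)" by (rule sum_mono) (rule le)
  finally show ?thesis by simp
qed

lemma subspace_on_sum:
  assumes "subspace_on S A" "finite B" "B \<subseteq> A"
  shows "(\<lambda>s. \<Sum>b\<in>B. c b * b s) \<in> A"
  using assms(2,3)
proof (induction B rule: finite_induct)
  case empty thus ?case using assms(1) unfolding subspace_on_def by simp
next
  case (insert x F)
  have "(\<lambda>s. c x * x s) \<in> A" using insert subspace_on_scale[OF assms(1)] by blast
  moreover have "(\<lambda>s. \<Sum>b\<in>F. c b * b s) \<in> A" using insert by blast
  ultimately have "(\<lambda>s. c x * x s + (\<Sum>b\<in>F. c b * b s)) \<in> A"
    by (rule subspace_on_add[OF assms(1)])
  thus ?case using insert(1,2) by simp
qed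

text \<open>An orthonormal subset of largest size, which exists because sizes are bounded by
  \<open>card S\<close>, spans: a nonzero residual of some vector could be normalized and added to
  it.\<close>

lemma orthonormal_basis_exists:
  assumes "finite S" "subspace_on S A"
  shows "\<exists>B\<subseteq>A. finite B \<and> orthonormal S B \<and> (\<forall>f\<in>A. f = (\<lambda>s. \<Sum>b\<in>B. dot S b f * b s))"
proof -
  let ?P = "\<lambda>B. B \<subseteq> A \<and> finite B \<and> orthonormal S B"
  have "?P {}" unfolding orthonormal_def by simp
  moreover have "\<forall>B. ?P B \<longrightarrow> card B \<le> card S" using orthonormal_card_le[OF assms(1)] by blast
  ultimately obtain B where B: "?P B" and mx: "\<And>C. ?P C \<Longrightarrow> card C \<le> card B"
    using ex_has_greatest_nat[of ?P "{}" card "Suc (card S)"] by (metis less_Suc_eq_le)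
  have "f = (\<lambda>s. \<Sum>b\<in>B. dot S b f * b s)" if f: "f \<in> A" for f
  proof (rule ccontr)
    assume ne: "f \<noteq> (\<lambda>s. \<Sum>b\<in>B. dot S b f * b s)"
    define g where "g s = f s - (\<Sum>b\<in>B. dot S b f * b s)" for s
    have "(\<lambda>s. (-1) * (\<Sum>b\<in>B. dot S b f * b s)) \<in> A"
      using B by (intro subspace_on_scale[OF assms(2)] subspace_on_sum[OF assms(2)]) auto
    hence "(\<lambda>s. f s + (-1) * (\<Sum>b\<in>B. dot S b f * b s)) \<in> A"
      by (rule subspace_on_add[OF assms(2) f])
    hence gA: "g \<in> A" unfolding g_def by simp
    have orth: "dot S b g = 0" if "b \<in> B" for b
      unfolding g_def using orthonormal_residual[OF _ _ that, of S f] B by simp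
    define n where "n = (\<Sum>s\<in>S. (cmod (g s))\<^sup>2)"
    have "n \<noteq> 0"
    proof
      assume "n = 0"
      hence "dot S g g = 0" unfolding dot_self n_def[symmetric] by simp
      hence "g s = 0" for s
        using dot_self_zero[OF assms(1), of g s] gA assms(2) unfolding subspace_on_def by blast
      thus False using ne unfolding g_def by auto
    qed
    moreover have "n \<ge> 0" unfolding n_def by (simp add: sum_nonneg)
    ultimately have n: "n > 0" by simp
    define e where "e s = complex_of_real (1 / sqrt n) * g s" for s
    have eA: "e \<in> A" unfolding e_def by (rule subspace_on_scale[OF assms(2) gA])
    have sq: "complex_of_real (sqrt n) * complex_of_real (sqrt n) = of_real n"
      using n by (metis of_real_mult real_sqrt_mult_self abs_of_pos)
    have "dot S e e = complex_of_real (1 / sqrt n) * complex_of_real (1 / sqrt n) * dot S g g"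
      unfolding dot_def e_def by (simp add: sum_distrib_left sum_divide_distrib ac_simps)
    also have "\<dots> = 1" unfolding dot_self n_def[symmetric] using sq n by (simp add: field_simps)
    finally have ee: "dot S e e = 1" .
    have be: "dot S b e = 0" if "b \<in> B" for b
    proof -
      have "dot S b e = complex_of_real (1 / sqrt n) * dot S b g"
        unfolding dot_def e_def by (simp add: sum_distrib_left sum_divide_distrib ac_simps)
      thus ?thesis using orth[OF that] by simp
    qed
    have eb: "dot S e b = 0" if "b \<in> B" for b using be[OF that] dot_cnj[of S b e] by simp
    have "e \<notin> B" using be ee by force
    have "?P (insert e B)" using B eA ee be eb \<open>e \<notin> B\<close> unfolding orthonormal_def by auto
    from mx[OF this] show False using B \<open>e \<notin> B\<close> by simp
  qed
  thus ?thesis using B by blast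
qed

section \<open>Homomorphism tensors of composed graphs\<close>

lemma labels_ok_iff: "labels_ok h u x \<longleftrightarrow> map h u = x"
  unfolding labels_ok_def by (auto simp: list_eq_iff_nth_eq)

definition hom_set :: "lgraph \<Rightarrow> 'a sgraph \<Rightarrow> (nat \<Rightarrow> 'a) set" where
  "hom_set F G = {h \<in> PiE (fst F) (\<lambda>_. fst G). is_hom (snd F) (snd G) h}"

lemma hom_tensor_eq:
  "hom_tensor (F, u, v) G x y = of_nat (card {h \<in> hom_set F G. map h u = x \<and> map h v = y})"
  unfolding hom_tensor_def hom_set_def labels_ok_iff by (intro arg_cong[of _ _ of_nat] arg_cong[of _ _ card]) auto

text \<open>The two ends may coincide, because gluing can turn an edge into a loop.\<close>

definition wf_lgraph :: "lgraph \<Rightarrow> bool" where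
  "wf_lgraph F \<longleftrightarrow> finite (fst F) \<and> (\<forall>e\<in>snd F. \<exists>a\<in>fst F. \<exists>b\<in>fst F. e = {a, b})"

definition wf_bl :: "nat \<Rightarrow> blgraph \<Rightarrow> bool" where
  "wf_bl k F \<longleftrightarrow> wf_lgraph (fst F) \<and> length (fst (snd F)) = k \<and> length (snd (snd F)) = k \<and>
     set (fst (snd F)) \<subseteq> fst (fst F) \<and> set (snd (snd F)) \<subseteq> fst (fst F)"

lemma finite_hom_set: "finite (fst G) \<Longrightarrow> finite (fst F) \<Longrightarrow> finite (hom_set F G)"
  unfolding hom_set_def by (rule finite_subset[of _ "PiE (fst F) (\<lambda>_. fst G)"]) (auto intro: finite_PiE)

lemma finite_tuples: "finite V \<Longrightarrow> finite (tuples V k)"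
  unfolding tuples_def using finite_lists_length_eq[of V k] by (rule rev_finite_subset) auto

text \<open>The class of \<open>a\<close> is finite, since all its other members occur in
  \<open>R\<close>; hence the minimum that defines \<open>gen_rep\<close> is attained in the
  class.\<close>

lemma gen_rep_connected:
  assumes "finite R" shows "(a, gen_rep R a) \<in> (R \<union> R\<inverse>)\<^sup>*"
proof -
  have "{b. (a, b) \<in> (R \<union> R\<inverse>)\<^sup>*} \<subseteq> insert a (snd ` (R \<union> R\<inverse>))"
  proof
    fix b assume "b \<in> {b. (a, b) \<in> (R \<union> R\<inverse>)\<^sup>*}"
    hence "(a, b) \<in> (R \<union> R\<inverse>)\<^sup>*" by simp
    thus "b \<in> insert a (snd ` (R \<union> R\<inverse>))" by (cases rule: rtranclE) force+
  qed
  hence "finite {b. (a, b) \<in> (R \<union> R\<inverse>)\<^sup>*}" using assms by (elim finite_subset) simp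
  from Min_in[OF this] show ?thesis unfolding gen_rep_def by blast
qed

lemma gen_rep_eq:
  assumes "(a, b) \<in> R" shows "gen_rep R a = gen_rep R b"
proof -
  have s: "sym ((R \<union> R\<inverse>)\<^sup>*)" by (intro sym_rtrancl) (auto simp: sym_def)
  have "(a, b) \<in> (R \<union> R\<inverse>)\<^sup>*" using assms by blast
  hence "{c. (a, c) \<in> (R \<union> R\<inverse>)\<^sup>*} = {c. (b, c) \<in> (R \<union> R\<inverse>)\<^sup>*}"
    using s by (auto dest: rtrancl_trans symD)
  thus ?thesis unfolding gen_rep_def by simp
qed

lemma gen_rep_invariant:
  assumes "finite R" "\<And>p q. (p, q) \<in> R \<Longrightarrow> g p = g q" shows "g (gen_rep R a) = g a"
proof -
  have "g b = g a" if "(a, b) \<in> (R \<union> R\<inverse>)\<^sup>*" for b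
    using that
  proof (induction rule: rtrancl_induct)
    case base show ?case by (rule HOL.refl)
  next
    case (step y z)
    have "g y = g z" using step(2) assms(2)[of y z] assms(2)[of z y, THEN HOL.sym] by blast
    thus ?case using step(3) by (rule HOL.trans[OF HOL.sym])
  qed
  from this[OF gen_rep_connected[OF assms(1)]] show ?thesis .
qed

lemma is_hom_image:
  assumes "\<And>x y. adj x y \<Longrightarrow> adj y x" "\<forall>e\<in>E. \<exists>a b. e = {a, b}"
  shows "is_hom ((\<lambda>e. f ` e) ` E) adj h \<longleftrightarrow> is_hom E adj (h \<circ> f)"
proof
  assume "is_hom ((\<lambda>e. f ` e) ` E) adj h"
  moreover have "{f a, f b} \<in> (\<lambda>e. f ` e) ` E" if "{a, b} \<in> E" for a b
    using imageI[OF that, of "\<lambda>e. f ` e"] by simp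
  ultimately show "is_hom E adj (h \<circ> f)" unfolding is_hom_def by simp
next
  assume *: "is_hom E adj (h \<circ> f)"
  show "is_hom ((\<lambda>e. f ` e) ` E) adj h" unfolding is_hom_def
  proof (intro allI impI)
    fix p q assume "{p, q} \<in> (\<lambda>e. f ` e) ` E"
    then obtain e where e: "e \<in> E" "{p, q} = f ` e" by blast
    then obtain a b where "e = {a, b}" using assms(2) by blast
    with e have ab: "{a, b} \<in> E" "{p, q} = {f a, f b}" by simp_all
    have "adj (h (f a)) (h (f b))" using * ab(1) unfolding is_hom_def by simp
    thus "adj (h p) (h q)" using ab(2) assms(1) by (auto simp: doubleton_eq_iff)
  qed
qed

lemma is_hom_cong:
  assumes "\<forall>e\<in>E. \<exists>a\<in>V. \<exists>b\<in>V. e = {a, b}" "\<And>x. x \<in> V \<Longrightarrow> h x = h' x"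
  shows "is_hom E adj h \<longleftrightarrow> is_hom E adj h'"
proof -
  have "a \<in> V \<and> b \<in> V" if "{a, b} \<in> E" for a b
    using assms(1) that by (auto simp: doubleton_eq_iff dest!: bspec)
  thus ?thesis unfolding is_hom_def using assms(2) by metis
qed

lemma is_hom_Un: "is_hom (E \<union> E') adj h \<longleftrightarrow> is_hom E adj h \<and> is_hom E' adj h"
  unfolding is_hom_def by blast

lemma map_eq_nth: "map f a = map g b \<Longrightarrow> i < length a \<Longrightarrow> f (a ! i) = g (b ! i)"
  by (metis length_map nth_map)

text \<open>Universal property of gluing: a homomorphism from the glued graph is the same as a pair
  of homomorphisms that agree on the identified labels. Both compositions of graphs are
  instances.\<close>

lemma glue_bij:
  fixes G :: "'a sgraph"
  assumes adj: "\<And>x y. snd G x y \<Longrightarrow> snd G y x" and wf: "wf_lgraph F" "wf_lgraph F'"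
    and len: "length a = length b" and sub: "set a \<subseteq> fst F" "set b \<subseteq> fst F'"
    and R: "R = set (zip (map ev a) (map od b))"
  shows "bij_betw (\<lambda>h. (restrict (h \<circ> gen_rep R \<circ> ev) (fst F), restrict (h \<circ> gen_rep R \<circ> od) (fst F')))
     (hom_set (quot_graph (gen_rep R) (disj_union F F')) G)
     {(h1, h2). h1 \<in> hom_set F G \<and> h2 \<in> hom_set F' G \<and> map h1 a = map h2 b}"
proof -
  obtain V E where F: "F = (V, E)" by fastforce
  obtain V' E' where F': "F' = (V', E')" by fastforce
  define r where "r = gen_rep R"
  define W where "W = r ` (ev ` V \<union> od ` V')"
  have finR: "finite R" unfolding R by simp
  have Vr: "fst (quot_graph r (disj_union F F')) = W" unfolding quot_graph_def disj_union_def F F' W_def by simp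
  have Er: "snd (quot_graph r (disj_union F F')) = (\<lambda>e. r ` e) ` ((\<lambda>e. ev ` e) ` E \<union> (\<lambda>e. od ` e) ` E')"
    unfolding quot_graph_def disj_union_def F F' by simp
  have wE: "\<forall>e\<in>E. \<exists>a\<in>V. \<exists>b\<in>V. e = {a, b}" "\<forall>e\<in>E'. \<exists>a\<in>V'. \<exists>b\<in>V'. e = {a, b}"
    using wf unfolding wf_lgraph_def F F' by auto
  have hom: "is_hom (snd (quot_graph r (disj_union F F'))) (snd G) h \<longleftrightarrow>
      is_hom E (snd G) (h \<circ> r \<circ> ev) \<and> is_hom E' (snd G) (h \<circ> r \<circ> od)" for h
  proof -
    have 1: "\<forall>e\<in>(\<lambda>e. ev ` e) ` E \<union> (\<lambda>e. od ` e) ` E'. \<exists>a b. e = {a, b}"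
    proof (rule ballI, elim UnE imageE)
      fix e d assume "e = ev ` d" "d \<in> E" thus "\<exists>a b. e = {a, b}" using wE(1) by (metis image_empty image_insert)
    next
      fix e d assume "e = od ` d" "d \<in> E'" thus "\<exists>a b. e = {a, b}" using wE(2) by (metis image_empty image_insert)
    qed
    have 2: "\<forall>e\<in>E. \<exists>a b. e = {a, b}" "\<forall>e\<in>E'. \<exists>a b. e = {a, b}" using wE by meson+
    have "is_hom ((\<lambda>e. r ` e) ` ((\<lambda>e. ev ` e) ` E \<union> (\<lambda>e. od ` e) ` E')) (snd G) h
        \<longleftrightarrow> is_hom ((\<lambda>e. ev ` e) ` E \<union> (\<lambda>e. od ` e) ` E') (snd G) (h \<circ> r)"
      by (rule is_hom_image[OF adj 1])
    also have "\<dots> \<longleftrightarrow> is_hom E (snd G) (h \<circ> r \<circ> ev) \<and> is_hom E' (snd G) (h \<circ> r \<circ> od)"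
      using is_hom_image[OF adj 2(1), where f = ev and h = "h \<circ> r"]
        is_hom_image[OF adj 2(2), where f = od and h = "h \<circ> r"]
      by (simp only: is_hom_Un)
    finally show ?thesis unfolding Er .
  qed
  have glued: "r (ev (a ! i)) = r (od (b ! i))" if "i < length a" for i
  proof -
    have "(ev (a ! i), od (b ! i)) \<in> R" unfolding R using that len by (auto simp: set_zip intro!: exI[of _ i])
    thus ?thesis unfolding r_def by (rule gen_rep_eq)
  qed
  \<comment> \<open>Even numbers are vertices of the first graph and odd ones of the second;
    \<open>div 2\<close> removes the tag.\<close>
  define g :: "(nat \<Rightarrow> 'a) \<times> (nat \<Rightarrow> 'a) \<Rightarrow> nat \<Rightarrow> 'a"
    where "g p n = (if even n then fst p (n div 2) else snd p (n div 2))" for p n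
  have g_ev: "g p (ev n) = fst p n" and g_od: "g p (od n) = snd p n" for p n
    unfolding g_def ev_def od_def by simp_all
  \<comment> \<open>Agreement on the labels makes the merged function constant on glued classes, so
    passing to representatives does not change it.\<close>
  have g_r: "g p (r n) = g p n" if "map (fst p) a = map (snd p) b" for p n
    unfolding r_def
  proof (rule gen_rep_invariant[OF finR])
    fix c d assume "(c, d) \<in> R"
    then obtain i where "i < length a" "c = ev (a ! i)" "d = od (b ! i)"
      unfolding R using len by (auto simp: set_zip)
    thus "g p c = g p d" using map_eq_nth[OF that] g_ev g_od by simp
  qed
  have wV: "w \<in> W \<longleftrightarrow> (\<exists>n\<in>V. w = r (ev n)) \<or> (\<exists>n\<in>V'. w = r (od n))" for w unfolding W_def by auto
  show ?thesis
    unfolding r_def[symmetric]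
  proof (rule bij_betw_byWitness[where f' = "\<lambda>p. restrict (g p) W"])
    show "\<forall>h\<in>hom_set (quot_graph r (disj_union F F')) G.
       restrict (g (restrict (h \<circ> r \<circ> ev) (fst F), restrict (h \<circ> r \<circ> od) (fst F'))) W = h"
    proof
      fix h assume "h \<in> hom_set (quot_graph r (disj_union F F')) G"
      hence h: "h \<in> PiE W (\<lambda>_. fst G)" unfolding hom_set_def Vr by blast
      let ?p = "(restrict (h \<circ> r \<circ> ev) (fst F), restrict (h \<circ> r \<circ> od) (fst F'))"
      have m: "map (fst ?p) a = map (snd ?p) b"
        using glued sub len by (auto simp: list_eq_iff_nth_eq F F' subset_iff)
      have "g ?p w = h w" if "w \<in> W" for w
        using that g_r[OF m] unfolding wV by (auto simp: g_ev g_od F F')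
      thus "restrict (g ?p) W = h" using h by (auto simp: fun_eq_iff PiE_def extensional_def)
    qed
    show "\<forall>p\<in>{(h1, h2). h1 \<in> hom_set F G \<and> h2 \<in> hom_set F' G \<and> map h1 a = map h2 b}.
       (restrict (restrict (g p) W \<circ> r \<circ> ev) (fst F), restrict (restrict (g p) W \<circ> r \<circ> od) (fst F')) = p"
    proof (clarify, intro conjI)
      fix h1 h2 assume h: "h1 \<in> hom_set F G" "h2 \<in> hom_set F' G" and m: "map h1 a = map h2 b"
      have e: "h1 \<in> extensional V" "h2 \<in> extensional V'" using h unfolding hom_set_def F F' by (auto simp: PiE_def)
      have m': "map (fst (h1, h2)) a = map (snd (h1, h2)) b" using m by simp
      show "restrict (restrict (g (h1, h2)) W \<circ> r \<circ> ev) (fst F) = h1"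
        using e(1) by (auto simp: fun_eq_iff F extensional_def wV g_r[OF m'] g_ev)
      show "restrict (restrict (g (h1, h2)) W \<circ> r \<circ> od) (fst F') = h2"
        using e(2) by (auto simp: fun_eq_iff F' extensional_def wV g_r[OF m'] g_od)
    qed
    show "(\<lambda>h. (restrict (h \<circ> r \<circ> ev) (fst F), restrict (h \<circ> r \<circ> od) (fst F'))) `
       hom_set (quot_graph r (disj_union F F')) G
       \<subseteq> {(h1, h2). h1 \<in> hom_set F G \<and> h2 \<in> hom_set F' G \<and> map h1 a = map h2 b}"
    proof clarify
      fix h assume "h \<in> hom_set (quot_graph r (disj_union F F')) G"
      hence h: "h \<in> PiE W (\<lambda>_. fst G)" "is_hom E (snd G) (h \<circ> r \<circ> ev)" "is_hom E' (snd G) (h \<circ> r \<circ> od)"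
        unfolding hom_set_def Vr hom by blast+
      have m: "map (restrict (h \<circ> r \<circ> ev) (fst F)) a = map (restrict (h \<circ> r \<circ> od) (fst F')) b"
        using glued sub len by (auto simp: list_eq_iff_nth_eq F F' subset_iff)
      have "is_hom E (snd G) (restrict (h \<circ> r \<circ> ev) V)" "is_hom E' (snd G) (restrict (h \<circ> r \<circ> od) V')"
        using h(2,3) is_hom_cong[OF wE(1), of "restrict (h \<circ> r \<circ> ev) V" "h \<circ> r \<circ> ev"]
          is_hom_cong[OF wE(2), of "restrict (h \<circ> r \<circ> od) V'" "h \<circ> r \<circ> od"] by auto
      moreover have "h (r (ev n)) \<in> fst G" if "n \<in> V" for n using h(1) that wV by (auto dest!: PiE_mem)
      moreover have "h (r (od n)) \<in> fst G" if "n \<in> V'" for n using h(1) that wV by (auto dest!: PiE_mem)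
      ultimately show "restrict (h \<circ> r \<circ> ev) (fst F) \<in> hom_set F G \<and> restrict (h \<circ> r \<circ> od) (fst F') \<in> hom_set F' G \<and>
          map (restrict (h \<circ> r \<circ> ev) (fst F)) a = map (restrict (h \<circ> r \<circ> od) (fst F')) b"
        using m unfolding hom_set_def F F' by auto
    qed
    show "(\<lambda>p. restrict (g p) W) ` {(h1, h2). h1 \<in> hom_set F G \<and> h2 \<in> hom_set F' G \<and> map h1 a = map h2 b}
       \<subseteq> hom_set (quot_graph r (disj_union F F')) G"
    proof clarify
      fix h1 h2 assume h: "h1 \<in> hom_set F G" "h2 \<in> hom_set F' G" and m: "map h1 a = map h2 b"
      have m': "map (fst (h1, h2)) a = map (snd (h1, h2)) b" using m by simp
      have 1: "h1 \<in> PiE V (\<lambda>_. fst G)" "is_hom E (snd G) h1" "h2 \<in> PiE V' (\<lambda>_. fst G)" "is_hom E' (snd G) h2"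
        using h unfolding hom_set_def F F' by auto
      have v: "(restrict (g (h1, h2)) W \<circ> r \<circ> ev) n = h1 n" if "n \<in> V" for n
        using that by (auto simp: wV g_r[OF m'] g_ev)
      have v': "(restrict (g (h1, h2)) W \<circ> r \<circ> od) n = h2 n" if "n \<in> V'" for n
        using that by (auto simp: wV g_r[OF m'] g_od)
      have "g (h1, h2) w \<in> fst G" if "w \<in> W" for w
        using that 1(1,3) unfolding wV by (auto simp: g_r[OF m'] g_ev g_od)
      moreover have "is_hom E (snd G) (restrict (g (h1, h2)) W \<circ> r \<circ> ev)"
        using 1(2) is_hom_cong[OF wE(1), where h = "restrict (g (h1, h2)) W \<circ> r \<circ> ev" and h' = h1, OF v] by blast
      moreover have "is_hom E' (snd G) (restrict (g (h1, h2)) W \<circ> r \<circ> od)"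
        using 1(4) is_hom_cong[OF wE(2), where h = "restrict (g (h1, h2)) W \<circ> r \<circ> od" and h' = h2, OF v'] by blast
      ultimately show "restrict (g (h1, h2)) W \<in> hom_set (quot_graph r (disj_union F F')) G"
        unfolding hom_set_def Vr hom by auto
    qed
  qed
qed

lemma bij_betw_card_filter:
  assumes "bij_betw f A B" "\<And>x. x \<in> A \<Longrightarrow> P x \<longleftrightarrow> P' (f x)"
  shows "card {x \<in> A. P x} = card {y \<in> B. P' y}"
proof -
  have "bij_betw f {x \<in> A. P x} {y \<in> B. P' y}"
    using assms unfolding bij_betw_def inj_on_def by (auto simp: image_iff)
  thus ?thesis by (rule bij_betw_same_card)
qed

lemma map_restrict: "set u \<subseteq> V \<Longrightarrow> map (restrict f V) u = map f u"
  by (auto simp: subset_iff)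

lemma simple_graph_sym: "simple_graph G \<Longrightarrow> snd G x y \<Longrightarrow> snd G y x"
  unfolding simple_graph_def by blast

lemma simple_graph_finite: "simple_graph G \<Longrightarrow> finite (fst G)"
  unfolding simple_graph_def by blast

text \<open>A glued homomorphism determines the images z of the middle labels. For fixed z the
  choices on the two sides are independent, and the sum over z is the matrix product.\<close>

lemma hom_tensor_series:
  fixes G :: "'a sgraph"
  assumes G: "simple_graph G" and wf: "wf_bl k F" "wf_bl k F'"
  shows "hom_tensor (series F F') G = mmul (fst G) k (hom_tensor F G) (hom_tensor F' G)"
proof (intro ext)
  fix x y
  obtain A u v where F: "F = (A, u, v)" by (cases F) auto
  obtain A' u' v' where F': "F' = (A', u', v')" by (cases F') auto
  define R where "R = set (zip (map ev v) (map od u'))"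
  define r where "r = gen_rep R"
  have w: "wf_lgraph A" "wf_lgraph A'" "length v = k" "length u' = k" "set u \<subseteq> fst A" "set v \<subseteq> fst A"
    "set u' \<subseteq> fst A'" "set v' \<subseteq> fst A'" using wf unfolding wf_bl_def F F' by auto
  note bij = glue_bij[OF simple_graph_sym[OF G] w(1,2) _ w(6,7) R_def, folded r_def]
  have fin: "finite (hom_set A G)" "finite (hom_set A' G)"
    using w(1,2) simple_graph_finite[OF G] unfolding wf_lgraph_def by (auto intro: finite_hom_set)
  define S where "S z = {h \<in> hom_set A G. map h u = x \<and> map h v = z}" for z
  define S' where "S' z = {h \<in> hom_set A' G. map h u' = z \<and> map h v' = y}" for z
  have "hom_tensor (series F F') G x y = of_nat (card {h \<in> hom_set (quot_graph r (disj_union A A')) G.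
     map h (map (r \<circ> ev) u) = x \<and> map h (map (r \<circ> od) v') = y})"
    unfolding series_def F F' r_def R_def by (simp add: hom_tensor_eq Let_def)
  also have "card {h \<in> hom_set (quot_graph r (disj_union A A')) G.
     map h (map (r \<circ> ev) u) = x \<and> map h (map (r \<circ> od) v') = y} =
     card {p \<in> {(h1, h2). h1 \<in> hom_set A G \<and> h2 \<in> hom_set A' G \<and> map h1 v = map h2 u'}.
       map (fst p) u = x \<and> map (snd p) v' = y}"
    by (rule bij_betw_card_filter[OF bij]) (use w in \<open>simp_all add: map_restrict comp_assoc[symmetric]\<close>)
  also have "{p \<in> {(h1, h2). h1 \<in> hom_set A G \<and> h2 \<in> hom_set A' G \<and> map h1 v = map h2 u'}.
       map (fst p) u = x \<and> map (snd p) v' = y} = (\<Union>z\<in>tuples (fst G) k. S z \<times> S' z)"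
  proof -
    have "map h v \<in> tuples (fst G) k" if "h \<in> hom_set A G" for h
      using that w unfolding tuples_def hom_set_def by (auto dest!: PiE_mem)
    moreover have "map h u' \<in> tuples (fst G) k" if "h \<in> hom_set A' G" for h
      using that w unfolding tuples_def hom_set_def by (auto dest!: PiE_mem)
    ultimately show ?thesis unfolding S_def S'_def by auto
  qed
  also have "card \<dots> = (\<Sum>z\<in>tuples (fst G) k. card (S z \<times> S' z))"
  proof (rule card_UN_disjoint)
    show "finite (tuples (fst G) k)" using simple_graph_finite[OF G] by (rule finite_tuples)
    show "\<forall>z\<in>tuples (fst G) k. finite (S z \<times> S' z)" using fin unfolding S_def S'_def by auto
    show "\<forall>i\<in>tuples (fst G) k. \<forall>j\<in>tuples (fst G) k. i \<noteq> j \<longrightarrow> S i \<times> S' i \<inter> S j \<times> S' j = {}"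
      unfolding S_def by auto
  qed
  finally show "hom_tensor (series F F') G x y = mmul (fst G) k (hom_tensor F G) (hom_tensor F' G) x y"
    unfolding mmul_def F F' hom_tensor_eq S_def S'_def by (simp add: card_cartesian_product)
qed

lemma hom_tensor_parallel:
  fixes G :: "'a sgraph"
  assumes G: "simple_graph G" and wf: "wf_bl k F" "wf_bl k F'"
  shows "hom_tensor (parallel F F') G = hadamard (hom_tensor F G) (hom_tensor F' G)"
proof (intro ext)
  fix x y
  obtain A u v where F: "F = (A, u, v)" by (cases F) auto
  obtain A' u' v' where F': "F' = (A', u', v')" by (cases F') auto
  define R where "R = set (zip (map ev (u @ v)) (map od (u' @ v')))"
  define r where "r = gen_rep R"
  have w: "wf_lgraph A" "wf_lgraph A'" "length u = k" "length v = k" "length u' = k" "length v' = k"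
    "set u \<subseteq> fst A" "set v \<subseteq> fst A"
    "set u' \<subseteq> fst A'" "set v' \<subseteq> fst A'" using wf unfolding wf_bl_def F F' by auto
  have w2: "set (u @ v) \<subseteq> fst A" "set (u' @ v') \<subseteq> fst A'" using w by auto
  note bij = glue_bij[OF simple_graph_sym[OF G] w(1,2) _ w2 R_def, folded r_def]
  \<comment> \<open>The two identifications in \<open>parallel\<close> become one, along the
    concatenated label lists, so that \<open>glue_bij\<close> applies once.\<close>
  have R: "R = set (zip (map ev u) (map od u')) \<union> set (zip (map ev v) (map od v'))"
    unfolding R_def using w by (simp add: zip_append)
  have "hom_tensor (parallel F F') G x y = of_nat (card {h \<in> hom_set (quot_graph r (disj_union A A')) G.
     map h (map (r \<circ> ev) u) = x \<and> map h (map (r \<circ> ev) v) = y})"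
    unfolding parallel_def F F' r_def R by (simp add: hom_tensor_eq Let_def)
  also have "card {h \<in> hom_set (quot_graph r (disj_union A A')) G.
     map h (map (r \<circ> ev) u) = x \<and> map h (map (r \<circ> ev) v) = y} =
     card {p \<in> {(h1, h2). h1 \<in> hom_set A G \<and> h2 \<in> hom_set A' G \<and> map h1 (u @ v) = map h2 (u' @ v')}.
       map (fst p) u = x \<and> map (fst p) v = y}"
    by (rule bij_betw_card_filter[OF bij]) (use w in \<open>simp_all add: map_restrict comp_assoc[symmetric]\<close>)
  also have "{p \<in> {(h1, h2). h1 \<in> hom_set A G \<and> h2 \<in> hom_set A' G \<and> map h1 (u @ v) = map h2 (u' @ v')}.
       map (fst p) u = x \<and> map (fst p) v = y} =
    {h \<in> hom_set A G. map h u = x \<and> map h v = y} \<times> {h \<in> hom_set A' G. map h u' = x \<and> map h v' = y}"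
    using w by auto
  finally show "hom_tensor (parallel F F') G x y = hadamard (hom_tensor F G) (hom_tensor F' G) x y"
    unfolding hadamard_def F F' hom_tensor_eq by (simp add: card_cartesian_product)
qed

lemma wf_glue:
  assumes "wf_lgraph F" "wf_lgraph F'" shows "wf_lgraph (quot_graph r (disj_union F F'))"
  using assms unfolding wf_lgraph_def quot_graph_def disj_union_def by fastforce

lemma wf_series: "wf_bl k F \<Longrightarrow> wf_bl k F' \<Longrightarrow> wf_bl k (series F F')"
  unfolding wf_bl_def series_def Let_def
  by (auto intro!: wf_glue) (auto simp: quot_graph_def disj_union_def)

lemma wf_parallel: "wf_bl k F \<Longrightarrow> wf_bl k F' \<Longrightarrow> wf_bl k (parallel F F')"
  unfolding wf_bl_def parallel_def Let_def
  by (auto intro!: wf_glue) (auto simp: quot_graph_def disj_union_def)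

lemma wf_bl_perm:
  assumes "wf_bl k F" "bij_betw \<sigma> {..<2*k} {..<2*k}" shows "wf_bl k (bl_perm k \<sigma> F)"
proof -
  have lt: "\<sigma> i < 2 * k" if "i < 2 * k" for i using assms(2) that unfolding bij_betw_def by auto
  have "(fst (snd F) @ snd (snd F)) ! \<sigma> i \<in> set (fst (snd F) @ snd (snd F))" if "i < 2 * k" for i
    using lt[OF that] assms(1) unfolding wf_bl_def by (intro nth_mem) simp
  hence "(fst (snd F) @ snd (snd F)) ! \<sigma> i \<in> fst (fst F)" if "i < 2 * k" for i
    using that assms(1) unfolding wf_bl_def by fastforce
  thus ?thesis using assms(1) unfolding wf_bl_def bl_perm_def Let_def by auto
qed

text \<open>Characterizes the permuted entry by any list \<open>w\<close> that solves the defining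
  equations, so that the inverse of \<sigma> need not be computed afterwards.\<close>

lemma permute_mat_eq:
  assumes "bij_betw \<sigma> {..<2*k} {..<2*k}" "length x = k" "length y = k" "length w = 2 * k"
    and "\<And>i. i < 2 * k \<Longrightarrow> w ! \<sigma> i = (x @ y) ! i"
  shows "permute_mat k \<sigma> X x y = X (take k w) (drop k w)"
proof -
  have "map (\<lambda>j. (x @ y) ! inv_into {..<2 * k} \<sigma> j) [0..<2 * k] = w"
  proof (rule nth_equalityI)
    fix j assume "j < length (map (\<lambda>j. (x @ y) ! inv_into {..<2 * k} \<sigma> j) [0..<2 * k])"
    hence j: "j \<in> \<sigma> ` {..<2*k}" using assms(1) unfolding bij_betw_def by simp
    have "inv_into {..<2 * k} \<sigma> j < 2 * k" "\<sigma> (inv_into {..<2 * k} \<sigma> j) = j"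
      using inv_into_into[OF j] f_inv_into_f[OF j] by auto
    thus "map (\<lambda>j. (x @ y) ! inv_into {..<2 * k} \<sigma> j) [0..<2 * k] ! j = w ! j"
      using assms(5)[of "inv_into {..<2 * k} \<sigma> j"] j assms(1) unfolding bij_betw_def by simp
  qed (use assms in simp)
  thus ?thesis unfolding permute_mat_def using assms by simp
qed

lemma hom_tensor_perm:
  assumes "wf_bl k F" "bij_betw \<sigma> {..<2*k} {..<2*k}"
  shows "hom_tensor (bl_perm k \<sigma> F) G = permute_mat k \<sigma> (hom_tensor F G)"
proof (intro ext)
  fix x y
  obtain A u v where F: "F = (A, u, v)" by (cases F) auto
  have len: "length u = k" "length v = k" using assms(1) unfolding wf_bl_def F by auto
  have lt: "\<sigma> i < 2 * k" if "i < 2 * k" for i using assms(2) that unfolding bij_betw_def by auto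
  show "hom_tensor (bl_perm k \<sigma> F) G x y = permute_mat k \<sigma> (hom_tensor F G) x y"
  proof (cases "length x = k \<and> length y = k")
    case False
    hence "{h \<in> hom_set A G. map h (map (\<lambda>i. (u @ v) ! \<sigma> i) [0..<k]) = x \<and>
       map h (map (\<lambda>j. (u @ v) ! \<sigma> (k + j)) [0..<k]) = y} = {}" by auto
    hence "hom_tensor (bl_perm k \<sigma> F) G x y = 0"
      unfolding bl_perm_def F Let_def fst_conv snd_conv hom_tensor_eq by (simp only: card.empty of_nat_0)
    moreover have "permute_mat k \<sigma> (hom_tensor F G) x y = 0" using False unfolding permute_mat_def by auto
    ultimately show ?thesis by simp
  next
    case True
    define w where "w = map (\<lambda>j. (x @ y) ! inv_into {..<2 * k} \<sigma> j) [0..<2 * k]"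
    have inv: "inv_into {..<2 * k} \<sigma> (\<sigma> i) = i" if "i < 2 * k" for i
      using assms(2) that unfolding bij_betw_def by (intro inv_into_f_f) auto
    have w: "w ! \<sigma> i = (x @ y) ! i" if "i < 2 * k" for i
      unfolding w_def using lt[OF that] inv[OF that] by simp
    have lw: "length w = 2 * k" unfolding w_def by simp
    have *: "map h (map (\<lambda>i. (u @ v) ! \<sigma> i) [0..<k]) = x \<and> map h (map (\<lambda>j. (u @ v) ! \<sigma> (k + j)) [0..<k]) = y
       \<longleftrightarrow> map h u = take k w \<and> map h v = drop k w" (is "?L \<longleftrightarrow> ?R") for h
    proof -
      have "?R \<longleftrightarrow> map h u @ map h v = w"
        using len lw by (metis append_eq_conv_conj append_take_drop_id length_map)
      also have "\<dots> \<longleftrightarrow> (\<forall>j<2*k. map h (u @ v) ! j = w ! j)"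
        using len lw by (auto simp: list_eq_iff_nth_eq)
      also have "\<dots> \<longleftrightarrow> (\<forall>i<2*k. map h (u @ v) ! \<sigma> i = w ! \<sigma> i)"
        using assms(2) lt unfolding bij_betw_def by (metis imageE lessThan_iff)
      also have "\<dots> \<longleftrightarrow> (\<forall>i<2*k. h ((u @ v) ! \<sigma> i) = (x @ y) ! i)"
        using w lt len by (metis (no_types, lifting) length_append length_map mult_2 nth_map)
      also have "\<dots> \<longleftrightarrow> (\<forall>i<k. h ((u @ v) ! \<sigma> i) = x ! i) \<and> (\<forall>i<k. h ((u @ v) ! \<sigma> (k + i)) = y ! i)"
      proof -
        have "(\<forall>i<2*k. P i) \<longleftrightarrow> (\<forall>i<k. P i) \<and> (\<forall>i<k. P (k + i))" for P
          by (auto, metis add_diff_inverse_nat nat_add_left_cancel_less mult_2)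
        thus ?thesis using True by (simp add: nth_append)
      qed
      also have "\<dots> \<longleftrightarrow> ?L" using True by (auto simp: list_eq_iff_nth_eq)
      finally show ?thesis by blast
    qed
    have "permute_mat k \<sigma> (hom_tensor F G) x y = hom_tensor F G (take k w) (drop k w)"
      unfolding permute_mat_def w_def using True by (simp add: Let_def)
    thus ?thesis unfolding bl_perm_def F by (simp only: hom_tensor_eq Let_def fst_conv snd_conv *)
  qed
qed


section \<open>Rotations of matrices\<close>

text \<open>Resolves the coding by positions once and for all: two straight segments, traversed in
  opposite directions, and the two crossings between in- and out-labels.\<close>

lemma cyc_gen_eq:
  assumes "k \<ge> 1" "i < 2 * k"
  shows "cyc_gen k i = (if i + 1 < k then i + 1 else if i + 1 = k then 2 * k - 1 else if i = k then 0 else i - 1)"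
proof -
  consider "i < k" | "i = k" | "i > k" by linarith
  thus ?thesis
  proof cases
    case 1
    hence "(i + 1) mod (2 * k) = i + 1" by simp
    thus ?thesis using 1 assms unfolding cyc_gen_def cyc_pos_def cyc_val_def by auto
  next
    case 2
    hence "3 * k - 1 - i + 1 = 2 * k" using assms by simp
    thus ?thesis using 2 assms unfolding cyc_gen_def cyc_pos_def cyc_val_def by auto
  next
    case 3
    hence *: "3 * k - 1 - i + 1 = 3 * k - i" "3 * k - i < 2 * k" "3 * k - i \<ge> k" using assms by auto
    hence "(3 * k - 1 - i + 1) mod (2 * k) = 3 * k - i" by simp
    moreover have "3 * k - 1 - (3 * k - i) = i - 1" using 3 assms by simp
    ultimately show ?thesis using 3 * assms unfolding cyc_gen_def cyc_pos_def cyc_val_def by simp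
  qed
qed

lemma cyc_gen_bij:
  assumes "k \<ge> 1" shows "bij_betw (cyc_gen k) {..<2*k} {..<2*k}"
proof -
  have "inj_on (cyc_gen k) {..<2*k}"
  proof (rule inj_onI)
    fix i j assume "i \<in> {..<2*k}" "j \<in> {..<2*k}" "cyc_gen k i = cyc_gen k j"
    thus "i = j" using assms cyc_gen_eq[OF assms, of i] cyc_gen_eq[OF assms, of j]
      by (auto split: if_splits)
  qed
  moreover have "cyc_gen k ` {..<2*k} \<subseteq> {..<2*k}"
    using assms by (auto simp: cyc_gen_eq)
  ultimately show ?thesis unfolding bij_betw_def by (simp add: endo_inj_surj)
qed

lemma cyc_pow_bij: "k \<ge> 1 \<Longrightarrow> bij_betw (cyc_gen k ^^ n) {..<2*k} {..<2*k}"
proof (induction n)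
  case (Suc n) thus ?case
    using bij_betw_trans[OF Suc.IH[OF Suc.prems] cyc_gen_bij[OF Suc.prems]] by (simp only: funpow.simps)
qed simp

lemma cyc_group_bij: "k \<ge> 1 \<Longrightarrow> \<sigma> \<in> cyc_group k \<Longrightarrow> bij_betw \<sigma> {..<2*k} {..<2*k}"
  unfolding cyc_group_def using cyc_pow_bij by blast

text \<open>The generator in terms of lists: on the cyclic word \<open>x @ rev y\<close> the index
  change moves the last letter to the front.\<close>

definition rot :: "nat \<Rightarrow> 'a mat \<Rightarrow> 'a mat" where
  "rot k X = (\<lambda>x y. if length x = k \<and> length y = k then X (hd y # butlast x) (tl y @ [last x]) else 0)"

lemma permute_mat_gen:
  assumes k: "k \<ge> 1" shows "permute_mat k (cyc_gen k) X = rot k X"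
proof (intro ext)
  fix x y :: "'a list"
  show "permute_mat k (cyc_gen k) X x y = rot k X x y"
  proof (cases "length x = k \<and> length y = k")
    case False thus ?thesis unfolding permute_mat_def rot_def by auto
  next
    case True
    hence l: "length x = k" "length y = k" by auto
    hence ne: "x \<noteq> []" "y \<noteq> []" using k by auto
    let ?w = "(hd y # butlast x) @ (tl y @ [last x])"
    have "?w ! cyc_gen k i = (x @ y) ! i" if i: "i < 2 * k" for i
    proof -
      consider "i + 1 < k" | "i + 1 = k" | "i = k" | "i > k" by linarith
      thus ?thesis
      proof cases
        case 1
        hence "i < k - 1" by simp
        thus ?thesis unfolding cyc_gen_eq[OF k i] using l 1 by (simp add: nth_append nth_butlast)
      next
        case 2
        hence "2 * k - 1 - k = k - 1" "length x - Suc 0 = i" using l by simp_all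
        thus ?thesis unfolding cyc_gen_eq[OF k i] using l 2 ne k
          by (auto simp: nth_append last_conv_nth nth_Cons')
      next
        case 3 thus ?thesis unfolding cyc_gen_eq[OF k i] using l ne k
          by (simp add: nth_append hd_conv_nth)
      next
        case 4
        hence "i - 1 - k < length (tl y)" "Suc (i - 1 - k) = i - k" using i l by auto
        thus ?thesis unfolding cyc_gen_eq[OF k i] using l ne k 4
          by (auto simp: nth_append nth_tl nth_Cons')
      qed
    qed
    hence "permute_mat k (cyc_gen k) X x y = X (take k ?w) (drop k ?w)"
      using l k by (intro permute_mat_eq cyc_gen_bij) auto
    moreover have "take k ?w = hd y # butlast x" "drop k ?w = tl y @ [last x]"
      using l k by (auto simp: take_Cons' drop_Cons')
    ultimately show ?thesis unfolding rot_def using l by simp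
  qed
qed

text \<open>The order is reversed because \<open>permute_mat\<close> acts through the indices. Among
  powers of one generator the reversal is invisible.\<close>

lemma permute_mat_comp:
  assumes "bij_betw \<sigma> {..<2*k} {..<2*k}" "bij_betw \<tau> {..<2*k} {..<2*k}"
  shows "permute_mat k (\<tau> \<circ> \<sigma>) X = permute_mat k \<sigma> (permute_mat k \<tau> X)"
proof (intro ext)
  fix x y :: "'a list"
  show "permute_mat k (\<tau> \<circ> \<sigma>) X x y = permute_mat k \<sigma> (permute_mat k \<tau> X) x y"
  proof (cases "length x = k \<and> length y = k")
    case False thus ?thesis unfolding permute_mat_def by auto
  next
    case True
    have ex: "\<exists>w. length w = 2 * k \<and> (\<forall>i<2*k. w ! \<rho> i = z ! i)"
      if b: "bij_betw \<rho> {..<2*k} {..<2*k}" for \<rho> and z :: "'a list"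
    proof -
      have "inv_into {..<2 * k} \<rho> (\<rho> i) = i \<and> \<rho> i < 2 * k" if "i < 2 * k" for i
        using b that unfolding bij_betw_def by auto
      thus ?thesis by (intro exI[of _ "map (\<lambda>j. z ! inv_into {..<2 * k} \<rho> j) [0..<2 * k]"]) auto
    qed
    obtain w' where w': "length w' = 2 * k" "\<And>i. i < 2 * k \<Longrightarrow> w' ! \<sigma> i = (x @ y) ! i"
      using ex[OF assms(1), of "x @ y"] by blast
    obtain w where w: "length w = 2 * k" "\<And>i. i < 2 * k \<Longrightarrow> w ! \<tau> i = w' ! i"
      using ex[OF assms(2), of w'] by blast
    have lt: "\<sigma> i < 2 * k" if "i < 2 * k" for i using assms(1) that unfolding bij_betw_def by auto
    have "permute_mat k (\<tau> \<circ> \<sigma>) X x y = X (take k w) (drop k w)"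
      using True w w' lt by (intro permute_mat_eq bij_betw_trans[OF assms]) auto
    moreover have "permute_mat k \<sigma> (permute_mat k \<tau> X) x y = permute_mat k \<tau> X (take k w') (drop k w')"
      using True w' by (intro permute_mat_eq assms) auto
    moreover have "permute_mat k \<tau> X (take k w') (drop k w') = X (take k w) (drop k w)"
      using w w' by (intro permute_mat_eq assms) auto
    ultimately show ?thesis by simp
  qed
qed

lemma matspace_zero: "X \<in> matspace V k \<Longrightarrow> x \<notin> tuples V k \<or> y \<notin> tuples V k \<Longrightarrow> X x y = 0"
  unfolding matspace_def by blast

text \<open>Reduces the cyclic group to iterates of \<open>rot\<close>. Even for the identity
  permutation \<open>permute_mat\<close> cuts off entries at lists of the wrong length; for members
  of \<open>matspace\<close> these are zero anyway.\<close>

lemma permute_mat_pow: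
  assumes "k \<ge> 1" "X \<in> matspace V k"
  shows "permute_mat k (cyc_gen k ^^ n) X = (rot k ^^ n) X"
proof -
  have 0: "permute_mat k (cyc_gen k ^^ 0) X = X"
  proof (intro ext)
    fix x y :: "'a list"
    show "permute_mat k (cyc_gen k ^^ 0) X x y = X x y"
    proof (cases "length x = k \<and> length y = k")
      case True
      thus ?thesis using permute_mat_eq[of "\<lambda>i. i" k x y "x @ y" X] by (simp add: id_def bij_betw_def)
    next
      case False
      hence "x \<notin> tuples V k \<or> y \<notin> tuples V k" unfolding tuples_def by auto
      from matspace_zero[OF assms(2) this] show ?thesis using False unfolding permute_mat_def by auto
    qed
  qed
  have "permute_mat k (cyc_gen k ^^ n) Y = (rot k ^^ n) (permute_mat k (cyc_gen k ^^ 0) Y)" for Y :: "'a mat"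
  proof (induction n arbitrary: Y)
    case (Suc n)
    have "permute_mat k (cyc_gen k ^^ Suc n) Y = permute_mat k (cyc_gen k ^^ n \<circ> cyc_gen k) Y"
      by (simp only: funpow_Suc_right)
    also have "\<dots> = rot k (permute_mat k (cyc_gen k ^^ n) Y)"
      unfolding permute_mat_comp[OF cyc_gen_bij[OF assms(1)] cyc_pow_bij[OF assms(1)]] permute_mat_gen[OF assms(1)] ..
    finally show ?case unfolding Suc.IH by (simp add: comp_def id_def)
  qed simp
  thus ?thesis using 0 by simp
qed

lemma rot_matspace:
  assumes "k \<ge> 1" "X \<in> matspace V k" shows "rot k X \<in> matspace V k"
  unfolding matspace_def
proof (clarify)
  fix x y assume "rot k X x y \<noteq> 0"
  hence l: "length x = k" "length y = k" and "X (hd y # butlast x) (tl y @ [last x]) \<noteq> 0"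
    unfolding rot_def by (auto split: if_splits)
  hence "hd y # butlast x \<in> tuples V k" "tl y @ [last x] \<in> tuples V k"
    using matspace_zero[OF assms(2)] by blast+
  hence s: "set (hd y # butlast x) \<subseteq> V" "set (tl y @ [last x]) \<subseteq> V" unfolding tuples_def by auto
  have "x = butlast x @ [last x]" "y = hd y # tl y" using l assms(1) by (auto intro!: append_butlast_last_id[symmetric] hd_Cons_tl[symmetric])
  hence "set x = set (butlast x @ [last x])" "set y = set (hd y # tl y)" by simp_all
  thus "x \<in> tuples V k \<and> y \<in> tuples V k" using s l unfolding tuples_def by auto
qed

section \<open>Minors of graphs all of whose vertices are labelled\<close>

text \<open>A minor of a base graph whose vertices are exactly its labels is determined, up to renaming of
  vertices, by the set \<open>Ce\<close> of contracted and the set \<open>Ca\<close> of surviving pairs of label positions.\<close>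
definition has_form :: "nat \<Rightarrow> blgraph \<Rightarrow> (nat \<times> nat) set \<Rightarrow> (nat \<times> nat) set \<Rightarrow> bool" where
  "has_form k F Ce Ca \<longleftrightarrow> (case F of ((V, E), u, v) \<Rightarrow> length u = k \<and> length v = k \<and> V = set (u @ v) \<and>
     (\<forall>(i, j)\<in>Ce. (u @ v) ! i = (u @ v) ! j) \<and>
     (\<forall>i<2*k. \<forall>j<2*k. (u @ v) ! i = (u @ v) ! j \<longrightarrow> (i, j) \<in> (Ce \<union> Ce\<inverse>)\<^sup>*) \<and>
     E = (\<lambda>(i, j). {(u @ v) ! i, (u @ v) ! j}) ` Ca \<and>
     (\<forall>(i, j)\<in>Ca. (u @ v) ! i \<noteq> (u @ v) ! j))"

lemma has_formD:
  assumes "has_form k ((V, E), u, v) Ce Ca"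
  shows "length u = k" "length v = k" "V = set (u @ v)"
    "\<And>i j. (i, j) \<in> Ce \<Longrightarrow> (u @ v) ! i = (u @ v) ! j"
    "\<And>i j. i < 2 * k \<Longrightarrow> j < 2 * k \<Longrightarrow> (u @ v) ! i = (u @ v) ! j \<Longrightarrow> (i, j) \<in> (Ce \<union> Ce\<inverse>)\<^sup>*"
    "E = (\<lambda>(i, j). {(u @ v) ! i, (u @ v) ! j}) ` Ca"
    "\<And>i j. (i, j) \<in> Ca \<Longrightarrow> (u @ v) ! i \<noteq> (u @ v) ! j"
  using assms unfolding has_form_def prod.case by blast+

lemma blgraph_cases: obtains V E u v where "(F :: blgraph) = ((V, E), u, v)"
  by (metis surj_pair)

definition form_tensor :: "nat \<Rightarrow> (nat \<times> nat) set \<Rightarrow> (nat \<times> nat) set \<Rightarrow> 'a sgraph \<Rightarrow> 'a mat" where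
  "form_tensor k Ce Ca G = (\<lambda>x y. if x \<in> tuples (fst G) k \<and> y \<in> tuples (fst G) k \<and>
     (\<forall>(i, j)\<in>Ce. (x @ y) ! i = (x @ y) ! j) \<and> (\<forall>(i, j)\<in>Ca. snd G ((x @ y) ! i) ((x @ y) ! j)) then 1 else 0)"

lemma connected_invariant:
  assumes "(i, j) \<in> (R \<union> R\<inverse>)\<^sup>*" "\<And>p q. (p, q) \<in> R \<Longrightarrow> f p = f q" shows "f i = f j"
  using assms(1)
proof (induction rule: rtrancl_induct)
  case base show ?case by (rule HOL.refl)
next
  case (step y z)
  have "f y = f z" using step(2) assms(2)[of y z] assms(2)[of z y, THEN HOL.sym] by blast
  with step(3) show ?case by (rule HOL.trans)
qed

text \<open>All vertices are labelled, so a homomorphism is determined by the images of the labels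
  and the count is 0 or 1. It is 1 if the prescribed images are consistent on contracted classes and
  adjacent along surviving edges.\<close>

lemma has_form_tensor:
  fixes G :: "'a sgraph"
  assumes F: "has_form k F Ce Ca" and sub: "Ce \<subseteq> {..<2*k} \<times> {..<2*k}" "Ca \<subseteq> {..<2*k} \<times> {..<2*k}"
    and G: "simple_graph G"
  shows "hom_tensor F G = form_tensor k Ce Ca G"
proof (intro ext)
  fix x y :: "'a list"
  obtain V E u v where Feq: "F = ((V, E), u, v)" by (rule blgraph_cases)
  note f = Feq has_formD[OF F[unfolded Feq]]
  define w where "w = u @ v"
  define z where "z = x @ y"
  have lw: "length w = 2 * k" unfolding w_def using f by simp
  let ?S = "{h \<in> hom_set (V, E) G. map h u = x \<and> map h v = y}"
  have S: "h \<in> ?S \<longleftrightarrow> h \<in> PiE V (\<lambda>_. fst G) \<and> is_hom E (snd G) h \<and> length x = k \<and> length y = k \<and> map h w = z" for h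
    unfolding hom_set_def w_def z_def using f(2,3) by auto
  have uniq: "h = h'" if "h \<in> ?S" "h' \<in> ?S" for h h'
  proof (rule PiE_ext)
    show "h \<in> PiE V (\<lambda>_. fst G)" "h' \<in> PiE V (\<lambda>_. fst G)" using that unfolding S by auto
    have "map h w = map h' w" using that unfolding S by simp
    thus "h n = h' n" if "n \<in> V" for n using that unfolding f(4) w_def[symmetric] by simp
  qed
  show "hom_tensor F G x y = form_tensor k Ce Ca G x y"
  proof (cases "x \<in> tuples (fst G) k \<and> y \<in> tuples (fst G) k \<and> (\<forall>(i, j)\<in>Ce. z ! i = z ! j)
      \<and> (\<forall>(i, j)\<in>Ca. snd G (z ! i) (z ! j))")
    case True
    have lz: "length z = 2 * k" using True unfolding z_def tuples_def by simp
    have zG: "z ! i \<in> fst G" if "i < 2 * k" for i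
    proof -
      have "set z \<subseteq> fst G" using True unfolding z_def tuples_def by simp
      thus ?thesis using nth_mem[of i z] lz that by auto
    qed
    \<comment> \<open>The image of a vertex is read off at an arbitrary position carrying it;
      positions of one vertex are connected by contracted pairs and hence carry the same
      letter.\<close>
    define h where "h = restrict (\<lambda>n. z ! (SOME i. i < 2 * k \<and> w ! i = n)) V"
    have h: "h (w ! i) = z ! i" if i: "i < 2 * k" for i
    proof -
      define j where "j = (SOME j. j < 2 * k \<and> w ! j = w ! i)"
      have j: "j < 2 * k \<and> w ! j = w ! i" unfolding j_def by (rule someI[of _ i]) (use i in simp)
      hence "(j, i) \<in> (Ce \<union> Ce\<inverse>)\<^sup>*" using f(6) i unfolding w_def by blast
      hence "z ! j = z ! i" by (rule connected_invariant) (use True in blast)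
      moreover have "w ! i \<in> V" unfolding f(4) w_def[symmetric] using i lw by simp
      ultimately show ?thesis unfolding h_def j_def by simp
    qed
    have "map h w = z" using h lw lz by (intro nth_equalityI) auto
    moreover have "h \<in> PiE V (\<lambda>_. fst G)"
    proof (rule PiE_I)
      fix n assume "n \<in> V"
      then obtain i where "i < 2 * k" "n = w ! i" unfolding f(4) w_def[symmetric] in_set_conv_nth lw by auto
      thus "h n \<in> fst G" using h zG by simp
    qed (simp add: h_def)
    moreover have "is_hom E (snd G) h" unfolding is_hom_def
    proof (intro allI impI)
      fix a b assume "{a, b} \<in> E"
      then obtain i j where ij: "(i, j) \<in> Ca" "{a, b} = {w ! i, w ! j}" unfolding f(7) w_def by auto
      have "snd G (z ! i) (z ! j)" using True ij(1) by blast
      moreover have "h (w ! i) = z ! i" "h (w ! j) = z ! j" using h ij(1) sub by auto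
      ultimately have "snd G (h (w ! i)) (h (w ! j))" by simp
      thus "snd G (h a) (h b)" using ij(2) simple_graph_sym[OF G] by (auto simp: doubleton_eq_iff)
    qed
    ultimately have "h \<in> ?S" unfolding S using True by (simp add: tuples_def)
    hence "?S = {h}" using uniq by blast
    moreover have "hom_tensor F G x y = of_nat (card ?S)" unfolding f(1) by (rule hom_tensor_eq)
    ultimately have "hom_tensor F G x y = 1" by simp
    thus ?thesis unfolding form_tensor_def z_def[symmetric] if_P[OF True] .
  next
    case False
    have "?S = {}"
    proof (rule ccontr)
      assume "?S \<noteq> {}"
      then obtain h where "h \<in> ?S" by blast
      hence h: "h \<in> PiE V (\<lambda>_. fst G)" "is_hom E (snd G) h" "length x = k" "length y = k" "map h w = z"
        unfolding S by blast+
      have nth: "z ! i = h (w ! i)" if "i < 2 * k" for i using h(5) lw that by auto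
      have "set z \<subseteq> fst G"
        unfolding h(5)[symmetric] using h(1) unfolding f(4) w_def by (auto dest: PiE_mem)
      hence "x \<in> tuples (fst G) k" "y \<in> tuples (fst G) k" using h(3,4) unfolding z_def tuples_def by auto
      moreover have "z ! i = z ! j" if "(i, j) \<in> Ce" for i j
        using nth[of i] nth[of j] f(5)[OF that] sub that unfolding w_def by auto
      moreover have "snd G (z ! i) (z ! j)" if "(i, j) \<in> Ca" for i j
      proof -
        have "{w ! i, w ! j} \<in> E" unfolding f(7) w_def using that by force
        hence "snd G (h (w ! i)) (h (w ! j))" using h(2) unfolding is_hom_def by blast
        thus ?thesis using nth[of i] nth[of j] sub that by auto
      qed
      ultimately show False using False by blast
    qed
    moreover have "hom_tensor F G x y = of_nat (card ?S)" unfolding f(1) by (rule hom_tensor_eq)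
    ultimately have "hom_tensor F G x y = 0" by (simp only: card.empty of_nat_0)
    thus ?thesis unfolding form_tensor_def z_def[symmetric] if_not_P[OF False] .
  qed
qed

lemma has_form_wf:
  assumes "has_form k F Ce Ca" "Ca \<subseteq> {..<2*k} \<times> {..<2*k}" shows "wf_bl k F"
proof -
  obtain V E u v where Feq: "F = ((V, E), u, v)" by (rule blgraph_cases)
  note f = Feq has_formD[OF assms(1)[unfolded Feq]]
  have "(u @ v) ! i \<in> V" if "i < 2 * k" for i unfolding f(4) using f that by (intro nth_mem) simp
  hence "\<forall>e\<in>E. \<exists>a\<in>V. \<exists>b\<in>V. e = {a, b}" unfolding f(7) using assms(2) by auto
  thus ?thesis unfolding wf_bl_def wf_lgraph_def f(1) using f(2,3,4) by auto
qed

text \<open>The pair (i, j) that represents the edge becomes a contracted pair. All pairs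
  representing the same edge leave \<open>Ca\<close>, since the edge is removed before the quotient
  is taken; the others cannot become loops.\<close>

lemma has_form_contract:
  assumes F: "has_form k ((V, E), u, v) Ce Ca" and Ca: "Ca \<subseteq> {..<2*k} \<times> {..<2*k}"
    and Ce: "Ce \<subseteq> {..<2*k} \<times> {..<2*k}"
    and ij: "(i, j) \<in> Ca" and ab: "{a, b} = {(u @ v) ! i, (u @ v) ! j}" "a \<noteq> b"
    and r: "r = (\<lambda>x. if x = b then a else x)"
  shows "has_form k (quot_graph r (V, E - {{a, b}}), map r u, map r v) (insert (i, j) Ce)
     {(p, q) \<in> Ca. {(u @ v) ! p, (u @ v) ! q} \<noteq> {a, b}}"
proof -
  define w where "w = u @ v"
  define Ca' where "Ca' = {(p, q) \<in> Ca. {(u @ v) ! p, (u @ v) ! q} \<noteq> {a, b}}"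
  have f: "length u = k" "length v = k" "V = set w"
     "\<And>i j. (i, j) \<in> Ce \<Longrightarrow> w ! i = w ! j"
     "\<And>i j. i < 2 * k \<Longrightarrow> j < 2 * k \<Longrightarrow> w ! i = w ! j \<Longrightarrow> (i, j) \<in> (Ce \<union> Ce\<inverse>)\<^sup>*"
     "E = (\<lambda>(i, j). {w ! i, w ! j}) ` Ca" "\<And>i j. (i, j) \<in> Ca \<Longrightarrow> w ! i \<noteq> w ! j"
    using has_formD[OF F] unfolding w_def by simp_all
  have lw: "length w = 2 * k" unfolding w_def using f by simp
  have w': "map r u @ map r v = map r w" unfolding w_def by simp
  have nw: "map r w ! p = r (w ! p)" if "p < 2 * k" for p using that lw by simp
  have ijk: "i < 2 * k" "j < 2 * k" using ij Ca by auto
  have rab: "r a = a" "r b = a" unfolding r by auto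
  let ?C = "insert (i, j) Ce"
  have rij: "r (w ! i) = r (w ! j)" using ab rab unfolding w_def[symmetric] by (auto simp: doubleton_eq_iff)
  have mono: "(Ce \<union> Ce\<inverse>)\<^sup>* \<subseteq> (?C \<union> ?C\<inverse>)\<^sup>*" by (rule rtrancl_mono) auto
  have conn: "(p, q) \<in> (?C \<union> ?C\<inverse>)\<^sup>*" if pq: "p < 2 * k" "q < 2 * k" "r (w ! p) = r (w ! q)" for p q
  proof (cases "w ! p = w ! q")
    case True thus ?thesis using f(5)[OF pq(1,2)] mono by blast
  next
    case False
    hence "{w ! p, w ! q} = {a, b}" using pq(3) unfolding r by (auto split: if_splits)
    hence "(w ! p = w ! i \<and> w ! j = w ! q) \<or> (w ! p = w ! j \<and> w ! i = w ! q)"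
      using ab(1) unfolding w_def[symmetric] by (auto simp: doubleton_eq_iff)
    thus ?thesis
    proof
      assume "w ! p = w ! i \<and> w ! j = w ! q"
      hence "(p, i) \<in> (?C \<union> ?C\<inverse>)\<^sup>*" "(j, q) \<in> (?C \<union> ?C\<inverse>)\<^sup>*" using f(5) mono pq ijk by blast+
      moreover have "(i, j) \<in> (?C \<union> ?C\<inverse>)\<^sup>*" by blast
      ultimately show ?thesis by (meson rtrancl_trans)
    next
      assume "w ! p = w ! j \<and> w ! i = w ! q"
      hence "(p, j) \<in> (?C \<union> ?C\<inverse>)\<^sup>*" "(i, q) \<in> (?C \<union> ?C\<inverse>)\<^sup>*" using f(5) mono pq ijk by blast+
      moreover have "(j, i) \<in> (?C \<union> ?C\<inverse>)\<^sup>*" by blast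
      ultimately show ?thesis by (meson rtrancl_trans)
    qed
  qed
  have rne: "r (w ! p) \<noteq> r (w ! q)" if "(p, q) \<in> Ca'" for p q
  proof -
    have "w ! p \<noteq> w ! q" "{w ! p, w ! q} \<noteq> {a, b}" using that f(7) unfolding Ca'_def w_def by auto
    thus ?thesis unfolding r by (auto split: if_splits)
  qed
  have edges: "(\<lambda>e. r ` e) ` (E - {{a, b}}) = (\<lambda>(p, q). {map r w ! p, map r w ! q}) ` Ca'"
  proof -
    have "E - {{a, b}} = (\<lambda>(p, q). {w ! p, w ! q}) ` Ca'" unfolding f(6) Ca'_def w_def by auto
    moreover have "(\<lambda>e. r ` e) ` (\<lambda>(p, q). {w ! p, w ! q}) ` Ca' = (\<lambda>(p, q). {map r w ! p, map r w ! q}) ` Ca'"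
      unfolding image_image
    proof (rule image_cong[OF HOL.refl])
      fix c assume c: "c \<in> Ca'"
      obtain p q where pq: "c = (p, q)" by fastforce
      have "p < 2 * k" "q < 2 * k" using c Ca unfolding Ca'_def pq by auto
      thus "r ` (case c of (p, q) \<Rightarrow> {w ! p, w ! q}) = (case c of (p, q) \<Rightarrow> {map r w ! p, map r w ! q})"
        unfolding pq using nw by simp
    qed
    ultimately show ?thesis by simp
  qed
  show ?thesis
    unfolding has_form_def Ca'_def[symmetric] quot_graph_def prod.case fst_conv snd_conv
  proof (intro conjI)
    show "length (map r u) = k" "length (map r v) = k" using f by auto
    show "r ` V = set (map r u @ map r v)" unfolding w' f(3) by simp
    show "\<forall>(i, j)\<in>?C. (map r u @ map r v) ! i = (map r u @ map r v) ! j"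
      unfolding w' using Ce f(4) rij nw ijk by auto
    show "\<forall>i<2*k. \<forall>j<2*k. (map r u @ map r v) ! i = (map r u @ map r v) ! j \<longrightarrow> (i, j) \<in> (?C \<union> ?C\<inverse>)\<^sup>*"
      unfolding w' using conn nw by simp
    show "(\<lambda>e. r ` e) ` (E - {{a, b}}) = (\<lambda>(i, j). {(map r u @ map r v) ! i, (map r u @ map r v) ! j}) ` Ca'"
      unfolding w' by (rule edges)
    show "\<forall>(i, j)\<in>Ca'. (map r u @ map r v) ! i \<noteq> (map r u @ map r v) ! j"
    proof (clarify)
      fix p q assume c: "(p, q) \<in> Ca'" "(map r u @ map r v) ! p = (map r u @ map r v) ! q"
      have "p < 2 * k" "q < 2 * k" using c(1) Ca unfolding Ca'_def by auto
      thus False using rne[OF c(1)] c(2) nw unfolding w' by simp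
    qed
  qed
qed

text \<open>Treats \<open>C_atom\<close> and \<open>M_atom\<close> together: in both, vertex i
  carries exactly the label at position i of the 2k labels.\<close>

locale labelled_base =
  fixes k :: nat and E0 :: "nat set set"
  assumes edges: "\<And>e. e \<in> E0 \<Longrightarrow> \<exists>i j. i < 2 * k \<and> j < 2 * k \<and> i \<noteq> j \<and> e = {i, j}"
begin

definition base :: blgraph where "base = (({0..<2*k}, E0), [0..<k], [k..<2*k])"
definition epairs :: "(nat \<times> nat) set" where "epairs = {(i, j). i < 2 * k \<and> j < 2 * k \<and> {i, j} \<in> E0}"

lemma epairs_sub: "epairs \<subseteq> {..<2*k} \<times> {..<2*k}" unfolding epairs_def by auto

lemma base_labels: "[0..<k] @ [k..<2*k] = [0..<2*k]"
  using upt_add_eq_append[of 0 k k] by (simp add: mult_2)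

lemma start_form:
  assumes "Ca \<subseteq> epairs"
  shows "has_form k (({0..<2*k}, (\<lambda>(i, j). {i, j}) ` Ca), [0..<k], [k..<2*k]) {} Ca"
proof -
  have lt: "i < 2 * k \<and> j < 2 * k \<and> i \<noteq> j" if "(i, j) \<in> Ca" for i j
  proof -
    have *: "i < 2 * k" "j < 2 * k" "{i, j} \<in> E0" using assms that unfolding epairs_def by auto
    obtain p q where "p \<noteq> q" "{i, j} = {p, q}" using edges[OF *(3)] by blast
    thus ?thesis using * by auto
  qed
  have "(\<lambda>(i, j). {i, j}) ` Ca = (\<lambda>(i, j). {[0..<2*k] ! i, [0..<2*k] ! j}) ` Ca"
    by (rule image_cong) (use lt in auto)
  moreover have "\<forall>(i, j)\<in>Ca. [0..<2*k] ! i \<noteq> [0..<2*k] ! j" using lt by auto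
  ultimately show ?thesis unfolding has_form_def prod.case base_labels by (simp del: upt_Suc)
qed

lemma minor_form:
  assumes "F \<in> bl_minors base"
  shows "\<exists>Ce Ca. Ce \<subseteq> epairs \<and> Ca \<subseteq> epairs \<and> has_form k F Ce Ca"
  using assms
proof (induction rule: bl_minors.induct)
  case self
  have "E0 \<subseteq> (\<lambda>(i, j). {i, j}) ` epairs"
  proof
    fix e assume e: "e \<in> E0"
    obtain i j where "i < 2 * k" "j < 2 * k" "e = {i, j}" using edges[OF e] by blast
    thus "e \<in> (\<lambda>(i, j). {i, j}) ` epairs" using e unfolding epairs_def by auto
  qed
  moreover have "(\<lambda>(i, j). {i, j}) ` epairs \<subseteq> E0" unfolding epairs_def by auto
  ultimately have "E0 = (\<lambda>(i, j). {i, j}) ` epairs" by (rule subset_antisym)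
  thus ?case using start_form[of epairs] unfolding base_def by auto
next
  case (del_edge V E u v e)
  then obtain Ce Ca where f: "Ce \<subseteq> epairs" "Ca \<subseteq> epairs" "has_form k ((V, E), u, v) Ce Ca" by blast
  let ?Ca = "{(p, q) \<in> Ca. {(u @ v) ! p, (u @ v) ! q} \<noteq> e}"
  have "has_form k ((V, E - {e}), u, v) Ce ?Ca"
    using has_formD[OF f(3)] unfolding has_form_def prod.case by auto
  moreover have "?Ca \<subseteq> epairs" using f(2) by auto
  ultimately show ?case using f(1) by blast
next
  case (contract V E u v a b)
  then obtain Ce Ca where f: "Ce \<subseteq> epairs" "Ca \<subseteq> epairs" "has_form k ((V, E), u, v) Ce Ca" by blast
  obtain i j where ij: "(i, j) \<in> Ca" "{a, b} = {(u @ v) ! i, (u @ v) ! j}"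
    using has_formD(6)[OF f(3)] contract.hyps(2) by auto
  have "has_form k (quot_graph (\<lambda>x. if x = b then a else x) (V, E - {{a, b}}),
      map (\<lambda>x. if x = b then a else x) u, map (\<lambda>x. if x = b then a else x) v) (insert (i, j) Ce)
      {(p, q) \<in> Ca. {(u @ v) ! p, (u @ v) ! q} \<noteq> {a, b}}"
    using f epairs_sub ij contract.hyps(3) by (intro has_form_contract) auto
  moreover have "insert (i, j) Ce \<subseteq> epairs" "{(p, q) \<in> Ca. {(u @ v) ! p, (u @ v) ! q} \<noteq> {a, b}} \<subseteq> epairs"
    using f(1,2) ij by auto
  ultimately show ?case unfolding Let_def by blast
next
  \<comment> \<open>Vertex deletion never applies, because all vertices stay labelled.\<close>
  case (del_vertex V E u v x)
  then obtain Ce Ca where "has_form k ((V, E), u, v) Ce Ca" by blast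
  hence "V = set (u @ v)" by (rule has_formD)
  thus ?case using del_vertex.hyps by simp
qed

lemma minor_delete_edges:
  assumes "((V, E), u, v) \<in> bl_minors base" "finite D" "D \<subseteq> E"
  shows "((V, E - D), u, v) \<in> bl_minors base"
  using assms(2,3)
proof (induction D rule: finite_induct)
  case empty thus ?case using assms(1) by simp
next
  case (insert x D)
  have "((V, E - D - {x}), u, v) \<in> bl_minors base"
    using insert by (intro bl_minors.del_edge) auto
  moreover have "E - D - {x} = E - insert x D" by blast
  ultimately show ?case by simp
qed

text \<open>Converse of \<open>minor_form\<close>: every system of pairs in which no surviving pair
  is a loop comes from a minor. The contractions are performed one pair at a time; a pair whose ends
  are already merged requires nothing.\<close>

lemma minor_realize:
  assumes "finite Ce" "Ce \<subseteq> epairs" "Ca \<subseteq> epairs" "\<And>i j. (i, j) \<in> Ca \<Longrightarrow> (i, j) \<notin> (Ce \<union> Ce\<inverse>)\<^sup>*"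
  shows "\<exists>F\<in>bl_minors base. has_form k F Ce Ca"
  using assms
proof (induction Ce arbitrary: Ca rule: finite_induct)
  case empty
  let ?E = "(\<lambda>(i, j). {i, j}) ` Ca"
  have sub: "?E \<subseteq> E0" using empty unfolding epairs_def by auto
  have "E0 \<subseteq> Pow {0..<2*k}" using edges by fastforce
  hence "finite E0" by (rule finite_subset) simp
  hence "(({0..<2*k}, E0 - (E0 - ?E)), [0..<k], [k..<2*k]) \<in> bl_minors base"
    using bl_minors.self[of base] by (intro minor_delete_edges) (auto simp: base_def)
  moreover have "E0 - (E0 - ?E) = ?E" using sub by blast
  ultimately show ?case using start_form[OF empty(2)] by (intro bexI) auto
next
  case (insert c Ce)
  obtain i j where c: "c = (i, j)" by fastforce
  have Ce: "Ce \<subseteq> epairs" "(i, j) \<in> epairs" using insert.prems(1) c by auto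
  have mono: "(Ce \<union> Ce\<inverse>)\<^sup>* \<subseteq> (insert c Ce \<union> (insert c Ce)\<inverse>)\<^sup>*" by (rule rtrancl_mono) auto
  hence nCa: "(p, q) \<notin> (Ce \<union> Ce\<inverse>)\<^sup>*" if "(p, q) \<in> Ca" for p q using insert.prems(3)[OF that] by blast
  show ?case
  proof (cases "(i, j) \<in> (Ce \<union> Ce\<inverse>)\<^sup>*")
    case True
    obtain F where F: "F \<in> bl_minors base" "has_form k F Ce Ca"
      using insert.IH[OF Ce(1) insert.prems(2) nCa] by blast
    obtain V E u v where Feq: "F = ((V, E), u, v)" by (rule blgraph_cases)
    note f = Feq has_formD[OF F(2)[unfolded Feq]]
    have "(u @ v) ! i = (u @ v) ! j" using True by (rule connected_invariant) (rule f(5))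
    hence "\<forall>(i, j)\<in>insert c Ce. (u @ v) ! i = (u @ v) ! j" using f(5) c by auto
    moreover have "\<forall>i<2*k. \<forall>j<2*k. (u @ v) ! i = (u @ v) ! j \<longrightarrow> (i, j) \<in> (insert c Ce \<union> (insert c Ce)\<inverse>)\<^sup>*"
      using f(6) mono by blast
    ultimately have "has_form k F (insert c Ce) Ca"
      unfolding has_form_def Feq prod.case using f(2,3,4,7,8) by auto
    thus ?thesis using F(1) by blast
  next
    case False
    \<comment> \<open>The pair is first kept as an edge, so that there is something to contract; it
      is no loop because its ends are not yet connected.\<close>
    have "\<exists>F\<in>bl_minors base. has_form k F Ce (insert (i, j) Ca)"
      using Ce insert.prems(2) nCa False by (intro insert.IH) auto
    then obtain V E u v where F: "((V, E), u, v) \<in> bl_minors base" "has_form k ((V, E), u, v) Ce (insert (i, j) Ca)"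
      by (metis prod.collapse)
    let ?w = "u @ v"
    let ?a = "?w ! i" and ?b = "?w ! j"
    let ?r = "\<lambda>x. if x = ?b then ?a else x"
    have ne: "?a \<noteq> ?b" and E: "{?a, ?b} \<in> E" using has_formD(6,7)[OF F(2)] by auto
    have fm: "has_form k (quot_graph ?r (V, E - {{?a, ?b}}), map ?r u, map ?r v) (insert (i, j) Ce)
       {(p, q) \<in> insert (i, j) Ca. {?w ! p, ?w ! q} \<noteq> {?a, ?b}}" (is "has_form k ?F _ ?Ca")
    proof (rule has_form_contract[OF F(2)])
      show "insert (i, j) Ca \<subseteq> {..<2*k} \<times> {..<2*k}" using Ce(2) insert.prems(2) epairs_sub by blast
      show "Ce \<subseteq> {..<2*k} \<times> {..<2*k}" using Ce(1) epairs_sub by blast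
    qed (use ne in auto)
    \<comment> \<open>Contraction only loses pairs parallel to (i, j). A pair of \<open>Ca\<close>
      parallel to it would become connected, against the assumption on \<open>Ca\<close>.\<close>
    have "?Ca = Ca"
    proof -
      have "(p, q) \<noteq> (i, j) \<and> {?w ! p, ?w ! q} \<noteq> {?a, ?b}" if pq: "(p, q) \<in> Ca" for p q
      proof (rule ccontr)
        assume "\<not> ?thesis"
        hence "{?w ! p, ?w ! q} = {?a, ?b}" by auto
        hence "?r (?w ! p) = ?r (?w ! q)" by (auto simp: doubleton_eq_iff)
        moreover have pqk: "p < 2 * k" "q < 2 * k" using pq insert.prems(2) epairs_sub by auto
        moreover have "length u = k" "length v = k" using has_formD[OF F(2)] by auto
        ultimately have "(map ?r u @ map ?r v) ! p = (map ?r u @ map ?r v) ! q"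
          unfolding map_append[symmetric] by (simp del: map_append)
        hence "(p, q) \<in> (insert (i, j) Ce \<union> (insert (i, j) Ce)\<inverse>)\<^sup>*"
          by (rule has_formD(5)[OF fm[unfolded quot_graph_def fst_conv snd_conv] pqk])
        thus False using insert.prems(3)[OF pq] c by simp
      qed
      thus ?thesis by auto
    qed
    moreover have "?F \<in> bl_minors base" using bl_minors.contract[OF F(1) E ne] unfolding Let_def .
    ultimately show ?thesis using fm c by auto
  qed
qed

end

section \<open>The atomic graphs\<close>

definition C_edges :: "nat \<Rightarrow> nat set set" where
  "C_edges k = {{i, i + 1} | i. i + 1 < 2 * k \<and> i \<noteq> k - 1} \<union> {{0, k}, {k - 1, 2 * k - 1}}"

definition M_edges :: "nat \<Rightarrow> nat set set" where
  "M_edges k = {{i, i + k} | i. i < k}"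

abbreviation C_pairs :: "nat \<Rightarrow> (nat \<times> nat) set" where "C_pairs k \<equiv> labelled_base.epairs k (C_edges k)"
abbreviation M_pairs :: "nat \<Rightarrow> (nat \<times> nat) set" where "M_pairs k \<equiv> labelled_base.epairs k (M_edges k)"

lemma C_labelled_base: "k \<ge> 1 \<Longrightarrow> labelled_base k (C_edges k)"
proof
  fix e assume k: "k \<ge> 1" and "e \<in> C_edges k"
  then consider i where "e = {i, i + 1}" "i + 1 < 2 * k" | "e = {0, k}" | "e = {k - 1, 2 * k - 1}"
    unfolding C_edges_def by blast
  thus "\<exists>i j. i < 2 * k \<and> j < 2 * k \<and> i \<noteq> j \<and> e = {i, j}"
  proof cases
    case 1 thus ?thesis by (intro exI[of _ i] exI[of _ "i + 1"]) simp
  next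
    case 2 thus ?thesis using k by (intro exI[of _ 0] exI[of _ k]) simp
  next
    case 3
    have "k - 1 < 2 * k" "2 * k - 1 < 2 * k" "k - 1 \<noteq> 2 * k - 1" using k by linarith+
    thus ?thesis using 3 by blast
  qed
qed

lemma M_labelled_base: "k \<ge> 1 \<Longrightarrow> labelled_base k (M_edges k)"
proof
  fix e assume k: "k \<ge> 1" and "e \<in> M_edges k"
  then obtain i where "e = {i, i + k}" "i < k" unfolding M_edges_def by blast
  thus "\<exists>i j. i < 2 * k \<and> j < 2 * k \<and> i \<noteq> j \<and> e = {i, j}"
    using k by (intro exI[of _ i] exI[of _ "i + k"]) simp
qed

lemma pairs_sub:
  assumes "k \<ge> 1" shows "C_pairs k \<subseteq> {..<2*k} \<times> {..<2*k}" "M_pairs k \<subseteq> {..<2*k} \<times> {..<2*k}"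
  using labelled_base.epairs_sub[OF C_labelled_base[OF assms]] labelled_base.epairs_sub[OF M_labelled_base[OF assms]]
  by auto

lemma QP_form:
  assumes "k \<ge> 1" "F \<in> QP k" obtains Ce Ca where "Ce \<subseteq> C_pairs k" "Ca \<subseteq> C_pairs k" "has_form k F Ce Ca"
proof -
  interpret labelled_base k "C_edges k" by (rule C_labelled_base[OF assms(1)])
  have "C_atom k = base" unfolding base_def unfolding C_atom_def C_edges_def by (rule HOL.refl)
  thus ?thesis using minor_form[of F] assms(2) that unfolding QP_def by auto
qed

lemma QS_form:
  assumes "k \<ge> 1" "F \<in> QS k" obtains Ce Ca where "Ce \<subseteq> M_pairs k" "Ca \<subseteq> M_pairs k" "has_form k F Ce Ca"
proof -
  interpret labelled_base k "M_edges k" by (rule M_labelled_base[OF assms(1)])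
  have "M_atom k = base" unfolding base_def unfolding M_atom_def M_edges_def by (rule HOL.refl)
  thus ?thesis using minor_form[of F] assms(2) that unfolding QS_def by auto
qed

lemma QP_realize:
  assumes "k \<ge> 1" "Ce \<subseteq> C_pairs k" "Ca \<subseteq> C_pairs k" "\<And>i j. (i, j) \<in> Ca \<Longrightarrow> (i, j) \<notin> (Ce \<union> Ce\<inverse>)\<^sup>*"
  obtains F where "F \<in> QP k" "has_form k F Ce Ca"
proof -
  interpret labelled_base k "C_edges k" by (rule C_labelled_base[OF assms(1)])
  have "C_atom k = base" unfolding base_def unfolding C_atom_def C_edges_def by (rule HOL.refl)
  moreover have "finite Ce" using assms(2) epairs_sub by (meson finite_SigmaI finite_lessThan finite_subset)
  ultimately show ?thesis using minor_realize[of Ce Ca] assms that unfolding QP_def by auto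
qed

lemma QS_realize:
  assumes "k \<ge> 1" "Ce \<subseteq> M_pairs k" "Ca \<subseteq> M_pairs k" "\<And>i j. (i, j) \<in> Ca \<Longrightarrow> (i, j) \<notin> (Ce \<union> Ce\<inverse>)\<^sup>*"
  obtains F where "F \<in> QS k" "has_form k F Ce Ca"
proof -
  interpret labelled_base k "M_edges k" by (rule M_labelled_base[OF assms(1)])
  have "M_atom k = base" unfolding base_def unfolding M_atom_def M_edges_def by (rule HOL.refl)
  moreover have "finite Ce" using assms(2) epairs_sub by (meson finite_SigmaI finite_lessThan finite_subset)
  ultimately show ?thesis using minor_realize[of Ce Ca] assms that unfolding QS_def by auto
qed

lemma form_tensor_matspace: "form_tensor k Ce Ca G \<in> matspace (fst G) k"
  unfolding matspace_def form_tensor_def by (auto split: if_splits)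

lemma Q_form:
  assumes "k \<ge> 1" "F \<in> Q k"
  obtains Ce Ca where "Ce \<subseteq> {..<2*k} \<times> {..<2*k}" "Ca \<subseteq> {..<2*k} \<times> {..<2*k}" "has_form k F Ce Ca"
proof (cases "F \<in> QP k")
  case True
  from QP_form[OF assms(1) this] that show ?thesis using pairs_sub(1)[OF assms(1)] by (metis subset_trans)
next
  case False
  hence "F \<in> QS k" using assms(2) unfolding Q_def by blast
  from QS_form[OF assms(1) this] that show ?thesis using pairs_sub(2)[OF assms(1)] by (metis subset_trans)
qed

lemma Q_matspace: "k \<ge> 1 \<Longrightarrow> simple_graph G \<Longrightarrow> F \<in> Q k \<Longrightarrow> hom_tensor F G \<in> matspace (fst G) k"
  by (erule (1) Q_form) (simp add: has_form_tensor form_tensor_matspace)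

lemma rel_eq_iff:
  "rel G a b = rel H c d \<Longrightarrow> a = b \<longleftrightarrow> c = d"
  unfolding rel_def by (auto split: if_splits)

lemma rel_adj_iff:
  "rel G a b = rel H c d \<Longrightarrow> simple_graph G \<Longrightarrow> simple_graph H \<Longrightarrow> snd G a b \<longleftrightarrow> snd H c d"
  unfolding rel_def simple_graph_def by (auto split: if_splits)

lemma rel_sym: "simple_graph G \<Longrightarrow> rel G a b = rel G b a"
  unfolding rel_def simple_graph_def by auto

text \<open>A constraint system sees tuples only through the relation types of the constrained
  pairs. Hence agreement of the relation types on \<open>P\<close> settles all minors at
  once.\<close>

lemma form_tensor_transfer:
  assumes "simple_graph G" "simple_graph H"
    and "x \<in> tuples (fst G) k" "x' \<in> tuples (fst G) k" "y \<in> tuples (fst H) k" "y' \<in> tuples (fst H) k"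
    and "\<And>i j. (i, j) \<in> P \<Longrightarrow> rel G ((x @ x') ! i) ((x @ x') ! j) = rel H ((y @ y') ! i) ((y @ y') ! j)"
    and "Ce \<subseteq> P" "Ca \<subseteq> P"
  shows "form_tensor k Ce Ca G x x' = form_tensor k Ce Ca H y y'"
proof -
  have "(\<forall>(i, j)\<in>Ce. (x @ x') ! i = (x @ x') ! j) \<longleftrightarrow> (\<forall>(i, j)\<in>Ce. (y @ y') ! i = (y @ y') ! j)"
    using rel_eq_iff[OF assms(7)] assms(8) by (auto simp: subset_iff)
  moreover have "(\<forall>(i, j)\<in>Ca. snd G ((x @ x') ! i) ((x @ x') ! j)) \<longleftrightarrow> (\<forall>(i, j)\<in>Ca. snd H ((y @ y') ! i) ((y @ y') ! j))"
    using rel_adj_iff[OF assms(7) assms(1,2)] assms(9) by (auto simp: subset_iff)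
  ultimately show ?thesis unfolding form_tensor_def using assms(3-6) by simp
qed

section \<open>From certificates to quantum isomorphism maps\<close>

text \<open>The constraints on the i-th pair as a predicate on its relation type alone, so that they
  can be read in either graph. This is the form of the conditions \<open>c i\<close> in
  \<open>npa_marginal\<close>.\<close>

definition pair_cond :: "nat \<Rightarrow> (nat \<times> nat) set \<Rightarrow> (nat \<times> nat) set \<Rightarrow> nat \<Rightarrow> relkind \<Rightarrow> bool" where
  "pair_cond k Ce Ca i r \<longleftrightarrow> ((i, i + k) \<in> Ce \<or> (i + k, i) \<in> Ce \<longrightarrow> r = RelEq) \<and>
     ((i, i + k) \<in> Ca \<or> (i + k, i) \<in> Ca \<longrightarrow> r = RelAdj)"

lemma M_pairs_cases:
  assumes "k \<ge> 1" "(i, j) \<in> M_pairs k"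
  shows "(i < k \<and> j = i + k) \<or> (j < k \<and> i = j + k)"
  using assms(2) unfolding labelled_base.epairs_def[OF M_labelled_base[OF assms(1)]]
  unfolding M_edges_def by (auto simp: doubleton_eq_iff)

text \<open>The edges of \<open>M_atom\<close> form a perfect matching, so the constraints split
  into independent conditions on the pairs (\<open>x ! i\<close>, \<open>y ! i\<close>).\<close>

lemma form_tensor_M:
  assumes k: "k \<ge> 1" and sub: "Ce \<subseteq> M_pairs k" "Ca \<subseteq> M_pairs k" and G: "simple_graph G"
  shows "form_tensor k Ce Ca G x y = (if x \<in> tuples (fst G) k \<and> y \<in> tuples (fst G) k \<and>
     (\<forall>i<k. pair_cond k Ce Ca i (rel G (x ! i) (y ! i))) then 1 else 0)"
proof (cases "x \<in> tuples (fst G) k \<and> y \<in> tuples (fst G) k")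
  case True
  hence l: "length x = k" "length y = k" unfolding tuples_def by auto
  have n: "(x @ y) ! i = x ! i" "(x @ y) ! (i + k) = y ! i" if "i < k" for i using l that by (auto simp: nth_append)
  have re: "rel G a b = RelEq \<longleftrightarrow> a = b" for a b unfolding rel_def by simp
  have ra: "rel G a b = RelAdj \<longleftrightarrow> snd G a b" for a b
    using G unfolding rel_def simple_graph_def by auto
  note cs = M_pairs_cases[OF k subsetD[OF sub(1)]] M_pairs_cases[OF k subsetD[OF sub(2)]]
  have e: "(\<forall>(i, j)\<in>Ce. (x @ y) ! i = (x @ y) ! j) \<longleftrightarrow> (\<forall>i<k. (i, i + k) \<in> Ce \<or> (i + k, i) \<in> Ce \<longrightarrow> x ! i = y ! i)"
    (is "?L \<longleftrightarrow> ?R")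
  proof
    assume L: ?L
    show ?R
    proof (intro allI impI)
      fix i assume i: "i < k" "(i, i + k) \<in> Ce \<or> (i + k, i) \<in> Ce"
      hence "(x @ y) ! i = (x @ y) ! (i + k)" using L by auto
      thus "x ! i = y ! i" using n[OF i(1)] by simp
    qed
  next
    assume R: ?R
    show ?L
    proof clarify
      fix i j assume ij: "(i, j) \<in> Ce"
      from cs(1)[OF ij] show "(x @ y) ! i = (x @ y) ! j" using R n ij by auto
    qed
  qed
  have a: "(\<forall>(i, j)\<in>Ca. snd G ((x @ y) ! i) ((x @ y) ! j)) \<longleftrightarrow> (\<forall>i<k. (i, i + k) \<in> Ca \<or> (i + k, i) \<in> Ca \<longrightarrow> snd G (x ! i) (y ! i))"
    (is "?L \<longleftrightarrow> ?R")
  proof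
    assume L: ?L
    show ?R
    proof (intro allI impI)
      fix i assume i: "i < k" "(i, i + k) \<in> Ca \<or> (i + k, i) \<in> Ca"
      hence "snd G ((x @ y) ! i) ((x @ y) ! (i + k))" using L simple_graph_sym[OF G] by auto
      thus "snd G (x ! i) (y ! i)" using n[OF i(1)] by simp
    qed
  next
    assume R: ?R
    show ?L
    proof clarify
      fix i j assume ij: "(i, j) \<in> Ca"
      from cs(2)[OF ij] show "snd G ((x @ y) ! i) ((x @ y) ! j)" using R n ij simple_graph_sym[OF G] by auto
    qed
  qed
  show ?thesis unfolding form_tensor_def e a pair_cond_def re ra using True by (simp only: imp_conjR all_conj_distrib)
qed (auto simp: form_tensor_def)

lemma tuples_Suc: "tuples V (Suc m) = (\<lambda>(a, x). a # x) ` (V \<times> tuples V m)"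
  unfolding tuples_def by (auto simp: length_Suc_conv image_iff)

lemma sum_tuples_Suc: "(\<Sum>x\<in>tuples V (Suc m). f x) = (\<Sum>a\<in>V. \<Sum>x\<in>tuples V m. f (a # x))"
proof -
  have "(\<Sum>x\<in>tuples V (Suc m). f x) = (\<Sum>p\<in>V \<times> tuples V m. f (fst p # snd p))"
    unfolding tuples_Suc by (subst sum.reindex) (auto simp: inj_on_def split_def)
  thus ?thesis by (simp add: sum.cartesian_product split_def)
qed

lemma tuples_0: "tuples V 0 = {[]}"
  unfolding tuples_def by auto

text \<open>Summing out one matched pair of letters at a time: the constraint on the pair can be moved
  from the \<open>A\<close>-side to the \<open>B\<close>-side, since all terms in which the two relations differ vanish.\<close>
lemma npa_marginal:
  fixes R :: "'p list \<Rightarrow> 'p list \<Rightarrow> complex" and mk :: "'a \<Rightarrow> 'b \<Rightarrow> 'p"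
  assumes S1: "\<And>s t b. b \<in> VB \<Longrightarrow> set s \<subseteq> Z \<Longrightarrow> set t \<subseteq> Z \<Longrightarrow> length s < k \<Longrightarrow> length t \<le> k \<Longrightarrow>
      (\<Sum>a\<in>VA. R (mk a b # s) t) = R s t"
    and S2: "\<And>s t b. b \<in> VB \<Longrightarrow> set s \<subseteq> Z \<Longrightarrow> set t \<subseteq> Z \<Longrightarrow> length s < k \<Longrightarrow> length t \<le> k \<Longrightarrow>
      (\<Sum>a\<in>VA. R t (mk a b # s)) = R t s"
    and mism: "\<And>a a' b b' s t. a \<in> VA \<Longrightarrow> a' \<in> VA \<Longrightarrow> b \<in> VB \<Longrightarrow> b' \<in> VB \<Longrightarrow> set s \<subseteq> Z \<Longrightarrow> set t \<subseteq> Z \<Longrightarrow>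
      length s < k \<Longrightarrow> length t < k \<Longrightarrow> R (mk a b # s) (mk a' b' # t) \<noteq> 0 \<Longrightarrow> relA a a' = relB b b'"
    and R0: "R [] [] = 1" and mk: "\<And>a b. a \<in> VA \<Longrightarrow> b \<in> VB \<Longrightarrow> mk a b \<in> Z"
  shows "m \<le> k \<Longrightarrow> y \<in> tuples VB m \<Longrightarrow> y' \<in> tuples VB m \<Longrightarrow>
    (\<Sum>x\<in>tuples VA m. \<Sum>x'\<in>tuples VA m.
       if \<forall>i<m. c i (relA (x ! i) (x' ! i)) then R (map2 mk x y) (map2 mk x' y') else 0)
    = (if \<forall>i<m. c i (relB (y ! i) (y' ! i)) then 1 else 0)"
proof (induction m arbitrary: y y' c)
  case 0 thus ?case using R0 by (simp add: tuples_0)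
next
  case (Suc m)
  obtain b ys where y: "y = b # ys" "b \<in> VB" "ys \<in> tuples VB m" using Suc.prems(2) unfolding tuples_Suc by auto
  obtain b' ys' where y': "y' = b' # ys'" "b' \<in> VB" "ys' \<in> tuples VB m" using Suc.prems(3) unfolding tuples_Suc by auto
  have all: "(\<forall>i<Suc m. P i) \<longleftrightarrow> P 0 \<and> (\<forall>i<m. P (Suc i))" for P by (simp add: All_less_Suc2)
  have Z: "set (map2 mk x ys) \<subseteq> Z" if "x \<in> tuples VA m" "ys \<in> tuples VB m" for x ys
  proof
    fix p assume "p \<in> set (map2 mk x ys)"
    then obtain a b where ab: "(a, b) \<in> set (zip x ys)" "p = mk a b" by auto
    have "a \<in> VA" "b \<in> VB" using set_zip_leftD[OF ab(1)] set_zip_rightD[OF ab(1)] that unfolding tuples_def by auto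
    thus "p \<in> Z" using mk ab(2) by simp
  qed
  have len: "length (map2 mk x ys) = m" if "x \<in> tuples VA m" "ys \<in> tuples VB m" for x ys
    using that unfolding tuples_def by simp
  have inner: "(\<Sum>a\<in>VA. \<Sum>a'\<in>VA. if c 0 (relA a a') then R (mk a b # s) (mk a' b' # t) else 0)
      = (if c 0 (relB b b') then R s t else 0)"
    if st: "set s \<subseteq> Z" "set t \<subseteq> Z" "length s = m" "length t = m" for s t
  proof -
    have "(\<Sum>a\<in>VA. \<Sum>a'\<in>VA. if c 0 (relA a a') then R (mk a b # s) (mk a' b' # t) else 0) =
      (\<Sum>a\<in>VA. \<Sum>a'\<in>VA. if c 0 (relB b b') then R (mk a b # s) (mk a' b' # t) else 0)"
    proof (intro sum.cong HOL.refl)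
      fix a a' assume "a \<in> VA" "a' \<in> VA"
      with mism[of a a' b b' s t] y(2) y'(2) st Suc.prems(1)
      show "(if c 0 (relA a a') then R (mk a b # s) (mk a' b' # t) else 0) =
        (if c 0 (relB b b') then R (mk a b # s) (mk a' b' # t) else 0)"
        by (cases "R (mk a b # s) (mk a' b' # t) = 0") auto
    qed
    also have "\<dots> = (if c 0 (relB b b') then (\<Sum>a\<in>VA. \<Sum>a'\<in>VA. R (mk a b # s) (mk a' b' # t)) else 0)" by simp
    also have "(\<Sum>a\<in>VA. \<Sum>a'\<in>VA. R (mk a b # s) (mk a' b' # t)) = (\<Sum>a\<in>VA. R (mk a b # s) t)"
      using S2[OF y'(2) st(2)] st Suc.prems(1) mk y(2) by (intro sum.cong HOL.refl) auto
    also have "\<dots> = R s t" using S1[OF y(2) st(1,2)] st Suc.prems(1) by simp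
    finally show ?thesis .
  qed
  have "(\<Sum>x\<in>tuples VA (Suc m). \<Sum>x'\<in>tuples VA (Suc m).
       if \<forall>i<Suc m. c i (relA (x ! i) (x' ! i)) then R (map2 mk x y) (map2 mk x' y') else 0) =
     (\<Sum>a\<in>VA. \<Sum>x\<in>tuples VA m. \<Sum>a'\<in>VA. \<Sum>x'\<in>tuples VA m.
       if \<forall>i<m. c (Suc i) (relA (x ! i) (x' ! i)) then
         (if c 0 (relA a a') then R (mk a b # map2 mk x ys) (mk a' b' # map2 mk x' ys') else 0) else 0)"
    unfolding sum_tuples_Suc y y' all by (intro sum.cong HOL.refl) auto
  also have "\<dots> = (\<Sum>x\<in>tuples VA m. \<Sum>x'\<in>tuples VA m. \<Sum>a\<in>VA. \<Sum>a'\<in>VA.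
       if \<forall>i<m. c (Suc i) (relA (x ! i) (x' ! i)) then
         (if c 0 (relA a a') then R (mk a b # map2 mk x ys) (mk a' b' # map2 mk x' ys') else 0) else 0)"
    (is "?lhs = ?rhs")
  proof -
    have "?lhs = (\<Sum>x\<in>tuples VA m. \<Sum>a\<in>VA. \<Sum>a'\<in>VA. \<Sum>x'\<in>tuples VA m.
       if \<forall>i<m. c (Suc i) (relA (x ! i) (x' ! i)) then
         (if c 0 (relA a a') then R (mk a b # map2 mk x ys) (mk a' b' # map2 mk x' ys') else 0) else 0)"
      by (rule sum.swap)
    also have "\<dots> = ?rhs" by (intro sum.cong HOL.refl sum_swap3)
    finally show ?thesis .
  qed
  also have "\<dots> = (\<Sum>x\<in>tuples VA m. \<Sum>x'\<in>tuples VA m.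
       if \<forall>i<m. c (Suc i) (relA (x ! i) (x' ! i)) then
         (if c 0 (relB b b') then R (map2 mk x ys) (map2 mk x' ys') else 0) else 0)"
  proof (intro sum.cong HOL.refl)
    fix x x' assume x: "x \<in> tuples VA m" "x' \<in> tuples VA m"
    show "(\<Sum>a\<in>VA. \<Sum>a'\<in>VA. if \<forall>i<m. c (Suc i) (relA (x ! i) (x' ! i)) then
         (if c 0 (relA a a') then R (mk a b # map2 mk x ys) (mk a' b' # map2 mk x' ys') else 0) else 0) =
       (if \<forall>i<m. c (Suc i) (relA (x ! i) (x' ! i)) then
         (if c 0 (relB b b') then R (map2 mk x ys) (map2 mk x' ys') else 0) else 0)"
    proof (cases "\<forall>i<m. c (Suc i) (relA (x ! i) (x' ! i))")
      case True show ?thesis unfolding if_P[OF True]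
        by (rule inner[OF Z[OF x(1) y(3)] Z[OF x(2) y'(3)] len[OF x(1) y(3)] len[OF x(2) y'(3)]])
    next
      case False show ?thesis unfolding if_not_P[OF False] by simp
    qed
  qed
  also have "\<dots> = (if c 0 (relB b b') then (if \<forall>i<m. c (Suc i) (relB (ys ! i) (ys' ! i)) then 1 else 0) else 0)"
  proof (cases "c 0 (relB b b')")
    case True show ?thesis unfolding if_P[OF True]
      by (rule Suc.IH[of ys ys' "\<lambda>i. c (Suc i)", OF Suc_leD[OF Suc.prems(1)] y(3) y'(3)])
  next
    case False show ?thesis unfolding if_not_P[OF False] by simp
  qed
  finally show ?case unfolding y y' all by simp
qed

lemma tuples_length: "x \<in> tuples V k \<Longrightarrow> length x = k"
  unfolding tuples_def by simp

lemma tuplesI: "length x = k \<Longrightarrow> set x \<subseteq> V \<Longrightarrow> x \<in> tuples V k"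
  unfolding tuples_def by simp

lemma rot_index_tuples:
  assumes "k \<ge> 1" "x \<in> tuples V k" "y \<in> tuples V k"
  shows "hd y # butlast x \<in> tuples V k" "tl y @ [last x] \<in> tuples V k"
    "tl x @ [last y] \<in> tuples V k" "hd x # butlast y \<in> tuples V k"
proof -
  have l: "length x = k" "length y = k" "x \<noteq> []" "y \<noteq> []" "set x \<subseteq> V" "set y \<subseteq> V"
    using assms unfolding tuples_def by auto
  have "hd x \<in> V" "hd y \<in> V" "last x \<in> V" "last y \<in> V" "set (butlast x) \<subseteq> V" "set (butlast y) \<subseteq> V"
    "set (tl x) \<subseteq> V" "set (tl y) \<subseteq> V"
    using l hd_in_set[of x] hd_in_set[of y] last_in_set[of x] last_in_set[of y]
    by (auto dest: in_set_butlastD list.set_sel(2))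
  thus "hd y # butlast x \<in> tuples V k" "tl y @ [last x] \<in> tuples V k"
    "tl x @ [last y] \<in> tuples V k" "hd x # butlast y \<in> tuples V k"
    using l assms(1) by (auto intro!: tuplesI)
qed

lemma rot_index_bij:
  assumes "k \<ge> 1"
  shows "bij_betw (\<lambda>(x, y). (hd y # butlast x, tl y @ [last x])) (tuples V k \<times> tuples V k) (tuples V k \<times> tuples V k)"
proof (rule bij_betw_byWitness[where f' = "\<lambda>(x, y). (tl x @ [last y], hd x # butlast y)"])
  have ne: "x \<noteq> []" if "x \<in> tuples V k" for x using that assms unfolding tuples_def by auto
  show "\<forall>p\<in>tuples V k \<times> tuples V k.
     (case (case p of (x, y) \<Rightarrow> (hd y # butlast x, tl y @ [last x])) of (x, y) \<Rightarrow> (tl x @ [last y], hd x # butlast y)) = p"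
    using ne by auto
  show "\<forall>p\<in>tuples V k \<times> tuples V k.
     (case (case p of (x, y) \<Rightarrow> (tl x @ [last y], hd x # butlast y)) of (x, y) \<Rightarrow> (hd y # butlast x, tl y @ [last x])) = p"
    using ne by auto
qed (use rot_index_tuples[OF assms] in auto)

text \<open>The index change behind \<open>rot\<close> permutes pairs of tuples. It makes
  \<open>rot\<close> unitary and compatible with double sums over index pairs.\<close>

lemma sum_rot_index:
  assumes "k \<ge> 1"
  shows "(\<Sum>x\<in>tuples V k. \<Sum>y\<in>tuples V k. f (hd y # butlast x) (tl y @ [last x])) =
     (\<Sum>x\<in>tuples V k. \<Sum>y\<in>tuples V k. f x y)"
proof -
  have "(\<Sum>p\<in>tuples V k \<times> tuples V k. (\<lambda>(x, y). f x y) ((\<lambda>(x, y). (hd y # butlast x, tl y @ [last x])) p)) =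
     (\<Sum>p\<in>tuples V k \<times> tuples V k. (\<lambda>(x, y). f x y) p)"
    by (rule sum.reindex_bij_betw[OF rot_index_bij[OF assms]])
  thus ?thesis by (simp add: sum.cartesian_product split_def)
qed

lemma sum_swap4:
  "(\<Sum>a\<in>A. \<Sum>b\<in>B. \<Sum>c\<in>C. \<Sum>d\<in>D. f a b c d) = (\<Sum>c\<in>C. \<Sum>d\<in>D. \<Sum>a\<in>A. \<Sum>b\<in>B. f a b c d)"
proof -
  have "(\<Sum>a\<in>A. \<Sum>b\<in>B. \<Sum>c\<in>C. \<Sum>d\<in>D. f a b c d) = (\<Sum>c\<in>C. \<Sum>a\<in>A. \<Sum>b\<in>B. \<Sum>d\<in>D. f a b c d)"
    by (rule sum_swap3)
  also have "\<dots> = (\<Sum>c\<in>C. \<Sum>d\<in>D. \<Sum>a\<in>A. \<Sum>b\<in>B. f a b c d)" by (intro sum.cong HOL.refl sum_swap3)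
  finally show ?thesis .
qed

lemma minner_eq: "minner V k A B = (\<Sum>x\<in>tuples V k. \<Sum>y\<in>tuples V k. cnj (A x y) * B x y)"
  unfolding minner_def mtrace_def mmul_def mstar_def by (rule sum.swap)

text \<open>Puts I into the shape of a conjunction of conditions on relation types, so that the
  marginal computation for matchings also gives the conditions on I and J.\<close>

lemma idm_cond:
  "idm (fst G) k = (\<lambda>x y. if x \<in> tuples (fst G) k \<and> y \<in> tuples (fst G) k \<and> (\<forall>i<k. rel G (x ! i) (y ! i) = RelEq) then 1 else 0)"
proof (intro ext)
  fix x y
  have "rel G a b = RelEq \<longleftrightarrow> a = b" for a b unfolding rel_def by simp
  moreover have "y = x \<longleftrightarrow> (\<forall>i<k. x ! i = y ! i)" if "x \<in> tuples (fst G) k" "y \<in> tuples (fst G) k"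
    using that unfolding tuples_def by (auto intro!: nth_equalityI)
  ultimately show "idm (fst G) k x y =
     (if x \<in> tuples (fst G) k \<and> y \<in> tuples (fst G) k \<and> (\<forall>i<k. rel G (x ! i) (y ! i) = RelEq) then 1 else 0)"
    unfolding idm_def by auto
qed

lemma onesm_cond:
  "onesm (fst G) k = (\<lambda>x y. if x \<in> tuples (fst G) k \<and> y \<in> tuples (fst G) k \<and> (\<forall>i<k. True) then 1 else 0)"
  unfolding onesm_def by simp

lemma hadamard_onesm: "X \<in> matspace V k \<Longrightarrow> hadamard X (onesm V k) = X"
  unfolding hadamard_def onesm_def by (intro ext) (auto simp: matspace_def)

lemma idm_matspace: "idm V k \<in> matspace V k" and onesm_matspace: "onesm V k \<in> matspace V k"
  unfolding idm_def onesm_def matspace_def by (auto split: if_splits)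

lemma permute_commute:
  assumes k: "k \<ge> 1" and ms: "\<And>X. X \<in> matspace V k \<Longrightarrow> \<Phi> X \<in> matspace V' k"
    and r: "\<And>X. X \<in> matspace V k \<Longrightarrow> \<Phi> (rot k X) = rot k (\<Phi> X)"
    and "\<sigma> \<in> cyc_group k" "X \<in> matspace V k"
  shows "\<Phi> (permute_mat k \<sigma> X) = permute_mat k \<sigma> (\<Phi> X)"
proof -
  obtain n where n: "\<sigma> = cyc_gen k ^^ n" using assms(4) unfolding cyc_group_def by blast
  have "(rot k ^^ n) X \<in> matspace V k \<and> \<Phi> ((rot k ^^ n) X) = (rot k ^^ n) (\<Phi> X)"
    using assms(5) by (induction n) (auto simp: r rot_matspace[OF k])
  thus ?thesis unfolding n permute_mat_pow[OF k assms(5)] permute_mat_pow[OF k ms[OF assms(5)]] by blast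
qed

text \<open>Choi's criterion: products of Gram vectors of the Choi matrix with Gram vectors of the
  block matrix, summed over the input index, are Gram vectors of the output.\<close>

lemma completely_positive_if_choi:
  assumes fin: "finite VG" "finite VH"
    and psd: "psd_on (tuples VG k \<times> tuples VH k) (\<lambda>(x, y) (x', y'). C x y x' y')"
    and Phi: "\<And>X y y'. y \<in> tuples VH k \<Longrightarrow> y' \<in> tuples VH k \<Longrightarrow>
       \<Phi> X y y' = (\<Sum>x\<in>tuples VG k. \<Sum>x'\<in>tuples VG k. C x y x' y' * X x x')"
  shows "completely_positive k VG VH \<Phi>"
  unfolding completely_positive_def
proof (intro allI impI)
  fix n :: nat and B :: "nat \<times> 'a list \<Rightarrow> nat \<times> 'a list \<Rightarrow> complex"
  assume psdB: "psd_on ({..<n} \<times> tuples VG k) B"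
  have fT: "finite ({..<n} \<times> tuples VG k)" "finite (tuples VG k \<times> tuples VH k)"
    using finite_tuples[OF fin(1)] finite_tuples[OF fin(2)] by auto
  obtain n1 :: nat and b where "\<forall>p\<in>{..<n} \<times> tuples VG k. \<forall>q\<in>{..<n} \<times> tuples VG k.
      B p q = (\<Sum>r<n1. cnj (b r p) * b r q)"
    using psd_on_gram[OF fT(1) psdB] by (elim exE) (rule that)
  hence b: "B (i, x) (j, x') = (\<Sum>r<n1. cnj (b r (i, x)) * b r (j, x'))"
    if "i < n" "j < n" "x \<in> tuples VG k" "x' \<in> tuples VG k" for i j x x' using that by simp
  obtain n2 :: nat and c where "\<forall>p\<in>tuples VG k \<times> tuples VH k. \<forall>q\<in>tuples VG k \<times> tuples VH k.
      (\<lambda>(x, y) (x', y'). C x y x' y') p q = (\<Sum>r<n2. cnj (c r p) * c r q)"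
    using psd_on_gram[OF fT(2) psd] by (elim exE) (rule that)
  hence c: "C x y x' y' = (\<Sum>r<n2. cnj (c r (x, y)) * c r (x', y'))"
    if "x \<in> tuples VG k" "y \<in> tuples VH k" "x' \<in> tuples VG k" "y' \<in> tuples VH k" for x y x' y'
    using that by simp
  show "psd_on ({..<n} \<times> tuples VH k) (\<lambda>(i, x) (j, y). \<Phi> (\<lambda>x' y'. B (i, x') (j, y')) x y)"
  proof (rule psd_on_if_gram[where R = "{..<n2} \<times> {..<n1}" and
        p = "\<lambda>(r, q) (i, y). \<Sum>x\<in>tuples VG k. c r (x, y) * b q (i, x)"])
    fix a a' assume "a \<in> {..<n} \<times> tuples VH k" "a' \<in> {..<n} \<times> tuples VH k"
    then obtain i y j y' where a: "a = (i, y)" "a' = (j, y')" "i < n" "j < n" "y \<in> tuples VH k" "y' \<in> tuples VH k" by auto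
    have "\<Phi> (\<lambda>x' y'. B (i, x') (j, y')) y y' = (\<Sum>x\<in>tuples VG k. \<Sum>x'\<in>tuples VG k. C x y x' y' * B (i, x) (j, x'))"
      using a by (intro Phi)
    also have "\<dots> = (\<Sum>x\<in>tuples VG k. \<Sum>x'\<in>tuples VG k. \<Sum>r<n2. \<Sum>q<n1.
        cnj (c r (x, y) * b q (i, x)) * (c r (x', y') * b q (j, x')))"
    proof (intro sum.cong HOL.refl)
      fix x x' assume x: "x \<in> tuples VG k" "x' \<in> tuples VG k"
      show "C x y x' y' * B (i, x) (j, x') = (\<Sum>r<n2. \<Sum>q<n1. cnj (c r (x, y) * b q (i, x)) * (c r (x', y') * b q (j, x')))"
        unfolding c[OF x(1) a(5) x(2) a(6)] b[OF a(3,4) x] sum_product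
        by (intro sum.cong HOL.refl) (simp only: complex_cnj_mult mult_ac)
    qed
    also have "\<dots> = (\<Sum>r<n2. \<Sum>q<n1. \<Sum>x\<in>tuples VG k. \<Sum>x'\<in>tuples VG k.
        cnj (c r (x, y) * b q (i, x)) * (c r (x', y') * b q (j, x')))" by (rule sum_swap4)
    also have "\<dots> = (\<Sum>r<n2. \<Sum>q<n1. cnj (\<Sum>x\<in>tuples VG k. c r (x, y) * b q (i, x)) * (\<Sum>x\<in>tuples VG k. c r (x, y') * b q (j, x)))"
      unfolding cnj_sum sum_product ..
    finally show "(case a of (i, x) \<Rightarrow> \<lambda>(j, y). \<Phi> (\<lambda>x' y'. B (i, x') (j, y')) x y) a' =
      (\<Sum>r\<in>{..<n2} \<times> {..<n1}. cnj ((case r of (r, q) \<Rightarrow> \<lambda>(i, y). \<Sum>x\<in>tuples VG k. c r (x, y) * b q (i, x)) a) *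
         (case r of (r, q) \<Rightarrow> \<lambda>(i, y). \<Sum>x\<in>tuples VG k. c r (x, y) * b q (i, x)) a')"
      unfolding a by (simp add: sum.cartesian_product split_def)
  qed
qed

lemma zip_rot_index:
  assumes "length x = length y" "length x' = length y'" "x \<noteq> []" "x' \<noteq> []"
  shows "zip (hd x' # butlast x) (hd y' # butlast y) = hd (zip x' y') # butlast (zip x y)"
    "zip (tl x' @ [last x]) (tl y' @ [last y]) = tl (zip x' y') @ [last (zip x y)]"
proof -
  have ne: "y \<noteq> []" "y' \<noteq> []" using assms by auto
  obtain a as where x: "x = as @ [a]" using assms(3) by (metis rev_exhaust)
  obtain b bs where y: "y = bs @ [b]" using ne(1) by (metis rev_exhaust)
  obtain a' as' where x': "x' = a' # as'" using assms(4) by (cases x') auto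
  obtain b' bs' where y': "y' = b' # bs'" using ne(2) by (cases y') auto
  show "zip (hd x' # butlast x) (hd y' # butlast y) = hd (zip x' y') # butlast (zip x y)"
    "zip (tl x' @ [last x]) (tl y' @ [last y]) = tl (zip x' y') @ [last (zip x y)]"
    using assms(1,2) unfolding x y x' y' by auto
qed

lemma C_pairs_cases:
  assumes "k \<ge> 1" "(i, j) \<in> C_pairs k"
  obtains (step) p where "{i, j} = {p, p + 1}" "p + 1 < k \<or> (k \<le> p \<and> p + 1 < 2 * k)"
    | (first) "{i, j} = {0, k}" | (last) "{i, j} = {k - 1, 2 * k - 1}"
proof -
  have "{i, j} \<in> C_edges k" using assms(2) unfolding labelled_base.epairs_def[OF C_labelled_base[OF assms(1)]] by simp
  then obtain e where e: "e \<in> C_edges k" "{i, j} = e" by simp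
  from e(1) consider p where "e = {p, p + 1}" "p + 1 < 2 * k" "p \<noteq> k - 1" | "e = {0, k}" | "e = {k - 1, 2 * k - 1}"
    unfolding C_edges_def by blast
  thus ?thesis unfolding e(2)[symmetric]
  proof cases
    case (1 p)
    hence "p + 1 < k \<or> (k \<le> p \<and> p + 1 < 2 * k)" by linarith
    thus ?thesis using step 1 by blast
  qed (use first last in blast)+
qed

section \<open>The map whose Choi matrix is given by a certificate\<close>

locale npa_cert =
  fixes G :: "'a sgraph" and H :: "'b sgraph" and k :: nat and R :: "('a \<times> 'b) list \<Rightarrow> ('a \<times> 'b) list \<Rightarrow> complex"
  assumes G: "simple_graph G" and H: "simple_graph H" and card_eq: "card (fst G) = card (fst H)" and k: "k \<ge> 1"
    and cert: "npa_certificate k G H R"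
begin

abbreviation "VG \<equiv> fst G"
abbreviation "VH \<equiv> fst H"
abbreviation "TG \<equiv> tuples VG k"
abbreviation "TH \<equiv> tuples VH k"
abbreviation "Wd \<equiv> words VG VH k"

lemma fin: "finite VG" "finite VH" using G H by (auto simp: simple_graph_finite)

lemma psd: "psd_on Wd R" and R0: "R [] [] = 1"
  using cert unfolding npa_certificate_def Let_def by blast+

lemma equivD: "s \<in> Wd \<Longrightarrow> t \<in> Wd \<Longrightarrow> s' \<in> Wd \<Longrightarrow> t' \<in> Wd \<Longrightarrow> word_equiv (rev s @ t) (rev s' @ t') \<Longrightarrow> R s t = R s' t'"
  using cert unfolding npa_certificate_def Let_def by blast

lemma sumD:
  assumes "g \<in> VG" "h \<in> VH" "s @ [(g, h)] @ s' \<in> Wd" "t \<in> Wd"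
  shows "(\<Sum>h'\<in>VH. R (s @ [(g, h')] @ s') t) = R (s @ s') t"
    "(\<Sum>g'\<in>VG. R (s @ [(g', h)] @ s') t) = R (s @ s') t"
    "(\<Sum>h'\<in>VH. R t (s @ [(g, h')] @ s')) = R t (s @ s')"
    "(\<Sum>g'\<in>VG. R t (s @ [(g', h)] @ s')) = R t (s @ s')"
  using cert assms unfolding npa_certificate_def Let_def by blast+

lemma mismD:
  assumes "s \<in> Wd" "t \<in> Wd" "R s t \<noteq> 0" "i + 1 < length (rev s @ t)"
  shows "rel G (fst ((rev s @ t) ! i)) (fst ((rev s @ t) ! (i + 1))) = rel H (snd ((rev s @ t) ! i)) (snd ((rev s @ t) ! (i + 1)))"
proof -
  have "\<forall>s\<in>Wd. \<forall>t\<in>Wd. \<forall>i. i + 1 < length (rev s @ t) \<longrightarrow>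
          rel G (fst ((rev s @ t) ! i)) (fst ((rev s @ t) ! (i + 1))) \<noteq>
          rel H (snd ((rev s @ t) ! i)) (snd ((rev s @ t) ! (i + 1))) \<longrightarrow> R s t = 0"
    using cert unfolding npa_certificate_def Let_def by (elim conjE)
  thus ?thesis using assms by blast
qed

lemma WdI: "set s \<subseteq> VG \<times> VH \<Longrightarrow> length s \<le> k \<Longrightarrow> s \<in> Wd" unfolding words_def by simp

lemma mism_head:
  assumes "a \<in> VG" "a' \<in> VG" "b \<in> VH" "b' \<in> VH" "set s \<subseteq> VG \<times> VH" "set t \<subseteq> VG \<times> VH"
    "length s < k" "length t < k" "R ((a, b) # s) ((a', b') # t) \<noteq> 0"
  shows "rel G a a' = rel H b b'"
proof -
  have "(a, b) # s \<in> Wd" "(a', b') # t \<in> Wd" using assms by (auto intro!: WdI)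
  from mismD[OF this assms(9), of "length s"] show ?thesis by (simp add: nth_append)
qed

text \<open>The summation rules concern words that already contain a letter. When one coordinate is
  summed out, equal cardinality supplies some value for it.\<close>

lemma ex_G: "h \<in> VH \<Longrightarrow> \<exists>g. g \<in> VG" and ex_H: "g \<in> VG \<Longrightarrow> \<exists>h. h \<in> VH"
  using card_eq fin by (metis card_0_eq ex_in_conv)+

lemma map2_Pair: "map2 Pair x y = zip x y" by (simp add: case_prod_Pair)

lemma map2_swap: "map2 (\<lambda>a b. (b, a)) y x = zip x y"
  by (induction y x rule: list_induct2') auto

lemma marginal_G:
  assumes "y \<in> TH" "y' \<in> TH"
  shows "(\<Sum>x\<in>TG. \<Sum>x'\<in>TG. if \<forall>i<k. c i (rel G (x ! i) (x' ! i)) then R (zip x y) (zip x' y') else 0)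
    = (if \<forall>i<k. c i (rel H (y ! i) (y' ! i)) then 1 else 0)"
proof (rule npa_marginal[where mk = Pair and VB = VH and Z = "VG \<times> VH" and k = k, unfolded map2_Pair])
  fix s t b assume st: "b \<in> VH" "set s \<subseteq> VG \<times> VH" "set t \<subseteq> VG \<times> VH" "length s < k" "length t \<le> k"
  obtain g where g: "g \<in> VG" using ex_G[OF st(1)] by blast
  have "[] @ [(g, b)] @ s \<in> Wd" "t \<in> Wd" using st g by (auto intro!: WdI)
  from sumD(2,4)[OF g st(1) this]
  show "(\<Sum>a\<in>VG. R ((a, b) # s) t) = R s t" "(\<Sum>a\<in>VG. R t ((a, b) # s)) = R t s" by auto
qed (use mism_head R0 assms in auto)

text \<open>The induction of \<open>npa_marginal\<close> with the two graphs exchanged: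
  \<open>mk\<close> swaps the coordinates of a letter. This direction serves the adjoint
  map.\<close>

lemma marginal_H:
  assumes "x \<in> TG" "x' \<in> TG"
  shows "(\<Sum>y\<in>TH. \<Sum>y'\<in>TH. if \<forall>i<k. c i (rel H (y ! i) (y' ! i)) then R (zip x y) (zip x' y') else 0)
    = (if \<forall>i<k. c i (rel G (x ! i) (x' ! i)) then 1 else 0)"
proof (rule npa_marginal[where mk = "\<lambda>a b. (b, a)" and VB = VG and Z = "VG \<times> VH" and k = k, unfolded map2_swap])
  fix s t b assume st: "b \<in> VG" "set s \<subseteq> VG \<times> VH" "set t \<subseteq> VG \<times> VH" "length s < k" "length t \<le> k"
  obtain h where h: "h \<in> VH" using ex_H[OF st(1)] by blast
  have "[] @ [(b, h)] @ s \<in> Wd" "t \<in> Wd" using st h by (auto intro!: WdI)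
  from sumD(1,3)[OF st(1) h this]
  show "(\<Sum>a\<in>VH. R ((b, a) # s) t) = R s t" "(\<Sum>a\<in>VH. R t ((b, a) # s)) = R t s" by auto
next
  fix a a' b b' s t
  assume "a \<in> VH" "a' \<in> VH" "b \<in> VG" "b' \<in> VG" "set s \<subseteq> VG \<times> VH" "set t \<subseteq> VG \<times> VH"
    "length s < k" "length t < k" "R ((b, a) # s) ((b', a') # t) \<noteq> 0"
  thus "rel H a a' = rel G b b'" using mism_head[of b b' a a' s t] by simp
qed (use R0 assms in auto)

lemma zip_Wd: "x \<in> TG \<Longrightarrow> y \<in> TH \<Longrightarrow> zip x y \<in> Wd"
  unfolding words_def tuples_def by (auto dest: set_zip_leftD set_zip_rightD)

text \<open>Rotating the index pair moves the first letter of the cyclic word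
  \<open>rev s @ t\<close> to its end, and a certificate does not see cyclic shifts.\<close>

lemma R_rot:
  assumes "x \<in> TG" "x' \<in> TG" "y \<in> TH" "y' \<in> TH"
  shows "R (zip (hd x' # butlast x) (hd y' # butlast y)) (zip (tl x' @ [last x]) (tl y' @ [last y])) = R (zip x y) (zip x' y')"
proof (rule equivD)
  have l: "length x = k" "length x' = k" "length y = k" "length y' = k" using assms unfolding tuples_def by auto
  have ne: "x \<noteq> []" "x' \<noteq> []" "zip x y \<noteq> []" "zip x' y' \<noteq> []" using l k by auto
  have e: "zip (hd x' # butlast x) (hd y' # butlast y) = hd (zip x' y') # butlast (zip x y)"
    "zip (tl x' @ [last x]) (tl y' @ [last y]) = tl (zip x' y') @ [last (zip x y)]"
    using zip_rot_index[of x y x' y'] l ne by auto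
  have "rev (hd (zip x' y') # butlast (zip x y)) @ tl (zip x' y') @ [last (zip x y)] = (rev (butlast (zip x y)) @ zip x' y') @ [last (zip x y)]"
    using ne(4) by simp
  moreover have "rev (zip x y) @ zip x' y' = [last (zip x y)] @ (rev (butlast (zip x y)) @ zip x' y')"
    using ne(3) by (metis append.assoc append_butlast_last_id rev.simps(1) rev.simps(2) rev_append append_Nil)
  ultimately show "word_equiv (rev (zip (hd x' # butlast x) (hd y' # butlast y)) @ zip (tl x' @ [last x]) (tl y' @ [last y]))
     (rev (zip x y) @ zip x' y')"
    unfolding e by (simp only: word_equiv.cyc)
  show "zip (hd x' # butlast x) (hd y' # butlast y) \<in> Wd" "zip (tl x' @ [last x]) (tl y' @ [last y]) \<in> Wd"
    using assms by (auto intro!: zip_Wd rot_index_tuples[OF k] simp del: zip_Cons_Cons)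
qed (use assms zip_Wd in auto)

text \<open>Neighbouring letters of \<open>rev s @ t\<close> run along the edges of
  \<open>C_atom\<close>: down the in-labels, across to the first out-label, then up. Only the edge
  that closes the cycle joins the two ends of the word.\<close>

lemma R_rel:
  assumes T: "x \<in> TG" "x' \<in> TG" "y \<in> TH" "y' \<in> TH" and nz: "R (zip x y) (zip x' y') \<noteq> 0" and ij: "(i, j) \<in> C_pairs k"
  shows "rel G ((x @ x') ! i) ((x @ x') ! j) = rel H ((y @ y') ! i) ((y @ y') ! j)"
proof -
  define P where "P i j \<longleftrightarrow> rel G ((x @ x') ! i) ((x @ x') ! j) = rel H ((y @ y') ! i) ((y @ y') ! j)" for i j
  have l: "length x = k" "length x' = k" "length y = k" "length y' = k" using T unfolding tuples_def by auto
  have symP: "P i j \<longleftrightarrow> P j i" for i j unfolding P_def using rel_sym[OF G] rel_sym[OF H] by metis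
  have un: "P i j" if "{i, j} = {a, b}" "P a b" for a b using that symP by (auto simp: doubleton_eq_iff)
  let ?w = "rev (zip x y) @ zip x' y'"
  have lw: "length ?w = 2 * k" using l by simp
  have m: "rel G (fst (?w ! p)) (fst (?w ! (p + 1))) = rel H (snd (?w ! p)) (snd (?w ! (p + 1)))" if "p + 1 < 2 * k" for p
    using mismD[OF zip_Wd[OF T(1,3)] zip_Wd[OF T(2,4)] nz, of p] that lw by simp
  have w1: "?w ! p = (x ! (k - 1 - p), y ! (k - 1 - p))" if "p < k" for p
    using that l by (simp add: nth_append rev_nth)
  have w2: "?w ! p = (x' ! (p - k), y' ! (p - k))" if "k \<le> p" "p < 2 * k" for p
    using that l by (simp add: nth_append)
  from k ij have "P i j"
  proof (cases rule: C_pairs_cases)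
    case (step p)
    have "P p (p + 1)"
    proof (cases "p + 1 < k")
      case True
      have "k - 1 - (k - 2 - p) = p + 1" "k - 1 - (k - 2 - p + 1) = p" using True by auto
      hence "rel G (x ! (p + 1)) (x ! p) = rel H (y ! (p + 1)) (y ! p)"
        using m[of "k - 2 - p"] w1[of "k - 2 - p"] w1[of "k - 2 - p + 1"] True by simp
      hence "P (p + 1) p" unfolding P_def using True l by (simp add: nth_append)
      thus ?thesis using symP by blast
    next
      case False
      hence p: "k \<le> p" "p + 1 < 2 * k" using step(2) by auto
      thus ?thesis unfolding P_def using m[of p] w2[of p] w2[of "p + 1"] l by (simp add: nth_append Suc_diff_le)
    qed
    thus ?thesis by (rule un[OF step(1)])
  next
    case first
    have "P 0 k" unfolding P_def using m[of "k - 1"] w1[of "k - 1"] w2[of k] k l by (simp add: nth_append)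
    thus ?thesis by (rule un[OF first])
  next
    case last
    \<comment> \<open>One rotation brings the two ends of the word together, as the letters at
      positions 2k - 2 and 2k - 1.\<close>
    have T': "hd x' # butlast x \<in> TG" "tl x' @ [last x] \<in> TG" "hd y' # butlast y \<in> TH" "tl y' @ [last y] \<in> TH"
      using rot_index_tuples[OF k] T by blast+
    have nz': "R (zip (hd x' # butlast x) (hd y' # butlast y)) (zip (tl x' @ [last x]) (tl y' @ [last y])) \<noteq> 0"
      using R_rot[OF T] nz by simp
    define s where "s = zip (hd x' # butlast x) (hd y' # butlast y)"
    define t where "t = zip (tl x' @ [last x]) (tl y' @ [last y])"
    have ls: "length s = k" "length t = k" using T' unfolding tuples_def s_def t_def by auto
    have nt: "(rev s @ t) ! (k + m) = t ! m" for m using nth_append_length_plus[of "rev s" t m] ls by simp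
    have "rel G (fst ((rev s @ t) ! (2 * k - 2))) (fst ((rev s @ t) ! (2 * k - 2 + 1)))
        = rel H (snd ((rev s @ t) ! (2 * k - 2))) (snd ((rev s @ t) ! (2 * k - 2 + 1)))"
      using mismD[OF zip_Wd[OF T'(1,3)] zip_Wd[OF T'(2,4)] nz', folded s_def t_def, of "2 * k - 2"] ls k by simp
    moreover have "(rev s @ t) ! (2 * k - 2 + 1) = (x ! (k - 1), y ! (k - 1))"
    proof -
      have e: "2 * k - 2 + 1 = k + (k - 1)" using k by simp
      have "(rev s @ t) ! (2 * k - 2 + 1) = t ! (k - 1)" unfolding e by (rule nt)
      moreover have "x \<noteq> []" "y \<noteq> []" using l k by auto
      ultimately show ?thesis using l k unfolding t_def by (simp add: nth_append last_conv_nth)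
    qed
    moreover have "(rev s @ t) ! (2 * k - 2) = (x' ! (k - 1), y' ! (k - 1))"
    \<comment> \<open>For k = 1 the letter at position 2k - 2 lies in \<open>s\<close>, otherwise in
      \<open>t\<close>.\<close>
    proof (cases "k = 1")
      case True
      have "\<exists>a. x' = [a]" "\<exists>a. x = [a]" "\<exists>a. y' = [a]" "\<exists>a. y = [a]"
        using l True by (auto simp: length_Suc_conv)
      then obtain a b c d where "x' = [a]" "y' = [b]" "x = [c]" "y = [d]" by blast
      thus ?thesis using True l unfolding s_def t_def by simp
    next
      case False
      hence e: "2 * k - 2 = k + (k - 2)" "k - 2 < k - 1" "Suc (k - 2) = k - 1" using k by auto
      have "(rev s @ t) ! (2 * k - 2) = t ! (k - 2)" unfolding e(1) by (rule nt)
      thus ?thesis unfolding t_def using l k \<open>k - 2 < k - 1\<close> \<open>Suc (k - 2) = k - 1\<close> by (simp add: nth_append nth_tl)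
    qed
    ultimately have "rel G (x' ! (k - 1)) (x ! (k - 1)) = rel H (y' ! (k - 1)) (y ! (k - 1))" by simp
    moreover have e: "2 * k - 1 = k + (k - 1)" using k by simp
    moreover have "(x @ x') ! (k + (k - 1)) = x' ! (k - 1)" "(y @ y') ! (k + (k - 1)) = y' ! (k - 1)"
      "(x @ x') ! (k - 1) = x ! (k - 1)" "(y @ y') ! (k - 1) = y ! (k - 1)"
      using nth_append_length_plus[of x x' "k - 1"] nth_append_length_plus[of y y' "k - 1"] l k
      by (simp_all add: nth_append)
    ultimately have "P (2 * k - 1) (k - 1)" unfolding P_def by simp
    hence "P (k - 1) (2 * k - 1)" using symP by blast
    thus ?thesis by (rule un[OF last])
  qed
  thus ?thesis unfolding P_def .
qed

definition Phi :: "'a mat \<Rightarrow> 'b mat" where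
  "Phi X = (\<lambda>y y'. if y \<in> TH \<and> y' \<in> TH then \<Sum>x\<in>TG. \<Sum>x'\<in>TG. R (zip x y) (zip x' y') * X x x' else 0)"

definition Psi :: "'b mat \<Rightarrow> 'a mat" where
  "Psi Y = (\<lambda>x x'. if x \<in> TG \<and> x' \<in> TG then \<Sum>y\<in>TH. \<Sum>y'\<in>TH. cnj (R (zip x y) (zip x' y')) * Y y y' else 0)"

lemma Phi_cond:
  "Phi (\<lambda>x x'. if x \<in> TG \<and> x' \<in> TG \<and> (\<forall>i<k. c i (rel G (x ! i) (x' ! i))) then 1 else 0) =
   (\<lambda>y y'. if y \<in> TH \<and> y' \<in> TH \<and> (\<forall>i<k. c i (rel H (y ! i) (y' ! i))) then 1 else 0)"
proof (intro ext)
  fix y y'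
  have "(\<Sum>x\<in>TG. \<Sum>x'\<in>TG. R (zip x y) (zip x' y') *
       (if x \<in> TG \<and> x' \<in> TG \<and> (\<forall>i<k. c i (rel G (x ! i) (x' ! i))) then 1 else 0)) =
     (\<Sum>x\<in>TG. \<Sum>x'\<in>TG. if \<forall>i<k. c i (rel G (x ! i) (x' ! i)) then R (zip x y) (zip x' y') else 0)"
    by (intro sum.cong HOL.refl) auto
  thus "Phi (\<lambda>x x'. if x \<in> TG \<and> x' \<in> TG \<and> (\<forall>i<k. c i (rel G (x ! i) (x' ! i))) then 1 else 0) y y' =
    (if y \<in> TH \<and> y' \<in> TH \<and> (\<forall>i<k. c i (rel H (y ! i) (y' ! i))) then 1 else 0)"
    unfolding Phi_def by (auto simp: marginal_G)
qed

lemma Psi_cond: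
  "Psi (\<lambda>x x'. if x \<in> TH \<and> x' \<in> TH \<and> (\<forall>i<k. c i (rel H (x ! i) (x' ! i))) then 1 else 0) =
   (\<lambda>y y'. if y \<in> TG \<and> y' \<in> TG \<and> (\<forall>i<k. c i (rel G (y ! i) (y' ! i))) then 1 else 0)"
proof (intro ext)
  fix x x'
  have e: "(\<Sum>y\<in>TH. \<Sum>y'\<in>TH. cnj (R (zip x y) (zip x' y')) *
       (if y \<in> TH \<and> y' \<in> TH \<and> (\<forall>i<k. c i (rel H (y ! i) (y' ! i))) then 1 else 0)) =
     cnj (\<Sum>y\<in>TH. \<Sum>y'\<in>TH. if \<forall>i<k. c i (rel H (y ! i) (y' ! i)) then R (zip x y) (zip x' y') else 0)"
    unfolding cnj_sum by (intro sum.cong HOL.refl) auto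
  show "Psi (\<lambda>x x'. if x \<in> TH \<and> x' \<in> TH \<and> (\<forall>i<k. c i (rel H (x ! i) (x' ! i))) then 1 else 0) x x' =
    (if x \<in> TG \<and> x' \<in> TG \<and> (\<forall>i<k. c i (rel G (x ! i) (x' ! i))) then 1 else 0)"
  proof (cases "x \<in> TG \<and> x' \<in> TG")
    case True
    hence T: "x \<in> TG" "x' \<in> TG" by auto
    show ?thesis unfolding Psi_def e marginal_H[OF T] using T by simp
  qed (auto simp: Psi_def)
qed

lemma Phi_matspace: "Phi X \<in> matspace VH k" unfolding matspace_def Phi_def by auto

lemma Phi_rot: "Phi (rot k X) = rot k (Phi X)"
proof (intro ext)
  fix y y'
  have lG: "length x = k" if "x \<in> TG" for x using that by (rule tuples_length)
  have lH: "length x = k" if "x \<in> TH" for x using that by (rule tuples_length)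
  \<comment> \<open>The index change can be undone within tuples, so both sides vanish together at
    other indices.\<close>
  have inT: "y \<in> TH \<and> y' \<in> TH" if "length y = k" "length y' = k" "hd y' # butlast y \<in> TH" "tl y' @ [last y] \<in> TH"
  proof -
    have ne: "y \<noteq> []" "y' \<noteq> []" using that k by auto
    have "tl (hd y' # butlast y) @ [last (tl y' @ [last y])] = y" "hd (hd y' # butlast y) # butlast (tl y' @ [last y]) = y'"
      using ne by auto
    thus ?thesis using rot_index_tuples(3,4)[OF k that(3,4)] by simp
  qed
  show "Phi (rot k X) y y' = rot k (Phi X) y y'"
  proof (cases "y \<in> TH \<and> y' \<in> TH")
    case False
    thus ?thesis unfolding rot_def Phi_def using inT by auto
  next
    case True
    have "Phi (rot k X) y y' = (\<Sum>x\<in>TG. \<Sum>x'\<in>TG. R (zip x y) (zip x' y') * X (hd x' # butlast x) (tl x' @ [last x]))"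
      unfolding Phi_def rot_def using True lG lH by (auto intro!: sum.cong)
    also have "\<dots> = (\<Sum>x\<in>TG. \<Sum>x'\<in>TG. R (zip (hd x' # butlast x) (hd y' # butlast y)) (zip (tl x' @ [last x]) (tl y' @ [last y]))
        * X (hd x' # butlast x) (tl x' @ [last x]))"
      using True R_rot by (intro sum.cong HOL.refl) simp
    also have "\<dots> = (\<Sum>x\<in>TG. \<Sum>x'\<in>TG. R (zip x (hd y' # butlast y)) (zip x' (tl y' @ [last y])) * X x x')"
      by (rule sum_rot_index[OF k, of "\<lambda>x x'. R (zip x (hd y' # butlast y)) (zip x' (tl y' @ [last y])) * X x x'"])
    also have "\<dots> = rot k (Phi X) y y'"
      unfolding rot_def Phi_def using True lH rot_index_tuples(1,2)[OF k True[THEN conjunct1] True[THEN conjunct2]] by auto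
    finally show ?thesis .
  qed
qed

text \<open>Where a Choi entry is nonzero, \<open>R_rel\<close> makes the tensor entries of
  \<open>F\<close> in the two graphs equal, so the factor can be moved out of the sum.\<close>

lemma Phi_hadamard:
  assumes "F \<in> QP k" shows "Phi (hadamard (hom_tensor F G) X) = hadamard (hom_tensor F H) (Phi X)"
proof -
  obtain Ce Ca where f: "Ce \<subseteq> C_pairs k" "Ca \<subseteq> C_pairs k" "has_form k F Ce Ca" by (rule QP_form[OF k assms])
  have s: "Ce \<subseteq> {..<2*k} \<times> {..<2*k}" "Ca \<subseteq> {..<2*k} \<times> {..<2*k}" using f pairs_sub(1)[OF k] by auto
  have *: "R (zip x y) (zip x' y') * (hom_tensor F G x x' * X x x') = hom_tensor F H y y' * (R (zip x y) (zip x' y') * X x x')"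
    if T: "x \<in> TG" "x' \<in> TG" "y \<in> TH" "y' \<in> TH" for x x' y y'
  proof (cases "R (zip x y) (zip x' y') = 0")
    case False
    have "form_tensor k Ce Ca G x x' = form_tensor k Ce Ca H y y'"
      by (rule form_tensor_transfer[OF G H T R_rel[OF T False] f(1,2)])
    thus ?thesis unfolding has_form_tensor[OF f(3) s G] has_form_tensor[OF f(3) s H] by simp
  qed simp
  show ?thesis
  proof (intro ext)
    fix y y'
    show "Phi (hadamard (hom_tensor F G) X) y y' = hadamard (hom_tensor F H) (Phi X) y y'"
    proof (cases "y \<in> TH \<and> y' \<in> TH")
      case True
      show ?thesis unfolding Phi_def hadamard_def if_P[OF True] sum_distrib_left
        using True by (intro sum.cong HOL.refl *) auto
    qed (auto simp: Phi_def hadamard_def)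
  qed
qed

lemma Phi_adjoint: "is_adjoint k VG VH Phi Psi"
  unfolding is_adjoint_def
proof (intro conjI ballI)
  fix A assume "A \<in> matspace VH k"
  show "Psi A \<in> matspace VG k" unfolding matspace_def Psi_def by auto
next
  fix A B
  have "minner VG k (Psi A) B = (\<Sum>x\<in>TG. \<Sum>x'\<in>TG. \<Sum>y\<in>TH. \<Sum>y'\<in>TH. R (zip x y) (zip x' y') * cnj (A y y') * B x x')"
    unfolding minner_eq Psi_def by (intro sum.cong HOL.refl) (simp add: sum_distrib_right)
  also have "\<dots> = (\<Sum>y\<in>TH. \<Sum>y'\<in>TH. \<Sum>x\<in>TG. \<Sum>x'\<in>TG. R (zip x y) (zip x' y') * cnj (A y y') * B x x')"
    by (rule sum_swap4)
  also have "\<dots> = minner VH k A (Phi B)"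
    unfolding minner_eq Phi_def by (intro sum.cong HOL.refl) (simp add: sum_distrib_left ac_simps)
  finally show "minner VG k (Psi A) B = minner VH k A (Phi B)" .
qed

text \<open>For \<open>QP k\<close> the tensor is its own Schur product with J, which is already
  mapped to J. For \<open>QS k\<close> the constraints split over a matching and
  \<open>Phi_cond\<close> applies.\<close>

lemma Phi_Q:
  assumes "F \<in> Q k" shows "Phi (hom_tensor F G) = hom_tensor F H"
proof (cases "F \<in> QP k")
  case True
  have "Phi (hom_tensor F G) = Phi (hadamard (hom_tensor F G) (onesm VG k))"
    using hadamard_onesm[OF Q_matspace[OF k G assms]] by simp
  also have "\<dots> = hadamard (hom_tensor F H) (onesm VH k)"
    unfolding Phi_hadamard[OF True] using Phi_cond[of "\<lambda>_ _. True"] unfolding onesm_cond by simp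
  finally show ?thesis using hadamard_onesm[OF Q_matspace[OF k H assms]] by simp
next
  case False
  hence "F \<in> QS k" using assms unfolding Q_def by blast
  then obtain Ce Ca where f: "Ce \<subseteq> M_pairs k" "Ca \<subseteq> M_pairs k" "has_form k F Ce Ca" by (rule QS_form[OF k])
  have s: "Ce \<subseteq> {..<2*k} \<times> {..<2*k}" "Ca \<subseteq> {..<2*k} \<times> {..<2*k}" using f pairs_sub(2)[OF k] by auto
  have e: "hom_tensor F G = (\<lambda>x x'. if x \<in> TG \<and> x' \<in> TG \<and> (\<forall>i<k. pair_cond k Ce Ca i (rel G (x ! i) (x' ! i))) then 1 else 0)"
    unfolding has_form_tensor[OF f(3) s G] by (intro ext form_tensor_M[OF k f(1,2) G])
  have e': "hom_tensor F H = (\<lambda>x x'. if x \<in> TH \<and> x' \<in> TH \<and> (\<forall>i<k. pair_cond k Ce Ca i (rel H (x ! i) (x' ! i))) then 1 else 0)"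
    unfolding has_form_tensor[OF f(3) s H] by (intro ext form_tensor_M[OF k f(1,2) H])
  show ?thesis unfolding e e' by (rule Phi_cond)
qed

lemma Phi_cp: "completely_positive k VG VH Phi"
proof (rule completely_positive_if_choi[OF fin, where C = "\<lambda>x y x' y'. R (zip x y) (zip x' y')"])
  have "Wd \<subseteq> {xs. set xs \<subseteq> VG \<times> VH \<and> length xs \<le> k}" unfolding words_def by auto
  hence fW: "finite Wd" using fin finite_lists_length_le[of "VG \<times> VH" k] by (auto dest: finite_subset)
  show "psd_on (TG \<times> TH) (\<lambda>(x, y) (x', y'). R (zip x y) (zip x' y'))"
    by (rule psd_on_pullback[OF fW psd, where P = "\<lambda>_. {()}" and f = "\<lambda>(x, y) _. zip x y"])
      (auto simp: zip_Wd)
qed (simp add: Phi_def)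

lemma Phi_qiso: "qiso_map k G H Phi"
  unfolding qiso_map_def Let_def
proof (intro conjI ballI allI)
  show "Phi X \<in> matspace VH k" for X by (rule Phi_matspace)
  show "Phi (madd X Y) = madd (Phi X) (Phi Y)" for X Y
    unfolding Phi_def madd_def by (intro ext) (simp add: distrib_left sum.distrib)
  show "Phi (msmult c X) = msmult c (Phi X)" for c X
    unfolding Phi_def msmult_def by (intro ext) (simp add: sum_distrib_left mult.left_commute)
  show "completely_positive k VG VH Phi" by (rule Phi_cp)
  show "Phi (hadamard (hom_tensor F G) X) = hadamard (hom_tensor F H) (Phi X)" if "F \<in> QP k" for F X
    by (rule Phi_hadamard[OF that])
  show "Phi (idm VG k) = idm VH k" unfolding idm_cond by (rule Phi_cond)
  show "Phi (onesm VG k) = onesm VH k" unfolding onesm_cond by (rule Phi_cond)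
  have "Psi (idm VH k) = idm VG k" unfolding idm_cond by (rule Psi_cond)
  moreover have "Psi (onesm VH k) = onesm VG k" unfolding onesm_cond by (rule Psi_cond)
  ultimately show "\<exists>\<Psi>. is_adjoint k VG VH Phi \<Psi> \<and> \<Psi> (idm VH k) = idm VG k \<and> \<Psi> (onesm VH k) = onesm VG k"
    using Phi_adjoint by blast
  show "Phi (hom_tensor F G) = hom_tensor F H" if "F \<in> Q k" for F by (rule Phi_Q[OF that])
  show "Phi (permute_mat k \<sigma> X) = permute_mat k \<sigma> (Phi X)" if "\<sigma> \<in> cyc_group k" "X \<in> matspace VG k" for \<sigma> X
    by (rule permute_commute[where V = VG and V' = VH and \<Phi> = Phi, OF k Phi_matspace Phi_rot that])
qed

end

lemma npa_imp_qiso: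
  assumes "simple_graph G" "simple_graph H" "card (fst G) = card (fst H)" "k \<ge> 1" "npa_certificate k G H R"
  shows "\<exists>\<Phi>. qiso_map k G H \<Phi>"
proof -
  interpret npa_cert G H k R by unfold_locales (rule assms)+
  show ?thesis using Phi_qiso by blast
qed

section \<open>Kraus operators and the multiplicative domain\<close>

text \<open>The two outer index types may differ: Kraus operators are rectangular, with rows indexed
  over one graph and columns over the other.\<close>

definition mm :: "'i set \<Rightarrow> ('a \<Rightarrow> 'i \<Rightarrow> complex) \<Rightarrow> ('i \<Rightarrow> 'b \<Rightarrow> complex) \<Rightarrow> 'a \<Rightarrow> 'b \<Rightarrow> complex" where
  "mm S A B = (\<lambda>x y. \<Sum>z\<in>S. A x z * B z y)"

definition dag :: "('a \<Rightarrow> 'b \<Rightarrow> complex) \<Rightarrow> 'b \<Rightarrow> 'a \<Rightarrow> complex" where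
  "dag A = (\<lambda>x y. cnj (A y x))"

lemma mmul_mm: "mmul V k A B = mm (tuples V k) A B" unfolding mmul_def mm_def ..
lemma mstar_dag: "mstar A = dag A" unfolding mstar_def dag_def ..

lemma mm_assoc: "mm S (mm T A B) C = mm T A (mm S B C)"
  unfolding mm_def by (intro ext, simp only: sum_distrib_left sum_distrib_right, subst sum.swap) (simp only: mult.assoc)

lemma dag_mm: "dag (mm S A B) = mm S (dag B) (dag A)"
  unfolding mm_def dag_def by (intro ext) (simp add: mult.commute)

lemma dag_dag[simp]: "dag (dag A) = A" unfolding dag_def by simp

lemma dag_diff: "dag (\<lambda>x y. A x y - B x y) = (\<lambda>x y. dag A x y - dag B x y)"
  unfolding dag_def by simp

lemma mm_diff_left: "mm S (\<lambda>x y. A x y - B x y) C = (\<lambda>x y. mm S A C x y - mm S B C x y)"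
  unfolding mm_def by (simp add: left_diff_distrib sum_subtractf)

lemma mm_diff_right: "mm S C (\<lambda>x y. A x y - B x y) = (\<lambda>x y. mm S C A x y - mm S C B x y)"
  unfolding mm_def by (simp add: right_diff_distrib sum_subtractf)

lemma mm_sum_left: "mm S (\<lambda>x y. \<Sum>r\<in>R. A r x y) C = (\<lambda>x y. \<Sum>r\<in>R. mm S (A r) C x y)"
  unfolding mm_def by (intro ext, simp only: sum_distrib_right, rule sum.swap)

lemma mm_sum_right: "mm S C (\<lambda>x y. \<Sum>r\<in>R. A r x y) = (\<lambda>x y. \<Sum>r\<in>R. mm S C (A r) x y)"
  unfolding mm_def by (intro ext, simp only: sum_distrib_left, rule sum.swap)

lemma dag_sum: "dag (\<lambda>x y. \<Sum>r\<in>R. A r x y) = (\<lambda>x y. \<Sum>r\<in>R. dag (A r) x y)"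
  unfolding dag_def by simp

lemma mm_idm_right:
  assumes "finite V" "\<And>x y. y \<notin> tuples V k \<Longrightarrow> A x y = 0" shows "mm (tuples V k) A (idm V k) = A"
proof (intro ext)
  fix x y
  have "mm (tuples V k) A (idm V k) x y = (\<Sum>z\<in>tuples V k. if z = y then A x z else 0)"
    unfolding mm_def idm_def by (intro sum.cong HOL.refl) auto
  thus "mm (tuples V k) A (idm V k) x y = A x y" using finite_tuples[OF assms(1)] assms(2) by simp
qed

lemma mm_idm_left:
  assumes "finite V" "\<And>x y. x \<notin> tuples V k \<Longrightarrow> A x y = 0" shows "mm (tuples V k) (idm V k) A = A"
proof (intro ext)
  fix x y
  have "mm (tuples V k) (idm V k) A x y = (\<Sum>z\<in>tuples V k. if z = x then A z y else 0)"
    unfolding mm_def idm_def by (intro sum.cong HOL.refl) auto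
  thus "mm (tuples V k) (idm V k) A x y = A x y" using finite_tuples[OF assms(1)] assms(2) by simp
qed

lemma mmul_matspace: "A \<in> matspace V k \<Longrightarrow> B \<in> matspace V k \<Longrightarrow> mmul V k A B \<in> matspace V k"
  unfolding matspace_def mem_Collect_eq
proof (intro allI impI)
  fix x y
  assume AB: "\<forall>x y. A x y \<noteq> 0 \<longrightarrow> x \<in> tuples V k \<and> y \<in> tuples V k"
    "\<forall>x y. B x y \<noteq> 0 \<longrightarrow> x \<in> tuples V k \<and> y \<in> tuples V k" and "mmul V k A B x y \<noteq> 0"
  then obtain z where "A x z * B z y \<noteq> 0"
    unfolding mmul_def by (rule_tac sum.not_neutral_contains_not_neutral)
  thus "x \<in> tuples V k \<and> y \<in> tuples V k" using AB by auto
qed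

lemma mstar_matspace: "A \<in> matspace V k \<Longrightarrow> mstar A \<in> matspace V k"
  unfolding matspace_def mstar_def by auto

lemma madd_matspace: "A \<in> matspace V k \<Longrightarrow> B \<in> matspace V k \<Longrightarrow> madd A B \<in> matspace V k"
  unfolding matspace_def madd_def by (auto, (metis add.right_neutral add.left_neutral)+)

lemma msmult_matspace: "A \<in> matspace V k \<Longrightarrow> msmult c A \<in> matspace V k"
  unfolding matspace_def msmult_def by auto

lemma hadamard_matspace: "A \<in> matspace V k \<Longrightarrow> hadamard B A \<in> matspace V k"
  unfolding matspace_def hadamard_def by auto

text \<open>The squared Hilbert-Schmidt norm.\<close>

definition sqnorm :: "'a set \<Rightarrow> nat \<Rightarrow> 'a mat \<Rightarrow> real" where
  "sqnorm V k X = (\<Sum>x\<in>tuples V k. \<Sum>y\<in>tuples V k. (cmod (X x y))\<^sup>2)"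

lemma minner_self: "minner V k X X = complex_of_real (sqnorm V k X)"
  unfolding minner_eq sqnorm_def by (simp only: cnj_mult_self of_real_sum)

lemma sqnorm_zero:
  assumes "finite V" "X \<in> matspace V k" "sqnorm V k X = 0" shows "X = (\<lambda>_ _. 0)"
proof (intro ext)
  fix x y
  have "\<forall>x\<in>tuples V k. (\<Sum>y\<in>tuples V k. (cmod (X x y))\<^sup>2) = 0"
    using assms(3) finite_tuples[OF assms(1)] unfolding sqnorm_def by (subst (asm) sum_nonneg_eq_0_iff) (auto simp: sum_nonneg)
  hence "X x y = 0" if "x \<in> tuples V k" "y \<in> tuples V k"
    using that finite_tuples[OF assms(1)] by (auto simp: sum_nonneg_eq_0_iff)
  thus "X x y = 0" using matspace_zero[OF assms(2)] by blast
qed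

lemma sqnorm_mstar: "sqnorm V k (mstar X) = sqnorm V k X"
  unfolding sqnorm_def mstar_def by (subst sum.swap) simp

lemma sqnorm_01:
  assumes "\<And>x y. M x y = 0 \<or> M x y = 1"
  shows "complex_of_real (sqnorm V k M) = (\<Sum>x\<in>tuples V k. \<Sum>y\<in>tuples V k. M x y)"
proof -
  have "complex_of_real ((cmod (M x y))\<^sup>2) = M x y" for x y using assms[of x y] by auto
  thus ?thesis unfolding sqnorm_def of_real_sum by simp
qed

lemma hom_tensor_01:
  assumes "k \<ge> 1" "F \<in> Q k" "simple_graph G" shows "hom_tensor F G x y = 0 \<or> hom_tensor F G x y = 1"
proof -
  obtain Ce Ca where f: "Ce \<subseteq> {..<2*k} \<times> {..<2*k}" "Ca \<subseteq> {..<2*k} \<times> {..<2*k}" "has_form k F Ce Ca"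
    by (rule Q_form[OF assms(1,2)])
  show ?thesis unfolding has_form_tensor[OF f(3,1,2) assms(3)] form_tensor_def by auto
qed

definition munit :: "'a list \<Rightarrow> 'a list \<Rightarrow> 'a mat" where
  "munit x y = (\<lambda>a b. if a = x \<and> b = y then 1 else 0)"

lemma munit_matspace: "x \<in> tuples V k \<Longrightarrow> y \<in> tuples V k \<Longrightarrow> munit x y \<in> matspace V k"
  unfolding munit_def matspace_def by auto

section \<open>Kraus operators and norms for a quantum isomorphism map\<close>

locale qiso =
  fixes G :: "'a sgraph" and H :: "'b sgraph" and k :: nat and \<Phi> :: "'a mat \<Rightarrow> 'b mat"
  assumes G: "simple_graph G" and H: "simple_graph H" and k: "k \<ge> 1" and qi: "qiso_map k G H \<Phi>"
begin

abbreviation "VG \<equiv> fst G"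
abbreviation "VH \<equiv> fst H"
abbreviation "TG \<equiv> tuples VG k"
abbreviation "TH \<equiv> tuples VH k"

lemma fin: "finite VG" "finite VH" "finite TG" "finite TH"
  using G H by (auto simp: simple_graph_finite finite_tuples)

lemma Phi_matspace: "X \<in> matspace VG k \<Longrightarrow> \<Phi> X \<in> matspace VH k"
  using qi unfolding qiso_map_def Let_def by blast

lemma Phi_madd: "X \<in> matspace VG k \<Longrightarrow> Y \<in> matspace VG k \<Longrightarrow> \<Phi> (madd X Y) = madd (\<Phi> X) (\<Phi> Y)"
  using qi unfolding qiso_map_def Let_def by blast

lemma Phi_msmult: "X \<in> matspace VG k \<Longrightarrow> \<Phi> (msmult c X) = msmult c (\<Phi> X)"
  using qi unfolding qiso_map_def Let_def by blast

lemma Phi_cp: "completely_positive k VG VH \<Phi>"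
  using qi unfolding qiso_map_def Let_def by blast

lemma Phi_had: "F \<in> QP k \<Longrightarrow> X \<in> matspace VG k \<Longrightarrow> \<Phi> (hadamard (hom_tensor F G) X) = hadamard (hom_tensor F H) (\<Phi> X)"
  using qi unfolding qiso_map_def Let_def by blast

lemma Phi_idm: "\<Phi> (idm VG k) = idm VH k" and Phi_onesm: "\<Phi> (onesm VG k) = onesm VH k"
  using qi unfolding qiso_map_def Let_def by blast+

lemma Phi_Q: "F \<in> Q k \<Longrightarrow> \<Phi> (hom_tensor F G) = hom_tensor F H"
  using qi unfolding qiso_map_def Let_def by blast

lemma Phi_perm: "\<sigma> \<in> cyc_group k \<Longrightarrow> X \<in> matspace VG k \<Longrightarrow> \<Phi> (permute_mat k \<sigma> X) = permute_mat k \<sigma> (\<Phi> X)"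
  using qi unfolding qiso_map_def Let_def by blast

lemma Phi_rot: "X \<in> matspace VG k \<Longrightarrow> \<Phi> (rot k X) = rot k (\<Phi> X)"
proof -
  assume X: "X \<in> matspace VG k"
  have "cyc_gen k \<in> cyc_group k" unfolding cyc_group_def using rangeI[of "\<lambda>n. cyc_gen k ^^ n" 1] by simp
  from Phi_perm[OF this X] show ?thesis unfolding permute_mat_gen[OF k] .
qed

lemma Phi_sum: assumes "finite P" "\<And>p. p \<in> P \<Longrightarrow> M p \<in> matspace VG k"
  shows "\<Phi> (\<lambda>a b. \<Sum>p\<in>P. c p * M p a b) = (\<lambda>a b. \<Sum>p\<in>P. c p * \<Phi> (M p) a b)"
proof -
  have "(\<lambda>a b. \<Sum>p\<in>P. c p * M p a b) \<in> matspace VG k \<and>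
    \<Phi> (\<lambda>a b. \<Sum>p\<in>P. c p * M p a b) = (\<lambda>a b. \<Sum>p\<in>P. c p * \<Phi> (M p) a b)"
    using assms
  proof (induction P rule: finite_induct)
    case empty
    have z: "(\<lambda>_ _. 0) \<in> matspace VG k" unfolding matspace_def by simp
    have "\<Phi> (msmult 0 (\<lambda>_ _. 0)) = msmult 0 (\<Phi> (\<lambda>_ _. 0))" by (rule Phi_msmult[OF z])
    thus ?case using z by (simp add: msmult_def)
  next
    case (insert p P)
    let ?A = "msmult (c p) (M p)" and ?B = "\<lambda>a b. \<Sum>p\<in>P. c p * M p a b"
    have e: "(\<lambda>a b. \<Sum>p\<in>insert p P. c p * M p a b) = madd ?A ?B"
      using insert(1,2) unfolding madd_def msmult_def by simp
    have A: "?A \<in> matspace VG k" using insert.prems by (intro msmult_matspace) simp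
    have B: "?B \<in> matspace VG k" "\<Phi> ?B = (\<lambda>a b. \<Sum>p\<in>P. c p * \<Phi> (M p) a b)" using insert.IH insert.prems by auto
    have "\<Phi> (madd ?A ?B) = madd (msmult (c p) (\<Phi> (M p))) (\<lambda>a b. \<Sum>p\<in>P. c p * \<Phi> (M p) a b)"
      unfolding Phi_madd[OF A B(1)] B(2) using insert.prems by (subst Phi_msmult) auto
    thus ?case unfolding e using madd_matspace[OF A B(1)] insert(1,2) unfolding madd_def msmult_def by simp
  qed
  thus ?thesis by blast
qed

lemma Phi_expand:
  assumes X: "X \<in> matspace VG k"
  shows "\<Phi> X = (\<lambda>y y'. \<Sum>x\<in>TG. \<Sum>x'\<in>TG. X x x' * \<Phi> (munit x x') y y')"
proof -
  have "X = (\<lambda>a b. \<Sum>p\<in>TG \<times> TG. X (fst p) (snd p) * munit (fst p) (snd p) a b)"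
  proof (intro ext)
    fix a b
    have "(\<Sum>p\<in>TG \<times> TG. X (fst p) (snd p) * munit (fst p) (snd p) a b) = (\<Sum>p\<in>TG \<times> TG. if p = (a, b) then X a b else 0)"
      unfolding munit_def by (intro sum.cong HOL.refl) auto
    also have "\<dots> = (if (a, b) \<in> TG \<times> TG then X a b else 0)" using fin by (intro sum.delta) auto
    also have "\<dots> = X a b" using matspace_zero[OF X, of a b] by auto
    finally show "X a b = (\<Sum>p\<in>TG \<times> TG. X (fst p) (snd p) * munit (fst p) (snd p) a b)" by simp
  qed
  hence "\<Phi> X = \<Phi> (\<lambda>a b. \<Sum>p\<in>TG \<times> TG. X (fst p) (snd p) * munit (fst p) (snd p) a b)" by (rule arg_cong)
  also have "\<dots> = (\<lambda>a b. \<Sum>p\<in>TG \<times> TG. X (fst p) (snd p) * \<Phi> (munit (fst p) (snd p)) a b)"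
    using fin by (intro Phi_sum) (auto intro: munit_matspace)
  finally show ?thesis by (simp add: sum.cartesian_product split_def)
qed

text \<open>Complete positivity is applied to the block matrix whose (i, j) block is the matrix unit
  at (\<open>e i\<close>, \<open>e j\<close>). It has rank one, hence is positive, and its image is
  the Choi matrix; \<open>e\<close> enumerates tuples because blocks are numbered.\<close>

lemma choi_psd: "psd_on (TG \<times> TH) (\<lambda>(x, y) (x', y'). \<Phi> (munit x x') y y')"
proof -
  obtain e where e: "bij_betw e {0..<card TG} TG" using ex_bij_betw_nat_finite[OF fin(3)] by blast
  let ?n = "card TG"
  let ?B = "\<lambda>p q. munit (e (fst p)) (e (fst q)) (snd p) (snd q)"
  have eT: "e i \<in> TG" if "i < ?n" for i using e that unfolding bij_betw_def by auto
  have B1: "psd_on ({..<?n} \<times> TG) ?B"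
    by (rule psd_on_if_gram[where R = "{()}" and p = "\<lambda>_ p. if snd p = e (fst p) then 1 else 0"]) (simp add: munit_def)
  have B2: "\<forall>i<?n. \<forall>j<?n. (\<lambda>x y. ?B (i, x) (j, y)) \<in> matspace VG k"
    using munit_matspace[OF eT eT] by simp
  from Phi_cp[unfolded completely_positive_def, THEN spec, THEN spec, THEN mp, THEN mp, OF B2 B1]
  have p: "psd_on ({..<?n} \<times> TH) (\<lambda>(i, x) (j, y). \<Phi> (munit (e i) (e j)) x y)" by simp
  define d where "d = the_inv_into {0..<?n} e"
  have d: "d x < ?n" "e (d x) = x" if "x \<in> TG" for x
    using e that unfolding d_def bij_betw_def
    by (auto simp: f_the_inv_into_f dest: the_inv_into_into[where B = "{0..<?n}"])
  show ?thesis
    by (rule psd_on_pullback[OF _ p, where P = "\<lambda>_. {()}" and f = "\<lambda>(x, y) _. (d x, y)"]) (use fin d in auto)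
qed

text \<open>A Gram vector of the Choi matrix, conjugated and reshaped into a matrix from
  \<open>TG\<close> to \<open>TH\<close>, is a Kraus operator. Cutting it off outside the tuples
  lets the identity matrices act as units.\<close>

lemma kraus:
  obtains n :: nat and K where "\<And>r y x. y \<notin> TH \<or> x \<notin> TG \<Longrightarrow> K r y x = 0"
    and "\<And>X. X \<in> matspace VG k \<Longrightarrow> \<Phi> X = (\<lambda>y y'. \<Sum>r<n. mm TG (mm TG (K r) X) (dag (K r)) y y')"
proof -
  obtain n :: nat and c where "\<forall>p\<in>TG \<times> TH. \<forall>q\<in>TG \<times> TH.
      (\<lambda>(x, y) (x', y'). \<Phi> (munit x x') y y') p q = (\<Sum>r<n. cnj (c r p) * c r q)"
    using psd_on_gram[OF _ choi_psd] fin by (elim meta_impE[of "finite _"], simp) (elim exE, rule that)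
  hence c: "\<Phi> (munit x x') y y' = (\<Sum>r<n. cnj (c r (x, y)) * c r (x', y'))"
    if "x \<in> TG" "y \<in> TH" "x' \<in> TG" "y' \<in> TH" for x y x' y' using that by simp
  define K where "K r y x = (if y \<in> TH \<and> x \<in> TG then cnj (c r (x, y)) else 0)" for r y x
  show ?thesis
  proof (rule that)
    show "K r y x = 0" if "y \<notin> TH \<or> x \<notin> TG" for r y x using that unfolding K_def by auto
    show "\<Phi> X = (\<lambda>y y'. \<Sum>r<n. mm TG (mm TG (K r) X) (dag (K r)) y y')" if X: "X \<in> matspace VG k" for X
    proof (intro ext)
      fix y y'
      show "\<Phi> X y y' = (\<Sum>r<n. mm TG (mm TG (K r) X) (dag (K r)) y y')"
      proof (cases "y \<in> TH \<and> y' \<in> TH")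
        case True
        have "\<Phi> X y y' = (\<Sum>x\<in>TG. \<Sum>x'\<in>TG. X x x' * \<Phi> (munit x x') y y')"
          unfolding Phi_expand[OF X] ..
        also have "\<dots> = (\<Sum>x\<in>TG. \<Sum>x'\<in>TG. \<Sum>r<n. K r y x * X x x' * dag (K r) x' y')"
        proof (intro sum.cong HOL.refl)
          fix x x' assume x: "x \<in> TG" "x' \<in> TG"
          show "X x x' * \<Phi> (munit x x') y y' = (\<Sum>r<n. K r y x * X x x' * dag (K r) x' y')"
            using True x unfolding c[OF x(1) True[THEN conjunct1] x(2) True[THEN conjunct2]] K_def dag_def
            by (simp add: sum_distrib_left ac_simps)
        qed
        also have "\<dots> = (\<Sum>r<n. \<Sum>x\<in>TG. \<Sum>x'\<in>TG. K r y x * X x x' * dag (K r) x' y')" by (rule sum_swap3)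
        also have "\<dots> = (\<Sum>r<n. mm TG (mm TG (K r) X) (dag (K r)) y y')"
          unfolding mm_def sum_distrib_right by (intro sum.cong HOL.refl sum.swap)
        finally show ?thesis .
      next
        case False
        hence "\<Phi> X y y' = 0" using matspace_zero[OF Phi_matspace[OF X]] by blast
        moreover have "mm TG (mm TG (K r) X) (dag (K r)) y y' = 0" for r
          using False unfolding mm_def dag_def K_def by auto
        ultimately show ?thesis by simp
      qed
    qed
  qed
qed

lemma Phi_mstar: assumes X: "X \<in> matspace VG k" shows "\<Phi> (mstar X) = mstar (\<Phi> X)"
proof -
  obtain n :: nat and K where K: "\<And>X. X \<in> matspace VG k \<Longrightarrow> \<Phi> X = (\<lambda>y y'. \<Sum>r<n. mm TG (mm TG (K r) X) (dag (K r)) y y')"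
    by (rule kraus) (rule that)
  show ?thesis unfolding K[OF X] K[OF mstar_matspace[OF X]] unfolding mstar_dag dag_sum dag_mm dag_dag mm_assoc ..
qed

text \<open>The trace is the inner product with I, which the adjoint fixes.\<close>

lemma Phi_trace: assumes X: "X \<in> matspace VG k" shows "mtrace VH k (\<Phi> X) = mtrace VG k X"
proof -
  obtain \<Psi> where P: "is_adjoint k VG VH \<Phi> \<Psi>" "\<Psi> (idm VH k) = idm VG k"
    using qi unfolding qiso_map_def Let_def by blast
  have tr: "minner V k (idm V k) M = mtrace V k M" if "finite V" for V :: "'c set" and M
  proof -
    have "minner V k (idm V k) M = (\<Sum>x\<in>tuples V k. \<Sum>y\<in>tuples V k. if y = x then M x y else 0)"
      unfolding minner_eq idm_def by (intro sum.cong HOL.refl) auto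
    thus ?thesis unfolding mtrace_def using finite_tuples[OF that] by (simp add: sum.delta')
  qed
  have "minner VG k (\<Psi> (idm VH k)) X = minner VH k (idm VH k) (\<Phi> X)"
    using P(1) X idm_matspace unfolding is_adjoint_def by blast
  thus ?thesis unfolding P(2) tr[OF fin(1)] tr[OF fin(2)] by simp
qed

text \<open>The sum of entries is the inner product with J, which the adjoint fixes.\<close>

lemma Phi_sum_entries: assumes X: "X \<in> matspace VG k"
  shows "(\<Sum>x\<in>TH. \<Sum>y\<in>TH. \<Phi> X x y) = (\<Sum>x\<in>TG. \<Sum>y\<in>TG. X x y)"
proof -
  obtain \<Psi> where P: "is_adjoint k VG VH \<Phi> \<Psi>" "\<Psi> (onesm VH k) = onesm VG k"
    using qi unfolding qiso_map_def Let_def by blast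
  have tr: "minner V k (onesm V k) M = (\<Sum>x\<in>tuples V k. \<Sum>y\<in>tuples V k. M x y)" for V :: "'c set" and M
    unfolding minner_eq onesm_def by simp
  have "minner VG k (\<Psi> (onesm VH k)) X = minner VH k (onesm VH k) (\<Phi> X)"
    using P(1) X onesm_matspace unfolding is_adjoint_def by blast
  thus ?thesis unfolding P(2) tr by simp
qed

text \<open>With Kraus operators \<open>K\<^sub>r\<close> and \<open>D\<^sub>r = X K\<^sub>r\<^sup>* - K\<^sub>r\<^sup>* \<Phi>(X)\<close> one has
  \<open>\<Sum>\<^sub>r \<parallel>D\<^sub>r\<parallel>\<^sup>2 = \<parallel>X\<parallel>\<^sup>2 - \<parallel>\<Phi>(X)\<parallel>\<^sup>2\<close>; if the right-hand side vanishes, \<open>X\<close> intertwines all \<open>K\<^sub>r\<close>.\<close>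
lemma Phi_contractive_multiplicative:
  assumes X: "X \<in> matspace VG k"
  shows "sqnorm VH k (\<Phi> X) \<le> sqnorm VG k X"
    and "\<And>Y. sqnorm VH k (\<Phi> X) = sqnorm VG k X \<Longrightarrow> Y \<in> matspace VG k \<Longrightarrow> \<Phi> (mmul VG k Y X) = mmul VH k (\<Phi> Y) (\<Phi> X)"
proof -
  obtain n :: nat and K where K0: "\<And>r y x. y \<notin> TH \<or> x \<notin> TG \<Longrightarrow> K r y x = 0"
    and K: "\<And>X. X \<in> matspace VG k \<Longrightarrow> \<Phi> X = (\<lambda>y y'. \<Sum>r<n. mm TG (mm TG (K r) X) (dag (K r)) y y')"
    by (rule kraus) (rule that)
  define A where "A r = mm TG X (dag (K r))" for r
  define B where "B r = mm TH (dag (K r)) (\<Phi> X)" for r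
  define D where "D r = (\<lambda>x y. A r x y - B r x y)" for r
  have Ph: "\<Phi> X x y = 0" if "x \<notin> TH \<or> y \<notin> TH" for x y using matspace_zero[OF Phi_matspace[OF X]] that by blast
  have XX: "mm TG (dag X) X \<in> matspace VG k"
    using mmul_matspace[OF mstar_matspace[OF X] X] unfolding mmul_mm mstar_dag .
  have unital: "(\<lambda>y y'. \<Sum>r<n. mm TG (K r) (dag (K r)) y y') = idm VH k"
  proof -
    have "mm TG (K r) (idm VG k) = K r" for r using K0 by (intro mm_idm_right fin) auto
    thus ?thesis using K[OF idm_matspace] unfolding Phi_idm by simp
  qed
  \<comment> \<open>Of the four products of \<open>A r\<close> and \<open>B r\<close>, the first
    gives \<Phi> of \<open>mm TG (dag X) X\<close>; the other three each give
    \<open>mm TH (dag (\<Phi> X)) (\<Phi> X)\<close>, the last one by unitality.\<close>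
  have "(\<Sum>r<n. mm TG (dag (D r)) (D r) y y') = \<Phi> (mm TG (dag X) X) y y' - mm TH (dag (\<Phi> X)) (\<Phi> X) y y'" for y y'
  proof -
    have 1: "(\<Sum>r<n. mm TG (dag (A r)) (A r) y y') = \<Phi> (mm TG (dag X) X) y y'"
      unfolding K[OF XX] A_def dag_mm dag_dag mm_assoc ..
    have 2: "(\<Sum>r<n. mm TG (dag (A r)) (B r) y y') = mm TH (dag (\<Phi> X)) (\<Phi> X) y y'"
    proof -
      have "dag (\<Phi> X) = \<Phi> (dag X)" using Phi_mstar[OF X] unfolding mstar_dag by simp
      also have "\<dots> = (\<lambda>y y'. \<Sum>r<n. mm TG (mm TG (K r) (dag X)) (dag (K r)) y y')"
        using K[OF mstar_matspace[OF X]] unfolding mstar_dag .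
      finally have e: "dag (\<Phi> X) = (\<lambda>y y'. \<Sum>r<n. mm TG (mm TG (K r) (dag X)) (dag (K r)) y y')" .
      show ?thesis unfolding e mm_sum_left B_def A_def dag_mm dag_dag mm_assoc ..
    qed
    have 3: "(\<Sum>r<n. mm TG (dag (B r)) (A r) y y') = mm TH (dag (\<Phi> X)) (\<Phi> X) y y'"
    proof -
      have "mm TH (dag (\<Phi> X)) (\<Phi> X) y y' = mm TH (dag (\<Phi> X)) (\<lambda>y y'. \<Sum>r<n. mm TG (mm TG (K r) X) (dag (K r)) y y') y y'"
        using K[OF X] by simp
      thus ?thesis unfolding mm_sum_right B_def A_def dag_mm dag_dag mm_assoc by simp
    qed
    have 4: "(\<Sum>r<n. mm TG (dag (B r)) (B r) y y') = mm TH (dag (\<Phi> X)) (\<Phi> X) y y'"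
    proof -
      have "mm TH (dag (\<Phi> X)) (\<Phi> X) y y' = mm TH (dag (\<Phi> X)) (mm TH (idm VH k) (\<Phi> X)) y y'"
        using Ph by (subst mm_idm_left[OF fin(2)]) auto
      also have "\<dots> = (\<Sum>r<n. mm TG (dag (B r)) (B r) y y')"
        unfolding unital[symmetric] mm_sum_left mm_sum_right B_def dag_mm dag_dag mm_assoc ..
      finally show ?thesis by simp
    qed
    show ?thesis
      unfolding D_def dag_diff mm_diff_left mm_diff_right sum_subtractf 1 2 3 4 by simp
  qed
  hence "(\<Sum>y\<in>TH. \<Sum>r<n. mm TG (dag (D r)) (D r) y y) = (\<Sum>y\<in>TH. \<Phi> (mm TG (dag X) X) y y) - (\<Sum>y\<in>TH. mm TH (dag (\<Phi> X)) (\<Phi> X) y y)"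
    by (simp add: sum_subtractf)
  also have "(\<Sum>y\<in>TH. \<Phi> (mm TG (dag X) X) y y) = complex_of_real (sqnorm VG k X)"
    using Phi_trace[OF XX] minner_self[of VG k X] unfolding minner_def mtrace_def mmul_mm mstar_dag by simp
  also have "(\<Sum>y\<in>TH. mm TH (dag (\<Phi> X)) (\<Phi> X) y y) = complex_of_real (sqnorm VH k (\<Phi> X))"
    using minner_self[of VH k "\<Phi> X"] unfolding minner_def mtrace_def mmul_mm mstar_dag by simp
  also have "(\<Sum>y\<in>TH. \<Sum>r<n. mm TG (dag (D r)) (D r) y y) = complex_of_real (\<Sum>y\<in>TH. \<Sum>r<n. \<Sum>x\<in>TG. (cmod (D r x y))\<^sup>2)"
    unfolding mm_def dag_def by (simp only: cnj_mult_self of_real_sum)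
  finally have eq: "(\<Sum>y\<in>TH. \<Sum>r<n. \<Sum>x\<in>TG. (cmod (D r x y))\<^sup>2) = sqnorm VG k X - sqnorm VH k (\<Phi> X)"
    unfolding of_real_diff[symmetric] of_real_eq_iff .
  moreover have "0 \<le> (\<Sum>y\<in>TH. \<Sum>r<n. \<Sum>x\<in>TG. (cmod (D r x y))\<^sup>2)" by (intro sum_nonneg) simp
  ultimately show "sqnorm VH k (\<Phi> X) \<le> sqnorm VG k X" by simp
  fix Y assume n: "sqnorm VH k (\<Phi> X) = sqnorm VG k X" and Y: "Y \<in> matspace VG k"
  have "\<forall>y\<in>TH. (\<Sum>r<n. \<Sum>x\<in>TG. (cmod (D r x y))\<^sup>2) = 0"
  proof -
    have "(\<Sum>y\<in>TH. \<Sum>r<n. \<Sum>x\<in>TG. (cmod (D r x y))\<^sup>2) = 0" using eq n by simp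
    thus ?thesis using fin by (subst (asm) sum_nonneg_eq_0_iff) (auto intro!: sum_nonneg)
  qed
  hence "\<forall>y\<in>TH. \<forall>r<n. (\<Sum>x\<in>TG. (cmod (D r x y))\<^sup>2) = 0"
    by (subst (asm) sum_nonneg_eq_0_iff) (auto intro!: sum_nonneg)
  hence Dz: "D r x y = 0" if "y \<in> TH" "r < n" "x \<in> TG" for r x y
    using that fin by (auto simp: sum_nonneg_eq_0_iff)
  have AB: "A r = B r" if r: "r < n" for r
  proof (intro ext)
    fix x y
    show "A r x y = B r x y"
    proof (cases "y \<in> TH \<and> x \<in> TG")
      case True thus ?thesis using Dz[of y r x] r unfolding D_def by simp
    next
      case False
      have "A r x y = 0" using False K0 matspace_zero[OF X] unfolding A_def mm_def dag_def by auto
      moreover have "B r x y = 0" using False K0 Ph unfolding B_def mm_def dag_def by auto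
      ultimately show ?thesis by simp
    qed
  qed
  \<comment> \<open>The equality of \<open>A r\<close> and \<open>B r\<close> moves X past each
    Kraus operator, where it reappears as \<Phi> X on the right.\<close>
  have "\<Phi> (mmul VG k Y X) = (\<lambda>y y'. \<Sum>r<n. mm TG (mm TG (K r) (mm TG Y X)) (dag (K r)) y y')"
    using K[OF mmul_matspace[OF Y X]] unfolding mmul_mm .
  also have "\<dots> = (\<lambda>y y'. \<Sum>r<n. mm TG (mm TG (K r) Y) (B r) y y')"
    unfolding mm_assoc using AB unfolding A_def by (intro ext sum.cong) auto
  also have "\<dots> = mmul VH k (\<Phi> Y) (\<Phi> X)"
    unfolding mmul_mm K[OF Y] mm_sum_left B_def mm_assoc ..
  finally show "\<Phi> (mmul VG k Y X) = mmul VH k (\<Phi> Y) (\<Phi> X)" .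
qed

lemma sqnorm_Q:
  assumes F: "F \<in> Q k" shows "sqnorm VH k (\<Phi> (hom_tensor F G)) = sqnorm VG k (hom_tensor F G)"
proof -
  have "complex_of_real (sqnorm VH k (hom_tensor F H)) = complex_of_real (sqnorm VG k (hom_tensor F G))"
    unfolding sqnorm_01[OF hom_tensor_01[OF k F G]] sqnorm_01[OF hom_tensor_01[OF k F H]]
    using Phi_sum_entries[OF Q_matspace[OF k G F]] unfolding Phi_Q[OF F] .
  thus ?thesis unfolding Phi_Q[OF F] of_real_eq_iff .
qed

end

section \<open>From quantum isomorphism maps to certificates\<close>

lemma tuples_append:
  "tuples V (m + n) = (\<lambda>(x, y). x @ y) ` (tuples V m \<times> tuples V n)"
proof -
  have "z \<in> (\<lambda>(x, y). x @ y) ` (tuples V m \<times> tuples V n)" if "z \<in> tuples V (m + n)" for z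
    using that unfolding tuples_def image_iff
    by (intro bexI[of _ "(take m z, drop m z)"]) (auto dest: in_set_takeD in_set_dropD)
  thus ?thesis unfolding tuples_def by auto
qed

lemma sum_tuples_append:
  "(\<Sum>z\<in>tuples V (m + n). f z) = (\<Sum>x\<in>tuples V m. \<Sum>y\<in>tuples V n. f (x @ y))"
proof -
  have "inj_on (\<lambda>(x, y). x @ y) (tuples V m \<times> tuples V n)" unfolding inj_on_def tuples_def by auto
  hence "(\<Sum>z\<in>tuples V (m + n). f z) = (\<Sum>p\<in>tuples V m \<times> tuples V n. f (fst p @ snd p))"
    unfolding tuples_append by (subst sum.reindex) (auto simp: split_def)
  thus ?thesis by (simp add: sum.cartesian_product split_def)
qed

lemma sum_tuples_rev: "(\<Sum>x\<in>tuples V n. f (rev x)) = (\<Sum>x\<in>tuples V n. f x)"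
proof -
  have "bij_betw rev (tuples V n) (tuples V n)"
    by (rule bij_betw_byWitness[where f' = rev]) (auto simp: tuples_def)
  thus ?thesis by (rule sum.reindex_bij_betw)
qed

text \<open>The Choi matrix abstracted to a function on cyclic words of length \<open>N\<close>.
  Mismatch and summation are assumed at one place of the word only; rotation carries them to all
  others.\<close>

locale moment =
  fixes G :: "'a sgraph" and H :: "'b sgraph" and N :: nat and L :: "('a \<times> 'b) list \<Rightarrow> complex"
    and g0 :: 'a and h0 :: 'b
  assumes g0: "g0 \<in> fst G" and h0: "h0 \<in> fst H" and finG: "finite (fst G)"
    and L_rot: "\<And>a v. set (a # v) \<subseteq> fst G \<times> fst H \<Longrightarrow> length v + 1 = N \<Longrightarrow> L (a # v) = L (v @ [a])"
    and L_mism: "\<And>a b v. set (a # b # v) \<subseteq> fst G \<times> fst H \<Longrightarrow> length v + 2 = N \<Longrightarrow>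
       rel G (fst a) (fst b) \<noteq> rel H (snd a) (snd b) \<Longrightarrow> L (a # b # v) = 0"
    and L_sum: "\<And>v g h. set v \<subseteq> fst G \<times> fst H \<Longrightarrow> length v + 1 = N \<Longrightarrow> g \<in> fst G \<Longrightarrow> h \<in> fst H \<Longrightarrow>
       (\<Sum>g'\<in>fst G. L (v @ [(g', h)])) = (\<Sum>h'\<in>fst H. L (v @ [(g, h')]))"
begin

abbreviation "Z \<equiv> fst G \<times> fst H"

text \<open>Sums out the last \<open>n\<close> letters; by \<open>ext_Suc\<close> the result does not depend on \<open>h0\<close>.\<close>
fun ext :: "nat \<Rightarrow> ('a \<times> 'b) list \<Rightarrow> complex" where
  "ext 0 w = L w"
| "ext (Suc n) w = (\<Sum>g\<in>fst G. ext n (w @ [(g, h0)]))"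

text \<open>The assumptions on \<open>L\<close> after n letters have been summed out. They are
  proved jointly: rotation at one level uses vanishing and independence of letters at the level
  before.\<close>

definition inv_rot :: "nat \<Rightarrow> bool" where
  "inv_rot n \<longleftrightarrow> (\<forall>a v. set (a # v) \<subseteq> Z \<longrightarrow> length v + 1 + n = N \<longrightarrow> ext n (a # v) = ext n (v @ [a]))"
definition inv_mism :: "nat \<Rightarrow> bool" where
  "inv_mism n \<longleftrightarrow> (\<forall>a b v. set (a # b # v) \<subseteq> Z \<longrightarrow> length v + 2 + n = N \<longrightarrow>
     rel G (fst a) (fst b) \<noteq> rel H (snd a) (snd b) \<longrightarrow> ext n (a # b # v) = 0)"
definition inv_sum :: "nat \<Rightarrow> bool" where
  "inv_sum n \<longleftrightarrow> (\<forall>v. set v \<subseteq> Z \<longrightarrow> length v + 1 + n = N \<longrightarrow> (\<forall>g\<in>fst G. \<forall>h\<in>fst H.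
     (\<Sum>g'\<in>fst G. ext n (v @ [(g', h)])) = (\<Sum>h'\<in>fst H. ext n (v @ [(g, h')]))))"

lemma inv_rotD: "inv_rot n \<Longrightarrow> set (a # v) \<subseteq> Z \<Longrightarrow> length v + 1 + n = N \<Longrightarrow> ext n (a # v) = ext n (v @ [a])"
  unfolding inv_rot_def by blast

lemma inv_rot_append:
  assumes "inv_rot n" "set (u @ v) \<subseteq> Z" "length (u @ v) + n = N" shows "ext n (u @ v) = ext n (v @ u)"
  using assms(2,3)
proof (induction u arbitrary: v)
  case (Cons a u)
  have "ext n ((a # u) @ v) = ext n (a # (u @ v))" by simp
  also have "\<dots> = ext n ((u @ v) @ [a])" using Cons.prems by (intro inv_rotD[OF assms(1)]) auto
  also have "\<dots> = ext n (u @ (v @ [a]))" by simp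
  also have "\<dots> = ext n ((v @ [a]) @ u)" using Cons.prems by (intro Cons.IH) auto
  finally show ?case by simp
qed simp

lemma inv_mismD:
  assumes "inv_rot n" "inv_mism n" "set (u @ [a, b] @ v) \<subseteq> Z" "length (u @ v) + 2 + n = N"
    "rel G (fst a) (fst b) \<noteq> rel H (snd a) (snd b)"
  shows "ext n (u @ [a, b] @ v) = 0"
proof -
  have "ext n (u @ [a, b] @ v) = ext n (([a, b] @ v) @ u)"
    using assms by (intro inv_rot_append) auto
  also have "\<dots> = ext n (a # b # (v @ u))" by simp
  also have "\<dots> = 0" using assms unfolding inv_mism_def by auto
  finally show ?thesis .
qed

lemma ext_Suc:
  assumes "inv_sum n" "set v \<subseteq> Z" "length v + 1 + n = N" "g \<in> fst G" "h \<in> fst H"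
  shows "ext (Suc n) v = (\<Sum>g'\<in>fst G. ext n (v @ [(g', h)]))" "ext (Suc n) v = (\<Sum>h'\<in>fst H. ext n (v @ [(g, h')]))"
proof -
  have s: "(\<Sum>g'\<in>fst G. ext n (v @ [(g', h)])) = (\<Sum>h'\<in>fst H. ext n (v @ [(g, h')]))"
    if "g \<in> fst G" "h \<in> fst H" for g h using assms(1-3) that unfolding inv_sum_def by blast
  show 2: "ext (Suc n) v = (\<Sum>h'\<in>fst H. ext n (v @ [(g, h')]))" using s[OF assms(4) h0] by simp
  show "ext (Suc n) v = (\<Sum>g'\<in>fst G. ext n (v @ [(g', h)]))" using s[OF assms(4,5)] 2 by simp
qed

text \<open>Next to the letter (g, h) a letter (g', h) with g' different from g is a mismatch, so a
  sum over g' keeps only the repeated letter. Summing out a letter is thereby traded for a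
  duplication.\<close>

lemma ext_dup:
  assumes "inv_rot n" "inv_mism n" "inv_sum n" "set (w @ [a]) \<subseteq> Z" "length w + 2 + n = N"
  shows "(\<Sum>g'\<in>fst G. ext n (w @ [(g', snd a), a])) = ext n (w @ [a, a])" "ext (Suc n) (w @ [a]) = ext n (w @ [a, a])"
proof -
  obtain g h where a: "a = (g, h)" by fastforce
  have gh: "g \<in> fst G" "h \<in> fst H" using assms(4) unfolding a by auto
  have d: "(\<Sum>g'\<in>fst G. f g') = f g" if "\<And>g'. g' \<in> fst G \<Longrightarrow> g' \<noteq> g \<Longrightarrow> f g' = 0" for f :: "'a \<Rightarrow> complex"
    using sum.remove[OF finG gh(1), of f] sum.neutral[of "fst G - {g}" f] that by auto
  show "(\<Sum>g'\<in>fst G. ext n (w @ [(g', snd a), a])) = ext n (w @ [a, a])"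
    unfolding a snd_conv
  proof (rule d)
    fix g' assume "g' \<in> fst G" "g' \<noteq> g"
    thus "ext n (w @ [(g', h), (g, h)]) = 0"
      using inv_mismD[OF assms(1,2), of w "(g', h)" "(g, h)" "[]"] assms(4,5) gh unfolding a rel_def by auto
  qed
  have "ext (Suc n) (w @ [a]) = (\<Sum>g'\<in>fst G. ext n ((w @ [a]) @ [(g', h)]))"
    using assms gh by (intro ext_Suc(1)) auto
  also have "\<dots> = ext n ((w @ [a]) @ [(g, h)])"
  proof (rule d)
    fix g' assume "g' \<in> fst G" "g' \<noteq> g"
    thus "ext n ((w @ [a]) @ [(g', h)]) = 0"
      using inv_mismD[OF assms(1,2), of w "(g, h)" "(g', h)" "[]"] assms(4,5) gh unfolding a rel_def by auto
  qed
  finally show "ext (Suc n) (w @ [a]) = ext n (w @ [a, a])" unfolding a by simp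
qed

lemma inv_all: "n \<le> N \<Longrightarrow> inv_rot n \<and> inv_mism n \<and> inv_sum n"
proof (induction n)
  case 0
  show ?case unfolding inv_rot_def inv_mism_def inv_sum_def using L_rot L_mism L_sum by simp
next
  case (Suc n)
  hence I: "inv_rot n" "inv_mism n" "inv_sum n" by auto
  have "inv_rot (Suc n)" unfolding inv_rot_def
  proof (intro allI impI)
    fix a v assume av: "set (a # v) \<subseteq> Z" "length v + 1 + Suc n = N"
    have sa: "snd a \<in> fst H" using av(1) by auto
    \<comment> \<open>The free second coordinate of the summed letter is taken to be that of
      \<open>a\<close>. After rotation the two letters are adjacent and the sum collapses to the
      duplicate of \<open>a\<close>.\<close>
    have "ext (Suc n) (a # v) = (\<Sum>g'\<in>fst G. ext n ((a # v) @ [(g', snd a)]))"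
      using av sa g0 I by (intro ext_Suc(1)) auto
    also have "\<dots> = (\<Sum>g'\<in>fst G. ext n (v @ [(g', snd a), a]))"
    proof (intro sum.cong HOL.refl)
      fix g' assume "g' \<in> fst G"
      thus "ext n ((a # v) @ [(g', snd a)]) = ext n (v @ [(g', snd a), a])"
        using inv_rotD[OF I(1), of a "v @ [(g', snd a)]"] av sa by simp
    qed
    also have "\<dots> = ext (Suc n) (v @ [a])" using ext_dup[OF I, of v a] av by simp
    finally show "ext (Suc n) (a # v) = ext (Suc n) (v @ [a])" .
  qed
  moreover have "inv_mism (Suc n)" unfolding inv_mism_def
  proof (intro allI impI)
    fix a b v assume av: "set (a # b # v) \<subseteq> Z" "length v + 2 + Suc n = N" "rel G (fst a) (fst b) \<noteq> rel H (snd a) (snd b)"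
    have "ext n (a # b # (v @ [(g, h0)])) = 0" if "g \<in> fst G" for g
      using I(2) av that h0 unfolding inv_mism_def by auto
    thus "ext (Suc n) (a # b # v) = 0" by simp
  qed
  moreover have "inv_sum (Suc n)" unfolding inv_sum_def
  proof (intro allI impI ballI)
    fix v g h assume v: "set v \<subseteq> Z" "length v + 1 + Suc n = N" and gh: "g \<in> fst G" "h \<in> fst H"
    \<comment> \<open>One more letter is expanded and rotated to the front. The letter in question
      is then last, and independence one level lower applies under the sum.\<close>
    have "(\<Sum>g'\<in>fst G. ext (Suc n) (v @ [(g', h)])) = (\<Sum>g'\<in>fst G. \<Sum>h''\<in>fst H. ext n ((v @ [(g', h)]) @ [(g, h'')]))"
      using v gh I by (intro sum.cong HOL.refl ext_Suc(2)) auto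
    also have "\<dots> = (\<Sum>g'\<in>fst G. \<Sum>h''\<in>fst H. ext n (((g, h'') # v) @ [(g', h)]))"
    proof (intro sum.cong HOL.refl)
      fix g' h'' assume "g' \<in> fst G" "h'' \<in> fst H"
      thus "ext n ((v @ [(g', h)]) @ [(g, h'')]) = ext n (((g, h'') # v) @ [(g', h)])"
        using inv_rotD[OF I(1), of "(g, h'')" "v @ [(g', h)]"] v gh by simp
    qed
    also have "\<dots> = (\<Sum>h''\<in>fst H. \<Sum>g'\<in>fst G. ext n (((g, h'') # v) @ [(g', h)]))" by (rule sum.swap)
    also have "\<dots> = (\<Sum>h''\<in>fst H. \<Sum>h'\<in>fst H. ext n (((g, h'') # v) @ [(g, h')]))"
    proof (intro sum.cong HOL.refl)
      fix h'' assume "h'' \<in> fst H"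
      hence "set ((g, h'') # v) \<subseteq> Z" "length ((g, h'') # v) + 1 + n = N" using v gh by auto
      thus "(\<Sum>g'\<in>fst G. ext n (((g, h'') # v) @ [(g', h)])) = (\<Sum>h'\<in>fst H. ext n (((g, h'') # v) @ [(g, h')]))"
        using I(3) gh unfolding inv_sum_def by blast
    qed
    also have "\<dots> = (\<Sum>h'\<in>fst H. \<Sum>h''\<in>fst H. ext n (((g, h'') # v) @ [(g, h')]))" by (rule sum.swap)
    also have "\<dots> = (\<Sum>h'\<in>fst H. \<Sum>h''\<in>fst H. ext n ((v @ [(g, h')]) @ [(g, h'')]))"
    proof (intro sum.cong HOL.refl)
      fix h' h'' assume "h' \<in> fst H" "h'' \<in> fst H"
      thus "ext n (((g, h'') # v) @ [(g, h')]) = ext n ((v @ [(g, h')]) @ [(g, h'')])"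
        using inv_rotD[OF I(1), of "(g, h'')" "v @ [(g, h')]"] v gh by simp
    qed
    also have "\<dots> = (\<Sum>h'\<in>fst H. ext (Suc n) (v @ [(g, h')]))"
      using v gh I by (intro sum.cong HOL.refl ext_Suc(2)[symmetric]) auto
    finally show "(\<Sum>g'\<in>fst G. ext (Suc n) (v @ [(g', h)])) = (\<Sum>h'\<in>fst H. ext (Suc n) (v @ [(g, h')]))" .
  qed
  ultimately show ?case by blast
qed

definition E :: "('a \<times> 'b) list \<Rightarrow> complex" where "E w = ext (N - length w) w"

lemma E_rot: "set (u @ v) \<subseteq> Z \<Longrightarrow> length (u @ v) \<le> N \<Longrightarrow> E (u @ v) = E (v @ u)"
  unfolding E_def using inv_rot_append[of "N - length (u @ v)" u v] inv_all[of "N - length (u @ v)"]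
  by (simp add: add.commute)

lemma E_mism:
  assumes "set (u @ [a, b] @ v) \<subseteq> Z" "length (u @ [a, b] @ v) \<le> N" "rel G (fst a) (fst b) \<noteq> rel H (snd a) (snd b)"
  shows "E (u @ [a, b] @ v) = 0"
  unfolding E_def using assms inv_all[of "N - length (u @ [a, b] @ v)"] by (intro inv_mismD) auto

lemma E_sum_last:
  assumes "set v \<subseteq> Z" "length v < N" "g \<in> fst G" "h \<in> fst H"
  shows "(\<Sum>g'\<in>fst G. E (v @ [(g', h)])) = E v" "(\<Sum>h'\<in>fst H. E (v @ [(g, h')])) = E v"
proof -
  define m where "m = N - length v - 1"
  have n: "N - length v = Suc m" "N - length (v @ [p]) = m" for p using assms(2) unfolding m_def by auto
  have "inv_sum m" "length v + 1 + m = N" using inv_all assms(2) unfolding m_def by simp_all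
  from ext_Suc[OF this(1) assms(1) this(2) assms(3,4)]
  show "(\<Sum>g'\<in>fst G. E (v @ [(g', h)])) = E v" "(\<Sum>h'\<in>fst H. E (v @ [(g, h')])) = E v"
    unfolding E_def n by auto
qed

lemma E_sum:
  assumes "set (u @ v) \<subseteq> Z" "length (u @ v) < N" "g \<in> fst G" "h \<in> fst H"
  shows "(\<Sum>g'\<in>fst G. E (u @ [(g', h)] @ v)) = E (u @ v)" "(\<Sum>h'\<in>fst H. E (u @ [(g, h')] @ v)) = E (u @ v)"
proof -
  have r: "E (u @ [p] @ v) = E ((v @ u) @ [p])" if "p \<in> Z" for p
  proof -
    have "E ((u @ [p]) @ v) = E (v @ (u @ [p]))" using assms that by (intro E_rot) auto
    thus ?thesis by simp
  qed
  have r': "E (u @ v) = E (v @ u)" using assms by (intro E_rot) auto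
  have vu: "set (v @ u) \<subseteq> Z" "length (v @ u) < N" using assms by auto
  have "(\<Sum>g'\<in>fst G. E (u @ [(g', h)] @ v)) = (\<Sum>g'\<in>fst G. E ((v @ u) @ [(g', h)]))"
    using assms r by (intro sum.cong HOL.refl) auto
  thus "(\<Sum>g'\<in>fst G. E (u @ [(g', h)] @ v)) = E (u @ v)" using E_sum_last(1)[OF vu assms(3,4)] r' by simp
  have "(\<Sum>h'\<in>fst H. E (u @ [(g, h')] @ v)) = (\<Sum>h'\<in>fst H. E ((v @ u) @ [(g, h')]))"
    using assms r by (intro sum.cong HOL.refl) auto
  thus "(\<Sum>h'\<in>fst H. E (u @ [(g, h')] @ v)) = E (u @ v)" using E_sum_last(2)[OF vu assms(3,4)] r' by simp
qed

lemma E_dup: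
  assumes "set (u @ [a] @ v) \<subseteq> Z" "length (u @ [a, a] @ v) \<le> N"
  shows "E (u @ [a, a] @ v) = E (u @ [a] @ v)"
proof -
  have "E ((u @ [a, a]) @ v) = E (v @ (u @ [a, a]))" using assms by (intro E_rot) auto
  also have "\<dots> = E ((v @ u) @ [a])"
  proof -
    let ?n = "N - length (v @ u) - 2"
    have n: "length (v @ u) + 2 + ?n = N" using assms(2) by auto
    have "ext (Suc ?n) ((v @ u) @ [a]) = ext ?n ((v @ u) @ [a, a])"
      using inv_all[of ?n] n assms(1) by (intro ext_dup(2)) auto
    moreover have "N - length ((v @ u) @ [a]) = Suc ?n" "N - length ((v @ u) @ [a, a]) = ?n" using n by auto
    ultimately show ?thesis unfolding E_def by simp
  qed
  also have "\<dots> = E ((u @ [a]) @ v)" using assms E_rot[of v "u @ [a]"] by auto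
  finally show ?thesis by simp
qed

definition pad :: "'a list \<Rightarrow> ('a \<times> 'b) list" where "pad p = map (\<lambda>g. (g, h0)) p"

lemma pad_set: "p \<in> tuples (fst G) m \<Longrightarrow> set (pad p) \<subseteq> Z \<and> length (pad p) = m"
  unfolding pad_def tuples_def using h0 by auto

text \<open>Expresses values at short words through longer ones, up to full length, where they are
  Choi entries. This feeds \<open>psd_on_pullback\<close>.\<close>

lemma E_pad:
  "set w \<subseteq> Z \<Longrightarrow> length w + m \<le> N \<Longrightarrow> E w = (\<Sum>p\<in>tuples (fst G) m. E (w @ pad p))"
proof (induction m arbitrary: w)
  case 0 thus ?case by (simp add: tuples_0 pad_def)
next
  case (Suc m)
  have "E w = (\<Sum>g\<in>fst G. E (w @ [(g, h0)]))" using Suc.prems g0 h0 by (intro E_sum_last(1)[symmetric]) auto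
  also have "\<dots> = (\<Sum>g\<in>fst G. \<Sum>p\<in>tuples (fst G) m. E ((w @ [(g, h0)]) @ pad p))"
    using Suc.prems h0 by (intro sum.cong HOL.refl Suc.IH) auto
  finally show ?case unfolding sum_tuples_Suc by (simp add: pad_def)
qed

text \<open>A representative of the \<open>word_equiv\<close>-class of a word, canonical up to rotation. It is needed because a chain of
  equivalences between two short words may pass through arbitrarily long ones.\<close>
definition cred :: "'c list \<Rightarrow> 'c list" where
  "cred w = (let d = remdups_adj w in if length d > 1 \<and> hd d = last d then butlast d else d)"

lemma cred_set: "set (cred w) \<subseteq> set w"
  unfolding cred_def Let_def by (auto dest: in_set_butlastD)

lemma cred_length: "length (cred w) \<le> length w"
proof -
  have "length (cred w) \<le> length (remdups_adj w)" unfolding cred_def Let_def by simp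
  thus ?thesis using remdups_adj_length by (rule le_trans)
qed

lemma E_remdups: "set (u @ w) \<subseteq> Z \<Longrightarrow> length (u @ w) \<le> N \<Longrightarrow> E (u @ w) = E (u @ remdups_adj w)"
proof (induction w arbitrary: u rule: remdups_adj.induct)
  case (3 x y xs)
  show ?case
  proof (cases "x = y")
    case True
    have "E (u @ [x, x] @ xs) = E (u @ [x] @ xs)" using 3(3,4) True by (intro E_dup) auto
    moreover have "E (u @ x # xs) = E (u @ remdups_adj (x # xs))"
      using 3(1)[OF True, of u] 3(3,4) True by auto
    ultimately show ?thesis using True by simp
  next
    case False
    have "E ((u @ [x]) @ y # xs) = E ((u @ [x]) @ remdups_adj (y # xs))"
      using 3(2)[OF False, of "u @ [x]"] 3(3,4) by simp
    thus ?thesis using False by simp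
  qed
qed simp_all

text \<open>Each reduction, the removal of a repeated neighbour or of a last letter equal to the
  first, shortens the word, so all intermediate words stay within length \<open>N\<close>.\<close>

lemma E_cred: assumes "set w \<subseteq> Z" "length w \<le> N" shows "E w = E (cred w)"
proof -
  define d where "d = remdups_adj w"
  have d: "set d \<subseteq> Z" "length d \<le> N" using assms le_trans[OF remdups_adj_length[of w]] unfolding d_def by auto
  have Ed: "E w = E d" using E_remdups[of "[]" w] assms unfolding d_def by simp
  show ?thesis
  proof (cases "length d > 1 \<and> hd d = last d")
    case True
    then obtain a r where dr: "d = a # r" "r \<noteq> []" by (cases d) auto
    then obtain m b where r: "r = m @ [b]" by (metis rev_exhaust)
    have "b = a" using True dr r by simp
    hence dm: "d = [a] @ (m @ [a])" using dr r by simp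
    have "E d = E ((m @ [a]) @ [a])" unfolding dm using d unfolding dm by (intro E_rot) auto
    also have "\<dots> = E (m @ [a, a] @ [])" by simp
    also have "\<dots> = E (m @ [a] @ [])" using d unfolding dm by (intro E_dup) auto
    also have "\<dots> = E ([a] @ m)" using d unfolding dm using E_rot[of m "[a]"] by auto
    also have "[a] @ m = cred w" unfolding cred_def Let_def d_def[symmetric] using True unfolding dm by simp
    finally show ?thesis using Ed by simp
  next
    case False
    thus ?thesis using Ed unfolding cred_def Let_def d_def[symmetric] by auto
  qed
qed

lemma remdups_adj_snoc: "w \<noteq> [] \<Longrightarrow> remdups_adj (w @ [x]) = (if last (remdups_adj w) = x then remdups_adj w else remdups_adj w @ [x])"
proof (induction w rule: remdups_adj.induct)
  case (3 a b xs)
  show ?case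
  proof (cases "a = b")
    case True thus ?thesis using 3 by simp
  next
    case False
    have "remdups_adj (b # xs) \<noteq> []" by simp
    thus ?thesis using 3(2)[OF False] False by simp
  qed
qed simp_all

lemma remdups_adj_Cons': "w \<noteq> [] \<Longrightarrow> remdups_adj (x # w) = (if hd (remdups_adj w) = x then remdups_adj w else x # remdups_adj w)"
  by (cases w) auto

text \<open>Shifting a word by one letter shifts its reduced form by at most one letter. The cases
  are whether the moved letter merges with the first or with the last letter of the reduced
  rest.\<close>

lemma cred_rot: "cred (x # w) = cred (w @ [x]) \<or> (\<exists>a v. cred (x # w) = a # v \<and> cred (w @ [x]) = v @ [a])"
proof (cases "w = []")
  case False
  define d where "d = remdups_adj w"
  have dne: "d \<noteq> []" unfolding d_def using False by simp
  note c = remdups_adj_Cons'[OF False, of x, folded d_def] remdups_adj_snoc[OF False, of x, folded d_def]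
  show ?thesis
  proof (cases "hd d = x")
    case hx: True
    show ?thesis
    proof (cases "last d = x")
      case True thus ?thesis unfolding cred_def c using hx by simp
    next
      case False thus ?thesis unfolding cred_def c using hx dne by simp
    qed
  next
    case hx: False
    show ?thesis
    proof (cases "last d = x")
      case True
      have e: "d = butlast d @ [x]" using True dne by (metis append_butlast_last_id)
      have "cred (x # w) = x # butlast d" unfolding cred_def c using hx True dne by simp
      moreover have "cred (w @ [x]) = d" unfolding cred_def c using hx True by simp
      ultimately show ?thesis using e by metis
    next
      case False
      have "cred (x # w) = x # d" "cred (w @ [x]) = d @ [x]" unfolding cred_def c using hx False dne by auto
      thus ?thesis by blast
    qed
  qed
qed simp

text \<open>Extends \<open>E\<close> to words of any length, so that it can be followed along a
  chain of equivalences. The value 0 for long reduced forms is consistent because shifts keep the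
  length of the reduced form.\<close>

definition Ered :: "('a \<times> 'b) list \<Rightarrow> complex" where
  "Ered w = (if length (cred w) \<le> N then E (cred w) else 0)"

lemma Ered_rot1: assumes "set (x # w) \<subseteq> Z" shows "Ered (x # w) = Ered (w @ [x])"
proof (cases "cred (x # w) = cred (w @ [x])")
  case False
  then obtain a v where av: "cred (x # w) = a # v" "cred (w @ [x]) = v @ [a]" using cred_rot[of x w] by blast
  have "set (a # v) \<subseteq> Z" using cred_set[of "x # w"] assms unfolding av by blast
  hence "E ([a] @ v) = E (v @ [a])" if "length v < N" using that by (intro E_rot) auto
  thus ?thesis unfolding Ered_def av by auto
qed (simp add: Ered_def)

lemma Ered_rot: "set (u @ v) \<subseteq> Z \<Longrightarrow> Ered (u @ v) = Ered (v @ u)"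
proof (induction u arbitrary: v)
  case (Cons a u)
  have "Ered ((a # u) @ v) = Ered ((u @ v) @ [a])" using Ered_rot1[of a "u @ v"] Cons.prems by simp
  also have "\<dots> = Ered (u @ (v @ [a]))" by simp
  also have "\<dots> = Ered ((v @ [a]) @ u)" using Cons.prems by (intro Cons.IH) auto
  finally show ?case by simp
qed simp

text \<open>Equality of the letter sets is part of the induction, so that the intermediate words of
  a chain stay over \<open>Z\<close>.\<close>

lemma Ered_equiv: "word_equiv s t \<Longrightarrow> set s = set t \<and> (set s \<subseteq> Z \<longrightarrow> Ered s = Ered t)"
proof (induction rule: word_equiv.induct)
  case (dup s a t)
  have "remdups_adj (s @ [a, a] @ t) = remdups_adj (s @ [a] @ t)"
    using remdups_adj_append[of s a "a # t"] remdups_adj_append[of s a t] by simp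
  hence "cred (s @ [a, a] @ t) = cred (s @ [a] @ t)" unfolding cred_def by simp
  thus ?case unfolding Ered_def by simp
next
  case (cyc s t) thus ?case using Ered_rot[of s t] by auto
qed auto

lemma E_equiv:
  assumes "word_equiv s t" "set s \<subseteq> Z" "set t \<subseteq> Z" "length s \<le> N" "length t \<le> N" shows "E s = E t"
proof -
  have "E s = Ered s" "E t = Ered t" using E_cred[OF assms(2,4)] E_cred[OF assms(3,5)] cred_length[of s] cred_length[of t] assms(4,5)
    unfolding Ered_def by auto
  thus ?thesis using Ered_equiv[OF assms(1)] assms(2) by simp
qed

end

text \<open>The tensor that tests equality of all labels but the last acts as summation over the
  last letter.\<close>

lemma sum_butlast_eq:
  assumes "k \<ge> 1" "finite V" "y \<in> tuples V k"
  shows "(\<Sum>c\<in>tuples V k. if butlast c = butlast y then f c else 0) = (\<Sum>h\<in>V. f (butlast y @ [h]))"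
proof -
  have y: "set (butlast y) \<subseteq> V" "length (butlast y) + 1 = k"
    using assms(1,3) unfolding tuples_def by (auto dest: in_set_butlastD)
  have e: "{c \<in> tuples V k. butlast c = butlast y} = (\<lambda>h. butlast y @ [h]) ` V"
  proof (intro equalityI subsetI)
    fix c assume c: "c \<in> {c \<in> tuples V k. butlast c = butlast y}"
    hence "c \<noteq> []" "set c \<subseteq> V" using assms(1) unfolding tuples_def by auto
    moreover have "butlast c = butlast y" using c by simp
    ultimately have "c = butlast y @ [last c]" "last c \<in> V"
      using append_butlast_last_id[of c] last_in_set[of c] by auto
    thus "c \<in> (\<lambda>h. butlast y @ [h]) ` V" by blast
  qed (use y in \<open>auto simp: tuples_def\<close>)
  have "(\<Sum>c\<in>tuples V k. if butlast c = butlast y then f c else 0) = (\<Sum>c\<in>{c \<in> tuples V k. butlast c = butlast y}. f c)"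
    by (rule sum.inter_filter[symmetric]) (rule finite_tuples[OF assms(2)])
  also have "\<dots> = (\<Sum>h\<in>V. f (butlast y @ [h]))"
    unfolding e by (subst sum.reindex) (auto simp: inj_on_def)
  finally show ?thesis .
qed

lemma butlast_eq_iff:
  assumes "length x = k" "length y = k" "k \<ge> 1"
  shows "butlast x = butlast y \<longleftrightarrow> (\<forall>i<k - 1. x ! i = y ! i)"
  using assms by (auto simp: list_eq_iff_nth_eq nth_butlast)

section \<open>A certificate built from a quantum isomorphism map\<close>

context qiso
begin

definition coeff :: "('a \<times> 'b) list \<Rightarrow> ('a \<times> 'b) list \<Rightarrow> complex" where
  "coeff s t = \<Phi> (munit (map fst s) (map fst t)) (map snd s) (map snd t)"

text \<open>Inverts the convention \<open>rev s @ t\<close> of certificates: the word is cut in the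
  middle and its first half reversed.\<close>

definition Lw :: "('a \<times> 'b) list \<Rightarrow> complex" where
  "Lw w = coeff (rev (take k w)) (drop k w)"

lemma Lw_eq: "length s = k \<Longrightarrow> Lw (rev s @ t) = coeff s t"
  unfolding Lw_def by simp

lemma fst_tuples: "set s \<subseteq> VG \<times> VH \<Longrightarrow> length s = m \<Longrightarrow> map fst s \<in> tuples VG m"
  and snd_tuples: "set s \<subseteq> VG \<times> VH \<Longrightarrow> length s = m \<Longrightarrow> map snd s \<in> tuples VH m"
  unfolding tuples_def by auto

lemma rot_munit:
  assumes "p \<in> TG" "q \<in> TG" shows "rot k (munit p q) = munit (tl p @ [last q]) (hd p # butlast q)"
proof (intro ext)
  fix x y :: "'a list"
  have l: "length p = k" "length q = k" "p \<noteq> []" "q \<noteq> []" using assms k unfolding tuples_def by auto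
  show "rot k (munit p q) x y = munit (tl p @ [last q]) (hd p # butlast q) x y"
  proof (cases "length x = k \<and> length y = k")
    case True
    hence ne: "x \<noteq> []" "y \<noteq> []" using k by auto
    have "(hd y # butlast x = p \<and> tl y @ [last x] = q) \<longleftrightarrow> (x = tl p @ [last q] \<and> y = hd p # butlast q)"
      using ne l(3,4) by auto
    thus ?thesis unfolding rot_def munit_def using True by simp
  next
    case False
    hence "\<not> (x = tl p @ [last q] \<and> y = hd p # butlast q)" using l k by auto
    thus ?thesis unfolding rot_def munit_def using False by auto
  qed
qed

lemma coeff_rot:
  assumes "set s \<subseteq> VG \<times> VH" "set t \<subseteq> VG \<times> VH" "length s = k" "length t = k"
  shows "coeff (tl s @ [last t]) (hd s # butlast t) = coeff s t"
proof -
  have ne: "s \<noteq> []" "t \<noteq> []" using assms k by auto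
  have T: "map fst s \<in> TG" "map fst t \<in> TG" using fst_tuples assms by auto
  have m: "map f (tl s @ [last t]) = tl (map f s) @ [last (map f t)]" "map f (hd s # butlast t) = hd (map f s) # butlast (map f t)" for f :: "_ \<Rightarrow> 'c"
    using ne by (auto simp: map_tl last_map hd_map map_butlast)
  have "\<Phi> (munit (tl (map fst s) @ [last (map fst t)]) (hd (map fst s) # butlast (map fst t))) = rot k (\<Phi> (munit (map fst s) (map fst t)))"
    unfolding rot_munit[OF T, symmetric] by (rule Phi_rot[OF munit_matspace[OF T]])
  thus ?thesis unfolding coeff_def m rot_def using ne assms(3,4) k by simp
qed

lemma Lw_rot:
  assumes "set (a # v) \<subseteq> VG \<times> VH" "length v + 1 = 2 * k"
  shows "Lw (a # v) = Lw (v @ [a])"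
proof -
  define w where "w = v @ [a]"
  define s where "s = rev (take k w)"
  define t where "t = drop k w"
  have lw: "length w = 2 * k" unfolding w_def using assms by simp
  have st: "length s = k" "length t = k" "w = rev s @ t" unfolding s_def t_def using lw by auto
  have sub: "set s \<subseteq> VG \<times> VH" "set t \<subseteq> VG \<times> VH"
    using assms(1) unfolding s_def t_def w_def by (auto dest!: in_set_takeD in_set_dropD)
  have ne: "s \<noteq> []" "t \<noteq> []" using st k by auto
  have e: "a # v = last w # butlast w" unfolding w_def by simp
  have "a # v = rev (tl s @ [last t]) @ (hd s # butlast t)"
    unfolding e st(3) using ne by (simp add: butlast_append) (metis append_Cons append_assoc append_Nil list.collapse rev.simps(2))
  moreover have "length (tl s @ [last t]) = k" using st k by simp
  ultimately have "Lw (a # v) = coeff (tl s @ [last t]) (hd s # butlast t)" using Lw_eq by metis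
  also have "\<dots> = coeff s t" by (rule coeff_rot[OF sub st(1,2)])
  also have "\<dots> = Lw w" unfolding st(3) using Lw_eq[OF st(1)] by simp
  finally show ?thesis unfolding w_def .
qed

lemma Lw_rot_append: "set (u @ v) \<subseteq> VG \<times> VH \<Longrightarrow> length (u @ v) = 2 * k \<Longrightarrow> Lw (u @ v) = Lw (v @ u)"
proof (induction u arbitrary: v)
  case (Cons a u)
  have "Lw ((a # u) @ v) = Lw ((u @ v) @ [a])" using Lw_rot[of a "u @ v"] Cons.prems by simp
  also have "\<dots> = Lw (u @ (v @ [a]))" by simp
  also have "\<dots> = Lw ((v @ [a]) @ u)" using Cons.prems by (intro Cons.IH) auto
  finally show ?case by simp
qed simp

text \<open>Schur multiplication of a matrix unit by a tensor only scales it. Compatibility with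
  \<Phi> therefore makes the entries of the tensor in the two graphs agree wherever the Choi entry
  is nonzero. Equality and adjacency on the edge (0, k) together determine the relation
  type.\<close>

lemma coeff_mism:
  assumes "set s \<subseteq> VG \<times> VH" "set t \<subseteq> VG \<times> VH" "length s = k" "length t = k" "coeff s t \<noteq> 0"
  shows "rel G (fst (hd s)) (fst (hd t)) = rel H (snd (hd s)) (snd (hd t))"
proof -
  let ?x = "map fst s" and ?x' = "map fst t" and ?y = "map snd s" and ?y' = "map snd t"
  have ne: "s \<noteq> []" "t \<noteq> []" using assms k by auto
  have T: "?x \<in> TG" "?x' \<in> TG" "?y \<in> TH" "?y' \<in> TH" using fst_tuples snd_tuples assms by auto
  have P: "(0, k) \<in> C_pairs k"
    unfolding labelled_base.epairs_def[OF C_labelled_base[OF k]] unfolding C_edges_def using k by simp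
  have eq: "form_tensor k Ce Ca G ?x ?x' = form_tensor k Ce Ca H ?y ?y'"
    if cc: "Ce \<subseteq> C_pairs k" "Ca \<subseteq> C_pairs k" "\<And>i j. (i, j) \<in> Ca \<Longrightarrow> (i, j) \<notin> (Ce \<union> Ce\<inverse>)\<^sup>*" for Ce Ca
  proof -
    obtain F where F: "F \<in> QP k" "has_form k F Ce Ca" by (rule QP_realize[OF k cc])
    have s: "Ce \<subseteq> {..<2*k} \<times> {..<2*k}" "Ca \<subseteq> {..<2*k} \<times> {..<2*k}" using cc pairs_sub(1)[OF k] by auto
    have m: "munit ?x ?x' \<in> matspace VG k" by (rule munit_matspace[OF T(1,2)])
    have "hadamard (hom_tensor F G) (munit ?x ?x') = msmult (hom_tensor F G ?x ?x') (munit ?x ?x')"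
      unfolding hadamard_def msmult_def munit_def by (intro ext) auto
    hence "msmult (hom_tensor F G ?x ?x') (\<Phi> (munit ?x ?x')) = hadamard (hom_tensor F H) (\<Phi> (munit ?x ?x'))"
      using Phi_had[OF F(1) m] Phi_msmult[OF m] by metis
    from fun_cong[OF fun_cong[OF this, of ?y], of ?y']
    have "hom_tensor F G ?x ?x' * coeff s t = hom_tensor F H ?y ?y' * coeff s t"
      unfolding msmult_def hadamard_def coeff_def .
    thus ?thesis using assms(5) unfolding has_form_tensor[OF F(2) s G] has_form_tensor[OF F(2) s H] by simp
  qed
  have n: "(?x @ ?x') ! 0 = fst (hd s)" "(?x @ ?x') ! k = fst (hd t)" "(?y @ ?y') ! 0 = snd (hd s)" "(?y @ ?y') ! k = snd (hd t)"
    using ne assms(3,4) k by (auto simp: nth_append hd_conv_nth)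
  have "form_tensor k {(0, k)} {} G ?x ?x' = form_tensor k {(0, k)} {} H ?y ?y'" using P by (intro eq) auto
  hence 1: "fst (hd s) = fst (hd t) \<longleftrightarrow> snd (hd s) = snd (hd t)"
    unfolding form_tensor_def using T n by (simp split: if_splits)
  have "form_tensor k {} {(0, k)} G ?x ?x' = form_tensor k {} {(0, k)} H ?y ?y'" using P k by (intro eq) auto
  hence 2: "snd G (fst (hd s)) (fst (hd t)) \<longleftrightarrow> snd H (snd (hd s)) (snd (hd t))"
    unfolding form_tensor_def using T n by (simp split: if_splits)
  show ?thesis unfolding rel_def using 1 2 by simp
qed

lemma Lw_mism:
  assumes "set (a # b # v) \<subseteq> VG \<times> VH" "length v + 2 = 2 * k" "rel G (fst a) (fst b) \<noteq> rel H (snd a) (snd b)"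
  shows "Lw (a # b # v) = 0"
proof -
  define p where "p = take (k - 1) v"
  define q where "q = drop (k - 1) v"
  have pq: "v = p @ q" "length p = k - 1" "length q = k - 1" unfolding p_def q_def using assms(2) by auto
  have "Lw (a # b # v) = Lw (([a, b] @ p) @ q)" unfolding pq(1) by simp
  \<comment> \<open>The pair is rotated to the middle of the word, where its letters become the
    heads of the two halves.\<close>
  also have "\<dots> = Lw (q @ [a, b] @ p)" using Lw_rot_append[of "[a, b] @ p" q] assms pq by simp
  also have "\<dots> = Lw (rev (a # rev q) @ (b # p))" by simp
  also have "\<dots> = coeff (a # rev q) (b # p)" using pq k by (intro Lw_eq) simp
  also have "\<dots> = 0"
    using coeff_mism[of "a # rev q" "b # p"] assms pq k by auto
  finally show ?thesis .
qed

text \<open>A matrix unit times the tensor that forgets the last label is the sum over the last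
  letter in \<open>G\<close>. Multiplicativity on that tensor turns it into the corresponding sum in
  \<open>H\<close>.\<close>

lemma coeff_sum:
  assumes "set s \<subseteq> VG \<times> VH" "set t \<subseteq> VG \<times> VH" "length s = k" "length t + 1 = k" "g \<in> VG" "h \<in> VH"
  shows "(\<Sum>g'\<in>VG. coeff s (t @ [(g', h)])) = (\<Sum>h'\<in>VH. coeff s (t @ [(g, h')]))"
proof -
  \<comment> \<open>All matching edges but the last are contracted and the last one is
    deleted.\<close>
  let ?Ce = "{(i, i + k) | i. i < k - 1}"
  have Ce: "?Ce \<subseteq> M_pairs k"
    unfolding labelled_base.epairs_def[OF M_labelled_base[OF k]] unfolding M_edges_def by auto
  obtain F where F: "F \<in> QS k" "has_form k F ?Ce {}" by (rule QS_realize[OF k Ce, of "{}"]) auto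
  have FQ: "F \<in> Q k" using F(1) unfolding Q_def by blast
  have s: "?Ce \<subseteq> {..<2*k} \<times> {..<2*k}" "{} \<subseteq> {..<2*k} \<times> {..<2*k}" by auto
  have ten: "hom_tensor F A x y = (if x \<in> tuples (fst A) k \<and> y \<in> tuples (fst A) k \<and> butlast x = butlast y then 1 else 0)"
    if "simple_graph A" for A :: "'c sgraph" and x y
  proof (cases "x \<in> tuples (fst A) k \<and> y \<in> tuples (fst A) k")
    case True
    hence l: "length x = k" "length y = k" unfolding tuples_def by auto
    have "(\<forall>(i, j)\<in>?Ce. (x @ y) ! i = (x @ y) ! j) \<longleftrightarrow> (\<forall>i<k-1. x ! i = y ! i)"
      using l by (auto simp: nth_append)
    thus ?thesis unfolding has_form_tensor[OF F(2) s that] form_tensor_def using True butlast_eq_iff[OF l k] by simp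
  qed (auto simp: has_form_tensor[OF F(2) s that] form_tensor_def)
  let ?x = "map fst s" and ?y = "map snd s" and ?x' = "map fst t @ [g]" and ?y' = "map snd t @ [h]"
  have T: "?x \<in> TG" "?y \<in> TH" "?x' \<in> TG" "?y' \<in> TH" using assms unfolding tuples_def by auto
  have m: "munit ?x ?x' \<in> matspace VG k" by (rule munit_matspace[OF T(1,3)])
  have T2: "map fst t @ [z] \<in> TG" if "z \<in> VG" for z using assms that unfolding tuples_def by auto
  have lhs: "mmul VG k (munit ?x ?x') (hom_tensor F G) = (\<lambda>a b. \<Sum>z\<in>VG. 1 * munit ?x (map fst t @ [z]) a b)"
  proof (intro ext)
    fix a b
    have "mmul VG k (munit ?x ?x') (hom_tensor F G) a b = (\<Sum>c\<in>TG. if c = ?x' then munit ?x ?x' a c * hom_tensor F G c b else 0)"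
      unfolding mmul_def munit_def by (intro sum.cong HOL.refl) auto
    also have "\<dots> = munit ?x ?x' a ?x' * hom_tensor F G ?x' b" using fin T by simp
    also have "\<dots> = (\<Sum>z\<in>VG. 1 * munit ?x (map fst t @ [z]) a b)"
    proof (cases "a = ?x \<and> b \<in> TG \<and> butlast b = map fst t")
      case True
      moreover have "b \<noteq> []" "set b \<subseteq> VG" using True k unfolding tuples_def by auto
      ultimately have b: "b = map fst t @ [last b]" "last b \<in> VG"
        using append_butlast_last_id[of b] last_in_set[of b] by auto
      have "(\<Sum>z\<in>VG. 1 * munit ?x (map fst t @ [z]) a b) = (\<Sum>z\<in>VG. if z = last b then 1 else 0)"
        unfolding munit_def using True b(1) by (intro sum.cong HOL.refl) auto
      thus ?thesis using fin b(2) True T by (simp add: ten[OF G] munit_def)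
    next
      case False
      have "munit ?x (map fst t @ [z]) a b = 0" if "z \<in> VG" for z
        using False T2[OF that] unfolding munit_def by auto
      moreover have "munit ?x ?x' a ?x' * hom_tensor F G ?x' b = 0"
        using False T unfolding ten[OF G] munit_def by auto
      ultimately show ?thesis by simp
    qed
    finally show "mmul VG k (munit ?x ?x') (hom_tensor F G) a b = (\<Sum>z\<in>VG. 1 * munit ?x (map fst t @ [z]) a b)" .
  qed
  have "\<Phi> (mmul VG k (munit ?x ?x') (hom_tensor F G)) = mmul VH k (\<Phi> (munit ?x ?x')) (hom_tensor F H)"
    using Phi_contractive_multiplicative(2)[OF Q_matspace[OF k G FQ] sqnorm_Q[OF FQ] m] unfolding Phi_Q[OF FQ] .
  moreover have "\<Phi> (\<lambda>a b. \<Sum>z\<in>VG. 1 * munit ?x (map fst t @ [z]) a b) = (\<lambda>a b. \<Sum>z\<in>VG. 1 * \<Phi> (munit ?x (map fst t @ [z])) a b)"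
    by (rule Phi_sum) (auto simp: fin intro!: munit_matspace T T2)
  ultimately have "(\<lambda>a b. \<Sum>z\<in>VG. 1 * \<Phi> (munit ?x (map fst t @ [z])) a b) = mmul VH k (\<Phi> (munit ?x ?x')) (hom_tensor F H)"
    unfolding lhs by (rule HOL.trans[OF HOL.sym, rotated])
  from fun_cong[OF fun_cong[OF this, of ?y], of ?y']
  have "(\<Sum>z\<in>VG. 1 * \<Phi> (munit ?x (map fst t @ [z])) ?y ?y') = mmul VH k (\<Phi> (munit ?x ?x')) (hom_tensor F H) ?y ?y'" .
  also have "\<dots> = (\<Sum>c\<in>TH. if butlast c = butlast ?y' then \<Phi> (munit ?x ?x') ?y c else 0)"
    unfolding mmul_def ten[OF H] using T by (intro sum.cong HOL.refl) auto
  also have "\<dots> = (\<Sum>h'\<in>VH. \<Phi> (munit ?x ?x') ?y (butlast ?y' @ [h']))"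
    by (rule sum_butlast_eq[OF k fin(2) T(4)])
  finally show ?thesis unfolding coeff_def by simp
qed

lemma Lw_sum:
  assumes "set v \<subseteq> VG \<times> VH" "length v + 1 = 2 * k" "g \<in> VG" "h \<in> VH"
  shows "(\<Sum>g'\<in>VG. Lw (v @ [(g', h)])) = (\<Sum>h'\<in>VH. Lw (v @ [(g, h')]))"
proof -
  define s where "s = rev (take k v)"
  define t where "t = drop k v"
  have st: "length s = k" "length t + 1 = k" "v = rev s @ t" unfolding s_def t_def using assms(2) k by auto
  have sub: "set s \<subseteq> VG \<times> VH" "set t \<subseteq> VG \<times> VH"
    using assms(1) unfolding s_def t_def by (auto dest!: in_set_takeD in_set_dropD)
  have "Lw (v @ [p]) = coeff s (t @ [p])" for p unfolding st(3) append_assoc using Lw_eq[OF st(1)] by simp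
  thus ?thesis using coeff_sum[OF sub st(1,2) assms(3,4)] by simp
qed

lemma npa_from_qiso:
  assumes card_eq: "card VG = card VH"
  shows "\<exists>R. npa_certificate k G H R"
\<comment> \<open>The locale \<open>moment\<close> needs base letters, so empty graphs, over which
  the only word is empty, are treated apart.\<close>
proof (cases "VG = {}")
  case True
  hence "VH = {}" using card_eq fin by simp
  hence W: "words VG VH k = {[]}" unfolding words_def by auto
  have "psd_on {[] :: ('a \<times> 'b) list} (\<lambda>s t. 1)"
    by (rule psd_on_if_gram[where R = "{()}" and p = "\<lambda>_ _. 1"]) simp
  hence "npa_certificate k G H (\<lambda>s t. 1)"
    unfolding npa_certificate_def Let_def W using True by simp
  thus ?thesis by blast
next
  case False
  then obtain g0 where g0: "g0 \<in> VG" by blast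
  have "VH \<noteq> {}" using card_eq fin False by auto
  then obtain h0 where h0: "h0 \<in> VH" by blast
  interpret moment G H "2 * k" Lw g0 h0
    by unfold_locales (use g0 h0 fin Lw_rot Lw_mism Lw_sum in auto)
  define R where "R s t = E (rev s @ t)" for s t
  let ?W = "words VG VH k"
  have W: "set s \<subseteq> VG \<times> VH" "length s \<le> k" if "s \<in> ?W" for s using that unfolding words_def by auto
  have Rfull: "R s t = coeff s t" if "length s = k" "length t = k" for s t
    unfolding R_def E_def using that Lw_eq[OF that(1)] by simp
  have padl: "length (pad p) = length p" "set (pad p) = (\<lambda>g. (g, h0)) ` set p" for p unfolding pad_def by auto
  \<comment> \<open>Summed over all paddings, whose second coordinates are all \<open>h0\<close>,
    the Choi entries give a diagonal entry of \<Phi> J, and J is mapped to J.\<close>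
  have one: "R [] [] = 1"
  proof -
    have "R [] [] = (\<Sum>p\<in>tuples VG (k + k). E (pad p))"
      unfolding R_def using E_pad[of "[]" "k + k"] by simp
    also have "\<dots> = (\<Sum>x\<in>TG. \<Sum>x'\<in>TG. E (pad x @ pad x'))" unfolding sum_tuples_append by (simp add: pad_def)
    also have "\<dots> = (\<Sum>x\<in>TG. \<Sum>x'\<in>TG. E (pad (rev x) @ pad x'))"
      by (rule sum_tuples_rev[symmetric, of "\<lambda>x. \<Sum>x'\<in>TG. E (pad x @ pad x')"])
    also have "\<dots> = (\<Sum>x\<in>TG. \<Sum>x'\<in>TG. onesm VG k x x' * \<Phi> (munit x x') (replicate k h0) (replicate k h0))"
    proof (intro sum.cong HOL.refl)
      fix x x' assume x: "x \<in> TG" "x' \<in> TG"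
      hence l: "length x = k" "length x' = k" unfolding tuples_def by auto
      have "E (pad (rev x) @ pad x') = R (pad x) (pad x')" unfolding R_def pad_def by (simp add: rev_map)
      also have "\<dots> = coeff (pad x) (pad x')" using l padl by (intro Rfull) auto
      also have "\<dots> = \<Phi> (munit x x') (replicate k h0) (replicate k h0)"
        unfolding coeff_def pad_def using l by (simp add: comp_def map_replicate_const)
      finally show "E (pad (rev x) @ pad x') = onesm VG k x x' * \<Phi> (munit x x') (replicate k h0) (replicate k h0)"
        using x unfolding onesm_def by simp
    qed
    also have "\<dots> = \<Phi> (onesm VG k) (replicate k h0) (replicate k h0)"
      unfolding Phi_expand[OF onesm_matspace] ..
    also have "\<dots> = onesm VH k (replicate k h0) (replicate k h0)" unfolding Phi_onesm ..
    also have "\<dots> = 1" unfolding onesm_def tuples_def using h0 by auto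
    finally show ?thesis .
  qed
  \<comment> \<open>The padding of \<open>s\<close> is rotated to the front of the word, where it
    extends \<open>s\<close>. The entry becomes a sum over independent paddings of \<open>s\<close>
    and of \<open>t\<close>, which is the block form that preserves positivity.\<close>
  have Rpad: "R s t = (\<Sum>p\<in>tuples VG (k - length s). \<Sum>q\<in>tuples VG (k - length t). coeff (s @ pad p) (t @ pad q))"
    if s: "s \<in> ?W" and t: "t \<in> ?W" for s t
  proof -
    note Ws = W[OF s] note Wt = W[OF t]
    have "R s t = (\<Sum>p\<in>tuples VG (k - length s). E ((rev s @ t) @ pad p))"
      unfolding R_def using Ws Wt by (intro E_pad) auto
    also have "\<dots> = (\<Sum>p\<in>tuples VG (k - length s). E ((pad p @ rev s) @ t))"
    proof (intro sum.cong HOL.refl)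
      fix p assume p: "p \<in> tuples VG (k - length s)"
      have "E ((rev s @ t) @ pad p) = E (pad p @ rev s @ t)"
        using Ws Wt pad_set[OF p] by (intro E_rot) auto
      thus "E ((rev s @ t) @ pad p) = E ((pad p @ rev s) @ t)" by simp
    qed
    also have "\<dots> = (\<Sum>p\<in>tuples VG (k - length s). E ((pad (rev p) @ rev s) @ t))"
      by (rule sum_tuples_rev[symmetric, of "\<lambda>p. E ((pad p @ rev s) @ t)"])
    also have "\<dots> = (\<Sum>p\<in>tuples VG (k - length s). \<Sum>q\<in>tuples VG (k - length t). coeff (s @ pad p) (t @ pad q))"
    proof (intro sum.cong HOL.refl)
      fix p assume p: "p \<in> tuples VG (k - length s)"
      have rp: "pad (rev p) = rev (pad p)" unfolding pad_def by (simp add: rev_map)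
      have "E ((pad (rev p) @ rev s) @ t) = (\<Sum>q\<in>tuples VG (k - length t). E (((pad (rev p) @ rev s) @ t) @ pad q))"
        unfolding rp using Ws Wt pad_set[OF p] by (intro E_pad) auto
      also have "\<dots> = (\<Sum>q\<in>tuples VG (k - length t). coeff (s @ pad p) (t @ pad q))"
      proof (intro sum.cong HOL.refl)
        fix q assume q: "q \<in> tuples VG (k - length t)"
        have "E (((pad (rev p) @ rev s) @ t) @ pad q) = R (s @ pad p) (t @ pad q)" unfolding rp R_def by simp
        also have "\<dots> = coeff (s @ pad p) (t @ pad q)" using Ws Wt pad_set[OF p] pad_set[OF q] by (intro Rfull) auto
        finally show "E (((pad (rev p) @ rev s) @ t) @ pad q) = coeff (s @ pad p) (t @ pad q)" .
      qed
      finally show "E ((pad (rev p) @ rev s) @ t) = (\<Sum>q\<in>tuples VG (k - length t). coeff (s @ pad p) (t @ pad q))" .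
    qed
    finally show ?thesis .
  qed
  have fTT: "finite (TG \<times> TH)" using fin by simp
  have psdR: "psd_on ?W R"
  proof (rule psd_on_pullback[OF fTT choi_psd, where P = "\<lambda>s. tuples VG (k - length s)" and
        f = "\<lambda>s p. (map fst (s @ pad p), map snd (s @ pad p))"])
    fix s p assume s: "s \<in> ?W" and p: "p \<in> tuples VG (k - length s)"
    show "(map fst (s @ pad p), map snd (s @ pad p)) \<in> TG \<times> TH"
      using W[OF s] pad_set[OF p] fst_tuples[of "s @ pad p" k] snd_tuples[of "s @ pad p" k] by auto
  next
    fix s t assume "s \<in> ?W" "t \<in> ?W"
    thus "R s t = (\<Sum>p\<in>tuples VG (k - length s). \<Sum>q\<in>tuples VG (k - length t).
       (case (map fst (s @ pad p), map snd (s @ pad p)) of (x, y) \<Rightarrow> \<lambda>(x', y'). \<Phi> (munit x x') y y')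
          (map fst (t @ pad q), map snd (t @ pad q)))"
      using Rpad unfolding coeff_def by simp
  qed
  have "npa_certificate k G H R"
    unfolding npa_certificate_def Let_def
  proof (intro conjI ballI allI impI)
    show "psd_on ?W R" by (rule psdR)
    show "R [] [] = 1" by (rule one)
  next
    fix s t s' t' assume "s \<in> ?W" "t \<in> ?W" "s' \<in> ?W" "t' \<in> ?W" "word_equiv (rev s @ t) (rev s' @ t')"
    thus "R s t = R s' t'" unfolding R_def using W[of s] W[of t] W[of s'] W[of t'] by (intro E_equiv) auto
  next
    fix s s' g h t assume a: "g \<in> VG" "h \<in> VH" "s @ [(g, h)] @ s' \<in> ?W" "t \<in> ?W"
    note Ws = W[OF a(3)] note Wt = W[OF a(4)]
    have e1: "set (rev s' @ (rev s @ t)) \<subseteq> Z" "length (rev s' @ (rev s @ t)) < 2 * k" using Ws Wt by auto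
    have e2: "set ((rev t @ s) @ s') \<subseteq> Z" "length ((rev t @ s) @ s') < 2 * k" using Ws Wt by auto
    show "(\<Sum>h'\<in>VH. R (s @ [(g, h')] @ s') t) = R (s @ s') t" "(\<Sum>g'\<in>VG. R (s @ [(g', h)] @ s') t) = R (s @ s') t"
      unfolding R_def using E_sum[OF e1 a(1,2)] by simp_all
    show "(\<Sum>h'\<in>VH. R t (s @ [(g, h')] @ s')) = R t (s @ s')" "(\<Sum>g'\<in>VG. R t (s @ [(g', h)] @ s')) = R t (s @ s')"
      unfolding R_def using E_sum[OF e2 a(1,2)] by simp_all
  next
    fix s t i assume a: "s \<in> ?W" "t \<in> ?W" "i + 1 < length (rev s @ t)"
      "rel G (fst ((rev s @ t) ! i)) (fst ((rev s @ t) ! (i + 1))) \<noteq> rel H (snd ((rev s @ t) ! i)) (snd ((rev s @ t) ! (i + 1)))"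
    define w where "w = rev s @ t"
    have "w = take i w @ [w ! i, w ! (i + 1)] @ drop (i + 2) w"
      using a(3) unfolding w_def[symmetric] by (metis Suc_eq_plus1 Suc_lessD add_2_eq_Suc' append_Cons append_Nil id_take_nth_drop Cons_nth_drop_Suc)
    moreover have "set w \<subseteq> Z" "length w \<le> 2 * k" using W[OF a(1)] W[OF a(2)] unfolding w_def by auto
    ultimately show "R s t = 0"
      unfolding R_def w_def[symmetric] using E_mism[of "take i w" "w ! i" "w ! (i + 1)" "drop (i + 2) w"] a(4) unfolding w_def[symmetric] by metis
  qed
  thus ?thesis by blast
qed

end

section \<open>From quantum isomorphism maps to algebra isomorphisms and homomorphism counts\<close>

lemma permute_matspace:
  assumes "k \<ge> 1" "\<sigma> \<in> cyc_group k" "X \<in> matspace V k" shows "permute_mat k \<sigma> X \<in> matspace V k"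
proof -
  obtain n where n: "\<sigma> = cyc_gen k ^^ n" using assms(2) unfolding cyc_group_def by blast
  have "(rot k ^^ n) X \<in> matspace V k" using assms(3) by (induction n) (auto simp: rot_matspace[OF assms(1)])
  thus ?thesis unfolding n permute_mat_pow[OF assms(1,3)] .
qed

lemma sqnorm_rot:
  assumes "k \<ge> 1" shows "sqnorm V k (rot k X) = sqnorm V k X"
proof -
  have "sqnorm V k (rot k X) = (\<Sum>x\<in>tuples V k. \<Sum>y\<in>tuples V k. (cmod (X (hd y # butlast x) (tl y @ [last x])))\<^sup>2)"
    unfolding sqnorm_def rot_def by (intro sum.cong HOL.refl) (auto simp: tuples_def)
  also have "\<dots> = sqnorm V k X" unfolding sqnorm_def by (rule sum_rot_index[OF assms, of "\<lambda>x y. (cmod (X x y))\<^sup>2"])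
  finally show ?thesis .
qed

lemma sqnorm_permute:
  assumes "k \<ge> 1" "\<sigma> \<in> cyc_group k" "X \<in> matspace V k" shows "sqnorm V k (permute_mat k \<sigma> X) = sqnorm V k X"
proof -
  obtain n where n: "\<sigma> = cyc_gen k ^^ n" using assms(2) unfolding cyc_group_def by blast
  have "sqnorm V k ((rot k ^^ n) X) = sqnorm V k X" by (induction n) (auto simp: sqnorm_rot[OF assms(1)])
  thus ?thesis unfolding n permute_mat_pow[OF assms(1,3)] .
qed

lemma QP_Q: "F \<in> QP k \<Longrightarrow> F \<in> Q k" unfolding Q_def by blast

lemma qalg_matspace:
  assumes "k \<ge> 1" "simple_graph G" "M \<in> qalg k G" shows "M \<in> matspace (fst G) k"
  using assms(3)
  by (induction rule: qalg.induct)
    (auto intro: idm_matspace onesm_matspace Q_matspace[OF assms(1,2)] madd_matspace msmult_matspace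
      mmul_matspace mstar_matspace hadamard_matspace permute_matspace[OF assms(1)])

lemma mmul_madd_right: "mmul V k A (madd B C) = madd (mmul V k A B) (mmul V k A C)"
  and mmul_madd_left: "mmul V k (madd B C) A = madd (mmul V k B A) (mmul V k C A)"
  and mmul_msmult_right: "mmul V k A (msmult c B) = msmult c (mmul V k A B)"
  and mmul_msmult_left: "mmul V k (msmult c B) A = msmult c (mmul V k B A)"
  unfolding mmul_def madd_def msmult_def
  by (auto simp: distrib_left distrib_right sum.distrib sum_distrib_left ac_simps)

lemma mmul_assoc: "mmul V k (mmul V k A B) C = mmul V k A (mmul V k B C)"
  unfolding mmul_mm by (rule mm_assoc)

lemma mstar_mmul: "mstar (mmul V k A B) = mmul V k (mstar B) (mstar A)"
  unfolding mmul_mm mstar_dag by (rule dag_mm)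

lemma mstar_mstar[simp]: "mstar (mstar A) = A" unfolding mstar_def by simp

text \<open>Pythagoras: a 0/1 matrix splits X into two parts with disjoint supports.\<close>

lemma sqnorm_split:
  assumes "\<And>x y. P x y = 0 \<or> P x y = (1 :: complex)"
  shows "sqnorm V k X = sqnorm V k (hadamard P X) + sqnorm V k (madd X (msmult (-1) (hadamard P X)))"
proof -
  have "(cmod (X x y))\<^sup>2 = (cmod (hadamard P X x y))\<^sup>2 + (cmod (madd X (msmult (-1) (hadamard P X)) x y))\<^sup>2" for x y
    using assms[of x y] unfolding hadamard_def madd_def msmult_def by auto
  thus ?thesis unfolding sqnorm_def by (simp add: sum.distrib)
qed

lemma idm_01: "idm V k x y = 0 \<or> idm V k x y = 1" and onesm_01: "onesm V k x y = 0 \<or> onesm V k x y = 1"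
  unfolding idm_def onesm_def by auto

context qiso
begin

text \<open>These matrices form the multiplicative domain of \<Phi>, described by norms.\<close>

definition isom :: "'a mat \<Rightarrow> bool" where
  "isom X \<longleftrightarrow> X \<in> matspace VG k \<and> sqnorm VH k (\<Phi> X) = sqnorm VG k X"

text \<open>The multiplicative form is closed under sums and products, the norm form under adjoints,
  Schur products and rotations. For the way back, take Y to be the adjoint of X and compare
  traces.\<close>

lemma isom_iff:
  "isom X \<longleftrightarrow> X \<in> matspace VG k \<and> (\<forall>Y\<in>matspace VG k. \<Phi> (mmul VG k Y X) = mmul VH k (\<Phi> Y) (\<Phi> X))"
proof
  assume "isom X"
  thus "X \<in> matspace VG k \<and> (\<forall>Y\<in>matspace VG k. \<Phi> (mmul VG k Y X) = mmul VH k (\<Phi> Y) (\<Phi> X))"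
    unfolding isom_def using Phi_contractive_multiplicative(2) by blast
next
  assume a: "X \<in> matspace VG k \<and> (\<forall>Y\<in>matspace VG k. \<Phi> (mmul VG k Y X) = mmul VH k (\<Phi> Y) (\<Phi> X))"
  hence X: "X \<in> matspace VG k" by blast
  have "complex_of_real (sqnorm VH k (\<Phi> X)) = mtrace VH k (mmul VH k (mstar (\<Phi> X)) (\<Phi> X))"
    unfolding minner_self[symmetric] minner_def ..
  also have "\<dots> = mtrace VH k (\<Phi> (mmul VG k (mstar X) X))"
    using a mstar_matspace[OF X] Phi_mstar[OF X] by simp
  also have "\<dots> = complex_of_real (sqnorm VG k X)"
    unfolding Phi_trace[OF mmul_matspace[OF mstar_matspace[OF X] X]] minner_self[symmetric] minner_def ..
  finally show "isom X" unfolding isom_def using X by simp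
qed

lemma isom_01:
  assumes "X \<in> matspace VG k" "\<And>x y. X x y = 0 \<or> X x y = 1" "\<And>x y. \<Phi> X x y = 0 \<or> \<Phi> X x y = 1"
  shows "isom X"
proof -
  have "complex_of_real (sqnorm VH k (\<Phi> X)) = complex_of_real (sqnorm VG k X)"
    unfolding sqnorm_01[of X, OF assms(2)] sqnorm_01[of "\<Phi> X", OF assms(3)] by (rule Phi_sum_entries[OF assms(1)])
  thus ?thesis unfolding isom_def of_real_eq_iff using assms(1) by simp
qed

text \<open>The map contracts both the part on the support of the tensor and the rest. Since their
  squared norms add up to a preserved total, neither can shrink.\<close>

lemma isom_had:
  assumes X: "isom X" and F: "F \<in> QP k" shows "isom (hadamard (hom_tensor F G) X)"
proof -
  let ?A = "hadamard (hom_tensor F G) X"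
  let ?B = "madd X (msmult (-1) ?A)"
  have ms: "X \<in> matspace VG k" "sqnorm VH k (\<Phi> X) = sqnorm VG k X" using X unfolding isom_def by auto
  have A: "?A \<in> matspace VG k" using ms(1) by (rule hadamard_matspace)
  have mA: "msmult (-1) ?A \<in> matspace VG k" using A by (rule msmult_matspace)
  have B: "?B \<in> matspace VG k" using ms(1) mA by (rule madd_matspace)
  have PA: "\<Phi> ?A = hadamard (hom_tensor F H) (\<Phi> X)" by (rule Phi_had[OF F ms(1)])
  have PB: "\<Phi> ?B = madd (\<Phi> X) (msmult (-1) (hadamard (hom_tensor F H) (\<Phi> X)))"
    unfolding Phi_madd[OF ms(1) mA] Phi_msmult[OF A] PA ..
  have "sqnorm VG k X = sqnorm VG k ?A + sqnorm VG k ?B"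
    by (rule sqnorm_split) (rule hom_tensor_01[OF k QP_Q[OF F] G])
  moreover have "sqnorm VH k (\<Phi> X) = sqnorm VH k (\<Phi> ?A) + sqnorm VH k (\<Phi> ?B)"
    unfolding PA PB by (rule sqnorm_split) (rule hom_tensor_01[OF k QP_Q[OF F] H])
  moreover have "sqnorm VH k (\<Phi> ?A) \<le> sqnorm VG k ?A" "sqnorm VH k (\<Phi> ?B) \<le> sqnorm VG k ?B"
    using Phi_contractive_multiplicative(1)[OF A] Phi_contractive_multiplicative(1)[OF B] .
  ultimately show ?thesis unfolding isom_def using A ms(2) by linarith
qed

lemma isom_qalg: assumes "M \<in> qalg k G" shows "isom M \<and> \<Phi> M \<in> qalg k H"
  using assms
proof (induction rule: qalg.induct)
  case I
  have "isom (idm VG k)" by (rule isom_01[OF idm_matspace idm_01, unfolded Phi_idm, OF idm_01])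
  thus ?case unfolding Phi_idm using qalg.I by blast
next
  case J
  have "isom (onesm VG k)" by (rule isom_01[OF onesm_matspace onesm_01, unfolded Phi_onesm, OF onesm_01])
  thus ?case unfolding Phi_onesm using qalg.J by blast
next
  case (atom F)
  thus ?case unfolding Phi_Q[OF atom] using sqnorm_Q[OF atom] Q_matspace[OF k G atom] qalg.atom[OF atom]
    unfolding isom_def Phi_Q[OF atom] by blast
next
  case (add M N)
  hence ms: "M \<in> matspace VG k" "N \<in> matspace VG k" unfolding isom_def by auto
  have "\<Phi> (mmul VG k Y (madd M N)) = mmul VH k (\<Phi> Y) (\<Phi> (madd M N))" if Y: "Y \<in> matspace VG k" for Y
    using add.IH Y ms unfolding isom_iff mmul_madd_right Phi_madd[OF ms]
    by (simp add: Phi_madd mmul_matspace mmul_madd_right)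
  hence "isom (madd M N)" unfolding isom_iff using madd_matspace[OF ms] by blast
  thus ?case unfolding Phi_madd[OF ms] using add.IH qalg.add by blast
next
  case (smult M c)
  hence ms: "M \<in> matspace VG k" unfolding isom_def by auto
  have "\<Phi> (mmul VG k Y (msmult c M)) = mmul VH k (\<Phi> Y) (\<Phi> (msmult c M))" if Y: "Y \<in> matspace VG k" for Y
    using smult.IH Y ms unfolding isom_iff mmul_msmult_right Phi_msmult[OF ms]
    by (simp add: Phi_msmult mmul_matspace mmul_msmult_right)
  hence "isom (msmult c M)" unfolding isom_iff using msmult_matspace[OF ms] by blast
  thus ?case unfolding Phi_msmult[OF ms] using smult.IH qalg.smult by blast
next
  case (mul M N)
  hence ms: "M \<in> matspace VG k" "N \<in> matspace VG k" unfolding isom_def by auto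
  have MN: "\<Phi> (mmul VG k M N) = mmul VH k (\<Phi> M) (\<Phi> N)" using mul.IH ms unfolding isom_iff by blast
  have "\<Phi> (mmul VG k Y (mmul VG k M N)) = mmul VH k (\<Phi> Y) (\<Phi> (mmul VG k M N))" if Y: "Y \<in> matspace VG k" for Y
  proof -
    have "\<Phi> (mmul VG k (mmul VG k Y M) N) = mmul VH k (\<Phi> (mmul VG k Y M)) (\<Phi> N)"
      using mul.IH mmul_matspace[OF Y ms(1)] unfolding isom_iff by blast
    also have "\<Phi> (mmul VG k Y M) = mmul VH k (\<Phi> Y) (\<Phi> M)" using mul.IH Y unfolding isom_iff by blast
    finally show ?thesis unfolding MN mmul_assoc .
  qed
  hence "isom (mmul VG k M N)" unfolding isom_iff using mmul_matspace[OF ms] by blast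
  thus ?case unfolding MN using mul.IH qalg.mul by blast
next
  case (star M)
  hence ms: "M \<in> matspace VG k" unfolding isom_def by auto
  have "isom (mstar M)" using star.IH mstar_matspace[OF ms] Phi_mstar[OF ms] unfolding isom_def sqnorm_mstar by (simp add: sqnorm_mstar)
  thus ?case unfolding Phi_mstar[OF ms] using star.IH qalg.star by blast
next
  case (had M F)
  hence ms: "M \<in> matspace VG k" unfolding isom_def by auto
  show ?case unfolding Phi_had[OF had.hyps(2) ms] using isom_had[OF _ had.hyps(2)] had.IH qalg.had[OF _ had.hyps(2)] by blast
next
  case (perm M \<sigma>)
  hence ms: "M \<in> matspace VG k" unfolding isom_def by auto
  have "isom (permute_mat k \<sigma> M)"
    using perm.IH permute_matspace[OF k perm.hyps(2) ms] sqnorm_permute[OF k perm.hyps(2) ms]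
      sqnorm_permute[OF k perm.hyps(2) Phi_matspace[OF ms]] Phi_perm[OF perm.hyps(2) ms] unfolding isom_def by simp
  thus ?case unfolding Phi_perm[OF perm.hyps(2) ms] using perm.IH qalg.perm[OF _ perm.hyps(2)] by blast
qed

lemma Phi_surj_qalg: assumes "N \<in> qalg k H" shows "\<exists>M\<in>qalg k G. \<Phi> M = N"
  using assms
proof (induction rule: qalg.induct)
  case I show ?case using Phi_idm qalg.I by blast
next
  case J show ?case using Phi_onesm qalg.J by blast
next
  case (atom F) thus ?case using Phi_Q qalg.atom by blast
next
  case (add M N)
  then obtain A B where AB: "A \<in> qalg k G" "\<Phi> A = M" "B \<in> qalg k G" "\<Phi> B = N" by blast
  thus ?case using Phi_madd[OF qalg_matspace[OF k G AB(1)] qalg_matspace[OF k G AB(3)]] qalg.add[OF AB(1,3)] by blast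
next
  case (smult M c)
  then obtain A where A: "A \<in> qalg k G" "\<Phi> A = M" by blast
  thus ?case using Phi_msmult[OF qalg_matspace[OF k G A(1)]] qalg.smult[OF A(1)] by blast
next
  case (mul M N)
  then obtain A B where AB: "A \<in> qalg k G" "\<Phi> A = M" "B \<in> qalg k G" "\<Phi> B = N" by blast
  have "\<Phi> (mmul VG k A B) = mmul VH k M N"
    using isom_qalg[OF AB(3)] qalg_matspace[OF k G AB(1)] AB unfolding isom_iff by blast
  thus ?case using qalg.mul[OF AB(1,3)] by blast
next
  case (star M)
  then obtain A where A: "A \<in> qalg k G" "\<Phi> A = M" by blast
  thus ?case using Phi_mstar[OF qalg_matspace[OF k G A(1)]] qalg.star[OF A(1)] by blast
next
  case (had M F)
  then obtain A where A: "A \<in> qalg k G" "\<Phi> A = M" by blast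
  thus ?case using Phi_had[OF had.hyps(2) qalg_matspace[OF k G A(1)]] qalg.had[OF A(1) had.hyps(2)] by blast
next
  case (perm M \<sigma>)
  then obtain A where A: "A \<in> qalg k G" "\<Phi> A = M" by blast
  thus ?case using Phi_perm[OF perm.hyps(2) qalg_matspace[OF k G A(1)]] qalg.perm[OF A(1) perm.hyps(2)] by blast
qed

lemma alg_equiv_from_qiso: "alg_equiv k G H"
  unfolding alg_equiv_def
proof (intro exI[of _ \<Phi>] conjI ballI allI)
  note ms = qalg_matspace[OF k G]
  show "inj_on \<Phi> (qalg k G)"
  proof (rule inj_onI)
    fix M N assume MN: "M \<in> qalg k G" "N \<in> qalg k G" "\<Phi> M = \<Phi> N"
    let ?D = "madd M (msmult (-1) N)"
    have D: "?D \<in> qalg k G" using MN by (intro qalg.add qalg.smult)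
    have "\<Phi> ?D = madd (\<Phi> M) (msmult (-1) (\<Phi> N))"
      using MN by (simp add: Phi_madd Phi_msmult ms msmult_matspace)
    also have "\<dots> = (\<lambda>_ _. 0)" unfolding MN(3) madd_def msmult_def by simp
    finally have "sqnorm VG k ?D = 0" using isom_qalg[OF D] unfolding isom_def sqnorm_def by simp
    from sqnorm_zero[OF fin(1) ms[OF D] this] show "M = N"
      unfolding madd_def msmult_def by (simp add: fun_eq_iff)
  qed
  show "\<Phi> ` qalg k G = qalg k H" using isom_qalg Phi_surj_qalg by blast
  show "\<Phi> (madd M N) = madd (\<Phi> M) (\<Phi> N)" if "M \<in> qalg k G" "N \<in> qalg k G" for M N
    using that by (intro Phi_madd ms)
  show "\<Phi> (mmul VG k M N) = mmul VH k (\<Phi> M) (\<Phi> N)" if "M \<in> qalg k G" "N \<in> qalg k G" for M N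
    using isom_qalg[OF that(2)] ms[OF that(1)] unfolding isom_iff by blast
  show "\<Phi> (msmult c M) = msmult c (\<Phi> M)" if "M \<in> qalg k G" for M c by (rule Phi_msmult[OF ms[OF that]])
  show "\<Phi> (mstar M) = mstar (\<Phi> M)" if "M \<in> qalg k G" for M by (rule Phi_mstar[OF ms[OF that]])
  show "\<Phi> (hadamard (hom_tensor F G) M) = hadamard (hom_tensor F H) (\<Phi> M)" if "M \<in> qalg k G" "F \<in> QP k" for M F
    by (rule Phi_had[OF that(2) ms[OF that(1)]])
  show "\<Phi> (permute_mat k \<sigma> M) = permute_mat k \<sigma> (\<Phi> M)" if "M \<in> qalg k G" "\<sigma> \<in> cyc_group k" for M \<sigma>
    by (rule Phi_perm[OF that(2) ms[OF that(1)]])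
  show "mtrace VH k (\<Phi> M) = mtrace VG k M" if "M \<in> qalg k G" for M by (rule Phi_trace[OF ms[OF that]])
  show "\<Phi> (idm VG k) = idm VH k" "\<Phi> (onesm VG k) = onesm VH k" by (rule Phi_idm Phi_onesm)+
  show "\<Phi> (hom_tensor F G) = hom_tensor F H" if "F \<in> Q k" for F by (rule Phi_Q[OF that])
qed

end

section \<open>Homomorphism counts of the graphs in \<open>PP k\<close> as traces in the
  algebra\<close>

lemma Q_wf: "k \<ge> 1 \<Longrightarrow> F \<in> Q k \<Longrightarrow> wf_bl k F"
  by (erule (1) Q_form) (rule has_form_wf)

lemma PP_wf: assumes "k \<ge> 1" "F \<in> PP k" shows "wf_bl k F"
  using assms(2)
  by (induction rule: PP.induct)
    (auto intro: Q_wf[OF assms(1)] wf_series wf_parallel wf_bl_perm QP_Q cyc_group_bij[OF assms(1)])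

lemma hom_count_sum:
  fixes G :: "'a sgraph"
  assumes G: "simple_graph G" and wf: "wf_bl k F"
  shows "of_nat (hom_count (fst F) G) = (\<Sum>x\<in>tuples (fst G) k. \<Sum>y\<in>tuples (fst G) k. hom_tensor F G x y)"
proof -
  obtain A u v where F: "F = (A, u, v)" by (cases F) auto
  let ?T = "tuples (fst G) k"
  define S where "S p = {h \<in> hom_set A G. map h u = fst p \<and> map h v = snd p}" for p :: "'a list \<times> 'a list"
  have w: "finite (fst A)" "length u = k" "length v = k" "set u \<subseteq> fst A" "set v \<subseteq> fst A"
    using wf unfolding wf_bl_def wf_lgraph_def F by auto
  have "map h u \<in> ?T \<and> map h v \<in> ?T" if "h \<in> hom_set A G" for h
  proof -
    have "h n \<in> fst G" if "n \<in> fst A" for n using \<open>h \<in> hom_set A G\<close> PiE_mem[OF _ that] unfolding hom_set_def by blast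
    thus ?thesis using w unfolding tuples_def by (auto simp: subset_iff)
  qed
  hence "hom_set A G = (\<Union>p\<in>?T \<times> ?T. S p)" unfolding S_def by auto
  hence "card (hom_set A G) = card (\<Union>p\<in>?T \<times> ?T. S p)" by simp
  also have "\<dots> = (\<Sum>p\<in>?T \<times> ?T. card (S p))"
    by (rule card_UN_disjoint) (use finite_hom_set[OF simple_graph_finite[OF G] w(1)] finite_tuples[OF simple_graph_finite[OF G]]
      in \<open>auto simp: S_def prod_eq_iff\<close>)
  finally show ?thesis
    unfolding hom_count_def F fst_conv hom_tensor_eq S_def hom_set_def
    by (simp add: sum.cartesian_product split_def)
qed

text \<open>Turns a homomorphism count into the trace of a product with J, which an algebra
  isomorphism preserves.\<close>

lemma sum_entries_trace: "(\<Sum>x\<in>tuples V k. \<Sum>y\<in>tuples V k. M x y) = mtrace V k (mmul V k (onesm V k) M)"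
  unfolding mtrace_def mmul_def onesm_def by (subst sum.swap) simp

lemma hadamard_commute: "hadamard A B = hadamard B A" unfolding hadamard_def by (simp add: mult.commute)

lemma hom_tensor_PP_qalg:
  assumes k: "k \<ge> 1" and G: "simple_graph G" and F: "F \<in> PP k" shows "hom_tensor F G \<in> qalg k G"
  using F
proof (induction rule: PP.induct)
  case (atom F) thus ?case by (rule qalg.atom)
next
  case (ser F F') thus ?case using hom_tensor_series[OF G PP_wf[OF k] PP_wf[OF k]] qalg.mul by metis
next
  case (par F F') thus ?case using hom_tensor_parallel[OF G PP_wf[OF k] Q_wf[OF k QP_Q]] qalg.had hadamard_commute by metis
next
  case (perm F \<sigma>) thus ?case using hom_tensor_perm[OF PP_wf[OF k] cyc_group_bij[OF k]] qalg.perm by metis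
qed

text \<open>The body of \<open>alg_equiv\<close> with its witness exposed, so that its clauses can
  be named.\<close>

definition alg_iso :: "nat \<Rightarrow> 'a sgraph \<Rightarrow> 'b sgraph \<Rightarrow> ('a mat \<Rightarrow> 'b mat) \<Rightarrow> bool" where
  "alg_iso k G H \<phi> \<longleftrightarrow> inj_on \<phi> (qalg k G) \<and> \<phi> ` qalg k G = qalg k H \<and>
     (\<forall>M\<in>qalg k G. \<forall>N\<in>qalg k G. \<phi> (madd M N) = madd (\<phi> M) (\<phi> N) \<and>
        \<phi> (mmul (fst G) k M N) = mmul (fst H) k (\<phi> M) (\<phi> N)) \<and>
     (\<forall>M\<in>qalg k G. (\<forall>c. \<phi> (msmult c M) = msmult c (\<phi> M)) \<and>
        \<phi> (mstar M) = mstar (\<phi> M) \<and>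
        (\<forall>F\<in>QP k. \<phi> (hadamard (hom_tensor F G) M) = hadamard (hom_tensor F H) (\<phi> M)) \<and>
        (\<forall>\<sigma>\<in>cyc_group k. \<phi> (permute_mat k \<sigma> M) = permute_mat k \<sigma> (\<phi> M)) \<and>
        mtrace (fst H) k (\<phi> M) = mtrace (fst G) k M) \<and>
     \<phi> (idm (fst G) k) = idm (fst H) k \<and> \<phi> (onesm (fst G) k) = onesm (fst H) k \<and>
     (\<forall>F\<in>Q k. \<phi> (hom_tensor F G) = hom_tensor F H)"

lemma alg_equiv_iff: "alg_equiv k G H \<longleftrightarrow> (\<exists>\<phi>. alg_iso k G H \<phi>)"
  unfolding alg_equiv_def alg_iso_def ..

lemma alg_isoD:
  assumes "alg_iso k G H \<phi>"
  shows "inj_on \<phi> (qalg k G)" "\<phi> ` qalg k G = qalg k H"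
    "\<And>M N. M \<in> qalg k G \<Longrightarrow> N \<in> qalg k G \<Longrightarrow> \<phi> (madd M N) = madd (\<phi> M) (\<phi> N)"
    "\<And>M N. M \<in> qalg k G \<Longrightarrow> N \<in> qalg k G \<Longrightarrow> \<phi> (mmul (fst G) k M N) = mmul (fst H) k (\<phi> M) (\<phi> N)"
    "\<And>M c. M \<in> qalg k G \<Longrightarrow> \<phi> (msmult c M) = msmult c (\<phi> M)"
    "\<And>M. M \<in> qalg k G \<Longrightarrow> \<phi> (mstar M) = mstar (\<phi> M)"
    "\<And>M F. M \<in> qalg k G \<Longrightarrow> F \<in> QP k \<Longrightarrow> \<phi> (hadamard (hom_tensor F G) M) = hadamard (hom_tensor F H) (\<phi> M)"
    "\<And>M \<sigma>. M \<in> qalg k G \<Longrightarrow> \<sigma> \<in> cyc_group k \<Longrightarrow> \<phi> (permute_mat k \<sigma> M) = permute_mat k \<sigma> (\<phi> M)"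
    "\<And>M. M \<in> qalg k G \<Longrightarrow> mtrace (fst H) k (\<phi> M) = mtrace (fst G) k M"
    "\<phi> (idm (fst G) k) = idm (fst H) k" "\<phi> (onesm (fst G) k) = onesm (fst H) k"
    "\<And>F. F \<in> Q k \<Longrightarrow> \<phi> (hom_tensor F G) = hom_tensor F H"
  using assms unfolding alg_iso_def by simp_all

lemma alg_equiv_imp_hom_indist:
  assumes G: "simple_graph G" and H: "simple_graph H" and k: "k \<ge> 1" and eq: "alg_equiv k G H"
  shows "hom_indist_PP k G H"
proof -
  obtain \<phi> where a: "alg_iso k G H \<phi>" using eq unfolding alg_equiv_iff by blast
  note mul = alg_isoD(4)[OF a] and had = alg_isoD(7)[OF a] and prm = alg_isoD(8)[OF a] and tr = alg_isoD(9)[OF a]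
    and J = alg_isoD(11)[OF a] and at = alg_isoD(12)[OF a]
  have phi: "\<phi> (hom_tensor F G) = hom_tensor F H" if "F \<in> PP k" for F
    using that
  proof (induction rule: PP.induct)
    case (atom F) thus ?case by (rule at)
  next
    case (ser F F')
    note w = PP_wf[OF k ser.hyps(1)] PP_wf[OF k ser.hyps(2)]
    show ?case unfolding hom_tensor_series[OF G w] hom_tensor_series[OF H w]
      using mul[OF hom_tensor_PP_qalg[OF k G ser.hyps(1)] hom_tensor_PP_qalg[OF k G ser.hyps(2)]] ser.IH by simp
  next
    case (par F F')
    note w = PP_wf[OF k par.hyps(1)] Q_wf[OF k QP_Q[OF par.hyps(2)]]
    show ?case unfolding hom_tensor_parallel[OF G w] hom_tensor_parallel[OF H w]
      using had[OF hom_tensor_PP_qalg[OF k G par.hyps(1)] par.hyps(2)] par.IH by (simp add: hadamard_commute)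
  next
    case (perm F \<sigma>)
    note w = PP_wf[OF k perm.hyps(1)] cyc_group_bij[OF k perm.hyps(2)]
    show ?case unfolding hom_tensor_perm[OF w]
      using prm[OF hom_tensor_PP_qalg[OF k G perm.hyps(1)] perm.hyps(2)] perm.IH by simp
  qed
  have "hom_count (fst F) G = hom_count (fst F) H" if F: "F \<in> PP k" for F
  proof -
    note Fq = hom_tensor_PP_qalg[OF k G F]
    have "complex_of_nat (hom_count (fst F) G) = mtrace (fst G) k (mmul (fst G) k (onesm (fst G) k) (hom_tensor F G))"
      unfolding hom_count_sum[OF G PP_wf[OF k F]] sum_entries_trace ..
    also have "\<dots> = mtrace (fst H) k (\<phi> (mmul (fst G) k (onesm (fst G) k) (hom_tensor F G)))"
      by (rule tr[OF qalg.mul[OF qalg.J Fq], symmetric])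
    also have "\<dots> = mtrace (fst H) k (mmul (fst H) k (onesm (fst H) k) (hom_tensor F H))"
      unfolding mul[OF qalg.J Fq] J phi[OF F] ..
    also have "\<dots> = complex_of_nat (hom_count (fst F) H)"
      unfolding hom_count_sum[OF H PP_wf[OF k F]] sum_entries_trace ..
    finally show ?thesis by (simp only: of_nat_eq_iff)
  qed
  thus ?thesis unfolding hom_indist_PP_def by blast
qed

section \<open>Transposition of graphs in the planar class\<close>

text \<open>The inverse of \<open>rot\<close>: on the cyclic word \<open>x @ rev y\<close> the first
  letter moves to the end.\<close>

definition rotl :: "nat \<Rightarrow> 'a mat \<Rightarrow> 'a mat" where
  "rotl k X = (\<lambda>x y. if length x = k \<and> length y = k then X (tl x @ [last y]) (hd x # butlast y) else 0)"

lemma matspace_length: "X \<in> matspace V k \<Longrightarrow> length x \<noteq> k \<or> length y \<noteq> k \<Longrightarrow> X x y = 0"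
  unfolding matspace_def tuples_def by auto

lemma rotl_rot:
  assumes "k \<ge> 1" "X \<in> matspace V k" shows "rotl k (rot k X) = X"
proof (intro ext)
  fix x y
  show "rotl k (rot k X) x y = X x y"
  proof (cases "length x = k \<and> length y = k")
    case True
    hence "x \<noteq> []" "y \<noteq> []" using assms(1) by auto
    thus ?thesis unfolding rotl_def rot_def using True assms(1) by simp
  next
    case False thus ?thesis unfolding rotl_def using matspace_length[OF assms(2)] by auto
  qed
qed

text \<open>On the word \<open>x @ rev y\<close> this rotation is the rotation of lists, so its
  iterates, and in particular its period, are known.\<close>

lemma rotl_pow:
  assumes "k \<ge> 1" "length x = k" "length y = k"
  shows "(rotl k ^^ n) X x y = X (take k (rotate n (x @ rev y))) (rev (drop k (rotate n (x @ rev y))))"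
  using assms(2,3)
proof (induction n arbitrary: x y)
  case 0 thus ?case by simp
next
  case (Suc n)
  have ne: "x \<noteq> []" "y \<noteq> []" using Suc.prems assms(1) by auto
  let ?x = "tl x @ [last y]" and ?y = "hd x # butlast y"
  have l: "length ?x = k" "length ?y = k" using Suc.prems assms(1) by auto
  have "rev y = last y # rev (butlast y)"
    using ne(2) by (metis append_butlast_last_id rev.simps(1) rev.simps(2) rev_append append_Nil append_Cons)
  hence "rotate1 (x @ rev y) = ?x @ rev ?y" using ne(1) by (cases x) auto
  hence r: "rotate (Suc n) (x @ rev y) = rotate n (?x @ rev ?y)"
    by (simp add: rotate1_rotate_swap)
  have "(rotl k ^^ Suc n) X x y = (rotl k ^^ n) X ?x ?y" using Suc.prems by (simp add: rotl_def)
  also have "\<dots> = X (take k (rotate n (?x @ rev ?y))) (rev (drop k (rotate n (?x @ rev ?y))))" by (rule Suc.IH[OF l])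
  finally show ?case unfolding r .
qed

lemma rot_pow_matspace: "k \<ge> 1 \<Longrightarrow> X \<in> matspace V k \<Longrightarrow> (rot k ^^ n) X \<in> matspace V k"
  by (induction n) (auto simp: rot_matspace)

lemma rot_order:
  assumes k: "k \<ge> 1" and X: "X \<in> matspace V k" shows "(rot k ^^ (2 * k)) X = X"
proof -
  have "(rotl k ^^ n) ((rot k ^^ n) X) = X" for n
  proof (induction n)
    case (Suc n)
    have "(rotl k ^^ Suc n) ((rot k ^^ Suc n) X) = (rotl k ^^ n) (rotl k (rot k ((rot k ^^ n) X)))"
      by (simp add: funpow_swap1)
    also have "\<dots> = X" unfolding rotl_rot[OF k rot_pow_matspace[OF k X]] by (rule Suc.IH)
    finally show ?case .
  qed simp
  moreover have "(rotl k ^^ (2 * k)) Y = Y" if Y: "Y \<in> matspace V k" for Y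
  proof (intro ext)
    fix x y
    show "(rotl k ^^ (2 * k)) Y x y = Y x y"
    proof (cases "length x = k \<and> length y = k")
      case True
      hence "length (x @ rev y) = 2 * k" by simp
      hence "rotate (2 * k) (x @ rev y) = x @ rev y" using rotate_id[of "2 * k" "x @ rev y"] by simp
      thus ?thesis using rotl_pow[OF k, of x y "2 * k" Y] True by simp
    next
      case False
      have "2 * k = Suc (2 * k - 1)" using k by simp
      hence "(rotl k ^^ (2 * k)) Y x y = rotl k ((rotl k ^^ (2 * k - 1)) Y) x y" by (metis funpow.simps(2) o_apply)
      also have "\<dots> = 0" using False unfolding rotl_def by auto
      finally show ?thesis using matspace_length[OF Y] False by auto
    qed
  qed
  ultimately show ?thesis using rot_pow_matspace[OF k X] by metis
qed

text \<open>\<open>cyc_group\<close> consists of nonnegative powers of the generator, so the inverse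
  rotation has to be exhibited as one of them.\<close>

lemma rotl_eq_rot_pow:
  assumes k: "k \<ge> 1" and X: "X \<in> matspace V k" shows "rotl k X = (rot k ^^ (2 * k - 1)) X"
proof -
  have e: "2 * k = Suc (2 * k - 1)" using k by simp
  have "X = rot k ((rot k ^^ (2 * k - 1)) X)" using rot_order[OF k X] e by (metis funpow.simps(2) o_apply)
  hence "rotl k X = rotl k (rot k ((rot k ^^ (2 * k - 1)) X))" by simp
  also have "\<dots> = (rot k ^^ (2 * k - 1)) X" by (rule rotl_rot[OF k rot_pow_matspace[OF k X]])
  finally show ?thesis .
qed

text \<open>Taking adjoints reflects the cyclic word and thereby reverses the direction of
  rotation.\<close>

lemma mstar_rot: "k \<ge> 1 \<Longrightarrow> mstar (rot k X) = rotl k (mstar X)"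
  unfolding mstar_def rot_def rotl_def by (intro ext) auto

text \<open>The exponent (2k - 1) n stands for -n modulo the order 2k.\<close>

lemma mstar_permute_pow:
  assumes k: "k \<ge> 1" and X: "X \<in> matspace V k"
  shows "mstar (permute_mat k (cyc_gen k ^^ n) X) = permute_mat k (cyc_gen k ^^ ((2 * k - 1) * n)) (mstar X)"
proof -
  have "mstar ((rot k ^^ n) X) = (rot k ^^ ((2 * k - 1) * n)) (mstar X)"
  proof (induction n)
    case (Suc n)
    have "mstar ((rot k ^^ Suc n) X) = rotl k (mstar ((rot k ^^ n) X))" by (simp add: mstar_rot[OF k])
    also have "\<dots> = rotl k ((rot k ^^ ((2 * k - 1) * n)) (mstar X))" unfolding Suc.IH ..
    also have "\<dots> = (rot k ^^ (2 * k - 1)) ((rot k ^^ ((2 * k - 1) * n)) (mstar X))"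
      by (rule rotl_eq_rot_pow[OF k rot_pow_matspace[OF k mstar_matspace[OF X]]])
    also have "\<dots> = (rot k ^^ ((2 * k - 1) * Suc n)) (mstar X)" by (simp only: mult_Suc_right funpow_add o_apply)
    finally show ?case .
  qed simp
  thus ?thesis unfolding permute_mat_pow[OF k X] permute_mat_pow[OF k mstar_matspace[OF X]] .
qed

text \<open>The exchange of in- and out-positions. It is an automorphism of \<open>C_atom\<close>
  and of \<open>M_atom\<close>, so it carries minors to minors and the transpose of an atomic tensor
  is atomic.\<close>

definition swap_half :: "nat \<Rightarrow> nat \<Rightarrow> nat" where
  "swap_half k i = (if i < k then i + k else i - k)"

lemma swap_half_lt: "i < 2 * k \<Longrightarrow> swap_half k i < 2 * k" and swap_half_swap: "i < 2 * k \<Longrightarrow> swap_half k (swap_half k i) = i"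
  unfolding swap_half_def by auto

lemma C_pairs_swap:
  assumes k: "k \<ge> 1" and ij: "(i, j) \<in> C_pairs k" shows "(swap_half k i, swap_half k j) \<in> C_pairs k"
proof -
  have lt: "i < 2 * k" "j < 2 * k" using ij pairs_sub(1)[OF k] by auto
  have im: "{swap_half k i, swap_half k j} = swap_half k ` {i, j}" by simp
  from k ij have "swap_half k ` {i, j} \<in> C_edges k"
  proof (cases rule: C_pairs_cases)
    case (step p)
    show ?thesis
    proof (cases "p + 1 < k")
      case True
      hence "swap_half k ` {i, j} = {p + k, p + k + 1}" unfolding step(1) swap_half_def by auto
      moreover have "p + k + 1 < 2 * k" "p + k \<noteq> k - 1" using True by auto
      ultimately show ?thesis unfolding C_edges_def by blast
    next
      case False
      hence p: "k \<le> p" "p + 1 < 2 * k" using step(2) by auto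
      hence "swap_half k ` {i, j} = {p - k, p - k + 1}" unfolding step(1) swap_half_def by auto
      moreover have "p - k + 1 < 2 * k" "p - k \<noteq> k - 1" using p by auto
      ultimately show ?thesis unfolding C_edges_def by blast
    qed
  next
    case first
    have "swap_half k ` {i, j} = {0, k}" unfolding first swap_half_def using k by auto
    thus ?thesis unfolding C_edges_def by simp
  next
    case last
    have s: "swap_half k (k - 1) = 2 * k - 1" "swap_half k (2 * k - 1) = k - 1" unfolding swap_half_def using k by auto
    have "swap_half k ` {i, j} = {2 * k - 1, k - 1}" unfolding last image_insert image_empty s ..
    also have "\<dots> = {k - 1, 2 * k - 1}" by (rule insert_commute)
    finally have e: "swap_half k ` {i, j} = {k - 1, 2 * k - 1}" .
    show ?thesis unfolding e C_edges_def by (rule UnI2) simp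
  qed
  hence "{swap_half k i, swap_half k j} \<in> C_edges k" unfolding im .
  thus ?thesis unfolding labelled_base.epairs_def[OF C_labelled_base[OF k]]
    using swap_half_lt[OF lt(1)] swap_half_lt[OF lt(2)] by simp
qed

lemma M_pairs_swap:
  assumes k: "k \<ge> 1" and ij: "(i, j) \<in> M_pairs k" shows "(swap_half k i, swap_half k j) \<in> M_pairs k"
proof -
  from M_pairs_cases[OF k ij] have "(swap_half k i, swap_half k j) = (j, i)" unfolding swap_half_def by auto
  moreover have "(j, i) \<in> M_pairs k"
    using ij unfolding labelled_base.epairs_def[OF M_labelled_base[OF k]] by (simp add: insert_commute)
  ultimately show ?thesis by simp
qed

lemma connected_image:
  assumes "(i, j) \<in> (R \<union> R\<inverse>)\<^sup>*" shows "(f i, f j) \<in> (map_prod f f ` R \<union> (map_prod f f ` R)\<inverse>)\<^sup>*"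
  using assms
proof (induction rule: rtrancl_induct)
  case (step y z)
  have "(f y, f z) \<in> map_prod f f ` R \<union> (map_prod f f ` R)\<inverse>" using step(2) by force
  with step(3) show ?case by (rule rtrancl_into_rtrancl)
qed simp

lemma ball_map_prod: "(\<forall>(i, j)\<in>map_prod f f ` C. P i j) \<longleftrightarrow> (\<forall>(i, j)\<in>C. P (f i) (f j))"
  by (simp add: split_def)

text \<open>The entries are real, so the adjoint is the transpose, which is what exchanging the
  label halves produces.\<close>

lemma form_tensor_swap:
  fixes G :: "'a sgraph"
  assumes "Ce \<subseteq> {..<2*k} \<times> {..<2*k}" "Ca \<subseteq> {..<2*k} \<times> {..<2*k}"
  shows "form_tensor k (map_prod (swap_half k) (swap_half k) ` Ce) (map_prod (swap_half k) (swap_half k) ` Ca) G = mstar (form_tensor k Ce Ca G)"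
proof (intro ext)
  fix x y :: "'a list"
  have n: "(x @ y) ! swap_half k i = (y @ x) ! i" if "length x = k" "length y = k" "i < 2 * k" for i
    using that unfolding swap_half_def by (auto simp: nth_append)
  show "form_tensor k (map_prod (swap_half k) (swap_half k) ` Ce) (map_prod (swap_half k) (swap_half k) ` Ca) G x y = mstar (form_tensor k Ce Ca G) x y"
  proof (cases "x \<in> tuples (fst G) k \<and> y \<in> tuples (fst G) k")
    case True
    hence l: "length x = k" "length y = k" unfolding tuples_def by auto
    have 1: "(\<forall>(i, j)\<in>map_prod (swap_half k) (swap_half k) ` Ce. (x @ y) ! i = (x @ y) ! j) \<longleftrightarrow> (\<forall>(i, j)\<in>Ce. (y @ x) ! i = (y @ x) ! j)"
      unfolding ball_map_prod
    proof (intro ball_cong HOL.refl)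
      fix c assume "c \<in> Ce"
      thus "(case c of (i, j) \<Rightarrow> (x @ y) ! swap_half k i = (x @ y) ! swap_half k j) = (case c of (i, j) \<Rightarrow> (y @ x) ! i = (y @ x) ! j)"
        using n[OF l] assms(1) by (cases c) auto
    qed
    have 2: "(\<forall>(i, j)\<in>map_prod (swap_half k) (swap_half k) ` Ca. snd G ((x @ y) ! i) ((x @ y) ! j)) \<longleftrightarrow> (\<forall>(i, j)\<in>Ca. snd G ((y @ x) ! i) ((y @ x) ! j))"
      unfolding ball_map_prod
    proof (intro ball_cong HOL.refl)
      fix c assume "c \<in> Ca"
      thus "(case c of (i, j) \<Rightarrow> snd G ((x @ y) ! swap_half k i) ((x @ y) ! swap_half k j)) = (case c of (i, j) \<Rightarrow> snd G ((y @ x) ! i) ((y @ x) ! j))"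
        using n[OF l] assms(2) by (cases c) auto
    qed
    show ?thesis unfolding form_tensor_def mstar_def 1 2 using True by simp
  qed (auto simp: form_tensor_def mstar_def)
qed

lemma has_form_nonloop:
  assumes "has_form k F Ce Ca" "(p, q) \<in> Ca" shows "(p, q) \<notin> (Ce \<union> Ce\<inverse>)\<^sup>*"
proof
  assume c: "(p, q) \<in> (Ce \<union> Ce\<inverse>)\<^sup>*"
  obtain V E u v where F: "F = ((V, E), u, v)" by (rule blgraph_cases)
  note f = has_formD[OF assms(1)[unfolded F]]
  have "(u @ v) ! p = (u @ v) ! q" by (rule connected_invariant[OF c]) (rule f(4))
  thus False using f(7)[OF assms(2)] by simp
qed

lemma swap_nonloop:
  assumes sub: "Ce \<subseteq> {..<2*k} \<times> {..<2*k}" "Ca \<subseteq> {..<2*k} \<times> {..<2*k}"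
    and nl: "\<And>p q. (p, q) \<in> Ca \<Longrightarrow> (p, q) \<notin> (Ce \<union> Ce\<inverse>)\<^sup>*"
    and ij: "(i, j) \<in> map_prod (swap_half k) (swap_half k) ` Ca"
  shows "(i, j) \<notin> (map_prod (swap_half k) (swap_half k) ` Ce \<union> (map_prod (swap_half k) (swap_half k) ` Ce)\<inverse>)\<^sup>*"
proof
  let ?s = "swap_half k"
  assume c: "(i, j) \<in> (map_prod ?s ?s ` Ce \<union> (map_prod ?s ?s ` Ce)\<inverse>)\<^sup>*"
  obtain p q where pq: "(p, q) \<in> Ca" "i = ?s p" "j = ?s q" using ij by auto
  have "map_prod ?s ?s ` map_prod ?s ?s ` Ce = (\<lambda>x. x) ` Ce"
    unfolding image_image
  proof (rule image_cong[OF HOL.refl])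
    fix x assume "x \<in> Ce"
    thus "map_prod ?s ?s (map_prod ?s ?s x) = x" using sub(1) swap_half_swap by (cases x) auto
  qed
  hence "(?s i, ?s j) \<in> (Ce \<union> Ce\<inverse>)\<^sup>*" using connected_image[OF c, of ?s] by simp
  moreover have "?s i = p" "?s j = q" unfolding pq(2,3) using pq(1) sub(2) swap_half_swap by auto
  ultimately show False using nl[OF pq(1)] by simp
qed

text \<open>The clause on tensors occurs twice because an obtained fact is monomorphic, while it has
  to serve graphs of both vertex types.\<close>

lemma QP_transpose:
  assumes k: "k \<ge> 1" and F: "F \<in> QP k"
  obtains F' where "F' \<in> QP k"
    "\<And>G :: 'a sgraph. simple_graph G \<Longrightarrow> hom_tensor F' G = mstar (hom_tensor F G)"
    "\<And>G :: 'b sgraph. simple_graph G \<Longrightarrow> hom_tensor F' G = mstar (hom_tensor F G)"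
proof -
  let ?s = "swap_half k"
  obtain Ce Ca where f: "Ce \<subseteq> C_pairs k" "Ca \<subseteq> C_pairs k" "has_form k F Ce Ca" by (rule QP_form[OF k F])
  have s: "Ce \<subseteq> {..<2*k} \<times> {..<2*k}" "Ca \<subseteq> {..<2*k} \<times> {..<2*k}" using f pairs_sub(1)[OF k] by auto
  let ?Ce = "map_prod ?s ?s ` Ce" and ?Ca = "map_prod ?s ?s ` Ca"
  have c: "?Ce \<subseteq> C_pairs k" "?Ca \<subseteq> C_pairs k" using f(1,2) C_pairs_swap[OF k] by auto
  have s': "?Ce \<subseteq> {..<2*k} \<times> {..<2*k}" "?Ca \<subseteq> {..<2*k} \<times> {..<2*k}" using c pairs_sub(1)[OF k] by auto
  obtain F' where F': "F' \<in> QP k" "has_form k F' ?Ce ?Ca"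
    by (rule QP_realize[OF k c swap_nonloop[OF s has_form_nonloop[OF f(3)]]])
  have "hom_tensor F' G = mstar (hom_tensor F G)" if "simple_graph G" for G :: "'c sgraph"
    unfolding has_form_tensor[OF F'(2) s' that] has_form_tensor[OF f(3) s that] by (rule form_tensor_swap[OF s])
  from that[OF F'(1) this this] show ?thesis .
qed

lemma QS_transpose:
  assumes k: "k \<ge> 1" and F: "F \<in> QS k"
  obtains F' where "F' \<in> QS k"
    "\<And>G :: 'a sgraph. simple_graph G \<Longrightarrow> hom_tensor F' G = mstar (hom_tensor F G)"
    "\<And>G :: 'b sgraph. simple_graph G \<Longrightarrow> hom_tensor F' G = mstar (hom_tensor F G)"
proof -
  let ?s = "swap_half k"
  obtain Ce Ca where f: "Ce \<subseteq> M_pairs k" "Ca \<subseteq> M_pairs k" "has_form k F Ce Ca" by (rule QS_form[OF k F])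
  have s: "Ce \<subseteq> {..<2*k} \<times> {..<2*k}" "Ca \<subseteq> {..<2*k} \<times> {..<2*k}" using f pairs_sub(2)[OF k] by auto
  let ?Ce = "map_prod ?s ?s ` Ce" and ?Ca = "map_prod ?s ?s ` Ca"
  have c: "?Ce \<subseteq> M_pairs k" "?Ca \<subseteq> M_pairs k" using f(1,2) M_pairs_swap[OF k] by auto
  have s': "?Ce \<subseteq> {..<2*k} \<times> {..<2*k}" "?Ca \<subseteq> {..<2*k} \<times> {..<2*k}" using c pairs_sub(2)[OF k] by auto
  obtain F' where F': "F' \<in> QS k" "has_form k F' ?Ce ?Ca"
    by (rule QS_realize[OF k c swap_nonloop[OF s has_form_nonloop[OF f(3)]]])
  have "hom_tensor F' G = mstar (hom_tensor F G)" if "simple_graph G" for G :: "'c sgraph"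
    unfolding has_form_tensor[OF F'(2) s' that] has_form_tensor[OF f(3) s that] by (rule form_tensor_swap[OF s])
  from that[OF F'(1) this this] show ?thesis .
qed

lemma mstar_hadamard: "mstar (hadamard A B) = hadamard (mstar A) (mstar B)"
  unfolding mstar_def hadamard_def by simp

lemma PP_matspace: "k \<ge> 1 \<Longrightarrow> simple_graph G \<Longrightarrow> F \<in> PP k \<Longrightarrow> hom_tensor F G \<in> matspace (fst G) k"
  by (intro qalg_matspace hom_tensor_PP_qalg)

text \<open>Adjoints reverse products, distribute over Schur products and invert rotations, and each
  of these is available for graphs. A single \<open>F'\<close> must serve both graphs, since later
  the pair of tensors is handled as one object.\<close>

lemma PP_transpose:
  fixes G :: "'a sgraph" and H :: "'b sgraph"
  assumes k: "k \<ge> 1" and G: "simple_graph G" and H: "simple_graph H" and F: "F \<in> PP k"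
  shows "\<exists>F'\<in>PP k. hom_tensor F' G = mstar (hom_tensor F G) \<and> hom_tensor F' H = mstar (hom_tensor F H)"
  using F
proof (induction rule: PP.induct)
  case (atom F)
  show ?case
  proof (cases "F \<in> QP k")
    case True
    obtain F' where "F' \<in> QP k" "hom_tensor F' G = mstar (hom_tensor F G)" "hom_tensor F' H = mstar (hom_tensor F H)"
      by (rule QP_transpose[OF k True]) (use G H in blast)
    thus ?thesis using PP.atom[OF QP_Q] by blast
  next
    case False
    hence F: "F \<in> QS k" using atom unfolding Q_def by blast
    obtain F' where "F' \<in> QS k" "hom_tensor F' G = mstar (hom_tensor F G)" "hom_tensor F' H = mstar (hom_tensor F H)"
      by (rule QS_transpose[OF k F]) (use G H in blast)
    moreover hence "F' \<in> Q k" unfolding Q_def by blast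
    ultimately show ?thesis using PP.atom by blast
  qed
next
  case (ser F1 F2)
  then obtain A B where A: "A \<in> PP k" "hom_tensor A G = mstar (hom_tensor F1 G)" "hom_tensor A H = mstar (hom_tensor F1 H)"
    and B: "B \<in> PP k" "hom_tensor B G = mstar (hom_tensor F2 G)" "hom_tensor B H = mstar (hom_tensor F2 H)" by blast
  note w = PP_wf[OF k ser.hyps(1)] PP_wf[OF k ser.hyps(2)] note w' = PP_wf[OF k B(1)] PP_wf[OF k A(1)]
  show ?case
    by (rule bexI[OF _ PP.ser[OF B(1) A(1)]])
      (simp add: hom_tensor_series[OF G w] hom_tensor_series[OF H w] hom_tensor_series[OF G w'] hom_tensor_series[OF H w'] mstar_mmul A B)
next
  case (par F1 F2)
  then obtain A where A: "A \<in> PP k" "hom_tensor A G = mstar (hom_tensor F1 G)" "hom_tensor A H = mstar (hom_tensor F1 H)" by blast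
  obtain B where B: "B \<in> QP k" "hom_tensor B G = mstar (hom_tensor F2 G)" "hom_tensor B H = mstar (hom_tensor F2 H)"
    by (rule QP_transpose[OF k par.hyps(2)]) (use G H in blast)
  note w = PP_wf[OF k par.hyps(1)] Q_wf[OF k QP_Q[OF par.hyps(2)]] note w' = PP_wf[OF k A(1)] Q_wf[OF k QP_Q[OF B(1)]]
  show ?case
    by (rule bexI[OF _ PP.par[OF A(1) B(1)]])
      (simp add: hom_tensor_parallel[OF G w] hom_tensor_parallel[OF H w] hom_tensor_parallel[OF G w'] hom_tensor_parallel[OF H w'] mstar_hadamard A B)
next
  case (perm F \<sigma>)
  then obtain A where A: "A \<in> PP k" "hom_tensor A G = mstar (hom_tensor F G)" "hom_tensor A H = mstar (hom_tensor F H)" by blast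
  obtain n where n: "\<sigma> = cyc_gen k ^^ n" using perm.hyps(2) unfolding cyc_group_def by blast
  let ?\<tau> = "cyc_gen k ^^ ((2 * k - 1) * n)"
  have t: "?\<tau> \<in> cyc_group k" unfolding cyc_group_def by blast
  note m = mstar_permute_pow[OF k PP_matspace[OF k G perm.hyps(1)], of n] mstar_permute_pow[OF k PP_matspace[OF k H perm.hyps(1)], of n]
  note w = PP_wf[OF k perm.hyps(1)] cyc_group_bij[OF k perm.hyps(2), unfolded n] note w' = PP_wf[OF k A(1)] cyc_group_bij[OF k t]
  show ?case
    by (rule bexI[OF _ PP.perm[OF A(1) t]])
      (simp only: hom_tensor_perm[OF w] hom_tensor_perm[OF w'] A n m simp_thms)
qed

section \<open>Traces of graphs in the planar class\<close>

text \<open>The trace of a tensor is computed inside the planar class by identifying the label pairs from the last to the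
  first. Once the labels beyond position \<open>j\<close> have been forgotten, they are free to carry the identification of
  the pair at position \<open>j\<close> around the cycle.\<close>
definition closed_up :: "nat \<Rightarrow> nat \<Rightarrow> blgraph \<Rightarrow> blgraph \<Rightarrow> 'a sgraph \<Rightarrow> bool" where
  "closed_up k j F F' A \<longleftrightarrow> (\<forall>x\<in>tuples (fst A) k. \<forall>y\<in>tuples (fst A) k. hom_tensor F' A x y =
     (\<Sum>z\<in>tuples (fst A) (k - j). hom_tensor F A (take j x @ z) (take j y @ z)))"

text \<open>Contracted pairs of the matching: the first j labels are passed through, the rest are
  forgotten on both sides.\<close>

definition eq_below :: "nat \<Rightarrow> nat \<Rightarrow> (nat \<times> nat) set" where
  "eq_below k j = {(i, i + k) | i. i < j}"

text \<open>The contracted pairs form a path of the cycle, from in-label j to the last in-label,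
  across, and back to out-label j. All labels from position j on, on both sides, become one
  vertex.\<close>

definition eq_above :: "nat \<Rightarrow> nat \<Rightarrow> (nat \<times> nat) set" where
  "eq_above k j = {(i, i + 1) | i. j \<le> i \<and> i + 1 < k} \<union> {(i + k, i + 1 + k) | i. j \<le> i \<and> i + 1 < k} \<union> {(k - 1, 2 * k - 1)}"

lemma eq_below_pairs: "k \<ge> 1 \<Longrightarrow> j \<le> k \<Longrightarrow> eq_below k j \<subseteq> M_pairs k"
  unfolding labelled_base.epairs_def[OF M_labelled_base] unfolding eq_below_def M_edges_def by auto

lemma eq_above_pairs: assumes "k \<ge> 1" shows "eq_above k j \<subseteq> C_pairs k"
proof
  fix p assume "p \<in> eq_above k j"
  then consider i where "p = (i, i + 1)" "i + 1 < k" | i where "p = (i + k, i + 1 + k)" "i + 1 < k" | "p = (k - 1, 2 * k - 1)"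
    unfolding eq_above_def by blast
  thus "p \<in> C_pairs k"
  proof cases
    case (1 i)
    have "{i, i + 1} \<in> C_edges k" unfolding C_edges_def using 1 by (intro UnI1) auto
    thus ?thesis unfolding 1 labelled_base.epairs_def[OF C_labelled_base[OF assms]] using 1 by simp
  next
    case (2 i)
    have "{i + k, i + k + 1} \<in> C_edges k" unfolding C_edges_def using 2 by (intro UnI1) auto
    thus ?thesis unfolding 2 labelled_base.epairs_def[OF C_labelled_base[OF assms]] using 2 by simp
  next
    case 3
    have "{k - 1, 2 * k - 1} \<in> C_edges k" unfolding C_edges_def by (rule UnI2) simp
    thus ?thesis unfolding 3 labelled_base.epairs_def[OF C_labelled_base[OF assms]] using assms by simp
  qed
qed

lemma eq_below_tensor:
  assumes "j \<le> k" "x \<in> tuples (fst A) k" "y \<in> tuples (fst A) k"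
  shows "form_tensor k (eq_below k j) {} A x y = (if take j x = take j y then 1 else 0)"
proof -
  have l: "length x = k" "length y = k" using assms unfolding tuples_def by auto
  have "(\<forall>(a, b)\<in>eq_below k j. (x @ y) ! a = (x @ y) ! b) \<longleftrightarrow> (\<forall>i<j. x ! i = y ! i)"
    unfolding eq_below_def using l assms(1) by (auto simp: nth_append)
  also have "\<dots> \<longleftrightarrow> take j x = take j y" using l assms(1) by (auto simp: list_eq_iff_nth_eq)
  finally show ?thesis unfolding form_tensor_def using assms by simp
qed

lemma eq_take_replicate:
  assumes "length x = k" "j \<le> k" "\<And>i. j \<le> i \<Longrightarrow> i < k \<Longrightarrow> x ! i = z"
  shows "x = take j x @ replicate (k - j) z"
proof (rule nth_equalityI)
  fix i assume "i < length x"
  thus "x ! i = (take j x @ replicate (k - j) z) ! i" using assms by (cases "i < j") (simp_all add: nth_append)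
qed (use assms in simp)

lemma eq_above_iff:
  assumes k: "k \<ge> 1" and j: "j < k" and l: "length x = k" "length y = k"
  shows "(\<forall>(a, b)\<in>eq_above k j. (x @ y) ! a = (x @ y) ! b) \<longleftrightarrow>
     (\<exists>z. x = take j x @ replicate (k - j) z \<and> y = take j y @ replicate (k - j) z)"
proof
  assume L: "\<forall>(a, b)\<in>eq_above k j. (x @ y) ! a = (x @ y) ! b"
  have sx: "x ! i = x ! (i + 1)" if "j \<le> i" "i + 1 < k" for i
  proof -
    have "(i, i + 1) \<in> eq_above k j" unfolding eq_above_def using that by blast
    hence "(x @ y) ! i = (x @ y) ! (i + 1)" using L by blast
    thus ?thesis using that l by (simp add: nth_append)
  qed
  have sy: "y ! i = y ! (i + 1)" if "j \<le> i" "i + 1 < k" for i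
  proof -
    have "(i + k, i + 1 + k) \<in> eq_above k j" unfolding eq_above_def using that by blast
    hence "(x @ y) ! (i + k) = (x @ y) ! (i + 1 + k)" using L by blast
    thus ?thesis using that l by (simp add: nth_append)
  qed
  have xy: "x ! (k - 1) = y ! (k - 1)"
  proof -
    have "(k - 1, 2 * k - 1) \<in> eq_above k j" unfolding eq_above_def by blast
    hence "(x @ y) ! (k - 1) = (x @ y) ! (2 * k - 1)" using L by blast
    moreover have "2 * k - 1 = length x + (k - 1)" using k l by simp
    ultimately have "(x @ y) ! (k - 1) = y ! (k - 1)" using nth_append_length_plus[of x y "k - 1"] by simp
    thus ?thesis using l k by (simp add: nth_append)
  qed
  have cx: "x ! (k - 1 - d) = x ! (k - 1)" if "j \<le> k - 1 - d" "d < k" for d using that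
  proof (induction d)
    case (Suc d)
    have "k - 1 - Suc d + 1 = k - 1 - d" using Suc.prems by simp
    thus ?case using sx[of "k - 1 - Suc d"] Suc by simp
  qed simp
  have cy: "y ! (k - 1 - d) = y ! (k - 1)" if "j \<le> k - 1 - d" "d < k" for d using that
  proof (induction d)
    case (Suc d)
    have "k - 1 - Suc d + 1 = k - 1 - d" using Suc.prems by simp
    thus ?case using sy[of "k - 1 - Suc d"] Suc by simp
  qed simp
  have c: "x ! i = x ! (k - 1) \<and> y ! i = x ! (k - 1)" if "j \<le> i" "i < k" for i
    using cx[of "k - 1 - i"] cy[of "k - 1 - i"] xy that by simp
  have "x = take j x @ replicate (k - j) (x ! (k - 1))"
    by (rule eq_take_replicate[OF l(1) less_imp_le[OF j] c[THEN conjunct1]])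
  moreover have "y = take j y @ replicate (k - j) (x ! (k - 1))"
    by (rule eq_take_replicate[OF l(2) less_imp_le[OF j] c[THEN conjunct2]])
  ultimately show "\<exists>z. x = take j x @ replicate (k - j) z \<and> y = take j y @ replicate (k - j) z" by blast
next
  assume "\<exists>z. x = take j x @ replicate (k - j) z \<and> y = take j y @ replicate (k - j) z"
  then obtain z where z: "x = take j x @ replicate (k - j) z" "y = take j y @ replicate (k - j) z" by blast
  have n: "x ! i = z" "y ! i = z" if "j \<le> i" "i < k" for i
  proof -
    have "(take j u @ replicate (k - j) z) ! i = z" if "length u = k" for u
      using \<open>j \<le> i\<close> \<open>i < k\<close> that j by (simp add: nth_append)
    from this[OF l(1)] this[OF l(2)] show "x ! i = z" "y ! i = z" unfolding z[symmetric] .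
  qed
  show "\<forall>(a, b)\<in>eq_above k j. (x @ y) ! a = (x @ y) ! b"
  proof (clarify)
    fix a b assume "(a, b) \<in> eq_above k j"
    then consider "b = a + 1" "j \<le> a" "a + 1 < k" | i where "a = i + k" "b = i + 1 + k" "j \<le> i" "i + 1 < k" | "a = k - 1" "b = 2 * k - 1"
      unfolding eq_above_def by blast
    thus "(x @ y) ! a = (x @ y) ! b"
    proof cases
      case 1 thus ?thesis using n(1)[of a] n(1)[of b] l by (simp add: nth_append)
    next
      case (2 i) thus ?thesis using n(2)[of i] n(2)[of "i + 1"] l by (simp add: nth_append)
    next
      case 3
      have "b = length x + (k - 1)" using 3 k l by simp
      hence "(x @ y) ! b = y ! (k - 1)" using nth_append_length_plus[of x y "k - 1"] by simp
      thus ?thesis using 3 n(1)[of "k - 1"] n(2)[of "k - 1"] l k j by (simp add: nth_append)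
    qed
  qed
qed

text \<open>\<open>E\<close> makes all labels from j on equal to one vertex z. The tensor of
  \<open>F'\<close> depends only on the first j + 1 labels of each side, so z takes the place of the
  pair at position j. The two copies of \<open>S\<close> forget z, which is thereby summed
  over.\<close>

lemma closed_up_step:
  fixes A :: "'a sgraph"
  assumes A: "simple_graph A" and k: "k \<ge> 1" and j: "j < k"
    and S: "wf_bl k S" "has_form k S (eq_below k j) {}" and E: "wf_bl k E" "has_form k E (eq_above k j) {}"
    and F': "wf_bl k F'" "closed_up k (Suc j) F F' A"
  shows "closed_up k j F (series (series S (parallel F' E)) S) A"
  unfolding closed_up_def
proof (intro ballI)
  let ?V = "fst A" and ?T = "tuples (fst A) k"
  have fT: "finite ?T" using A by (simp add: simple_graph_finite finite_tuples)
  fix x y assume xy: "x \<in> ?T" "y \<in> ?T"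
  hence l: "length x = k" "length y = k" and sub: "set x \<subseteq> ?V" "set y \<subseteq> ?V" unfolding tuples_def by auto
  have bs: "eq_below k j \<subseteq> {..<2*k} \<times> {..<2*k}" "eq_above k j \<subseteq> {..<2*k} \<times> {..<2*k}" "{} \<subseteq> {..<2*k} \<times> {..<2*k}"
    using eq_below_pairs[OF k, of j] eq_above_pairs[OF k, of j] pairs_sub[OF k] j by auto
  have wP: "wf_bl k (parallel F' E)" by (rule wf_parallel[OF F'(1) E(1)])
  have Sv: "hom_tensor S A a b = (if take j a = take j b then 1 else 0)" if "a \<in> ?T" "b \<in> ?T" for a b
    unfolding has_form_tensor[OF S(2) bs(1,3) A] using that j by (intro eq_below_tensor) auto
  \<comment> \<open>The first j labels of \<open>u\<close> followed by the common vertex in all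
    remaining places: the only tuples with these first labels that survive multiplication with
    \<open>E\<close>.\<close>
  define pt where "pt u z = take j u @ replicate (k - j) z" for u and z :: 'a
  have ptT: "pt u z \<in> ?T" "take j (pt u z) = take j u" "take (Suc j) (pt u z) = take j u @ [z]"
    if "u \<in> ?T" "z \<in> ?V" for u z
  proof -
    have u: "length u = k" "set u \<subseteq> ?V" using that unfolding tuples_def by auto
    show "pt u z \<in> ?T" unfolding pt_def tuples_def using u j that(2) by (auto dest: in_set_takeD)
    show "take j (pt u z) = take j u" unfolding pt_def using u j by simp
    have "Suc j - min (length u) j = 1" "min (k - j) 1 = 1" using u j by auto
    thus "take (Suc j) (pt u z) = take j u @ [z]" unfolding pt_def using u j by (simp add: min_def)
  qed
  have Ev: "hom_tensor E A a b = (if \<exists>z. a = pt a z \<and> b = pt b z then 1 else 0)" if "a \<in> ?T" "b \<in> ?T" for a b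
  proof -
    have "length a = k" "length b = k" using that unfolding tuples_def by auto
    from eq_above_iff[OF k j this] show ?thesis
      unfolding has_form_tensor[OF E(2) bs(2,3) A] form_tensor_def pt_def using that by simp
  qed
  have "hom_tensor (series (series S (parallel F' E)) S) A x y =
     (\<Sum>b\<in>?T. (\<Sum>a\<in>?T. hom_tensor S A x a * (hom_tensor F' A a b * hom_tensor E A a b)) * hom_tensor S A b y)"
    unfolding hom_tensor_series[OF A wf_series[OF S(1) wP] S(1)] hom_tensor_series[OF A S(1) wP]
      hom_tensor_parallel[OF A F'(1) E(1)] mmul_def hadamard_def ..
  also have "\<dots> = (\<Sum>b\<in>?T. \<Sum>a\<in>?T. if \<exists>z\<in>?V. a = pt x z \<and> b = pt y z then hom_tensor F' A a b else 0)"
    unfolding sum_distrib_right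
  proof (intro sum.cong HOL.refl)
    fix b a assume ab: "b \<in> ?T" "a \<in> ?T"
    have "(take j x = take j a \<and> (\<exists>z. a = pt a z \<and> b = pt b z) \<and> take j b = take j y) \<longleftrightarrow> (\<exists>z\<in>?V. a = pt x z \<and> b = pt y z)"
      (is "?L \<longleftrightarrow> ?R")
    proof
      assume L: ?L
      then obtain z where z: "a = pt a z" "b = pt b z" by blast
      have "a = pt x z" "b = pt y z" using z L unfolding pt_def by metis+
      moreover have "z \<in> ?V"
      proof -
        have "z \<in> set a" using z(1) j unfolding pt_def by (metis Un_iff in_set_replicate set_append zero_less_diff less_numeral_extra(3))
        thus ?thesis using ab(2) unfolding tuples_def by blast
      qed
      ultimately show ?R by blast
    next
      assume ?R
      then obtain z where z: "z \<in> ?V" "a = pt x z" "b = pt y z" by blast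
      have t: "take j a = take j x" "take j b = take j y" unfolding z(2,3) using ptT(2) xy z(1) by auto
      hence "a = pt a z" "b = pt b z" using z(2,3) unfolding pt_def by metis+
      thus ?L using t by metis
    qed
    thus "hom_tensor S A x a * (hom_tensor F' A a b * hom_tensor E A a b) * hom_tensor S A b y =
       (if \<exists>z\<in>?V. a = pt x z \<and> b = pt y z then hom_tensor F' A a b else 0)"
      unfolding Sv[OF xy(1) ab(2)] Sv[OF ab(1) xy(2)] Ev[OF ab(2,1)] by auto
  qed
  also have "\<dots> = (\<Sum>p\<in>?T \<times> ?T. if p \<in> (\<lambda>z. (pt y z, pt x z)) ` ?V then hom_tensor F' A (snd p) (fst p) else 0)"
    unfolding sum.cartesian_product by (intro sum.cong HOL.refl) (auto simp: image_iff)
  also have "\<dots> = (\<Sum>p\<in>(\<lambda>z. (pt y z, pt x z)) ` ?V. hom_tensor F' A (snd p) (fst p))"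
  proof -
    have "(\<lambda>z. (pt y z, pt x z)) ` ?V \<subseteq> ?T \<times> ?T" using ptT(1) xy by auto
    thus ?thesis using fT by (simp add: sum.inter_restrict[symmetric] Int_absorb1)
  qed
  also have "\<dots> = (\<Sum>z\<in>?V. hom_tensor F' A (pt x z) (pt y z))"
  proof -
    have "inj_on (\<lambda>z. (pt y z, pt x z)) ?V"
    proof (rule inj_onI)
      fix z z' assume "z \<in> ?V" "z' \<in> ?V" "(pt y z, pt x z) = (pt y z', pt x z')"
      hence "take j x @ [z] = take j x @ [z']" using ptT(3)[OF xy(1)] by (metis prod.inject)
      thus "z = z'" by simp
    qed
    thus ?thesis by (simp add: sum.reindex)
  qed
  also have "\<dots> = (\<Sum>z\<in>?V. \<Sum>w\<in>tuples ?V (k - Suc j). hom_tensor F A ((take j x @ [z]) @ w) ((take j y @ [z]) @ w))"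
  proof (intro sum.cong HOL.refl)
    fix z assume z: "z \<in> ?V"
    have "hom_tensor F' A (pt x z) (pt y z) = (\<Sum>w\<in>tuples ?V (k - Suc j). hom_tensor F A (take (Suc j) (pt x z) @ w) (take (Suc j) (pt y z) @ w))"
      using F'(2) ptT(1)[OF xy(1) z] ptT(1)[OF xy(2) z] unfolding closed_up_def by blast
    thus "hom_tensor F' A (pt x z) (pt y z) = (\<Sum>w\<in>tuples ?V (k - Suc j). hom_tensor F A ((take j x @ [z]) @ w) ((take j y @ [z]) @ w))"
      unfolding ptT(3)[OF xy(1) z] ptT(3)[OF xy(2) z] .
  qed
  also have "\<dots> = (\<Sum>z\<in>tuples ?V (k - j). hom_tensor F A (take j x @ z) (take j y @ z))"
  proof -
    have e: "k - j = Suc (k - Suc j)" using j by simp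
    show ?thesis unfolding e sum_tuples_Suc by simp
  qed
  finally show "hom_tensor (series (series S (parallel F' E)) S) A x y =
     (\<Sum>z\<in>tuples ?V (k - j). hom_tensor F A (take j x @ z) (take j y @ z))" .
qed

lemma PP_close_up:
  fixes G :: "'a sgraph" and H :: "'b sgraph"
  assumes G: "simple_graph G" and H: "simple_graph H" and k: "k \<ge> 1" and F: "F \<in> PP k" and d: "d \<le> k"
  shows "\<exists>F'\<in>PP k. closed_up k (k - d) F F' G \<and> closed_up k (k - d) F F' H"
  using d
proof (induction d)
  case 0
  have c0: "closed_up k k F F A" for A :: "'c sgraph" unfolding closed_up_def
  proof (intro ballI)
    fix x y assume "x \<in> tuples (fst A) k" "y \<in> tuples (fst A) k"
    hence "length x = k" "length y = k" by (auto dest: tuples_length)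
    thus "hom_tensor F A x y = (\<Sum>z\<in>tuples (fst A) (k - k). hom_tensor F A (take k x @ z) (take k y @ z))"
      by (simp add: tuples_0)
  qed
  show ?case using c0[of G] c0[of H] F by auto
next
  case (Suc d)
  then obtain F' where F': "F' \<in> PP k" "closed_up k (k - d) F F' G" "closed_up k (k - d) F F' H" by auto
  define j where "j = k - Suc d"
  have j: "j < k" "Suc j = k - d" unfolding j_def using Suc.prems by auto
  obtain S where S: "S \<in> QS k" "has_form k S (eq_below k j) {}"
    by (rule QS_realize[OF k eq_below_pairs[OF k], of j "{}"]) (use j in auto)
  obtain E where E: "E \<in> QP k" "has_form k E (eq_above k j) {}"
    by (rule QP_realize[OF k eq_above_pairs[OF k], of "{}" j]) auto
  have SQ: "S \<in> Q k" using S unfolding Q_def by blast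
  note w = Q_wf[OF k SQ] S(2) Q_wf[OF k QP_Q[OF E(1)]] E(2) PP_wf[OF k F'(1)]
  have "series (series S (parallel F' E)) S \<in> PP k"
    by (intro PP.ser PP.par PP.atom SQ F'(1) E(1))
  moreover have "closed_up k j F (series (series S (parallel F' E)) S) G"
    by (rule closed_up_step[OF G k j(1) w F'(2)[folded j(2)]])
  moreover have "closed_up k j F (series (series S (parallel F' E)) S) H"
    by (rule closed_up_step[OF H k j(1) w F'(3)[folded j(2)]])
  ultimately show ?case unfolding j_def by blast
qed

lemma card_tuples: "finite V \<Longrightarrow> card (tuples V k) = card V ^ k"
  unfolding tuples_def using card_lists_length_eq[of V k] by (simp add: conj_commute)

text \<open>When all pairs are closed up, every entry of the tensor of \<open>F'\<close> is the
  trace of \<open>F\<close>, and the homomorphism count is that trace times the squared number of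
  tuples. The factor is the same for both graphs and cancels unless there are no tuples, when both
  traces are empty sums.\<close>

lemma PP_trace:
  fixes G :: "'a sgraph" and H :: "'b sgraph"
  assumes G: "simple_graph G" and H: "simple_graph H" and k: "k \<ge> 1" and c: "card (fst G) = card (fst H)"
    and ind: "hom_indist_PP k G H" and F: "F \<in> PP k"
  shows "mtrace (fst H) k (hom_tensor F H) = mtrace (fst G) k (hom_tensor F G)"
proof -
  obtain F' where F': "F' \<in> PP k" "closed_up k 0 F F' G" "closed_up k 0 F F' H"
    using PP_close_up[OF G H k F, of k] by auto
  have e: "complex_of_nat (hom_count (fst F') A) = of_nat (card (tuples (fst A) k)) * (of_nat (card (tuples (fst A) k)) * mtrace (fst A) k (hom_tensor F A))"
    if A: "simple_graph A" "closed_up k 0 F F' A" for A :: "'c sgraph"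
  proof -
    have "complex_of_nat (hom_count (fst F') A) = (\<Sum>x\<in>tuples (fst A) k. \<Sum>y\<in>tuples (fst A) k. mtrace (fst A) k (hom_tensor F A))"
      unfolding hom_count_sum[OF A(1) PP_wf[OF k F'(1)]] mtrace_def
      using A(2) unfolding closed_up_def by (intro sum.cong HOL.refl) simp
    thus ?thesis by simp
  qed
  have cT: "card (tuples (fst G) k) = card (tuples (fst H) k)"
    using c G H by (simp add: card_tuples simple_graph_finite)
  have "hom_count (fst F') G = hom_count (fst F') H" using ind F'(1) unfolding hom_indist_PP_def by blast
  hence *: "of_nat (card (tuples (fst H) k)) * (of_nat (card (tuples (fst H) k)) * mtrace (fst G) k (hom_tensor F G)) =
     of_nat (card (tuples (fst H) k)) * (of_nat (card (tuples (fst H) k)) * mtrace (fst H) k (hom_tensor F H))"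
    unfolding e[OF G F'(2), unfolded cT, symmetric] e[OF H F'(3), symmetric] by simp
  show ?thesis
  proof (cases "card (tuples (fst H) k) = 0")
    case True
    hence "tuples (fst H) k = {}" "tuples (fst G) k = {}"
      using cT G H by (auto simp: simple_graph_finite finite_tuples)
    thus ?thesis unfolding mtrace_def by simp
  qed (use * in simp)
qed

section \<open>From homomorphism counts to algebra isomorphisms\<close>

text \<open>The future isomorphism as a relation. Spanning by pairs avoids choosing a representation
  of a matrix as a combination of tensors; single-valuedness is shown afterwards.\<close>

inductive_set tensor_span :: "nat \<Rightarrow> 'a sgraph \<Rightarrow> 'b sgraph \<Rightarrow> ('a mat \<times> 'b mat) set"
  for k :: nat and G :: "'a sgraph" and H :: "'b sgraph" where
  tensor: "F \<in> PP k \<Longrightarrow> (hom_tensor F G, hom_tensor F H) \<in> tensor_span k G H"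
| span_add: "(M, N) \<in> tensor_span k G H \<Longrightarrow> (M', N') \<in> tensor_span k G H \<Longrightarrow> (madd M M', madd N N') \<in> tensor_span k G H"
| span_smult: "(M, N) \<in> tensor_span k G H \<Longrightarrow> (msmult c M, msmult c N) \<in> tensor_span k G H"

lemma mstar_madd: "mstar (madd A B) = madd (mstar A) (mstar B)"
  and mstar_msmult: "mstar (msmult c A) = msmult (cnj c) (mstar A)"
  and hadamard_madd: "hadamard P (madd A B) = madd (hadamard P A) (hadamard P B)"
  and hadamard_msmult: "hadamard P (msmult c A) = msmult c (hadamard P A)"
  unfolding mstar_def madd_def msmult_def hadamard_def by (auto simp: algebra_simps)

lemma permute_madd: "permute_mat k \<sigma> (madd A B) = madd (permute_mat k \<sigma> A) (permute_mat k \<sigma> B)"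
  and permute_msmult: "permute_mat k \<sigma> (msmult c A) = msmult c (permute_mat k \<sigma> A)"
  unfolding permute_mat_def madd_def msmult_def by (auto simp: Let_def fun_eq_iff)

lemma mtrace_madd: "mtrace V k (madd A B) = mtrace V k A + mtrace V k B"
  and mtrace_msmult: "mtrace V k (msmult c A) = c * mtrace V k A"
  unfolding mtrace_def madd_def msmult_def by (auto simp: sum.distrib sum_distrib_left)

locale indist =
  fixes G :: "'a sgraph" and H :: "'b sgraph" and k :: nat
  assumes G: "simple_graph G" and H: "simple_graph H" and card_eq: "card (fst G) = card (fst H)" and k: "k \<ge> 1"
    and ind: "hom_indist_PP k G H"
begin

abbreviation "sp \<equiv> tensor_span k G H"

lemma fin: "finite (fst G)" "finite (fst H)" using G H by (auto simp: simple_graph_finite)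

lemma sp_qalg: "(M, N) \<in> sp \<Longrightarrow> M \<in> qalg k G \<and> N \<in> qalg k H"
  by (induction rule: tensor_span.induct)
    (auto intro: qalg.add qalg.smult hom_tensor_PP_qalg[OF k G] hom_tensor_PP_qalg[OF k H])

lemma sp_atom: "F \<in> Q k \<Longrightarrow> (hom_tensor F G, hom_tensor F H) \<in> sp"
  by (intro tensor_span.tensor PP.atom)

text \<open>J is itself an atomic tensor: all edges of the cycle are deleted. Likewise I below
  arises by contracting the whole matching.\<close>

lemma sp_J: "(onesm (fst G) k, onesm (fst H) k) \<in> sp"
proof -
  obtain F where F: "F \<in> QP k" "has_form k F {} {}" by (rule QP_realize[OF k, of "{}" "{}"]) auto
  have e: "hom_tensor F A = onesm (fst A) k" if "simple_graph A" for A :: "'c sgraph"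
    unfolding has_form_tensor[OF F(2) empty_subsetI empty_subsetI that] form_tensor_def onesm_def by simp
  show ?thesis using sp_atom[OF QP_Q[OF F(1)]] unfolding e[OF G] e[OF H] .
qed

lemma sp_I: "(idm (fst G) k, idm (fst H) k) \<in> sp"
proof -
  have p: "eq_below k k \<subseteq> M_pairs k" by (rule eq_below_pairs[OF k]) simp
  obtain F where F: "F \<in> QS k" "has_form k F (eq_below k k) {}" by (rule QS_realize[OF k p, of "{}"]) auto
  have s: "eq_below k k \<subseteq> {..<2*k} \<times> {..<2*k}" using p pairs_sub(2)[OF k] by blast
  have e: "hom_tensor F A = idm (fst A) k" if A: "simple_graph A" for A :: "'c sgraph"
  proof (intro ext)
    fix x y
    show "hom_tensor F A x y = idm (fst A) k x y"
    proof (cases "x \<in> tuples (fst A) k \<and> y \<in> tuples (fst A) k")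
      case True
      thus ?thesis unfolding has_form_tensor[OF F(2) s empty_subsetI A] idm_def
        using eq_below_tensor[of k k x A y] by (auto simp: tuples_def)
    qed (auto simp: has_form_tensor[OF F(2) s empty_subsetI A] form_tensor_def idm_def)
  qed
  have "F \<in> Q k" using F(1) unfolding Q_def by blast
  from sp_atom[OF this] show ?thesis unfolding e[OF G] e[OF H] .
qed

lemma sp_mul: "(M, N) \<in> sp \<Longrightarrow> (M', N') \<in> sp \<Longrightarrow> (mmul (fst G) k M M', mmul (fst H) k N N') \<in> sp"
proof (induction arbitrary: M' N' rule: tensor_span.induct)
  case (tensor F)
  from tensor.prems show ?case
  proof (induction rule: tensor_span.induct)
    case (tensor F')
    note w = PP_wf[OF k \<open>F \<in> PP k\<close>] PP_wf[OF k tensor]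
    show ?case using tensor_span.tensor[OF PP.ser[OF \<open>F \<in> PP k\<close> tensor], of G H]
      unfolding hom_tensor_series[OF G w] hom_tensor_series[OF H w] .
  qed (auto simp: mmul_madd_right mmul_msmult_right intro: tensor_span.intros)
qed (auto simp: mmul_madd_left mmul_msmult_left intro: tensor_span.intros)

lemma sp_star: "(M, N) \<in> sp \<Longrightarrow> (mstar M, mstar N) \<in> sp"
proof (induction rule: tensor_span.induct)
  case (tensor F)
  obtain F' where "F' \<in> PP k" "hom_tensor F' G = mstar (hom_tensor F G)" "hom_tensor F' H = mstar (hom_tensor F H)"
    using PP_transpose[OF k G H tensor] by blast
  thus ?case using tensor_span.tensor[of F' k G H] by simp
qed (auto simp: mstar_madd mstar_msmult intro: tensor_span.intros)

lemma sp_had: "(M, N) \<in> sp \<Longrightarrow> F \<in> QP k \<Longrightarrow> (hadamard (hom_tensor F G) M, hadamard (hom_tensor F H) N) \<in> sp"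
proof (induction rule: tensor_span.induct)
  case (tensor F')
  note w = PP_wf[OF k tensor.hyps] Q_wf[OF k QP_Q[OF tensor.prems]]
  show ?case using tensor_span.tensor[OF PP.par[OF tensor.hyps tensor.prems], of G H]
    unfolding hom_tensor_parallel[OF G w] hom_tensor_parallel[OF H w] by (simp add: hadamard_commute)
qed (auto simp: hadamard_madd hadamard_msmult intro: tensor_span.intros)

lemma sp_perm: "(M, N) \<in> sp \<Longrightarrow> \<sigma> \<in> cyc_group k \<Longrightarrow> (permute_mat k \<sigma> M, permute_mat k \<sigma> N) \<in> sp"
proof (induction rule: tensor_span.induct)
  case (tensor F)
  note w = PP_wf[OF k tensor.hyps] cyc_group_bij[OF k tensor.prems]
  show ?case using tensor_span.tensor[OF PP.perm[OF tensor.hyps tensor.prems], of G H] unfolding hom_tensor_perm[OF w] .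
qed (auto simp: permute_madd permute_msmult intro: tensor_span.intros)

lemma sp_trace: "(M, N) \<in> sp \<Longrightarrow> mtrace (fst H) k N = mtrace (fst G) k M"
  by (induction rule: tensor_span.induct)
    (auto simp: PP_trace[OF G H k card_eq ind] mtrace_madd mtrace_msmult)

lemma sp_total_G: "M \<in> qalg k G \<Longrightarrow> \<exists>N. (M, N) \<in> sp"
proof (induction rule: qalg.induct)
  case I show ?case using sp_I by blast
next
  case J show ?case using sp_J by blast
next
  case (atom F) thus ?case using sp_atom by blast
next
  case (add M N) thus ?case using tensor_span.span_add by blast
next
  case (smult M c) thus ?case using tensor_span.span_smult by blast
next
  case (mul M N) thus ?case using sp_mul by blast
next
  case (star M) thus ?case using sp_star by blast
next
  case (had M F) thus ?case using sp_had by blast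
next
  case (perm M \<sigma>) thus ?case using sp_perm by blast
qed

lemma sp_total_H: "N \<in> qalg k H \<Longrightarrow> \<exists>M. (M, N) \<in> sp"
proof (induction rule: qalg.induct)
  case I show ?case using sp_I by blast
next
  case J show ?case using sp_J by blast
next
  case (atom F) thus ?case using sp_atom by blast
next
  case (add M N) thus ?case using tensor_span.span_add by blast
next
  case (smult M c) thus ?case using tensor_span.span_smult by blast
next
  case (mul M N) thus ?case using sp_mul by blast
next
  case (star M) thus ?case using sp_star by blast
next
  case (had M F) thus ?case using sp_had by blast
next
  case (perm M \<sigma>) thus ?case using sp_perm by blast
qed

text \<open>The relation is closed under adjoints and products, so the squared norm is one of the
  preserved traces.\<close>

lemma sp_sqnorm: assumes "(M, N) \<in> sp" shows "sqnorm (fst H) k N = sqnorm (fst G) k M"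
  using sp_trace[OF sp_mul[OF sp_star[OF assms] assms]]
  unfolding minner_def[symmetric] minner_self of_real_eq_iff .

lemma sp_diff: assumes "(M, N) \<in> sp" "(M', N') \<in> sp" shows "(madd M (msmult (-1) M'), madd N (msmult (-1) N')) \<in> sp"
  using assms by (intro tensor_span.intros)

lemma diff_zero_iff: "madd M (msmult (-1) N) = (\<lambda>_ _. 0) \<longleftrightarrow> M = N"
  unfolding madd_def msmult_def by (auto simp: fun_eq_iff)

text \<open>A difference vanishes exactly if its norm does, and norms agree on the two sides. So the
  relation is the graph of an injective function.\<close>

lemma sp_eq_iff: assumes "(M, N) \<in> sp" "(M', N') \<in> sp" shows "M = M' \<longleftrightarrow> N = N'"
proof -
  let ?A = "madd M (msmult (-1) M')" and ?B = "madd N (msmult (-1) N')"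
  note d = sp_diff[OF assms]
  have ms: "?A \<in> matspace (fst G) k" "?B \<in> matspace (fst H) k"
    using sp_qalg[OF d] qalg_matspace[OF k G] qalg_matspace[OF k H] by auto
  have z: "sqnorm V k (\<lambda>_ _. 0) = 0" for V :: "'c set" unfolding sqnorm_def by simp
  have "?A = (\<lambda>_ _. 0) \<longleftrightarrow> ?B = (\<lambda>_ _. 0)"
    using sqnorm_zero[OF fin(1) ms(1)] sqnorm_zero[OF fin(2) ms(2)] sp_sqnorm[OF d] z by metis
  thus ?thesis unfolding diff_zero_iff .
qed

lemma alg_equiv_from_indist: "alg_equiv k G H"
  unfolding alg_equiv_iff
proof
  define \<phi> where "\<phi> M = (THE N. (M, N) \<in> sp)" for M
  have ph: "\<phi> M = N" if "(M, N) \<in> sp" for M N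
    unfolding \<phi>_def using that sp_eq_iff by (intro the_equality) blast+
  have sp: "(M, \<phi> M) \<in> sp" if "M \<in> qalg k G" for M using sp_total_G[OF that] ph by blast
  show "alg_iso k G H \<phi>" unfolding alg_iso_def
  proof (intro conjI ballI allI)
    show "inj_on \<phi> (qalg k G)" by (rule inj_onI) (use sp sp_eq_iff in blast)
    show "\<phi> ` qalg k G = qalg k H"
    proof
      show "\<phi> ` qalg k G \<subseteq> qalg k H" using sp sp_qalg by blast
      show "qalg k H \<subseteq> \<phi> ` qalg k G"
      proof
        fix N assume "N \<in> qalg k H"
        then obtain M where M: "(M, N) \<in> sp" using sp_total_H by blast
        thus "N \<in> \<phi> ` qalg k G" using ph[OF M] sp_qalg[OF M] by blast
      qed
    qed
    show "\<phi> (madd M N) = madd (\<phi> M) (\<phi> N)" if "M \<in> qalg k G" "N \<in> qalg k G" for M N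
      using that by (intro ph tensor_span.span_add sp)
    show "\<phi> (mmul (fst G) k M N) = mmul (fst H) k (\<phi> M) (\<phi> N)" if "M \<in> qalg k G" "N \<in> qalg k G" for M N
      using that by (intro ph sp_mul sp)
    show "\<phi> (msmult c M) = msmult c (\<phi> M)" if "M \<in> qalg k G" for M c using that by (intro ph tensor_span.span_smult sp)
    show "\<phi> (mstar M) = mstar (\<phi> M)" if "M \<in> qalg k G" for M using that by (intro ph sp_star sp)
    show "\<phi> (hadamard (hom_tensor F G) M) = hadamard (hom_tensor F H) (\<phi> M)" if "M \<in> qalg k G" "F \<in> QP k" for M F
      using that by (intro ph sp_had sp)
    show "\<phi> (permute_mat k \<sigma> M) = permute_mat k \<sigma> (\<phi> M)" if "M \<in> qalg k G" "\<sigma> \<in> cyc_group k" for M \<sigma>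
      using that by (intro ph sp_perm sp)
    show "mtrace (fst H) k (\<phi> M) = mtrace (fst G) k M" if "M \<in> qalg k G" for M using sp_trace[OF sp[OF that]] .
    show "\<phi> (idm (fst G) k) = idm (fst H) k" by (rule ph[OF sp_I])
    show "\<phi> (onesm (fst G) k) = onesm (fst H) k" by (rule ph[OF sp_J])
    show "\<phi> (hom_tensor F G) = hom_tensor F H" if "F \<in> Q k" for F by (rule ph[OF sp_atom[OF that]])
  qed
qed

end

section \<open>From algebra isomorphisms to quantum isomorphism maps\<close>

lemma matspace_onb:
  assumes "finite V" "A \<subseteq> matspace V k" "(\<lambda>_ _. 0) \<in> A" "\<And>M N. M \<in> A \<Longrightarrow> N \<in> A \<Longrightarrow> madd M N \<in> A"
    "\<And>c M. M \<in> A \<Longrightarrow> msmult c M \<in> A"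
  shows "\<exists>B\<subseteq>A. finite B \<and> (\<forall>M\<in>A. M = (\<lambda>x y. \<Sum>b\<in>B. minner V k b M * b x y))"
proof -
  let ?S = "tuples V k \<times> tuples V k"
  have d: "dot ?S (case_prod M) (case_prod N) = minner V k M N" for M N
    unfolding dot_def minner_eq sum.cartesian_product by (simp add: split_def)
  have "subspace_on ?S (case_prod ` A)"
    unfolding subspace_on_def
  proof (intro conjI ballI allI impI)
    fix f p assume "f \<in> case_prod ` A" "p \<notin> ?S"
    then obtain M where M: "M \<in> A" "f = case_prod M" by blast
    obtain x y where p: "p = (x, y)" by fastforce
    have "x \<notin> tuples V k \<or> y \<notin> tuples V k" using \<open>p \<notin> ?S\<close> unfolding p by simp
    thus "f p = 0" using matspace_zero[OF subsetD[OF assms(2) M(1)]] unfolding M(2) p by simp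
  next
    show "(\<lambda>_. 0) \<in> case_prod ` A" using assms(3) by (intro image_eqI[of _ _ "\<lambda>_ _. 0"]) auto
  next
    fix f g assume "f \<in> case_prod ` A" "g \<in> case_prod ` A"
    then obtain M N where "M \<in> A" "N \<in> A" "f = case_prod M" "g = case_prod N" by blast
    thus "(\<lambda>s. f s + g s) \<in> case_prod ` A"
      using assms(4) by (intro image_eqI[of _ _ "madd M N"]) (auto simp: madd_def)
  next
    fix c f assume "f \<in> case_prod ` A"
    then obtain M where "M \<in> A" "f = case_prod M" by blast
    thus "(\<lambda>s. c * f s) \<in> case_prod ` A"
      using assms(5) by (intro image_eqI[of _ _ "msmult c M"]) (auto simp: msmult_def)
  qed
  then obtain B where B: "B \<subseteq> case_prod ` A" "finite B" "orthonormal ?S B"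
     "\<forall>f\<in>case_prod ` A. f = (\<lambda>s. \<Sum>b\<in>B. dot ?S b f * b s)"
    using orthonormal_basis_exists[of ?S "case_prod ` A"] finite_tuples[OF assms(1)] by auto
  let ?B = "curry ` B"
  have inj: "inj_on curry B" by (intro inj_onI) (metis case_prod_curry)
  have dB: "dot ?S b f = minner V k (curry b) (curry f)" for b f using d[of "curry b" "curry f"] by simp
  have "?B \<subseteq> A" using B(1) by auto
  moreover have "finite ?B" using B(2) by simp
  moreover have "\<forall>M\<in>A. M = (\<lambda>x y. \<Sum>b\<in>?B. minner V k b M * b x y)"
  proof (intro ballI ext)
    fix M x y assume M: "M \<in> A"
    have "case_prod M = (\<lambda>s. \<Sum>b\<in>B. dot ?S b (case_prod M) * b s)" using B(4) M by blast
    from fun_cong[OF this, of "(x, y)"] have "M x y = (\<Sum>b\<in>B. dot ?S b (case_prod M) * b (x, y))" by simp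
    also have "\<dots> = (\<Sum>b\<in>B. minner V k (curry b) M * curry b x y)" unfolding dB by simp
    also have "\<dots> = (\<Sum>b\<in>?B. minner V k b M * b x y)" by (simp add: sum.reindex[OF inj])
    finally show "M x y = (\<Sum>b\<in>?B. minner V k b M * b x y)" .
  qed
  ultimately show ?thesis by (intro exI[of _ ?B] conjI)
qed

text \<open>A Gram matrix of a family without common kernel vector is positive definite, hence invertible: a vector
  orthogonal to its row space would be in that kernel.\<close>
lemma gram_row_surj:
  assumes fin: "finite S" and z: "\<And>x x'. x \<in> S \<Longrightarrow> x' \<in> S \<Longrightarrow> z x x' = (\<Sum>r\<in>R. cnj (q r x) * q r x')" and "finite R"
    and ker: "\<And>g. (\<And>r. r \<in> R \<Longrightarrow> (\<Sum>x\<in>S. q r x * cnj (g x)) = 0) \<Longrightarrow> (\<And>x. x \<in> S \<Longrightarrow> g x = 0)"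
  shows "\<exists>u. \<forall>x\<in>S. (\<Sum>x'\<in>S. u x' * z x' x) = f x"
proof -
  define row where "row u x = (if x \<in> S then \<Sum>x'\<in>S. u x' * z x' x else 0)" for u x
  have "subspace_on S (range row)"
    unfolding subspace_on_def
  proof (intro conjI ballI allI impI)
    fix f s assume "f \<in> range row" "s \<notin> S" thus "f s = 0" unfolding row_def by auto
  next
    show "(\<lambda>_. 0) \<in> range row" by (rule range_eqI[of _ _ "\<lambda>_. 0"]) (auto simp: row_def)
  next
    fix f g assume "f \<in> range row" "g \<in> range row"
    then obtain u v where "f = row u" "g = row v" by blast
    thus "(\<lambda>s. f s + g s) \<in> range row"
      by (intro range_eqI[of _ _ "\<lambda>s. u s + v s"]) (auto simp: row_def fun_eq_iff distrib_right sum.distrib)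
  next
    fix c f assume "f \<in> range row"
    then obtain u where "f = row u" by blast
    thus "(\<lambda>s. c * f s) \<in> range row"
      by (intro range_eqI[of _ _ "\<lambda>s. c * u s"]) (auto simp: row_def fun_eq_iff sum_distrib_left mult.assoc)
  qed
  note sub = this
  obtain B where B: "B \<subseteq> range row" "finite B" "orthonormal S B" "\<forall>f\<in>range row. f = (\<lambda>s. \<Sum>b\<in>B. dot S b f * b s)"
    using orthonormal_basis_exists[OF fin sub] by blast
  define p where "p s = (\<Sum>b\<in>B. dot S b f * b s)" for s
  define g where "g s = f s - p s" for s
  have p: "p \<in> range row" unfolding p_def by (rule subspace_on_sum[OF sub B(2,1)])
  have orth: "dot S b g = 0" if "b \<in> B" for b
    unfolding g_def p_def by (rule orthonormal_residual[OF B(2,3) that])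
  have orth': "dot S h g = 0" if "h \<in> range row" for h
  proof -
    have h: "h = (\<lambda>s. \<Sum>b\<in>B. dot S b h * b s)" using B(4) that by blast
    have "dot S g h = (\<Sum>b\<in>B. dot S b h * dot S g b)" by (subst h) (rule dot_sum_right)
    also have "\<dots> = 0"
    proof (rule sum.neutral, rule ballI)
      fix b assume "b \<in> B"
      thus "dot S b h * dot S g b = 0" using orth[of b] dot_cnj[of S g b] by simp
    qed
    finally show ?thesis using dot_cnj[of S h g] by simp
  qed
  \<comment> \<open>Pairing the residual g with the row whose coefficients are g itself gives the
    Gram form at g, a sum of squares over \<open>R\<close>; orthogonality makes it zero.\<close>
  have "(\<Sum>x\<in>S. \<Sum>x'\<in>S. \<Sum>r\<in>R. (q r x' * cnj (g x')) * cnj (q r x * cnj (g x))) = 0"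
  proof -
    have "dot S (row g) g = (\<Sum>x\<in>S. \<Sum>x'\<in>S. cnj (g x') * cnj (z x' x) * g x)"
      unfolding dot_def row_def by (intro sum.cong HOL.refl) (simp add: sum_distrib_right)
    also have "\<dots> = (\<Sum>x\<in>S. \<Sum>x'\<in>S. \<Sum>r\<in>R. (q r x' * cnj (g x')) * cnj (q r x * cnj (g x)))"
    proof (intro sum.cong HOL.refl)
      fix x x' assume x: "x \<in> S" "x' \<in> S"
      show "cnj (g x') * cnj (z x' x) * g x = (\<Sum>r\<in>R. (q r x' * cnj (g x')) * cnj (q r x * cnj (g x)))"
        unfolding z[OF x(2,1)] cnj_sum sum_distrib_left sum_distrib_right
        by (intro sum.cong HOL.refl) (simp add: mult_ac)
    qed
    finally show ?thesis using orth'[of "row g"] by simp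
  qed
  also have "(\<Sum>x\<in>S. \<Sum>x'\<in>S. \<Sum>r\<in>R. (q r x' * cnj (g x')) * cnj (q r x * cnj (g x))) =
     (\<Sum>r\<in>R. \<Sum>x\<in>S. \<Sum>x'\<in>S. (q r x' * cnj (g x')) * cnj (q r x * cnj (g x)))" by (rule sum_swap3)
  also have "\<dots> = (\<Sum>r\<in>R. cnj (\<Sum>x\<in>S. q r x * cnj (g x)) * (\<Sum>x\<in>S. q r x * cnj (g x)))"
    unfolding cnj_sum sum_product by (intro sum.cong HOL.refl) (simp add: mult.commute)
  also have "\<dots> = complex_of_real (\<Sum>r\<in>R. (cmod (\<Sum>x\<in>S. q r x * cnj (g x)))\<^sup>2)"
    by (simp only: cnj_mult_self of_real_sum)
  finally have "(\<Sum>r\<in>R. (cmod (\<Sum>x\<in>S. q r x * cnj (g x)))\<^sup>2) = 0" by (simp only: of_real_eq_0_iff)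
  hence "(\<Sum>x\<in>S. q r x * cnj (g x)) = 0" if "r \<in> R" for r
    using \<open>finite R\<close> that by (subst (asm) sum_nonneg_eq_0_iff) auto
  hence gz: "g x = 0" if "x \<in> S" for x using ker[of g x] that by blast
  obtain u where u: "p = row u" using p by blast
  have "(\<Sum>x'\<in>S. u x' * z x' x) = f x" if "x \<in> S" for x
    using gz[OF that] that unfolding g_def u row_def by simp
  thus ?thesis by blast
qed

lemma mm_scale_left: "mm S (\<lambda>x y. c * A x y) B = (\<lambda>x y. c * mm S A B x y)"
  and mm_scale_right: "mm S A (\<lambda>x y. c * B x y) = (\<lambda>x y. c * mm S A B x y)"
  unfolding mm_def by (auto simp: sum_distrib_left ac_simps)

lemma minner_cnj: "minner V k B A = cnj (minner V k A B)"
  unfolding minner_eq by (simp add: mult.commute)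

lemma minner_sum_right: "minner V k A (\<lambda>x y. \<Sum>b\<in>B. c b * M b x y) = (\<Sum>b\<in>B. c b * minner V k A (M b))"
proof -
  have "minner V k A (\<lambda>x y. \<Sum>b\<in>B. c b * M b x y) = (\<Sum>x\<in>tuples V k. \<Sum>y\<in>tuples V k. \<Sum>b\<in>B. c b * (cnj (A x y) * M b x y))"
    unfolding minner_eq sum_distrib_left by (intro sum.cong HOL.refl) (simp only: mult_ac)
  also have "\<dots> = (\<Sum>b\<in>B. \<Sum>x\<in>tuples V k. \<Sum>y\<in>tuples V k. c b * (cnj (A x y) * M b x y))" by (rule sum_swap3)
  finally show ?thesis unfolding minner_eq by (simp only: sum_distrib_left)
qed

lemma minner_mmul_left: "minner V k A (mmul V k C B) = minner V k (mmul V k (mstar C) A) B"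
  unfolding minner_def mstar_mmul mmul_assoc by simp

lemma minner_mstar: "minner V k A (mstar B) = cnj (minner V k (mstar A) B)"
  unfolding minner_eq mstar_def by (subst sum.swap) (simp add: mult.commute)

text \<open>\<open>rot\<close> permutes the entries of a matrix, so it is unitary and its adjoint is
  the inverse rotation.\<close>

lemma minner_rot:
  assumes "k \<ge> 1" shows "minner V k A (rot k X) = minner V k (rotl k A) X"
proof -
  have "minner V k A (rot k X) = (\<Sum>x\<in>tuples V k. \<Sum>y\<in>tuples V k. cnj (rotl k A (hd y # butlast x) (tl y @ [last x])) * X (hd y # butlast x) (tl y @ [last x]))"
    unfolding minner_eq
  proof (intro sum.cong HOL.refl)
    fix x y assume "x \<in> tuples V k" "y \<in> tuples V k"
    hence l: "length x = k" "length y = k" by (auto dest: tuples_length)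
    hence "x \<noteq> []" "y \<noteq> []" using assms by auto
    thus "cnj (A x y) * rot k X x y = cnj (rotl k A (hd y # butlast x) (tl y @ [last x])) * X (hd y # butlast x) (tl y @ [last x])"
      unfolding rot_def rotl_def using l assms by simp
  qed
  also have "\<dots> = minner V k (rotl k A) X" unfolding minner_eq
    by (rule sum_rot_index[OF assms, of "\<lambda>x y. cnj (rotl k A x y) * X x y"])
  finally show ?thesis .
qed

lemma minner_hadamard:
  assumes "\<And>x y. cnj (P x y) = P x y" shows "minner V k A (hadamard P X) = minner V k (hadamard P A) X"
  unfolding minner_eq hadamard_def using assms by (simp add: mult_ac)

section \<open>The extension of an algebra isomorphism by orthogonal projection\<close>

locale algiso =
  fixes G :: "'a sgraph" and H :: "'b sgraph" and k :: nat and \<phi> :: "'a mat \<Rightarrow> 'b mat" and B :: "'a mat set"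
  assumes G: "simple_graph G" and H: "simple_graph H" and k: "k \<ge> 1" and iso: "alg_iso k G H \<phi>"
    and BA: "B \<subseteq> qalg k G" and finB: "finite B"
    and onb: "\<And>M. M \<in> qalg k G \<Longrightarrow> M = (\<lambda>x y. \<Sum>b\<in>B. minner (fst G) k b M * b x y)"
begin

abbreviation "VG \<equiv> fst G"
abbreviation "VH \<equiv> fst H"
abbreviation "TG \<equiv> tuples VG k"
abbreviation "TH \<equiv> tuples VH k"
abbreviation "A \<equiv> qalg k G"

lemma fin: "finite VG" "finite VH" "finite TG" "finite TH"
  using G H by (auto simp: simple_graph_finite finite_tuples)

lemma phi_qalg: "M \<in> A \<Longrightarrow> \<phi> M \<in> qalg k H" using alg_isoD(2)[OF iso] by blast

lemma ms: "M \<in> A \<Longrightarrow> M \<in> matspace VG k" by (rule qalg_matspace[OF k G])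
lemma msH: "M \<in> A \<Longrightarrow> \<phi> M \<in> matspace VH k" by (rule qalg_matspace[OF k H phi_qalg])

lemma alg_sum:
  assumes "finite P" "\<And>p. p \<in> P \<Longrightarrow> M p \<in> A"
  shows "(\<lambda>x y. \<Sum>p\<in>P. c p * M p x y) \<in> A \<and> \<phi> (\<lambda>x y. \<Sum>p\<in>P. c p * M p x y) = (\<lambda>x y. \<Sum>p\<in>P. c p * \<phi> (M p) x y)"
  using assms
proof (induction P rule: finite_induct)
  case empty
  have z: "(\<lambda>_ _. 0) = msmult 0 (idm VG k)" "(\<lambda>_ _. 0) = msmult 0 (idm VH k)" unfolding msmult_def by simp_all
  have "\<phi> (msmult 0 (idm VG k)) = msmult 0 (idm VH k)" unfolding alg_isoD(5)[OF iso qalg.I] alg_isoD(10)[OF iso] ..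
  moreover have "msmult 0 (idm VG k) \<in> A" by (intro qalg.smult qalg.I)
  ultimately show ?case unfolding sum.empty z[symmetric] by simp
next
  case (insert p P)
  let ?M = "\<lambda>x y. \<Sum>p\<in>P. c p * M p x y"
  have e: "(\<lambda>x y. \<Sum>p\<in>insert p P. c p * M p x y) = madd (msmult (c p) (M p)) ?M"
    "(\<lambda>x y. \<Sum>p\<in>insert p P. c p * \<phi> (M p) x y) = madd (msmult (c p) (\<phi> (M p))) (\<lambda>x y. \<Sum>p\<in>P. c p * \<phi> (M p) x y)"
    using insert(1,2) unfolding madd_def msmult_def by simp_all
  have p: "M p \<in> A" "msmult (c p) (M p) \<in> A" using insert.prems by (auto intro: qalg.smult)
  have IH: "?M \<in> A" "\<phi> ?M = (\<lambda>x y. \<Sum>p\<in>P. c p * \<phi> (M p) x y)" using insert by auto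
  show ?case unfolding e alg_isoD(3)[OF iso p(2) IH(1)] alg_isoD(5)[OF iso p(1)] IH(2)
    using qalg.add[OF p(2) IH(1)] by blast
qed

text \<open>The inner product is a trace of a product with an adjoint, all of which \<phi>
  respects.\<close>

lemma phi_isometric: assumes "M \<in> A" "N \<in> A" shows "minner VH k (\<phi> M) (\<phi> N) = minner VG k M N"
proof -
  have "minner VH k (\<phi> M) (\<phi> N) = mtrace VH k (\<phi> (mmul VG k (mstar M) N))"
    unfolding minner_def alg_isoD(4)[OF iso qalg.star[OF assms(1)] assms(2)] alg_isoD(6)[OF iso assms(1)] ..
  also have "\<dots> = minner VG k M N"
    unfolding minner_def by (rule alg_isoD(9)[OF iso qalg.mul[OF qalg.star[OF assms(1)] assms(2)]])
  finally show ?thesis .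
qed

definition proj :: "'a mat \<Rightarrow> 'a mat" where
  "proj X = (\<lambda>x y. \<Sum>b\<in>B. minner VG k b X * b x y)"

definition Phi :: "'a mat \<Rightarrow> 'b mat" where
  "Phi X = (\<lambda>x y. \<Sum>b\<in>B. minner VG k b X * \<phi> b x y)"

lemma proj_A: "proj X \<in> A" and Phi_proj: "Phi X = \<phi> (proj X)"
proof -
  have "b \<in> A" if "b \<in> B" for b using BA that by blast
  from alg_sum[OF finB, of "\<lambda>b. b" "\<lambda>b. minner VG k b X", OF this]
  show "proj X \<in> A" "Phi X = \<phi> (proj X)" unfolding proj_def Phi_def by auto
qed

lemma proj_id: "M \<in> A \<Longrightarrow> proj M = M" unfolding proj_def by (rule onb[symmetric])

text \<open>Expanding \<open>a\<close> instead of X shows that X minus its projection is orthogonal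
  to the algebra.\<close>

lemma minner_proj: assumes "a \<in> A" shows "minner VG k a (proj X) = minner VG k a X"
proof -
  have "minner VG k X a = minner VG k X (\<lambda>x y. \<Sum>b\<in>B. minner VG k b a * b x y)" using onb[OF assms] by simp
  also have "\<dots> = (\<Sum>b\<in>B. minner VG k b a * minner VG k X b)" by (rule minner_sum_right)
  finally have eq: "minner VG k X a = (\<Sum>b\<in>B. minner VG k b a * minner VG k X b)" .
  have "minner VG k a X = cnj (minner VG k X a)" by (rule minner_cnj)
  also have "\<dots> = cnj (\<Sum>b\<in>B. minner VG k b a * minner VG k X b)" unfolding eq ..
  also have "\<dots> = (\<Sum>b\<in>B. minner VG k b X * minner VG k a b)"
    unfolding cnj_sum
  proof (intro sum.cong HOL.refl)
    fix b
    show "cnj (minner VG k b a * minner VG k X b) = minner VG k b X * minner VG k a b"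
      using minner_cnj[of VG k a b] minner_cnj[of VG k b X] by simp
  qed
  also have "\<dots> = minner VG k a (proj X)" unfolding proj_def by (rule minner_sum_right[symmetric])
  finally show ?thesis by simp
qed

text \<open>Used to replace X by \<open>proj X\<close> under an operation. For Schur products and
  rotations it suffices that the adjoint operation maps \<open>B\<close> into the algebra; for
  \<open>mstar\<close>, that \<open>B\<close> has its adjoints there.\<close>

lemma proj_cong: assumes "\<And>b. b \<in> B \<Longrightarrow> minner VG k b X = minner VG k b Y" shows "proj X = proj Y" "Phi X = Phi Y"
  unfolding proj_def Phi_def using assms by (auto intro!: sum.cong)

lemma Phi_id: "M \<in> A \<Longrightarrow> Phi M = \<phi> M" unfolding Phi_proj by (simp add: proj_id)

lemma Phi_had: assumes F: "F \<in> QP k" shows "Phi (hadamard (hom_tensor F G) X) = hadamard (hom_tensor F H) (Phi X)"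
proof -
  have r: "cnj (hom_tensor F G x y) = hom_tensor F G x y" for x y unfolding hom_tensor_def by simp
  have "Phi (hadamard (hom_tensor F G) X) = Phi (hadamard (hom_tensor F G) (proj X))"
  proof (rule proj_cong(2))
    fix b assume "b \<in> B"
    hence "hadamard (hom_tensor F G) b \<in> A" using BA qalg.had[OF _ F] by blast
    thus "minner VG k b (hadamard (hom_tensor F G) X) = minner VG k b (hadamard (hom_tensor F G) (proj X))"
      unfolding minner_hadamard[OF r] by (rule minner_proj[symmetric])
  qed
  also have "\<dots> = \<phi> (hadamard (hom_tensor F G) (proj X))" by (rule Phi_id[OF qalg.had[OF proj_A F]])
  also have "\<dots> = hadamard (hom_tensor F H) (Phi X)" unfolding alg_isoD(7)[OF iso proj_A F] Phi_proj ..
  finally show ?thesis .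
qed

lemma rot_A: "M \<in> A \<Longrightarrow> rot k M \<in> A" and phi_rot: "M \<in> A \<Longrightarrow> \<phi> (rot k M) = rot k (\<phi> M)"
proof -
  have g: "cyc_gen k \<in> cyc_group k" unfolding cyc_group_def using rangeI[of "\<lambda>n. cyc_gen k ^^ n" 1] by simp
  show "M \<in> A \<Longrightarrow> rot k M \<in> A" using qalg.perm[OF _ g, of M G] unfolding permute_mat_gen[OF k] .
  show "M \<in> A \<Longrightarrow> \<phi> (rot k M) = rot k (\<phi> M)" using alg_isoD(8)[OF iso _ g, of M] unfolding permute_mat_gen[OF k] .
qed

lemma rotl_A: assumes "M \<in> A" shows "rotl k M \<in> A"
proof -
  have "(rot k ^^ n) M \<in> A" for n using assms by (induction n) (auto simp: rot_A)
  thus ?thesis unfolding rotl_eq_rot_pow[OF k ms[OF assms]] .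
qed

lemma Phi_rot: "Phi (rot k X) = rot k (Phi X)"
proof -
  have "Phi (rot k X) = Phi (rot k (proj X))"
  proof (rule proj_cong(2))
    fix b assume "b \<in> B"
    hence "rotl k b \<in> A" using BA rotl_A by blast
    thus "minner VG k b (rot k X) = minner VG k b (rot k (proj X))"
      unfolding minner_rot[OF k] by (rule minner_proj[symmetric])
  qed
  also have "\<dots> = \<phi> (rot k (proj X))" by (rule Phi_id[OF rot_A[OF proj_A]])
  also have "\<dots> = rot k (Phi X)" unfolding phi_rot[OF proj_A] Phi_proj ..
  finally show ?thesis .
qed

lemma Phi_mstar: "Phi (mstar X) = mstar (Phi X)"
proof -
  have "Phi (mstar X) = Phi (mstar (proj X))"
  proof (rule proj_cong(2))
    fix b assume "b \<in> B"
    hence "mstar b \<in> A" using BA qalg.star by blast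
    thus "minner VG k b (mstar X) = minner VG k b (mstar (proj X))"
      unfolding minner_mstar using minner_proj by simp
  qed
  also have "\<dots> = \<phi> (mstar (proj X))" by (rule Phi_id[OF qalg.star[OF proj_A]])
  also have "\<dots> = mstar (Phi X)" unfolding alg_isoD(6)[OF iso proj_A] Phi_proj ..
  finally show ?thesis .
qed

lemma Phi_matspace: "Phi X \<in> matspace VH k" unfolding Phi_proj by (rule msH[OF proj_A])

section \<open>Positivity of the Choi matrix of the extended map\<close>

definition choi :: "'a list \<Rightarrow> 'b list \<Rightarrow> 'a list \<Rightarrow> 'b list \<Rightarrow> complex" where
  "choi x y x' y' = (\<Sum>b\<in>B. \<phi> b y y' * cnj (b x x'))"

lemma Phi_choi: "Phi X y y' = (\<Sum>x\<in>TG. \<Sum>x'\<in>TG. choi x y x' y' * X x x')"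
proof -
  have "Phi X y y' = (\<Sum>b\<in>B. \<Sum>x\<in>TG. \<Sum>x'\<in>TG. \<phi> b y y' * cnj (b x x') * X x x')"
    unfolding Phi_def minner_eq sum_distrib_right by (intro sum.cong HOL.refl) (simp only: mult_ac)
  also have "\<dots> = (\<Sum>x\<in>TG. \<Sum>x'\<in>TG. \<Sum>b\<in>B. \<phi> b y y' * cnj (b x x') * X x x')" by (rule sum_swap3[symmetric])
  finally show ?thesis unfolding choi_def sum_distrib_right .
qed

lemma choi_Phi: assumes "x \<in> TG" "x' \<in> TG" shows "choi x y x' y' = Phi (munit x x') y y'"
proof -
  have "minner VG k b (munit x x') = cnj (b x x')" for b
  proof -
    have "minner VG k b (munit x x') = (\<Sum>a\<in>TG. if a = x then (\<Sum>c\<in>TG. if c = x' then cnj (b a c) else 0) else 0)"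
      unfolding minner_eq munit_def by (intro sum.cong HOL.refl) (auto intro!: sum.cong)
    thus ?thesis using assms fin by simp
  qed
  thus ?thesis unfolding choi_def Phi_def by (simp add: mult.commute)
qed

lemma choi_hermitian: assumes "x \<in> TG" "x' \<in> TG" shows "choi x' y' x y = cnj (choi x y x' y')"
proof -
  have e: "munit x' x = mstar (munit x x')" unfolding munit_def mstar_def by (auto simp: fun_eq_iff)
  show ?thesis unfolding choi_Phi[OF assms] choi_Phi[OF assms(2,1)] e Phi_mstar unfolding mstar_def ..
qed

text \<open>The Choi matrix as an operator: \<open>Top V = \<Sum>\<^sub>b \<phi>(b) V b\<^sup>*\<close>. Its positivity follows from \<open>Top\<^sup>2 W = Top (W z) = (Top W) z\<close>
  with \<open>z = \<Sum>\<^sub>b b b\<^sup>*\<close> positive definite: for \<open>V = W z\<close> one gets \<open>\<langle>V, Top V\<rangle> = \<langle>(Top W) z, Top W\<rangle> \<ge> 0\<close>.\<close>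
definition Top :: "('b list \<Rightarrow> 'a list \<Rightarrow> complex) \<Rightarrow> 'b list \<Rightarrow> 'a list \<Rightarrow> complex" where
  "Top V = (\<lambda>y x. \<Sum>b\<in>B. mm TG (mm TH (\<phi> b) V) (dag b) y x)"

definition ip :: "('b list \<Rightarrow> 'a list \<Rightarrow> complex) \<Rightarrow> ('b list \<Rightarrow> 'a list \<Rightarrow> complex) \<Rightarrow> complex" where
  "ip U V = (\<Sum>y\<in>TH. \<Sum>x\<in>TG. cnj (U y x) * V y x)"

lemma Top_choi: "Top V y x = (\<Sum>y'\<in>TH. \<Sum>x'\<in>TG. choi x y x' y' * V y' x')"
proof -
  have "Top V y x = (\<Sum>b\<in>B. \<Sum>y'\<in>TH. \<Sum>x'\<in>TG. \<phi> b y y' * cnj (b x x') * V y' x')"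
    unfolding Top_def mm_def dag_def sum_distrib_right
    by (intro sum.cong HOL.refl, subst sum.swap, intro sum.cong HOL.refl) (simp only: mult_ac)
  also have "\<dots> = (\<Sum>y'\<in>TH. \<Sum>x'\<in>TG. \<Sum>b\<in>B. \<phi> b y y' * cnj (b x x') * V y' x')" by (rule sum_swap3[symmetric])
  finally show ?thesis unfolding choi_def sum_distrib_right .
qed

lemma Top_cong: assumes "\<And>y x. y \<in> TH \<Longrightarrow> x \<in> TG \<Longrightarrow> V y x = W y x" shows "Top V = Top W"
  unfolding Top_choi[abs_def] using assms by (intro ext sum.cong HOL.refl) simp

lemma Top_selfadjoint: "ip U (Top V) = ip (Top U) V"
proof -
  have "ip U (Top V) = (\<Sum>y\<in>TH. \<Sum>x\<in>TG. \<Sum>y'\<in>TH. \<Sum>x'\<in>TG. cnj (U y x) * choi x y x' y' * V y' x')"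
    unfolding ip_def Top_choi sum_distrib_left by (simp only: mult.assoc)
  also have "\<dots> = (\<Sum>y'\<in>TH. \<Sum>x'\<in>TG. \<Sum>y\<in>TH. \<Sum>x\<in>TG. cnj (U y x) * choi x y x' y' * V y' x')" by (rule sum_swap4)
  also have "\<dots> = (\<Sum>y'\<in>TH. \<Sum>x'\<in>TG. \<Sum>y\<in>TH. \<Sum>x\<in>TG. cnj (choi x' y' x y * U y x) * V y' x')"
  proof (intro sum.cong HOL.refl)
    fix y' x' y x assume "x' \<in> TG" "x \<in> TG"
    thus "cnj (U y x) * choi x y x' y' * V y' x' = cnj (choi x' y' x y * U y x) * V y' x'"
      using choi_hermitian[of x x' y' y] by (simp add: mult.commute)
  qed
  also have "\<dots> = ip (Top U) V" unfolding ip_def Top_choi cnj_sum sum_distrib_right ..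
  finally show ?thesis .
qed

text \<open>Expanding c b in the basis gives coefficients <l, c b>. Their conjugates <b, d> are the
  coefficients of d, the product of the adjoint of c with l. Summing over b instead of l therefore
  moves c from the left of the expression to its right.\<close>

lemma Top_left:
  assumes c: "c \<in> A" shows "mm TH (\<phi> c) (Top V) = mm TG (Top V) c"
proof -
  have BA': "b \<in> A" if "b \<in> B" for b using that BA by blast
  have "mm TH (\<phi> c) (Top V) = (\<lambda>y x. \<Sum>b\<in>B. mm TG (mm TH (mm TH (\<phi> c) (\<phi> b)) V) (dag b) y x)"
    unfolding Top_def mm_sum_right mm_assoc ..
  also have "\<dots> = (\<lambda>y x. \<Sum>b\<in>B. \<Sum>l\<in>B. minner VG k l (mmul VG k c b) * mm TG (mm TH (\<phi> l) V) (dag b) y x)"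
  proof (intro ext sum.cong HOL.refl)
    fix y x b assume b: "b \<in> B"
    have cb: "mmul VG k c b \<in> A" by (rule qalg.mul[OF c BA'[OF b]])
    have "mm TH (\<phi> c) (\<phi> b) = \<phi> (mmul VG k c b)" unfolding alg_isoD(4)[OF iso c BA'[OF b]] unfolding mmul_mm ..
    also have "\<dots> = (\<lambda>x y. \<Sum>l\<in>B. minner VG k l (mmul VG k c b) * \<phi> l x y)"
      unfolding Phi_id[OF cb, symmetric] Phi_def ..
    finally have "mm TH (\<phi> c) (\<phi> b) = (\<lambda>x y. \<Sum>l\<in>B. minner VG k l (mmul VG k c b) * \<phi> l x y)" .
    thus "mm TG (mm TH (mm TH (\<phi> c) (\<phi> b)) V) (dag b) y x = (\<Sum>l\<in>B. minner VG k l (mmul VG k c b) * mm TG (mm TH (\<phi> l) V) (dag b) y x)"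
      by (simp only: mm_sum_left mm_scale_left)
  qed
  also have "\<dots> = (\<lambda>y x. \<Sum>l\<in>B. \<Sum>b\<in>B. minner VG k l (mmul VG k c b) * mm TG (mm TH (\<phi> l) V) (dag b) y x)"
    by (intro ext sum.swap)
  also have "\<dots> = (\<lambda>y x. \<Sum>l\<in>B. mm TG (mm TH (\<phi> l) V) (mm TG (dag l) c) y x)"
  proof (intro ext sum.cong HOL.refl)
    fix y x l assume l: "l \<in> B"
    let ?m = "mmul VG k (mstar c) l"
    have m: "?m \<in> A" by (intro qalg.mul qalg.star c BA'[OF l])
    have "mm TG (dag l) c = dag ?m" unfolding mmul_mm mstar_dag dag_mm dag_dag ..
    also have "\<dots> = dag (\<lambda>x y. \<Sum>b\<in>B. minner VG k b ?m * b x y)" using onb[OF m] by simp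
    also have "\<dots> = (\<lambda>x y. \<Sum>b\<in>B. cnj (minner VG k b ?m) * dag b x y)" unfolding dag_def by simp
    also have "\<dots> = (\<lambda>x y. \<Sum>b\<in>B. minner VG k l (mmul VG k c b) * dag b x y)"
    proof -
      have "cnj (minner VG k b ?m) = minner VG k l (mmul VG k c b)" for b
        unfolding minner_mmul_left[of VG k l c b] by (rule minner_cnj[symmetric])
      thus ?thesis by simp
    qed
    finally have "mm TG (dag l) c = (\<lambda>x y. \<Sum>b\<in>B. minner VG k l (mmul VG k c b) * dag b x y)" .
    thus "(\<Sum>b\<in>B. minner VG k l (mmul VG k c b) * mm TG (mm TH (\<phi> l) V) (dag b) y x) = mm TG (mm TH (\<phi> l) V) (mm TG (dag l) c) y x"
      by (simp only: mm_sum_right mm_scale_right)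
  qed
  also have "\<dots> = mm TG (Top V) c" unfolding Top_def mm_sum_left mm_assoc ..
  finally show ?thesis .
qed

definition z :: "'a mat" where "z = (\<lambda>x y. \<Sum>b\<in>B. mm TG b (dag b) x y)"

lemma Top_Top: "Top (Top V) = mm TG (Top V) z"
proof -
  have "Top (Top V) = (\<lambda>y x. \<Sum>b\<in>B. mm TG (mm TG (Top V) b) (dag b) y x)"
    unfolding Top_def[of "Top V"] using BA Top_left by (intro ext sum.cong HOL.refl) (simp add: subset_iff)
  thus ?thesis unfolding z_def mm_sum_right mm_assoc .
qed

lemma z_hermitian: "cnj (z x y) = z y x"
  unfolding z_def mm_def dag_def by (simp add: mult.commute)

lemma ip_z: "ip (mm TG U z) V = ip U (mm TG V z)"
proof -
  have "ip (mm TG U z) V = (\<Sum>y\<in>TH. \<Sum>x\<in>TG. \<Sum>x'\<in>TG. cnj (U y x') * z x x' * V y x)"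
    unfolding ip_def mm_def by (intro sum.cong HOL.refl) (simp add: sum_distrib_right z_hermitian)
  also have "\<dots> = (\<Sum>y\<in>TH. \<Sum>x'\<in>TG. \<Sum>x\<in>TG. cnj (U y x') * z x x' * V y x)" by (intro sum.cong HOL.refl sum.swap)
  also have "\<dots> = ip U (mm TG V z)"
    unfolding ip_def mm_def by (intro sum.cong HOL.refl) (simp add: sum_distrib_left mult_ac)
  finally show ?thesis .
qed

text \<open>The adjoint of the identity \<open>Top_Top\<close>: \<open>Top\<close> and right
  multiplication by \<open>z\<close> are selfadjoint, so they may be interchanged. The difference D
  is tested against itself, which shows equality at the indices that \<open>ip\<close> sees.\<close>

lemma Top_z: assumes "y \<in> TH" "x \<in> TG" shows "Top (mm TG W z) y x = Top (Top W) y x"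
proof -
  define D where "D y x = Top (mm TG W z) y x - Top (Top W) y x" for y x
  have "ip D (Top (mm TG W z)) = ip D (Top (Top W))"
    unfolding Top_selfadjoint[of D] ip_z[symmetric] Top_Top[symmetric]
    unfolding Top_selfadjoint[of "Top D", symmetric] ..
  hence "ip D D = 0" unfolding ip_def D_def by (simp add: right_diff_distrib sum_subtractf)
  hence "complex_of_real (\<Sum>y\<in>TH. \<Sum>x\<in>TG. (cmod (D y x))\<^sup>2) = 0"
    unfolding ip_def by (simp only: cnj_mult_self of_real_sum)
  hence "(\<Sum>y\<in>TH. \<Sum>x\<in>TG. (cmod (D y x))\<^sup>2) = 0" by (simp only: of_real_eq_0_iff)
  hence "\<forall>y\<in>TH. (\<Sum>x\<in>TG. (cmod (D y x))\<^sup>2) = 0"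
    using fin by (subst (asm) sum_nonneg_eq_0_iff) (auto intro!: sum_nonneg)
  hence "D y x = 0" using assms fin by (auto simp: sum_nonneg_eq_0_iff)
  thus ?thesis unfolding D_def by simp
qed

lemma z_gram: "z x x' = (\<Sum>r\<in>B \<times> TG. cnj (cnj (fst r x (snd r))) * cnj (fst r x' (snd r)))"
  unfolding z_def mm_def dag_def by (simp add: sum.cartesian_product split_def)

text \<open>A vector annihilated by the columns of all b in \<open>B\<close> is annihilated by every
  matrix of the algebra, among them I, and hence is zero. So \<open>z\<close> is definite and every
  V has the form W z.\<close>

lemma z_surj: "\<exists>W. \<forall>y. \<forall>x\<in>TG. mm TG W z y x = V y x"
proof -
  have "\<exists>u. \<forall>x\<in>TG. (\<Sum>x'\<in>TG. u x' * z x' x) = V y x" for y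
  proof (rule gram_row_surj[OF fin(3), where R = "B \<times> TG" and q = "\<lambda>r x. cnj (fst r x (snd r))"])
    fix g x
    assume g: "\<And>r. r \<in> B \<times> TG \<Longrightarrow> (\<Sum>x\<in>TG. cnj (fst r x (snd r)) * cnj (g x)) = 0" and x: "x \<in> TG"
    have g': "(\<Sum>a\<in>TG. cnj (b a w) * cnj (g a)) = 0" if "b \<in> B" "w \<in> TG" for b w using g[of "(b, w)"] that by simp
    have "idm VG k = (\<lambda>x y. \<Sum>b\<in>B. minner VG k b (idm VG k) * b x y)" by (rule onb[OF qalg.I])
    from fun_cong[OF fun_cong[OF this]]
    have i: "idm VG k a x = (\<Sum>b\<in>B. minner VG k b (idm VG k) * b a x)" for a .
    have "cnj (g x) = (\<Sum>a\<in>TG. if a = x then cnj (g a) else 0)" using x fin by simp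
    also have "\<dots> = (\<Sum>a\<in>TG. cnj (idm VG k a x) * cnj (g a))"
      unfolding idm_def by (intro sum.cong HOL.refl) auto
    also have "\<dots> = (\<Sum>a\<in>TG. \<Sum>b\<in>B. cnj (minner VG k b (idm VG k)) * (cnj (b a x) * cnj (g a)))"
      unfolding i cnj_sum complex_cnj_mult sum_distrib_right by (simp only: mult.assoc)
    also have "\<dots> = (\<Sum>b\<in>B. cnj (minner VG k b (idm VG k)) * (\<Sum>a\<in>TG. cnj (b a x) * cnj (g a)))"
      unfolding sum_distrib_left by (rule sum.swap)
    also have "\<dots> = 0" using g'[OF _ x] by simp
    finally show "g x = 0" by simp
  qed (use z_gram finB fin in auto)
  hence "\<forall>y. \<exists>u. \<forall>x\<in>TG. (\<Sum>x'\<in>TG. u x' * z x' x) = V y x" by blast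
  then obtain W where "\<forall>y. \<forall>x\<in>TG. (\<Sum>x'\<in>TG. W y x' * z x' x) = V y x" by metis
  thus ?thesis unfolding mm_def by blast
qed

lemma ip_cong: "(\<And>y x. y \<in> TH \<Longrightarrow> x \<in> TG \<Longrightarrow> U y x = U' y x) \<Longrightarrow> (\<And>y x. y \<in> TH \<Longrightarrow> x \<in> TG \<Longrightarrow> V y x = V' y x) \<Longrightarrow> ip U V = ip U' V'"
  unfolding ip_def by (intro sum.cong HOL.refl) simp

lemma ip_z_nonneg: "\<exists>r\<ge>0. ip (mm TG Y z) Y = complex_of_real r"
proof -
  have "ip (mm TG Y z) Y = (\<Sum>y\<in>TH. \<Sum>x\<in>TG. \<Sum>x'\<in>TG. \<Sum>r\<in>B \<times> TG. cnj (Y y x' * fst r x' (snd r)) * (Y y x * fst r x (snd r)))"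
  proof -
    have "cnj (mm TG Y z y x) * Y y x = (\<Sum>x'\<in>TG. \<Sum>r\<in>B \<times> TG. cnj (Y y x' * fst r x' (snd r)) * (Y y x * fst r x (snd r)))" for y x
      unfolding mm_def cnj_sum complex_cnj_mult z_hermitian unfolding z_gram
      by (simp add: sum_distrib_left sum_distrib_right mult_ac)
    thus ?thesis unfolding ip_def by simp
  qed
  also have "\<dots> = (\<Sum>y\<in>TH. \<Sum>r\<in>B \<times> TG. \<Sum>x\<in>TG. \<Sum>x'\<in>TG. cnj (Y y x' * fst r x' (snd r)) * (Y y x * fst r x (snd r)))"
    by (intro sum.cong HOL.refl sum_swap3)
  also have "\<dots> = (\<Sum>y\<in>TH. \<Sum>r\<in>B \<times> TG. cnj (\<Sum>x\<in>TG. Y y x * fst r x (snd r)) * (\<Sum>x\<in>TG. Y y x * fst r x (snd r)))"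
    unfolding cnj_sum sum_product by (intro sum.cong HOL.refl sum.swap)
  also have "\<dots> = complex_of_real (\<Sum>y\<in>TH. \<Sum>r\<in>B \<times> TG. (cmod (\<Sum>x\<in>TG. Y y x * fst r x (snd r)))\<^sup>2)"
    by (simp only: cnj_mult_self of_real_sum)
  finally have "ip (mm TG Y z) Y = complex_of_real (\<Sum>y\<in>TH. \<Sum>r\<in>B \<times> TG. (cmod (\<Sum>x\<in>TG. Y y x * fst r x (snd r)))\<^sup>2)" .
  moreover have "0 \<le> (\<Sum>y\<in>TH. \<Sum>r\<in>B \<times> TG. (cmod (\<Sum>x\<in>TG. Y y x * fst r x (snd r)))\<^sup>2)" by (intro sum_nonneg) simp
  ultimately show ?thesis by blast
qed

lemma choi_psd: "psd_on (TG \<times> TH) (\<lambda>(x, y) (x', y'). choi x y x' y')"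
  unfolding psd_on_iff
proof
  fix v :: "'a list \<times> 'b list \<Rightarrow> complex"
  define V where "V y x = v (x, y)" for y x
  obtain W where W: "\<And>y x. x \<in> TG \<Longrightarrow> mm TG W z y x = V y x" using z_surj[of V] by blast
  have "quad_form (TG \<times> TH) (\<lambda>(x, y) (x', y'). choi x y x' y') v =
     (\<Sum>x\<in>TG. \<Sum>y\<in>TH. \<Sum>x'\<in>TG. \<Sum>y'\<in>TH. cnj (V y x) * choi x y x' y' * V y' x')"
    unfolding quad_form_def V_def sum.cartesian_product' by simp
  also have "\<dots> = (\<Sum>y\<in>TH. \<Sum>x\<in>TG. \<Sum>x'\<in>TG. \<Sum>y'\<in>TH. cnj (V y x) * choi x y x' y' * V y' x')" by (rule sum.swap)
  also have "\<dots> = (\<Sum>y\<in>TH. \<Sum>x\<in>TG. \<Sum>y'\<in>TH. \<Sum>x'\<in>TG. cnj (V y x) * choi x y x' y' * V y' x')"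
    by (intro sum.cong HOL.refl sum.swap)
  also have "\<dots> = ip V (Top V)" unfolding ip_def Top_choi sum_distrib_left by (simp only: mult.assoc)
  also have "\<dots> = ip (mm TG W z) (Top (mm TG W z))"
  proof -
    have "Top V = Top (mm TG W z)" by (rule Top_cong) (simp add: W)
    thus ?thesis by (auto intro!: ip_cong simp: W)
  qed
  also have "\<dots> = ip (mm TG W z) (Top (Top W))" by (rule ip_cong) (simp_all add: Top_z)
  also have "\<dots> = ip (Top (mm TG W z)) (Top W)" by (rule Top_selfadjoint)
  also have "\<dots> = ip (Top (Top W)) (Top W)" by (rule ip_cong) (simp_all add: Top_z)
  also have "\<dots> = ip (mm TG (Top W) z) (Top W)" unfolding Top_Top ..
  finally show "\<exists>r\<ge>0. quad_form (TG \<times> TH) (\<lambda>(x, y) (x', y'). choi x y x' y') v = complex_of_real r"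
    using ip_z_nonneg[of "Top W"] by metis
qed

text \<open>The adjoint of \<open>Phi\<close>. On the algebra of \<open>H\<close> it inverts \<phi>,
  because \<phi> is isometric; this yields the conditions on I and J for the adjoint.\<close>

definition Psi :: "'b mat \<Rightarrow> 'a mat" where
  "Psi Y = (\<lambda>x y. \<Sum>b\<in>B. minner VH k (\<phi> b) Y * b x y)"

lemma Psi_phi: assumes "M \<in> A" shows "Psi (\<phi> M) = M"
proof -
  have "Psi (\<phi> M) = (\<lambda>x y. \<Sum>b\<in>B. minner VG k b M * b x y)"
    unfolding Psi_def using phi_isometric[OF _ assms] BA by (intro ext sum.cong HOL.refl) (simp add: subset_iff)
  thus ?thesis using onb[OF assms] by simp
qed

lemma Psi_adjoint: "is_adjoint k VG VH Phi Psi"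
  unfolding is_adjoint_def
proof (intro conjI ballI)
  fix Y
  have "Psi Y \<in> A" unfolding Psi_def using alg_sum[OF finB, of "\<lambda>b. b" "\<lambda>b. minner VH k (\<phi> b) Y"] BA by auto
  thus "Psi Y \<in> matspace VG k" by (rule ms)
next
  fix Y X
  have "minner VG k (Psi Y) X = cnj (minner VG k X (Psi Y))" by (rule minner_cnj)
  also have "\<dots> = (\<Sum>b\<in>B. cnj (minner VH k (\<phi> b) Y) * cnj (minner VG k X b))"
    unfolding Psi_def minner_sum_right by simp
  also have "\<dots> = (\<Sum>b\<in>B. minner VG k b X * minner VH k Y (\<phi> b))"
    unfolding minner_cnj[symmetric] by (simp only: mult.commute)
  also have "\<dots> = minner VH k Y (Phi X)" unfolding Phi_def minner_sum_right ..
  finally show "minner VG k (Psi Y) X = minner VH k Y (Phi X)" .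
qed

lemma minner_madd: "minner V k M (madd X Y) = minner V k M X + minner V k M Y"
  and minner_msmult: "minner V k M (msmult c X) = c * minner V k M X"
  unfolding minner_eq madd_def msmult_def by (auto simp: distrib_left sum.distrib sum_distrib_left mult_ac)

lemma Phi_qiso: "qiso_map k G H Phi"
  unfolding qiso_map_def Let_def
proof (intro conjI ballI allI)
  show "Phi X \<in> matspace VH k" for X by (rule Phi_matspace)
  show "Phi (madd X Y) = madd (Phi X) (Phi Y)" for X Y
    unfolding Phi_def minner_madd by (simp add: madd_def distrib_right sum.distrib)
  show "Phi (msmult c X) = msmult c (Phi X)" for c X
    unfolding Phi_def minner_msmult by (simp add: msmult_def sum_distrib_left mult.assoc)
  show "completely_positive k VG VH Phi"
    by (rule completely_positive_if_choi[OF fin(1,2) choi_psd]) (rule Phi_choi)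
  show "Phi (hadamard (hom_tensor F G) X) = hadamard (hom_tensor F H) (Phi X)" if "F \<in> QP k" for F X by (rule Phi_had[OF that])
  show "Phi (idm VG k) = idm VH k" using Phi_id[OF qalg.I] alg_isoD(10)[OF iso] by simp
  show "Phi (onesm VG k) = onesm VH k" using Phi_id[OF qalg.J] alg_isoD(11)[OF iso] by simp
  have "Psi (idm VH k) = idm VG k" using Psi_phi[OF qalg.I] alg_isoD(10)[OF iso] by simp
  moreover have "Psi (onesm VH k) = onesm VG k" using Psi_phi[OF qalg.J] alg_isoD(11)[OF iso] by simp
  ultimately show "\<exists>\<Psi>. is_adjoint k VG VH Phi \<Psi> \<and> \<Psi> (idm VH k) = idm VG k \<and> \<Psi> (onesm VH k) = onesm VG k"
    using Psi_adjoint by blast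
  show "Phi (hom_tensor F G) = hom_tensor F H" if "F \<in> Q k" for F
    using Phi_id[OF qalg.atom[OF that]] alg_isoD(12)[OF iso that] by simp
  show "Phi (permute_mat k \<sigma> X) = permute_mat k \<sigma> (Phi X)" if "\<sigma> \<in> cyc_group k" "X \<in> matspace VG k" for \<sigma> X
    by (rule permute_commute[where V = VG and V' = VH and \<Phi> = Phi, OF k Phi_matspace Phi_rot that])
qed

end

lemma alg_equiv_imp_qiso:
  assumes G: "simple_graph G" and H: "simple_graph H" and k: "k \<ge> 1" and eq: "alg_equiv k G H"
  shows "\<exists>\<Phi>. qiso_map k G H \<Phi>"
proof -
  obtain \<phi> where iso: "alg_iso k G H \<phi>" using eq unfolding alg_equiv_iff by blast
  have z: "(\<lambda>_ _. 0) \<in> qalg k G" using qalg.smult[OF qalg.I[of G k], of 0] unfolding msmult_def by simp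
  obtain B where B: "B \<subseteq> qalg k G" "finite B"
     "\<forall>M\<in>qalg k G. M = (\<lambda>x y. \<Sum>b\<in>B. minner (fst G) k b M * b x y)"
    using matspace_onb[where k = k, OF simple_graph_finite[OF G] subsetI[OF qalg_matspace[OF k G]] z qalg.add qalg.smult] by blast
  interpret algiso G H k \<phi> B by unfold_locales (use G H k iso B in blast)+
  show ?thesis using Phi_qiso by blast
qed

theorem theorem1p1:
  fixes G :: "'a sgraph" and H :: "'b sgraph" and k :: nat
  assumes "simple_graph G" and "simple_graph H"
    and "card (fst G) = card (fst H)" and "k \<ge> 1"
  shows "((\<exists>R. npa_certificate k G H R) \<longleftrightarrow> (\<exists>\<Phi>. qiso_map k G H \<Phi>)) \<and>
         ((\<exists>\<Phi>. qiso_map k G H \<Phi>) \<longleftrightarrow> alg_equiv k G H) \<and>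
         (alg_equiv k G H \<longleftrightarrow> hom_indist_PP k G H)"
proof -
  have qiso: "qiso G H k \<Phi>" if "qiso_map k G H \<Phi>" for \<Phi>
    using assms that by unfold_locales
  have "(\<exists>R. npa_certificate k G H R) \<longleftrightarrow> (\<exists>\<Phi>. qiso_map k G H \<Phi>)"
    using npa_imp_qiso[OF assms] qiso.npa_from_qiso[OF qiso assms(3)] by blast
  moreover have "(\<exists>\<Phi>. qiso_map k G H \<Phi>) \<longleftrightarrow> alg_equiv k G H"
    using qiso.alg_equiv_from_qiso[OF qiso] alg_equiv_imp_qiso[OF assms(1,2,4)] by blast
  moreover have "alg_equiv k G H" if "hom_indist_PP k G H"
  proof -
    interpret indist G H k using assms that by unfold_locales
    show ?thesis by (rule alg_equiv_from_indist)
  qed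
  ultimately show ?thesis using alg_equiv_imp_hom_indist[OF assms(1,2,4)] by blast
qed

end
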